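(* Let $b\in\mathbb{R}^3$ and let $(U^b,P^b)$ be the Landau solution with parameter $b$. Let $(w,q)$ be a smooth self-similar solution of $$-\Delta w+U^b\cdot\nabla w+w\cdot\nabla U^b+\nabla q=0,\qquad \operatorname{div}w=0\qquad\text{in }\mathbb{R}^3\setminus\{0\}.$$ Then there is $c=(c_1,c_2,c_3)\in\mathbb{R}^3$ such that $$w=\sum_{i=1}^3c_i\,\partial_{b_i}U^b,\qquad q=\sum_{i=1}^3c_i\,\partial_{b_i}P^b,$$ and, in the sense of distributions on $\mathbb{R}^3$, $$-\Delta w+U^b\cdot\nabla w+w\cdot\nabla U^b+\nabla q=c\,\delta_0 .$$ That is, $$\operatorname{Ker}(\mathcal{L}_{U^b})\cap\{w: w\text{ is self-similar}\}=\operatorname{span}\{\partial_{b_1}U^b,\partial_{b_2}U^b,\partial_{b_3}U^b\}.$$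
   Context: Self-similar: $w(x)=\lambda w(\lambda x)$ and $q(x)=\lambda^2q(\lambda x)$ for all $\lambda>0$, $x\neq0$. $\operatorname{Ker}(\mathcal{L}_{U^b})$ is the set of smooth vector fields $w$ on $\mathbb{R}^3\setminus\{0\}$ with $\operatorname{div}w=0$ for which there is a smooth pressure $q$ with $\mathcal{L}_{U^b}w:=-\Delta w+U^b\cdot\nabla w+w\cdot\nabla U^b+\nabla q=0$ in $\mathbb{R}^3\setminus\{0\}$; in the equality of the claim self-similar elements are taken with self-similar pressure. In distributional identities across the origin, $U^b\cdot\nabla w+w\cdot\nabla U^b$ is understood as $\operatorname{div}(U^b\otimes w+w\otimes U^b)$. $\delta_0$ is the Dirac mass at the origin, and $\partial_{b_i}$ is the partial derivative with respect to the $i$-th component of the parameter $b\in\mathbb{R}^3$. Landau solutions: use spherical coordinates $x=(r\sin\phi\cos\theta,r\sin\phi\sin\theta,r\cos\phi)$, $e_r=x/r$, $e_\theta=(-\sin\theta,\cos\theta,0)$, $e_\phi=e_\theta\times e_r$. For $a\in(1,\infty)$ let $$U=\frac2r\Big(\frac{a^2-1}{(a-\cos\phi)^2}-1\Big)e_r-\frac{2\sin\phi}{r(a-\cos\phi)}e_\phi,\qquad P=\frac{4(a\cos\phi-1)}{r^2(a-\cos\phi)^2},$$ and for $a=\infty$ let $U=0$, $P=0$. Put $\beta(a)=16\pi\Big(a+\frac12a^2\log\frac{a-1}{a+1}+\frac{4a}{3(a^2-1)}\Big)$, $\beta(\infty)=0$; $\beta$ is a bijection from $(1,\infty]$ onto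 $[0,\infty)$. Write $(U^b,P^b)$ for the pair $(U,P)$ corresponding to the parameter $a\in(1,\infty]$ when $b=\beta(a)e_3$; it satisfies $-\Delta U^b+\operatorname{div}(U^b\otimes U^b)+\nabla P^b=b\,\delta_0$ in distributions on $\mathbb{R}^3$. For general $b\in\mathbb{R}^3\setminus\{0\}$ put $U^b(x)=Q\,U^{|b|e_3}(Q^{T}x)$, $P^b(x)=P^{|b|e_3}(Q^Tx)$ with any $Q\in SO(3)$ such that $Qe_3=b/|b|$. *)

theory Defs
  imports "HOL-Analysis.Analysis"
begin

section \<open>Differential operators on \<open>\<real>\<^sup>3\<close>\<close>

definition partial :: "3 \<Rightarrow> (real^3 \<Rightarrow> 'b::real_normed_vector) \<Rightarrow> real^3 \<Rightarrow> 'b" where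
  "partial i f x = vector_derivative (\<lambda>t. f (x + t *\<^sub>R axis i 1)) (at 0)"

definition grad :: "(real^3 \<Rightarrow> real) \<Rightarrow> real^3 \<Rightarrow> real^3" where
  "grad q x = (\<chi> i. partial i q x)"

definition divergence :: "(real^3 \<Rightarrow> real^3) \<Rightarrow> real^3 \<Rightarrow> real" where
  "divergence w x = (\<Sum>i\<in>UNIV. partial i w x $ i)"

definition laplacian :: "(real^3 \<Rightarrow> 'b::real_normed_vector) \<Rightarrow> real^3 \<Rightarrow> 'b" where
  "laplacian f x = (\<Sum>i\<in>UNIV. partial i (partial i f) x)"

text \<open>\<open>convective v w\<close> is \<open>v \<cdot> \<nabla>w\<close>.\<close>
definition convective :: "(real^3 \<Rightarrow> real^3) \<Rightarrow> (real^3 \<Rightarrow> real^3) \<Rightarrow> real^3 \<Rightarrow> real^3" where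
  "convective v w x = (\<Sum>j\<in>UNIV. (v x $ j) *\<^sub>R partial j w x)"

text \<open>Both notions are meant for open \<open>S\<close>.\<close>
primrec Ck_on :: "nat \<Rightarrow> (real^3 \<Rightarrow> 'b::real_normed_vector) \<Rightarrow> (real^3) set \<Rightarrow> bool" where
  "Ck_on 0 f S \<longleftrightarrow> continuous_on S f"
| "Ck_on (Suc k) f S \<longleftrightarrow> f differentiable_on S \<and> (\<forall>i. Ck_on k (partial i f) S)"

definition smooth_on :: "(real^3 \<Rightarrow> 'b::real_normed_vector) \<Rightarrow> (real^3) set \<Rightarrow> bool" where
  "smooth_on f S \<longleftrightarrow> (\<forall>k. Ck_on k f S)"


section \<open>Landau solutions\<close>

definition polar_angle :: "real^3 \<Rightarrow> real" where
  "polar_angle x = arccos (x $ 3 / norm x)"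

definition azimuth :: "real^3 \<Rightarrow> real" where
  "azimuth x = Arg (Complex (x $ 1) (x $ 2))"

lemma spherical_coordinates:
  fixes x :: "real^3"
  shows "x = vector [norm x * sin (polar_angle x) * cos (azimuth x),
                     norm x * sin (polar_angle x) * sin (azimuth x),
                     norm x * cos (polar_angle x)]"
proof (cases "x = 0")
  case True
  then show ?thesis by (simp add: vec_eq_iff forall_3 vector_3)
next
  case False
  define z where "z = Complex (x $ 1) (x $ 2)"
  define r where "r = norm x"
  have r: "r > 0" using False by (simp add: r_def)
  have r2: "r\<^sup>2 = (x $ 1)\<^sup>2 + (x $ 2)\<^sup>2 + (x $ 3)\<^sup>2"
    unfolding r_def power2_norm_eq_inner by (simp add: inner_vec_def sum_3 power2_eq_square)
  have b: "\<bar>x $ 3\<bar> \<le> r" unfolding r_def by (rule component_le_norm_cart)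
  have b': "-1 \<le> x $ 3 / r" "x $ 3 / r \<le> 1"
    using b r by (auto simp: field_simps abs_le_iff)
  have c: "r * cos (polar_angle x) = x $ 3"
    using b' r by (simp add: polar_angle_def r_def[symmetric])
  have s0: "sin (polar_angle x) \<ge> 0"
    using b' by (simp add: polar_angle_def r_def[symmetric] sin_ge_zero arccos_lbound arccos_ubound)
  have "(r * sin (polar_angle x))\<^sup>2 = r\<^sup>2 - (r * cos (polar_angle x))\<^sup>2"
    by (simp add: power_mult_distrib sin_squared_eq algebra_simps)
  also have "\<dots> = (cmod z)\<^sup>2" using r2 c by (simp add: z_def cmod_power2)
  finally have s: "r * sin (polar_angle x) = cmod z"
    using s0 r by (simp add: power2_eq_iff_nonneg)
  have "rcis (cmod z) (Arg z) = z" by (rule rcis_cmod_Arg)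
  then have "cmod z * cos (azimuth x) = x $ 1" "cmod z * sin (azimuth x) = x $ 2"
    unfolding azimuth_def z_def[symmetric]
    by (metis Re_rcis z_def complex.sel(1), metis Im_rcis z_def complex.sel(2))
  then show ?thesis using c s by (simp add: vec_eq_iff forall_3 vector_3 r_def[symmetric])
qed

definition e_r :: "real^3 \<Rightarrow> real^3" where
  "e_r x = x /\<^sub>R norm x"

definition e_theta :: "real^3 \<Rightarrow> real^3" where
  "e_theta x = vector [- sin (azimuth x), cos (azimuth x), 0]"

definition e_phi :: "real^3 \<Rightarrow> real^3" where
  "e_phi x = cross3 (e_theta x) (e_r x)"

text \<open>The parameter \<open>a\<close> ranges over \<open>(1, \<infinity>]\<close>, hence the type \<^typ>\<open>ereal\<close>.\<close>
definition landau_axis_vel :: "ereal \<Rightarrow> real^3 \<Rightarrow> real^3" where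
  "landau_axis_vel a x =
     (if a = \<infinity> then 0
      else let \<alpha> = real_of_ereal a; r = norm x; \<phi> = polar_angle x in
        (2 / r * ((\<alpha>\<^sup>2 - 1) / (\<alpha> - cos \<phi>)\<^sup>2 - 1)) *\<^sub>R e_r x
        - (2 * sin \<phi> / (r * (\<alpha> - cos \<phi>))) *\<^sub>R e_phi x)"

definition landau_axis_pressure :: "ereal \<Rightarrow> real^3 \<Rightarrow> real" where
  "landau_axis_pressure a x =
     (if a = \<infinity> then 0
      else let \<alpha> = real_of_ereal a; r = norm x; \<phi> = polar_angle x in
        4 * (\<alpha> * cos \<phi> - 1) / (r\<^sup>2 * (\<alpha> - cos \<phi>)\<^sup>2))"

definition landau_beta :: "ereal \<Rightarrow> real" where
  "landau_beta a =
     (if a = \<infinity> then 0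
      else let \<alpha> = real_of_ereal a in
        16 * pi * (\<alpha> + 1/2 * \<alpha>\<^sup>2 * ln ((\<alpha> - 1) / (\<alpha> + 1)) + 4 * \<alpha> / (3 * (\<alpha>\<^sup>2 - 1))))"

text \<open>Inverse of the bijection \<^const>\<open>landau_beta\<close> from \<open>(1, \<infinity>]\<close> onto \<open>[0, \<infinity>)\<close>.\<close>
definition landau_param :: "real \<Rightarrow> ereal" where
  "landau_param s = inv_into {1<..} landau_beta s"

text \<open>A rotation taking \<open>e\<^sub>3\<close> to \<open>b / |b|\<close>; the axisymmetry of the axis solutions (without swirl)
  makes the choice immaterial. For \<open>b = 0\<close> the axis solution vanishes, so the value is irrelevant.\<close>
definition landau_rot :: "real^3 \<Rightarrow> real^3^3" where
  "landau_rot b = (SOME Q. rotation_matrix Q \<and> Q *v axis 3 1 = b /\<^sub>R norm b)"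

definition landau_vel :: "real^3 \<Rightarrow> real^3 \<Rightarrow> real^3" where
  "landau_vel b x =
     landau_rot b *v landau_axis_vel (landau_param (norm b)) (transpose (landau_rot b) *v x)"

definition landau_pressure :: "real^3 \<Rightarrow> real^3 \<Rightarrow> real" where
  "landau_pressure b x =
     landau_axis_pressure (landau_param (norm b)) (transpose (landau_rot b) *v x)"

text \<open>The derivatives with respect to the \<open>i\<close>-th component of the parameter \<open>b\<close>.\<close>
definition landau_vel_db :: "3 \<Rightarrow> real^3 \<Rightarrow> real^3 \<Rightarrow> real^3" where
  "landau_vel_db i b x = partial i (\<lambda>b'. landau_vel b' x) b"

definition landau_pressure_db :: "3 \<Rightarrow> real^3 \<Rightarrow> real^3 \<Rightarrow> real" where
  "landau_pressure_db i b x = partial i (\<lambda>b'. landau_pressure b' x) b"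


section \<open>The linearized equation away from the origin\<close>

text \<open>Fields on \<open>\<real>\<^sup>3 - {0}\<close> are total functions whose value at \<open>0\<close> is never constrained.\<close>

definition linearized_op ::
  "(real^3 \<Rightarrow> real^3) \<Rightarrow> (real^3 \<Rightarrow> real^3) \<Rightarrow> (real^3 \<Rightarrow> real) \<Rightarrow> real^3 \<Rightarrow> real^3" where
  "linearized_op U w q x = - laplacian w x + convective U w x + convective w U x + grad q x"

definition smooth_linearized_solution ::
  "(real^3 \<Rightarrow> real^3) \<Rightarrow> (real^3 \<Rightarrow> real^3) \<Rightarrow> (real^3 \<Rightarrow> real) \<Rightarrow> bool" where
  "smooth_linearized_solution U w q \<longleftrightarrow>
     smooth_on w (- {0}) \<and> smooth_on q (- {0}) \<and>
     (\<forall>x. x \<noteq> 0 \<longrightarrow> linearized_op U w q x = 0 \<and> divergence w x = 0)"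

definition self_similar_vel :: "(real^3 \<Rightarrow> real^3) \<Rightarrow> bool" where
  "self_similar_vel w \<longleftrightarrow> (\<forall>l>0. \<forall>x. x \<noteq> 0 \<longrightarrow> w x = l *\<^sub>R w (l *\<^sub>R x))"

definition self_similar_pressure :: "(real^3 \<Rightarrow> real) \<Rightarrow> bool" where
  "self_similar_pressure q \<longleftrightarrow> (\<forall>l>0. \<forall>x. x \<noteq> 0 \<longrightarrow> q x = l\<^sup>2 * q (l *\<^sub>R x))"

text \<open>The self-similar part of the kernel of the linearized operator, with self-similar pressure.\<close>
definition self_similar_kernel :: "(real^3 \<Rightarrow> real^3) \<Rightarrow> (real^3 \<Rightarrow> real^3) set" where
  "self_similar_kernel U =
     {w. \<exists>q. smooth_linearized_solution U w q \<and> self_similar_vel w \<and> self_similar_pressure q}"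


section \<open>The linearized equation in the sense of distributions\<close>

definition test_function :: "(real^3 \<Rightarrow> real) \<Rightarrow> bool" where
  "test_function \<psi> \<longleftrightarrow> smooth_on \<psi> UNIV \<and> compact (closure {x. \<psi> x \<noteq> 0})"

definition locally_integrable :: "(real^3 \<Rightarrow> real) \<Rightarrow> bool" where
  "locally_integrable f \<longleftrightarrow> (\<forall>K. compact K \<longrightarrow> set_integrable lborel K f)"

text \<open>Distributions are represented by their action on test functions.\<close>
type_synonym distribution = "(real^3 \<Rightarrow> real) \<Rightarrow> real"

definition regular_distr :: "(real^3 \<Rightarrow> real) \<Rightarrow> distribution" where
  "regular_distr f \<psi> = (LINT x|lborel. f x * \<psi> x)"

definition distr_partial :: "3 \<Rightarrow> distribution \<Rightarrow> distribution" where
  "distr_partial i T \<psi> = - T (partial i \<psi>)"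

definition dirac0 :: distribution where
  "dirac0 \<psi> = \<psi> 0"

text \<open>The \<open>i\<close>-th component of \<open>-\<Delta>w + div (U \<otimes> w + w \<otimes> U) + \<nabla>q\<close> as a distribution on \<open>\<real>\<^sup>3\<close>.\<close>
definition linearized_distr ::
  "(real^3 \<Rightarrow> real^3) \<Rightarrow> (real^3 \<Rightarrow> real^3) \<Rightarrow> (real^3 \<Rightarrow> real) \<Rightarrow> 3 \<Rightarrow> distribution" where
  "linearized_distr U w q i \<psi> =
     - (\<Sum>j\<in>UNIV. distr_partial j (distr_partial j (regular_distr (\<lambda>x. w x $ i))) \<psi>)
     + (\<Sum>j\<in>UNIV. distr_partial j (regular_distr (\<lambda>x. U x $ i * w x $ j + w x $ i * U x $ j)) \<psi>)
     + distr_partial i (regular_distr q) \<psi>"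

text \<open>Local integrability is part of the statement, since the Lebesgue integral of a
  non-integrable function is \<open>0\<close> by convention.\<close>
definition linearized_distr_eq ::
  "(real^3 \<Rightarrow> real^3) \<Rightarrow> (real^3 \<Rightarrow> real^3) \<Rightarrow> (real^3 \<Rightarrow> real) \<Rightarrow> real^3 \<Rightarrow> bool" where
  "linearized_distr_eq U w q c \<longleftrightarrow>
     (\<forall>i. locally_integrable (\<lambda>x. w x $ i)) \<and>
     (\<forall>i j. locally_integrable (\<lambda>x. U x $ i * w x $ j + w x $ i * U x $ j)) \<and>
     locally_integrable q \<and>
     (\<forall>i \<psi>. test_function \<psi> \<longrightarrow> linearized_distr U w q i \<psi> = c $ i * dirac0 \<psi>)"

end

theory Submission
  imports Defs "HOL-Real_Asymp.Real_Asymp"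
begin

text \<open>
  The solutions are found by a computation on the unit sphere, and their force by a flux through it.

  A field of degree \<open>-1\<close> splits as \<open>v + f x / |x|\<^sup>2\<close> with \<open>v\<close> tangential to the spheres and \<open>f\<close>
  constant along rays. The Landau solutions are parametrized by points \<open>\<sigma>\<close> of the open unit ball,
  with \<open>b\<close> and \<open>\<sigma>\<close> in the same direction. For them, \<open>v = \<nabla> log \<rho>\<close> and \<open>f = 2 K \<rho> - 2\<close>, where
  \<open>\<rho> = |x|\<^sup>2 / (|x| - \<sigma> \<bullet> x)\<^sup>2\<close> and \<open>K = 1 - |\<sigma>|\<^sup>2\<close>, and \<open>\<rho>\<close> solves the Liouville equation: \<open>K \<rho>\<close>
  times the round metric of the sphere has curvature \<open>1\<close>.

  Let \<open>w = v + f x / |x|\<^sup>2\<close> now be a self-similar solution of the linearized equation. Its radial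
  vorticity \<open>x \<bullet> curl w\<close> satisfies a scalar equation that is also solved by the positive function
  \<open>\<rho> / |x|\<close>. By the maximum principle, here in the form of an energy identity on the sphere, the
  quotient is constant; as the radial vorticity has mean zero, it vanishes
  (\<open>radial_vorticity_vanishes\<close>). Therefore \<open>v\<close> has a potential \<open>\<phi>\<close>. The tangential part of the
  equation determines the pressure, and the radial part says that \<open>f / \<rho> - 2 K \<phi>\<close> is harmonic
  with weight \<open>\<rho>\<close>, hence constant. After adding a constant to \<open>\<phi>\<close>, one has \<open>f = 2 K \<rho> \<phi>\<close>, and
  \<open>div w = 0\<close> becomes the linearized Liouville equation for \<open>\<phi>\<close> (\<open>linearized_solution_potential\<close>).
  A Lorentz boost acts on the sphere of directions as a conformal map that carries the metric \<open>K \<rho>\<close>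
  to the round one, and \<open>\<phi>\<close> to an eigenfunction of the round Laplacian for the eigenvalue \<open>2\<close>, that
  is, to a linear function (\<open>eigenfunction_is_mode\<close>). So there are three independent solutions, and
  they are the derivatives of the Landau solution with respect to \<open>\<sigma>\<close>.

  The map \<open>flux_vec\<close> from \<open>\<sigma>\<close> to \<open>b\<close> stretches the ball radially by an increasing function with
  positive derivative, hence its derivative is invertible at every point (\<open>param_derivatives\<close>), and
  derivatives with respect to \<open>\<sigma>\<close> and with respect to \<open>b\<close> span the same space.

  Across the origin, homogeneity leaves only a multiple of the Dirac mass, with the flux of momentum
  through the unit sphere as coefficient (\<open>linearized_distribution_flux\<close>). For a derivative of the
  Landau solution in direction \<open>d\<close>, this flux is the derivative of the nonlinear flux in the same
  direction. Archimedes' hat-box theorem evaluates the nonlinear flux as \<open>flux_vec \<sigma>\<close>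
  (\<open>sph_flux_density\<close>), so the force is the derivative of \<open>flux_vec\<close> applied to \<open>d\<close>. This is
  the vector of coefficients of the solution in the basis of derivatives with respect to \<open>b\<close>.
\<close>

section \<open>Calculus with partial derivatives\<close>

lemma partial_has_derivative:
  assumes "(f has_derivative f') (at x)"
  shows "partial i f x = f' (axis i 1)"
proof -
  have "((\<lambda>t. f (x + t *\<^sub>R axis i 1)) has_derivative (\<lambda>t. f' (t *\<^sub>R axis i 1))) (at 0)"
    by (rule has_derivative_compose[where f="\<lambda>t. x + t *\<^sub>R axis i 1", unfolded])
       (use assms in \<open>auto intro!: derivative_eq_intros\<close>)
  then have "((\<lambda>t. f (x + t *\<^sub>R axis i 1)) has_vector_derivative f' (axis i 1)) (at 0)"
    using linear_scale[OF has_derivative_linear[OF assms]] by (simp add: has_vector_derivative_def)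
  then show ?thesis unfolding partial_def by (rule vector_derivative_at)
qed

lemma has_derivative_partial:
  fixes f :: "real^3 \<Rightarrow> real"
  assumes "f differentiable at x"
  shows "(f has_derivative (\<lambda>h. \<Sum>j\<in>UNIV. h $ j * partial j f x)) (at x)"
proof -
  obtain f' where f': "(f has_derivative f') (at x)" using assms by (auto simp: differentiable_def)
  have "f' h = (\<Sum>j\<in>UNIV. h $ j * partial j f x)" for h
  proof -
    have "h = (\<Sum>j\<in>UNIV. (h $ j) *\<^sub>R axis j 1)"
      using basis_expansion[of h] by (simp add: scalar_mult_eq_scaleR)
    then have "f' h = f' (\<Sum>j\<in>UNIV. (h $ j) *\<^sub>R axis j 1)" by simp
    also have "\<dots> = (\<Sum>j\<in>UNIV. h $ j * f' (axis j 1))"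
      using has_derivative_linear[OF f'] by (simp add: linear_sum linear_scale)
    finally show ?thesis using partial_has_derivative[OF f'] by simp
  qed
  with f' show ?thesis by (metis (no_types, lifting) ext)
qed

lemma has_vector_derivative_partial:
  assumes "f differentiable at x"
  shows "((\<lambda>t. f (x + t *\<^sub>R axis i 1)) has_vector_derivative partial i f x) (at 0)"
proof -
  obtain f' where f': "(f has_derivative f') (at x)" using assms by (auto simp: differentiable_def)
  have "((\<lambda>t. f (x + t *\<^sub>R axis i 1)) has_derivative (\<lambda>t. f' (t *\<^sub>R axis i 1))) (at 0)"
    by (rule has_derivative_compose[where f="\<lambda>t. x + t *\<^sub>R axis i 1", unfolded])
       (use f' in \<open>auto intro!: derivative_eq_intros\<close>)
  then show ?thesis
    using linear_scale[OF has_derivative_linear[OF f']] partial_has_derivative[OF f', of i]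
    by (simp add: has_vector_derivative_def)
qed

lemma partial_cong:
  assumes "open S" "x \<in> S" "\<And>y. y \<in> S \<Longrightarrow> f y = g y"
  shows "partial i f x = partial i g x"
  unfolding partial_def
proof (rule vector_derivative_cong_eq)
  have "((\<lambda>t::real. x + t *\<^sub>R axis i 1) \<longlongrightarrow> x + 0 *\<^sub>R axis i 1) (nhds 0)"
    by (intro tendsto_intros filterlim_ident)
  then have "\<forall>\<^sub>F t in nhds 0. x + t *\<^sub>R axis i 1 \<in> S"
    using assms by (auto dest: topological_tendstoD)
  then show "\<forall>\<^sub>F t in nhds (0::real). t \<in> UNIV \<longrightarrow> f (x + t *\<^sub>R axis i 1) = g (x + t *\<^sub>R axis i 1)"
    by eventually_elim (use assms in auto)
qed auto

lemma partial_const [simp]: "partial i (\<lambda>x. c) x = 0"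
  by (rule trans[OF partial_has_derivative[OF has_derivative_const]]) simp

lemma partial_component: "partial i (\<lambda>x. x $ j) x = (if i = j then 1 else 0)"
proof -
  have "((\<lambda>x::real^3. x $ j) has_derivative (\<lambda>x. x $ j)) (at x)"
    by (rule bounded_linear_imp_has_derivative) (rule bounded_linear_vec_nth)
  from partial_has_derivative[OF this, of i] show ?thesis by (auto simp: axis_def)
qed

lemma partial_linear:
  assumes "f differentiable at x" "bounded_linear h"
  shows "partial i (\<lambda>x. h (f x)) x = h (partial i f x)"
proof -
  obtain f' where f': "(f has_derivative f') (at x)" using assms by (auto simp: differentiable_def)
  show ?thesis
    using partial_has_derivative[OF bounded_linear.has_derivative[OF assms(2) f']]
      partial_has_derivative[OF f'] by simp
qed

lemma partial_vec_nth:
  "f differentiable at x \<Longrightarrow> partial i (\<lambda>x. f x $ j) x = partial i f x $ j"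
  by (rule partial_linear[OF _ bounded_linear_vec_nth])

lemma partial_minus:
  "f differentiable at x \<Longrightarrow> partial i (\<lambda>x. - f x) x = - partial i f x"
  by (rule partial_linear[OF _ bounded_linear_minus[OF bounded_linear_ident]])

lemma partial_add:
  assumes "f differentiable at x" "g differentiable at x"
  shows "partial i (\<lambda>x. f x + g x) x = partial i f x + partial i g x"
proof -
  obtain f' g' where d: "(f has_derivative f') (at x)" "(g has_derivative g') (at x)"
    using assms by (auto simp: differentiable_def)
  show ?thesis
    using partial_has_derivative[OF has_derivative_add[OF d]] d[THEN partial_has_derivative] by simp
qed

lemma partial_diff:
  assumes "f differentiable at x" "g differentiable at x"
  shows "partial i (\<lambda>x. f x - g x) x = partial i f x - partial i g x"
proof -
  obtain f' g' where d: "(f has_derivative f') (at x)" "(g has_derivative g') (at x)"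
    using assms by (auto simp: differentiable_def)
  show ?thesis
    using partial_has_derivative[OF has_derivative_diff[OF d]] d[THEN partial_has_derivative] by simp
qed

lemma partial_mult:
  fixes f g :: "real^3 \<Rightarrow> real"
  assumes "f differentiable at x" "g differentiable at x"
  shows "partial i (\<lambda>x. f x * g x) x = partial i f x * g x + f x * partial i g x"
proof -
  obtain f' g' where d: "(f has_derivative f') (at x)" "(g has_derivative g') (at x)"
    using assms by (auto simp: differentiable_def)
  show ?thesis
    using partial_has_derivative[OF has_derivative_mult[OF d]] d[THEN partial_has_derivative]
    by (simp add: algebra_simps)
qed

lemma partial_sum:
  assumes "\<And>j. j \<in> A \<Longrightarrow> f j differentiable at x"
  shows "partial i (\<lambda>x. \<Sum>j\<in>A. f j x) x = (\<Sum>j\<in>A. partial i (f j) x)"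
proof -
  have "\<forall>j\<in>A. \<exists>f'. (f j has_derivative f') (at x)" using assms by (auto simp: differentiable_def)
  then obtain f' where d: "\<And>j. j \<in> A \<Longrightarrow> (f j has_derivative f' j) (at x)" by metis
  have "((\<lambda>x. \<Sum>j\<in>A. f j x) has_derivative (\<lambda>x. \<Sum>j\<in>A. f' j x)) (at x)"
    by (rule has_derivative_sum) (rule d)
  from partial_has_derivative[OF this] show ?thesis
    using partial_has_derivative[OF d] by simp
qed

lemma partial_real_compose:
  fixes f :: "real^3 \<Rightarrow> real"
  assumes "f differentiable at x" "(h has_field_derivative d) (at (f x))"
  shows "partial i (\<lambda>x. h (f x)) x = d * partial i f x"
proof -
  obtain f' where f': "(f has_derivative f') (at x)" using assms by (auto simp: differentiable_def)
  have "((\<lambda>x. h (f x)) has_derivative (\<lambda>x. d * f' x)) (at x)"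
    using has_derivative_compose[OF f' assms(2)[unfolded has_field_derivative_def]] .
  from partial_has_derivative[OF this] show ?thesis using partial_has_derivative[OF f'] by simp
qed

lemma partial_inverse:
  fixes f :: "real^3 \<Rightarrow> real"
  assumes "f differentiable at x" "f x \<noteq> 0"
  shows "partial i (\<lambda>x. inverse (f x)) x = - (inverse (f x) * inverse (f x) * partial i f x)"
  using partial_real_compose[OF assms(1) DERIV_inverse[OF assms(2)]] by (simp add: power2_eq_square)

lemma has_derivative_norm_at:
  assumes "x \<noteq> (0::real^3)"
  shows "(norm has_derivative (\<lambda>h. (x \<bullet> h) / norm x)) (at x)"
  using has_derivative_norm[OF assms]
  by (rule has_derivative_eq_rhs) (auto simp: sgn_div_norm inner_commute divide_inverse)

lemma differentiable_norm: "x \<noteq> 0 \<Longrightarrow> norm differentiable at (x::real^3)"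
  using has_derivative_norm_at differentiable_def by blast

lemma partial_norm: "x \<noteq> 0 \<Longrightarrow> partial i norm x = x $ i / norm x"
  by (subst partial_has_derivative[OF has_derivative_norm_at]) (auto simp: inner_axis)

lemma partial_compose:
  fixes f :: "real^3 \<Rightarrow> real" and g :: "real^3 \<Rightarrow> real^3"
  assumes "f differentiable at (g x)" "g differentiable at x"
  shows "partial i (\<lambda>x. f (g x)) x = (\<Sum>j\<in>UNIV. partial j f (g x) * partial i (\<lambda>x. g x $ j) x)"
proof -
  obtain g' where g': "(g has_derivative g') (at x)" using assms by (auto simp: differentiable_def)
  from has_derivative_compose[OF g' has_derivative_partial[OF assms(1)]]
  have "partial i (\<lambda>x. f (g x)) x = (\<Sum>j\<in>UNIV. g' (axis i 1) $ j * partial j f (g x))"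
    by (rule partial_has_derivative)
  then show ?thesis using partial_has_derivative[OF g', of i] partial_vec_nth[OF assms(2), of i]
    by (simp add: mult.commute)
qed

lemma differentiable_vec_nth: 
  fixes f :: "real^3 \<Rightarrow> real^3"
  shows "f differentiable at x \<longleftrightarrow> (\<forall>j. (\<lambda>x. f x $ j) differentiable at x)"
proof
  assume "f differentiable at x"
  then show "\<forall>j. (\<lambda>x. f x $ j) differentiable at x"
    using bounded_linear.has_derivative[OF bounded_linear_vec_nth] unfolding differentiable_def by blast
next
  assume "\<forall>j. (\<lambda>x. f x $ j) differentiable at x"
  then have "\<forall>j. \<exists>f'. ((\<lambda>x. f x $ j) has_derivative f') (at x)" by (simp add: differentiable_def)
  then obtain f' where "\<And>j. ((\<lambda>x. f x $ j) has_derivative f' j) (at x)" by metis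
  then have "(f has_derivative (\<lambda>h. \<chi> j. f' j h)) (at x)"
    by (subst has_derivative_componentwise_within) 
       (auto simp: Basis_vec_def inner_axis)
  then show "f differentiable at x" unfolding differentiable_def by blast
qed

subsection \<open>Smooth functions\<close>

lemma Ck_on_cong:
  assumes "open S" "\<And>y. y \<in> S \<Longrightarrow> f y = g y" "Ck_on k f S"
  shows "Ck_on k g S"
  using assms(2,3)
proof (induction k arbitrary: f g)
  case 0
  then show ?case by (metis Ck_on.simps(1) continuous_on_cong)
next
  case (Suc k)
  have "g differentiable_on S"
    using Suc.prems by (auto simp: differentiable_on_def intro: differentiable_transform_within[OF _ zero_less_one])
  moreover have "Ck_on k (partial i g) S" for i
  proof (rule Suc.IH)
    show "partial i f y = partial i g y" if "y \<in> S" for y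
      by (rule partial_cong[OF assms(1) that]) (rule Suc.prems)
    show "Ck_on k (partial i f) S" using Suc.prems by simp
  qed
  ultimately show ?case by simp
qed

lemma Ck_on_Suc_D: "Ck_on (Suc k) f S \<Longrightarrow> Ck_on k f S"
proof (induction k arbitrary: f)
  case 0
  then show ?case by (simp add: differentiable_imp_continuous_on)
next
  case (Suc k)
  then have "f differentiable_on S" "Ck_on (Suc k) (partial i f) S" for i
    by (simp_all only: Ck_on.simps(2)[of "Suc k"])
  then show ?case using Suc.IH by (simp only: Ck_on.simps(2)[of k f] simp_thms)
qed

lemma Ck_on_differentiable:
  assumes "Ck_on (Suc k) f S" "open S" "x \<in> S" shows "f differentiable at x"
proof -
  have "f differentiable at x within S" using assms(1,3) by (simp add: differentiable_on_def)
  then show ?thesis using at_within_open[OF assms(3,2)] by simp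
qed

lemma Ck_on_const: "Ck_on k (\<lambda>x. c) S"
proof (induction k arbitrary: c)
  case (Suc k)
  have "partial i (\<lambda>x. c) = (\<lambda>x. 0)" for i by (rule ext) simp
  then show ?case using Suc by simp
qed simp

lemma Ck_on_component: "Ck_on k (\<lambda>x. x $ j) S"
proof (cases k)
  case (Suc m)
  have "partial i (\<lambda>x. x $ j) = (\<lambda>x. if i = j then 1 else 0)" for i by (rule ext) (rule partial_component)
  moreover have "(\<lambda>x::real^3. x $ j) differentiable_on S"
    by (auto simp: differentiable_on_def intro!: bounded_linear_imp_differentiable bounded_linear_vec_nth)
  ultimately show ?thesis using Suc by (auto simp: Ck_on_const)
qed (simp add: continuous_intros)

lemma Ck_on_add:
  assumes "open S" shows "Ck_on k f S \<Longrightarrow> Ck_on k g S \<Longrightarrow> Ck_on k (\<lambda>x. f x + g x) S"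
proof (induction k arbitrary: f g)
  case 0 then show ?case by (simp add: continuous_on_add)
next
  case (Suc k)
  have "Ck_on k (partial i (\<lambda>x. f x + g x)) S" for i
    by (rule Ck_on_cong[OF assms, of "\<lambda>x. partial i f x + partial i g x"])
       (use Suc in \<open>auto simp: partial_add Ck_on_differentiable[OF _ assms, of k]\<close>)
  then show ?case using Suc.prems by auto
qed

lemma Ck_on_linear:
  assumes "open S" "bounded_linear h" shows "Ck_on k f S \<Longrightarrow> Ck_on k (\<lambda>x. h (f x)) S"
proof (induction k arbitrary: f)
  case 0 then show ?case using assms(2) by (simp add: bounded_linear.continuous_on)
next
  case (Suc k)
  have "Ck_on k (partial i (\<lambda>x. h (f x))) S" for i
    by (rule Ck_on_cong[OF assms(1), of "\<lambda>x. h (partial i f x)"])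
       (use Suc in \<open>auto simp: partial_linear[OF _ assms(2)] Ck_on_differentiable[OF _ assms(1), of k]\<close>)
  moreover have "(\<lambda>x. h (f x)) differentiable_on S"
    using Suc.prems bounded_linear.has_derivative[OF assms(2)]
    unfolding differentiable_on_def differentiable_def Ck_on.simps(2) by blast
  ultimately show ?case by auto
qed

lemma Ck_on_mult:
  fixes f g :: "real^3 \<Rightarrow> real"
  assumes "open S" shows "Ck_on k f S \<Longrightarrow> Ck_on k g S \<Longrightarrow> Ck_on k (\<lambda>x. f x * g x) S"
proof (induction k arbitrary: f g)
  case 0 then show ?case by (simp add: continuous_on_mult)
next
  case (Suc k)
  have "Ck_on k (partial i (\<lambda>x. f x * g x)) S" for i
    by (rule Ck_on_cong[OF assms, of "\<lambda>x. partial i f x * g x + f x * partial i g x"])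
       (use Suc Suc.prems[THEN Ck_on_Suc_D] in
         \<open>auto simp: partial_mult Ck_on_differentiable[OF _ assms, of k] intro!: Ck_on_add[OF assms]\<close>)
  then show ?case using Suc.prems by auto
qed

lemma Ck_on_vec_nth_iff:
  fixes f :: "real^3 \<Rightarrow> real^3"
  assumes "open S" shows "Ck_on k f S \<longleftrightarrow> (\<forall>j. Ck_on k (\<lambda>x. f x $ j) S)"
proof
  assume "Ck_on k f S" then show "\<forall>j. Ck_on k (\<lambda>x. f x $ j) S"
    by (auto intro: Ck_on_linear[OF assms bounded_linear_vec_nth])
next
  have "(\<forall>j. Ck_on k (\<lambda>x. f x $ j) S) \<Longrightarrow> Ck_on k f S" for f :: "real^3 \<Rightarrow> real^3"
  proof (induction k arbitrary: f)
    case 0 then show ?case 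
      using continuous_on_vec_lambda[of S "\<lambda>j x. f x $ j"] by simp
  next
    case (Suc k)
    have d: "f differentiable at x" if "x \<in> S" for x
      using Ck_on_differentiable[OF _ assms that] Suc.prems unfolding differentiable_vec_nth by blast
    have "Ck_on k (\<lambda>x. partial i f x $ j) S" for i j
      by (rule Ck_on_cong[OF assms, of "partial i (\<lambda>x. f x $ j)"])
         (use Suc.prems d in \<open>auto simp: partial_vec_nth\<close>)
    then have "Ck_on k (partial i f) S" for i using Suc.IH by blast
    then show ?case using d by (auto simp: differentiable_on_def intro: differentiable_at_withinI)
  qed
  then show "\<forall>j. Ck_on k (\<lambda>x. f x $ j) S \<Longrightarrow> Ck_on k f S" .
qed

lemma Ck_on_sum:
  assumes "open S" "\<And>j. j \<in> A \<Longrightarrow> Ck_on k (f j) S" shows "Ck_on k (\<lambda>x. \<Sum>j\<in>A. f j x) S"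
  using assms(2) by (induction A rule: infinite_finite_induct) (auto intro: Ck_on_const Ck_on_add[OF assms(1)])

lemma Ck_on_inverse:
  fixes f :: "real^3 \<Rightarrow> real"
  assumes "open S" "\<And>x. x \<in> S \<Longrightarrow> f x \<noteq> 0" 
  shows "Ck_on k f S \<Longrightarrow> Ck_on k (\<lambda>x. inverse (f x)) S"
proof (induction k)
  case 0 then show ?case using assms(2) by (simp add: continuous_on_inverse)
next
  case (Suc k)
  have "Ck_on k (partial i (\<lambda>x. inverse (f x))) S" for i
    by (rule Ck_on_cong[OF assms(1), of "\<lambda>x. - (inverse (f x) * inverse (f x) * partial i f x)"])
       (use Suc Suc.prems[THEN Ck_on_Suc_D] assms(2) in
         \<open>auto simp: partial_inverse Ck_on_differentiable[OF _ assms(1), of k]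
            intro!: Ck_on_linear[OF assms(1) bounded_linear_minus[OF bounded_linear_ident]] Ck_on_mult[OF assms(1)]\<close>)
  then show ?case using Suc.prems assms(2) 
    by (auto simp: differentiable_on_def intro!: differentiable_inverse)
qed

lemma Ck_on_norm: "0 \<notin> S \<Longrightarrow> open S \<Longrightarrow> Ck_on k norm S"
proof (induction k)
  case 0 then show ?case by (simp add: continuous_on_norm_id)
next
  case (Suc k)
  have nz: "x \<noteq> 0" if "x \<in> S" for x using Suc.prems(1) that by blast
  have "Ck_on k (partial i norm) S" for i
  proof (rule Ck_on_cong[OF Suc.prems(2)])
    show "x $ i * inverse (norm x) = partial i norm x" if "x \<in> S" for x
      by (simp add: partial_norm[OF nz[OF that]] divide_inverse)
    show "Ck_on k (\<lambda>x. x $ i * inverse (norm x)) S"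
      using nz Suc by (intro Ck_on_mult Ck_on_component Ck_on_inverse) simp_all
  qed
  moreover have "norm differentiable_on S"
    unfolding differentiable_on_def using nz differentiable_norm differentiable_at_withinI by blast
  ultimately show ?case by simp
qed

text \<open>The chain rule expresses the partial derivatives of the composition by partial derivatives of \<open>f\<close>,
  composed with \<open>g\<close>, so the induction needs the claim for all functions \<open>f\<close> of one class less.\<close>
lemma Ck_on_compose:
  fixes f :: "real^3 \<Rightarrow> real" and g :: "real^3 \<Rightarrow> real^3"
  assumes "open S" "open T" "g ` S \<subseteq> T" 
  shows "Ck_on k f T \<Longrightarrow> (\<forall>j. Ck_on k (\<lambda>x. g x $ j) S) \<Longrightarrow> Ck_on k (\<lambda>x. f (g x)) S"
proof (induction k arbitrary: f)
  case 0 
  then have "continuous_on S g" using Ck_on_vec_nth_iff[OF assms(1), of 0 g] by simp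
  then show ?case using 0 assms(3) by (auto intro: continuous_on_compose2)
next
  case (Suc k)
  have g: "Ck_on (Suc k) g S" using Suc.prems(2) Ck_on_vec_nth_iff[OF assms(1)] by blast
  have d: "f differentiable at (g x)" "g differentiable at x" if "x \<in> S" for x
    using Ck_on_differentiable[OF Suc.prems(1) assms(2)] Ck_on_differentiable[OF g assms(1)] that assms(3)
    by auto
  have "Ck_on k (partial i (\<lambda>x. f (g x))) S" for i
  proof (rule Ck_on_cong[OF assms(1), of "\<lambda>x. \<Sum>j\<in>UNIV. partial j f (g x) * partial i (\<lambda>x. g x $ j) x"])
    have "Ck_on k (\<lambda>x. partial j f (g x)) S" for j
    proof (rule Suc.IH)
      show "Ck_on k (partial j f) T" using Suc.prems by simp
      show "\<forall>j. Ck_on k (\<lambda>x. g x $ j) S" using Suc.prems(2) Ck_on_Suc_D by blast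
    qed
    then show "Ck_on k (\<lambda>x. \<Sum>j\<in>UNIV. partial j f (g x) * partial i (\<lambda>x. g x $ j) x) S"
      using Suc.prems by (auto intro!: Ck_on_sum Ck_on_mult assms(1))
  qed (use d in \<open>auto simp: partial_compose\<close>)
  moreover have "(\<lambda>x. f (g x)) differentiable at x" if "x \<in> S" for x
    using differentiable_chain_at[OF d(2) d(1)] that by (simp add: o_def)
  ultimately show ?case by (auto simp: differentiable_on_def intro: differentiable_at_withinI)
qed

named_theorems smooth_intros

lemma smooth_on_cong: "smooth_on f S \<Longrightarrow> open S \<Longrightarrow> (\<And>y. y \<in> S \<Longrightarrow> f y = g y) \<Longrightarrow> smooth_on g S"
  unfolding smooth_on_def using Ck_on_cong by blast

lemma smooth_on_partial [smooth_intros]: "smooth_on f S \<Longrightarrow> smooth_on (partial i f) S"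
  unfolding smooth_on_def by (metis Ck_on.simps(2))

lemma smooth_on_differentiable: "smooth_on f S \<Longrightarrow> open S \<Longrightarrow> x \<in> S \<Longrightarrow> f differentiable at x"
  unfolding smooth_on_def using Ck_on_differentiable by blast

lemma smooth_on_continuous: "smooth_on f S \<Longrightarrow> continuous_on S f"
  unfolding smooth_on_def by (metis Ck_on.simps(1))

lemma smooth_on_from_partials:
  assumes "f differentiable_on S" "\<And>i. smooth_on (partial i f) S"
  shows "smooth_on f S"
  unfolding smooth_on_def
proof
  fix k show "Ck_on k f S"
    using assms by (cases k) (auto simp: smooth_on_def differentiable_imp_continuous_on)
qed

lemma smooth_on_const [smooth_intros]: "smooth_on (\<lambda>x. c) S"
  by (simp add: smooth_on_def Ck_on_const)

lemma smooth_on_component [smooth_intros]: "smooth_on (\<lambda>x. x $ j) S"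
  by (simp add: smooth_on_def Ck_on_component)

lemma smooth_on_norm [smooth_intros]: "open S \<Longrightarrow> 0 \<notin> S \<Longrightarrow> smooth_on (\<lambda>x. norm x) S"
  by (simp add: smooth_on_def Ck_on_norm)

lemma smooth_on_add [smooth_intros]:
  "open S \<Longrightarrow> smooth_on f S \<Longrightarrow> smooth_on g S \<Longrightarrow> smooth_on (\<lambda>x. f x + g x) S"
  by (simp add: smooth_on_def Ck_on_add)

lemma smooth_on_minus [smooth_intros]:
  "open S \<Longrightarrow> smooth_on f S \<Longrightarrow> smooth_on (\<lambda>x. - f x) S"
  by (simp add: smooth_on_def Ck_on_linear[OF _ bounded_linear_minus[OF bounded_linear_ident]])

lemma smooth_on_diff [smooth_intros]:
  "open S \<Longrightarrow> smooth_on f S \<Longrightarrow> smooth_on g S \<Longrightarrow> smooth_on (\<lambda>x. f x - g x) S"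
  using smooth_on_add[of S f "\<lambda>x. - g x"] smooth_on_minus[of S g] by simp

lemma smooth_on_mult [smooth_intros]:
  fixes f g :: "real^3 \<Rightarrow> real"
  shows "open S \<Longrightarrow> smooth_on f S \<Longrightarrow> smooth_on g S \<Longrightarrow> smooth_on (\<lambda>x. f x * g x) S"
  by (simp add: smooth_on_def Ck_on_mult)

lemma smooth_on_power [smooth_intros]:
  fixes f :: "real^3 \<Rightarrow> real"
  shows "open S \<Longrightarrow> smooth_on f S \<Longrightarrow> smooth_on (\<lambda>x. f x ^ n) S"
  by (induction n) (auto intro: smooth_intros)

lemma smooth_on_divide [smooth_intros]:
  fixes f g :: "real^3 \<Rightarrow> real"
  shows "open S \<Longrightarrow> smooth_on f S \<Longrightarrow> smooth_on g S \<Longrightarrow> (\<And>x. x \<in> S \<Longrightarrow> g x \<noteq> 0) \<Longrightarrow> smooth_on (\<lambda>x. f x / g x) S"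
  unfolding divide_inverse
  by (rule smooth_on_mult) (auto simp: smooth_on_def Ck_on_inverse)

lemma smooth_on_sum [smooth_intros]:
  "open S \<Longrightarrow> (\<And>j. j \<in> A \<Longrightarrow> smooth_on (f j) S) \<Longrightarrow> smooth_on (\<lambda>x. \<Sum>j\<in>A. f j x) S"
  by (simp add: smooth_on_def Ck_on_sum)

lemma smooth_on_vec_nth [smooth_intros]:
  "open S \<Longrightarrow> smooth_on f S \<Longrightarrow> smooth_on (\<lambda>x. f x $ j) S" for f :: "real^3 \<Rightarrow> real^3"
  using Ck_on_vec_nth_iff by (auto simp: smooth_on_def)

lemma smooth_on_vecI:
  "open S \<Longrightarrow> (\<And>j. smooth_on (\<lambda>x. f x $ j) S) \<Longrightarrow> smooth_on f S" for f :: "real^3 \<Rightarrow> real^3"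
  using Ck_on_vec_nth_iff[of S _ f] by (auto simp: smooth_on_def)

lemma smooth_on_compose:
  fixes f :: "real^3 \<Rightarrow> real" and g :: "real^3 \<Rightarrow> real^3"
  shows "open S \<Longrightarrow> open T \<Longrightarrow> g ` S \<subseteq> T \<Longrightarrow> smooth_on f T \<Longrightarrow> (\<And>j. smooth_on (\<lambda>x. g x $ j) S)
    \<Longrightarrow> smooth_on (\<lambda>x. f (g x)) S"
  using Ck_on_compose[of S T g _ f] by (auto simp: smooth_on_def)

lemma Ck_on_subset: "Ck_on k f S \<Longrightarrow> T \<subseteq> S \<Longrightarrow> Ck_on k f T"
  by (induction k arbitrary: f) (auto intro: continuous_on_subset differentiable_on_subset)

lemma smooth_on_subset: "smooth_on f S \<Longrightarrow> T \<subseteq> S \<Longrightarrow> smooth_on f T"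
  unfolding smooth_on_def using Ck_on_subset by blast

lemma DERIV_partial_line:
  fixes f :: "real^3 \<Rightarrow> real"
  assumes "f differentiable at (y + t *\<^sub>R axis i 1)"
  shows "((\<lambda>t. f (y + t *\<^sub>R axis i 1)) has_field_derivative partial i f (y + t *\<^sub>R axis i 1)) (at t)"
proof -
  have "((\<lambda>s. f ((y + t *\<^sub>R axis i 1) + s *\<^sub>R axis i 1)) has_field_derivative partial i f (y + t *\<^sub>R axis i 1)) (at 0)"
    using has_vector_derivative_partial[OF assms, of i]
    by (simp add: has_real_derivative_iff_has_vector_derivative)
  then have "((\<lambda>s. f (y + (s + t) *\<^sub>R axis i 1)) has_field_derivative partial i f (y + t *\<^sub>R axis i 1)) (at 0)"
    by (simp add: algebra_simps)
  then show ?thesis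
    using DERIV_shift[of "\<lambda>s. f (y + s *\<^sub>R axis i 1)" _ 0 t] by simp
qed

text \<open>The mean value theorem is applied first in direction \<open>i\<close> to the increment in direction \<open>j\<close>,
  then in direction \<open>j\<close> to \<open>\<partial>\<^sub>i f\<close>.\<close>
lemma second_difference_mean_value:
  fixes f :: "real^3 \<Rightarrow> real"
  assumes C: "Ck_on 2 f (ball x d)" and h: "0 < h" "2 * h < d"
  shows "\<exists>y\<in>ball x d. f (x + h *\<^sub>R axis i 1 + h *\<^sub>R axis j 1) - f (x + h *\<^sub>R axis i 1)
           - f (x + h *\<^sub>R axis j 1) + f x = h * (h * partial j (partial i f) y)"
proof -
  have inb: "x + a *\<^sub>R axis i 1 + b *\<^sub>R axis j 1 \<in> ball x d" if "0 \<le> a" "a \<le> h" "0 \<le> b" "b \<le> h" for a b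
  proof -
    have "norm (a *\<^sub>R axis i (1::real) + b *\<^sub>R axis j 1 :: real^3) \<le> a + b"
      using that by (intro order_trans[OF norm_triangle_ineq]) (simp add: norm_axis_1)
    moreover have "dist x (x + a *\<^sub>R axis i 1 + b *\<^sub>R axis j 1)
        = norm (a *\<^sub>R axis i (1::real) + b *\<^sub>R axis j 1 :: real^3)"
      using norm_minus_cancel[of "a *\<^sub>R axis i (1::real) + b *\<^sub>R axis j 1 :: real^3"]
      by (simp add: dist_norm algebra_simps)
    ultimately show ?thesis using that h by simp
  qed
  have C1: "Ck_on (Suc 0) f (ball x d)" "Ck_on (Suc 0) (partial i f) (ball x d)"
    using C Ck_on_Suc_D[of "Suc 0" f] by (simp_all only: numeral_2_eq_2) (simp_all only: Ck_on.simps simp_thms)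
  have d1: "f differentiable at y" "partial i f differentiable at y" if "y \<in> ball x d" for y
    using Ck_on_differentiable[OF C1(1) _ that] Ck_on_differentiable[OF C1(2) _ that] by simp_all
  let ?e = "axis i (1::real) :: real^3" and ?e' = "axis j (1::real) :: real^3"
  have "\<exists>a>0. a < h \<and> (f (x + h *\<^sub>R ?e' + h *\<^sub>R ?e) - f (x + h *\<^sub>R ?e)) - (f (x + h *\<^sub>R ?e' + 0 *\<^sub>R ?e) - f (x + 0 *\<^sub>R ?e))
     = (h - 0) * (partial i f (x + h *\<^sub>R ?e' + a *\<^sub>R ?e) - partial i f (x + a *\<^sub>R ?e))"
  proof (rule MVT2[OF h(1)])
    fix a assume a: "0 \<le> a" "a \<le> h"
    show "((\<lambda>a. f (x + h *\<^sub>R ?e' + a *\<^sub>R ?e) - f (x + a *\<^sub>R ?e)) has_field_derivative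
       partial i f (x + h *\<^sub>R ?e' + a *\<^sub>R ?e) - partial i f (x + a *\<^sub>R ?e)) (at a)"
      using inb[of a h] inb[of a 0] a h
      by (intro DERIV_diff DERIV_partial_line d1) (simp_all add: algebra_simps)
  qed
  then obtain a where a: "0 < a" "a < h" and
    e1: "(f (x + h *\<^sub>R ?e' + h *\<^sub>R ?e) - f (x + h *\<^sub>R ?e)) - (f (x + h *\<^sub>R ?e') - f x)
     = h * (partial i f (x + h *\<^sub>R ?e' + a *\<^sub>R ?e) - partial i f (x + a *\<^sub>R ?e))" by auto
  have "\<exists>b>0. b < h \<and> partial i f ((x + a *\<^sub>R ?e) + h *\<^sub>R ?e') - partial i f ((x + a *\<^sub>R ?e) + 0 *\<^sub>R ?e') 
     = (h - 0) * partial j (partial i f) ((x + a *\<^sub>R ?e) + b *\<^sub>R ?e')"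
    by (rule MVT2[OF h(1)], intro DERIV_partial_line d1 inb) (use a in auto)
  then obtain b where b: "0 < b" "b < h" and
    e2: "partial i f (x + a *\<^sub>R ?e + h *\<^sub>R ?e') - partial i f (x + a *\<^sub>R ?e)
     = h * partial j (partial i f) (x + a *\<^sub>R ?e + b *\<^sub>R ?e')" by auto
  have "f (x + h *\<^sub>R ?e + h *\<^sub>R ?e') - f (x + h *\<^sub>R ?e) - f (x + h *\<^sub>R ?e') + f x
     = h * (h * partial j (partial i f) (x + a *\<^sub>R ?e + b *\<^sub>R ?e'))"
    using e1 e2 by (simp add: algebra_simps)
  then show ?thesis using inb[of a b] a b by fastforce
qed

text \<open>Both orders of differentiation are limits of the same second difference quotient.\<close>
lemma partial_commute:
  fixes f :: "real^3 \<Rightarrow> real"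
  assumes "open S" "x \<in> S" "Ck_on 2 f S"
  shows "partial i (partial j f) x = partial j (partial i f) x"
\<comment> \<open>If the two derivatives differed at \<open>x\<close>, they would stay apart on a small ball, while the second
    difference is the same multiple of a value of each on that ball.\<close>
proof (rule ccontr)
  let ?A = "partial i (partial j f)" and ?B = "partial j (partial i f)"
  assume ne: "?A x \<noteq> ?B x"
  have "continuous_on S ?A" "continuous_on S ?B" using assms(3) by (simp_all add: numeral_2_eq_2)
  then have "isCont ?A x" "isCont ?B x" using assms by (simp_all add: continuous_on_eq_continuous_at)
  then have "\<exists>d>0. \<forall>y. dist y x < d \<longrightarrow> dist (?A y) (?A x) < dist (?A x) (?B x) / 2"
    "\<exists>d>0. \<forall>y. dist y x < d \<longrightarrow> dist (?B y) (?B x) < dist (?A x) (?B x) / 2"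
    unfolding continuous_at_eps_delta using zero_less_dist_iff[THEN iffD2, OF ne] half_gt_zero by blast+
  then obtain d1 d2 where d: "d1 > 0" "d2 > 0" 
    "\<And>y. dist y x < d1 \<Longrightarrow> dist (?A y) (?A x) < dist (?A x) (?B x) / 2"
    "\<And>y. dist y x < d2 \<Longrightarrow> dist (?B y) (?B x) < dist (?A x) (?B x) / 2" by metis
  obtain d3 where d3: "d3 > 0" "ball x d3 \<subseteq> S" using assms(1,2) openE by blast
  define r where "r = min d1 (min d2 d3)"
  have r: "r > 0" "r \<le> d1" "r \<le> d2" "ball x r \<subseteq> S" using d d3 by (auto simp: r_def)
  have C: "Ck_on 2 f (ball x r)" by (rule Ck_on_subset[OF assms(3) r(4)])
  have h: "0 < r / 3" "2 * (r / 3) < r" using r by auto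
  obtain y where y: "y \<in> ball x r" "f (x + (r/3) *\<^sub>R axis i 1 + (r/3) *\<^sub>R axis j 1) - f (x + (r/3) *\<^sub>R axis i 1)
           - f (x + (r/3) *\<^sub>R axis j 1) + f x = r/3 * (r/3 * ?B y)"
    using second_difference_mean_value[OF C h] by blast
  obtain z where z: "z \<in> ball x r" "f (x + (r/3) *\<^sub>R axis j 1 + (r/3) *\<^sub>R axis i 1) - f (x + (r/3) *\<^sub>R axis j 1)
           - f (x + (r/3) *\<^sub>R axis i 1) + f x = r/3 * (r/3 * ?A z)"
    using second_difference_mean_value[OF C h] by blast
  have "r/3 * (r/3 * ?B y) = r/3 * (r/3 * ?A z)" using y(2) z(2) by (simp add: algebra_simps)
  then have "?A z = ?B y" using r by simp
  moreover have "dist (?A z) (?A x) < dist (?A x) (?B x) / 2" "dist (?B y) (?B x) < dist (?A x) (?B x) / 2"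
    using d(3)[of z] d(4)[of y] y(1) z(1) r(2,3) by (simp_all only: mem_ball dist_commute[of x] less_le_trans)
  ultimately show False by (metis dist_triangle_half_r dist_commute less_irrefl)
qed

lemma smooth_partial_commute:
  fixes f :: "real^3 \<Rightarrow> real"
  assumes "smooth_on f S" "open S" "x \<in> S" 
  shows "partial i (partial j f) x = partial j (partial i f) x"
  using assms partial_commute unfolding smooth_on_def by blast

section \<open>Integration by parts\<close>

lemma integrable_continuous_bounded_support:
  fixes f :: "real^3 \<Rightarrow> real"
  assumes "continuous_on UNIV f" "\<And>x. norm x \<ge> R \<Longrightarrow> f x = 0"
  shows "integrable lborel f"
proof -
  have "integrable lborel (\<lambda>x. indicator (cball 0 R) x *\<^sub>R f x)"
    by (rule borel_integrable_compact) (use assms(1) continuous_on_subset in auto)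
  moreover have "(\<lambda>x. indicator (cball 0 R) x *\<^sub>R f x) = f"
    using assms(2) by (fastforce simp: indicator_def)
  ultimately show ?thesis by simp
qed

lemma integral_translate:
  fixes f :: "real^3 \<Rightarrow> real"
  assumes "f \<in> borel_measurable borel"
  shows "(LINT x|lborel. f (x + c)) = (LINT x|lborel. f x)"
proof -
  have "(LINT x|lborel. f x) = (LINT x|distr lborel borel ((+) c). f x)" by (simp add: lborel_distr_plus)
  also have "\<dots> = (LINT x|lborel. f (c + x))" by (rule integral_distr) (use assms in auto)
  finally show ?thesis by (simp add: add.commute)
qed

text \<open>Translation invariance makes the integral of every difference quotient vanish, and the
  quotients converge boundedly to the derivative.\<close>
lemma integral_partial_eq_0:
  fixes g :: "real^3 \<Rightarrow> real"
  assumes d: "\<And>x. g differentiable at x" and c: "continuous_on UNIV (partial i g)"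
    and s: "\<And>x. norm x \<ge> R \<Longrightarrow> g x = 0"
  shows "(LINT x|lborel. partial i g x) = 0"
proof -
  define e :: "real^3" where "e = axis i 1"
  have ne: "norm e = 1" by (simp add: e_def norm_axis_1)
  have cg: "continuous_on UNIV g"
    using d by (intro continuous_at_imp_continuous_on) (auto intro: differentiable_imp_continuous_within)
  have pz: "partial i g x = 0" if "norm x > R" for x
  proof -
    have "open {x::real^3. norm x > R}" by (intro open_Collect_less continuous_intros)
    then have "partial i g x = partial i (\<lambda>x. 0) x"
      by (rule partial_cong) (use that s in auto)
    then show ?thesis by simp
  qed
  have "compact (partial i g ` cball 0 (R + 2))"
    using c continuous_on_subset by (intro compact_continuous_image) auto
  then obtain M where M0: "\<And>x. x \<in> cball 0 (R + 2) \<Longrightarrow> \<bar>partial i g x\<bar> \<le> M"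
    by (metis compact_imp_bounded bounded_iff imageI real_norm_def)
  have M: "\<bar>partial i g x\<bar> \<le> \<bar>M\<bar>" for x
  proof (cases "norm x \<le> R + 2")
    case True then show ?thesis using M0[of x] by auto
  next
    case False then show ?thesis using pz[of x] by auto
  qed
  define t where "t n = 1 / (real n + 1)" for n
  have t: "0 < t n" "t n \<le> 1" for n by (auto simp: t_def)
  have tl: "t \<longlonglongrightarrow> 0" unfolding t_def
    using LIMSEQ_inverse_real_of_nat by (simp add: inverse_eq_divide add.commute)
  define D where "D n x = (g (x + t n *\<^sub>R e) - g x) / t n" for n x
  have gi: "integrable lborel g" using cg s by (rule integrable_continuous_bounded_support)
  have cgt: "continuous_on UNIV (\<lambda>x. g (x + t n *\<^sub>R e))" for n
    by (rule continuous_on_compose2[OF cg]) (auto intro!: continuous_intros)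
  have gti: "integrable lborel (\<lambda>x. g (x + t n *\<^sub>R e))" for n
  proof (rule integrable_continuous_bounded_support[OF cgt])
    fix x :: "real^3" assume "norm x \<ge> R + 1"
    then have "norm (x + t n *\<^sub>R e) \<ge> R"
      using norm_diff_ineq[of x "t n *\<^sub>R e"] t[of n] ne by simp
    then show "g (x + t n *\<^sub>R e) = 0" by (rule s)
  qed
  have D0: "(LINT x|lborel. D n x) = 0" for n
  proof -
    have "(LINT x|lborel. D n x) = ((LINT x|lborel. g (x + t n *\<^sub>R e)) - (LINT x|lborel. g x)) / t n"
      unfolding D_def using gi gti by simp
    then show ?thesis using integral_translate[of g "t n *\<^sub>R e"] cg borel_measurable_continuous_onI by auto
  qed
  have "(\<lambda>n. LINT x|lborel. D n x) \<longlonglongrightarrow> (LINT x|lborel. partial i g x)"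
  proof (rule integral_dominated_convergence)
    show "partial i g \<in> borel_measurable lborel" using c borel_measurable_continuous_onI by auto
    show "D n \<in> borel_measurable lborel" for n
      unfolding D_def[abs_def] using gi gti by auto
    show "integrable lborel (\<lambda>x. \<bar>M\<bar> * indicator (cball 0 (R + 1)) x)"
      by (intro integrable_mult_right integrable_real_indicator emeasure_lborel_cball_finite) simp
    show "AE x in lborel. (\<lambda>n. D n x) \<longlonglongrightarrow> partial i g x"
    proof (rule AE_I2)
      fix x
      have "((\<lambda>h. (g (x + h *\<^sub>R e) - g x) / h) \<longlongrightarrow> partial i g x) (at 0)"
        using DERIV_partial_line[of g x 0 i] d by (simp add: DERIV_def e_def)
      moreover have "filterlim t (at 0) sequentially"
        using tl t by (simp add: filterlim_at less_imp_neq[symmetric])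
      ultimately show "(\<lambda>n. D n x) \<longlonglongrightarrow> partial i g x"
        unfolding D_def by (rule filterlim_compose)
    qed
    \<comment> \<open>the difference quotient is a value of the derivative at an intermediate point\<close>
    show "AE x in lborel. norm (D n x) \<le> \<bar>M\<bar> * indicator (cball 0 (R + 1)) x" for n
    proof (rule AE_I2)
      fix x
      show "norm (D n x) \<le> \<bar>M\<bar> * indicator (cball 0 (R + 1)) x"
      proof (cases "norm x \<le> R + 1")
        case True
        have "\<exists>z>0. z < t n \<and> g (x + t n *\<^sub>R e) - g (x + 0 *\<^sub>R e) = (t n - 0) * partial i g (x + z *\<^sub>R e)"
          unfolding e_def by (rule MVT2) (use t d in \<open>auto intro!: DERIV_partial_line\<close>)
        then obtain z where "g (x + t n *\<^sub>R e) - g x = t n * partial i g (x + z *\<^sub>R e)" by auto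
        then have "D n x = partial i g (x + z *\<^sub>R e)" using t[of n] by (simp add: D_def)
        then show ?thesis using M True by simp
      next
        case False
        then have "norm (x + t n *\<^sub>R e) \<ge> R" "norm x \<ge> R"
          using norm_diff_ineq[of x "t n *\<^sub>R e"] t[of n] ne by simp_all
        then show ?thesis using s by (simp add: D_def)
      qed
    qed
  qed
  then show ?thesis using D0 LIMSEQ_unique[OF _ tendsto_const] by simp
qed

lemma continuous_on_extend_0:
  fixes f :: "real^3 \<Rightarrow> real"
  assumes "continuous_on (-{0}) f" "a > 0" "\<And>x. norm x < a \<Longrightarrow> f x = 0"
  shows "continuous_on UNIV f"
proof -
  have "continuous_on (ball 0 a) f"
    by (rule continuous_on_eq[OF continuous_on_const[of _ 0]]) (use assms in auto)
  then have "continuous_on (-{0} \<union> ball 0 a) f" using assms(1) by (intro continuous_on_open_Un) auto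
  moreover have "-{0} \<union> ball (0::real^3) a = UNIV" using assms(2) by auto
  ultimately show ?thesis by simp
qed

lemma partial_eq_0_near_0:
  fixes f :: "real^3 \<Rightarrow> real"
  assumes "a > 0" "\<And>x. norm x < a \<Longrightarrow> f x = 0" "norm x < a"
  shows "partial i f x = 0" "f differentiable at x"
proof -
  have "partial i f x = partial i (\<lambda>x. 0) x" by (rule partial_cong[of "ball 0 a"]) (use assms in auto)
  then show "partial i f x = 0" by simp
  have "((\<lambda>x. 0) has_derivative (\<lambda>x. 0)) (at x)" by simp
  then have "(f has_derivative (\<lambda>x. 0)) (at x)"
    by (rule has_derivative_transform_within_open[of _ _ _ _ "ball 0 a"]) (use assms in auto)
  then show "f differentiable at x" by (auto simp: differentiable_def)
qed

lemma partial_radial: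
  assumes "(h has_field_derivative d) (at (norm x))" "x \<noteq> 0"
  shows "partial i (\<lambda>x. h (norm x)) x = d * (x $ i / norm x)"
  using partial_real_compose[OF differentiable_norm[OF assms(2)] assms(1)] partial_norm[OF assms(2)] by simp

lemma differentiable_radial:
  assumes "(h has_field_derivative d) (at (norm x))" "x \<noteq> (0::real^3)"
  shows "(\<lambda>x. h (norm x)) differentiable at x"
proof -
  have "h differentiable at (norm x)" using assms(1) by (auto simp: differentiable_def has_field_derivative_def)
  then show ?thesis using differentiable_chain_at[OF differentiable_norm[OF assms(2)]] by (simp add: o_def)
qed

lemma open_punctured [simp]: "open (- {0::real^3})" by auto

text \<open>Integration by parts moves the derivatives to \<open>h (|x|)\<close>, whose gradient is radial and hence
  orthogonal to \<open>Z\<close>.\<close>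
lemma integral_radial_times_divergence:
  fixes Z :: "3 \<Rightarrow> real^3 \<Rightarrow> real"
  assumes h: "\<And>r. (h has_field_derivative h' r) (at r)" and h': "continuous_on UNIV h'"
    and a: "0 < a" and hz: "\<And>r. r \<le> a \<or> b \<le> r \<Longrightarrow> h r = 0"
    and Z: "\<And>j. smooth_on (Z j) (-{0})" 
    and tang: "\<And>x. x \<noteq> 0 \<Longrightarrow> (\<Sum>j\<in>UNIV. x $ j * Z j x) = 0"
  shows "(LINT x|lborel. h (norm x) * (\<Sum>j\<in>UNIV. partial j (Z j) x)) = 0"
proof -
  define g where "g j x = h (norm x) * Z j x" for j x
  have dZ: "Z j differentiable at x" if "x \<noteq> 0" for j x
    using smooth_on_differentiable[OF Z open_punctured] that by simp
  have hc: "continuous_on UNIV h" using h by (intro continuous_at_imp_continuous_on ballI) (rule DERIV_isCont)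
  have h'z: "h' r = 0" if "r < a" for r
  proof -
    have "eventually (\<lambda>s. h s = 0) (nhds r)"
      using that hz eventually_nhds_in_open[of "{..<a}" r] by (auto elim: eventually_mono)
    then have "DERIV h r :> 0 \<longleftrightarrow> DERIV (\<lambda>r. 0) r :> (0::real)" by (intro DERIV_cong_ev) auto
    then have "DERIV h r :> 0" by simp
    then show ?thesis using h DERIV_unique by blast
  qed
  have pg: "partial j (g j) x = h' (norm x) * (x $ j * Z j x / norm x) + h (norm x) * partial j (Z j) x"
    and dg: "g j differentiable at x" for j x
  proof -
    have near: "norm x < a \<Longrightarrow> partial j (g j) x = 0" "norm x < a \<Longrightarrow> g j differentiable at x"
      using partial_eq_0_near_0(1)[of a "g j" x j] partial_eq_0_near_0(2)[of a "g j" x] a hz by (auto simp: g_def)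
    show "partial j (g j) x = h' (norm x) * (x $ j * Z j x / norm x) + h (norm x) * partial j (Z j) x"
    proof (cases "x = 0")
      case True
      then show ?thesis using near(1) a hz[of 0] by simp
    next
      case False
      then show ?thesis unfolding g_def
        by (simp add: partial_mult differentiable_radial[OF h] dZ partial_radial[OF h])
    qed
    show "g j differentiable at x"
      using near(2) a dZ differentiable_radial[OF h] unfolding g_def
      by (cases "x = 0") (auto intro!: differentiable_mult)
  qed
  have cn: "continuous_on A (\<lambda>x. h (norm x))" "continuous_on A (\<lambda>x. h' (norm x))" for A :: "(real^3) set"
    by (auto intro!: continuous_on_compose2[OF hc] continuous_on_compose2[OF h'] continuous_intros)
  have cpg: "continuous_on UNIV (partial j (g j))" for j
  proof (rule continuous_on_extend_0[OF _ a])
    have "continuous_on (-{0}) (\<lambda>x. h' (norm x) * (x $ j * Z j x / norm x) + h (norm x) * partial j (Z j) x)"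
      using smooth_on_continuous[OF Z] smooth_on_continuous[OF smooth_on_partial[OF Z]]
      by (intro continuous_intros cn) auto
    then show "continuous_on (-{0}) (partial j (g j))"
      using pg by (simp cong: continuous_on_cong)
    show "partial j (g j) x = 0" if "norm x < a" for x using pg[of j x] hz h'z that by simp
  qed
  have zb: "g j x = 0" if "norm x \<ge> b" for j x using that hz by (simp add: g_def)
  have "(LINT x|lborel. partial j (g j) x) = 0" for j
    by (rule integral_partial_eq_0[OF dg cpg zb])
  moreover have "integrable lborel (partial j (g j))" for j
  proof (rule integrable_continuous_bounded_support[OF cpg, of "b + 1"])
    fix x :: "real^3" assume x: "b + 1 \<le> norm x"
    have "partial j (g j) x = partial j (\<lambda>x. 0) x"
      by (rule partial_cong[of "{x. b < norm x}"])
        (use x zb in \<open>auto intro!: open_Collect_less continuous_intros\<close>)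
    then show "partial j (g j) x = 0" by simp
  qed
  ultimately have "(LINT x|lborel. (\<Sum>j\<in>UNIV. partial j (g j) x)) = 0" by (simp add: integral_sum)
  moreover have "(\<Sum>j\<in>UNIV. partial j (g j) x) = h (norm x) * (\<Sum>j\<in>UNIV. partial j (Z j) x)" for x
  proof (cases "x = 0")
    case True
    then show ?thesis unfolding pg using hz[of 0] a by simp
  next
    case False
    have "(\<Sum>j\<in>UNIV. partial j (g j) x) = h' (norm x) * (\<Sum>j\<in>UNIV. x $ j * Z j x) / norm x + h (norm x) * (\<Sum>j\<in>UNIV. partial j (Z j) x)"
      unfolding pg by (simp add: sum.distrib sum_distrib_left sum_divide_distrib)
    then show ?thesis using tang[OF False] by simp
  qed
  ultimately show ?thesis by simp
qed

text \<open>A nonnegative \<open>C\<^sup>1\<close> profile, for \<open>a < b\<close> positive between \<open>a\<close> and \<open>b\<close> and zero elsewhere.\<close>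
definition bump :: "real \<Rightarrow> real \<Rightarrow> real \<Rightarrow> real" where
  "bump a b r = (max 0 ((r - a) * (b - r)))\<^sup>2"

lemma DERIV_max_0_square: "((\<lambda>y::real. (max 0 y)\<^sup>2) has_field_derivative 2 * max 0 y) (at y)"
proof -
  consider "y < 0" | "y > 0" | "y = 0" by linarith
  then show ?thesis
  proof cases
    case 1
    have "((\<lambda>y::real. 0) has_field_derivative 0) (at y)" by simp
    moreover have "\<forall>\<^sub>F z in nhds y. (max 0 z)\<^sup>2 = (0::real)"
      using eventually_nhds_in_open[of "{..<0}" y] 1 by (auto elim: eventually_mono)
    moreover have "DERIV (\<lambda>y. (max 0 y)\<^sup>2) y :> (0::real) \<longleftrightarrow> DERIV (\<lambda>y. 0) y :> (0::real)" if "\<forall>\<^sub>F z in nhds y. (max 0 z)\<^sup>2 = (0::real)"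
      by (rule DERIV_cong_ev) (use that in auto)
    ultimately show ?thesis using 1 by simp
  next
    case 2
    have "((\<lambda>y::real. y\<^sup>2) has_field_derivative 2 * y) (at y)" by (auto intro!: derivative_eq_intros)
    moreover have "\<forall>\<^sub>F z in nhds y. (max 0 z)\<^sup>2 = (z::real)\<^sup>2"
      using eventually_nhds_in_open[of "{0<..}" y] 2 by (auto elim!: eventually_mono)
    moreover have "DERIV (\<lambda>y. (max 0 y)\<^sup>2) y :> (2 * y) \<longleftrightarrow> DERIV (\<lambda>y. y\<^sup>2) y :> (2 * y)" if "\<forall>\<^sub>F z in nhds y. (max 0 z)\<^sup>2 = (z::real)\<^sup>2"
      by (rule DERIV_cong_ev) (use that in auto)
    ultimately show ?thesis using 2 by simp
  next
    case 3
    have "((\<lambda>h::real. ((max 0 (0 + h))\<^sup>2 - (max 0 0)\<^sup>2) / h) \<longlongrightarrow> 0) (at 0)"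
    proof (rule Lim_null_comparison)
      show "\<forall>\<^sub>F h::real in at 0. norm (((max 0 (0 + h))\<^sup>2 - (max 0 0)\<^sup>2) / h) \<le> \<bar>h\<bar>"
        by (auto simp: max_def power2_eq_square intro!: always_eventually)
      show "((\<lambda>h::real. \<bar>h\<bar>) \<longlongrightarrow> 0) (at 0)" using tendsto_rabs[OF tendsto_ident_at[of 0 UNIV]] by simp
    qed
    then show ?thesis using 3 by (simp add: DERIV_def)
  qed
qed

lemma DERIV_bump:
  "(bump a b has_field_derivative 2 * max 0 ((r - a) * (b - r)) * (a + b - 2 * r)) (at r)"
proof -
  have "((\<lambda>r. (r - a) * (b - r)) has_field_derivative (a + b - 2 * r)) (at r)"
    by (auto intro!: derivative_eq_intros)
  from DERIV_chain2[OF DERIV_max_0_square this] show ?thesis by (simp add: bump_def[abs_def])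
qed

lemma bump_eq_0: "a \<le> b \<Longrightarrow> r \<le> a \<or> b \<le> r \<Longrightarrow> bump a b r = 0"
  by (auto simp: bump_def max_def zero_le_mult_iff) 

lemma bump_pos: "a < r \<Longrightarrow> r < b \<Longrightarrow> bump a b r > 0"
  by (simp add: bump_def)

lemma bump_nonneg: "bump a b r \<ge> 0"
  by (simp add: bump_def)

lemma continuous_bump: "continuous_on UNIV (bump a b)"
  unfolding bump_def[abs_def] by (intro continuous_intros)

lemma integral_bump_times_divergence:
  fixes Z :: "3 \<Rightarrow> real^3 \<Rightarrow> real"
  assumes "0 < a" "a < b" "\<And>j. smooth_on (Z j) (-{0})" 
    "\<And>x. x \<noteq> 0 \<Longrightarrow> (\<Sum>j\<in>UNIV. x $ j * Z j x) = 0"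
  shows "(LINT x|lborel. bump a b (norm x) * (\<Sum>j\<in>UNIV. partial j (Z j) x)) = 0"
  by (rule integral_radial_times_divergence[OF DERIV_bump _ assms(1), where b=b])
     (use assms in \<open>auto intro!: continuous_intros bump_eq_0\<close>)

text \<open>Against a radial weight that is positive near \<open>x\<close>, the divergence has integral zero; being
  nonnegative and continuous, it vanishes there.\<close>
lemma tangential_divergence_nonneg:
  fixes Z :: "3 \<Rightarrow> real^3 \<Rightarrow> real"
  assumes Z: "\<And>j. smooth_on (Z j) (-{0})" 
    and tang: "\<And>x. x \<noteq> 0 \<Longrightarrow> (\<Sum>j\<in>UNIV. x $ j * Z j x) = 0"
    and nn: "\<And>x. x \<noteq> 0 \<Longrightarrow> (\<Sum>j\<in>UNIV. partial j (Z j) x) \<ge> 0" and x: "x \<noteq> 0"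
  shows "(\<Sum>j\<in>UNIV. partial j (Z j) x) = 0"
proof -
  define a b where "a = norm x / 2" and "b = norm x * 2"
  have ab: "0 < a" "a < norm x" "norm x < b" using x by (auto simp: a_def b_def)
  define f where "f y = bump a b (norm y) * (\<Sum>j\<in>UNIV. partial j (Z j) y)" for y
  have c: "continuous_on UNIV f"
  proof (rule continuous_on_extend_0[OF _ ab(1)])
    show "continuous_on (-{0}) f" unfolding f_def
      using smooth_on_continuous[OF smooth_on_partial[OF Z]]
      by (intro continuous_intros continuous_on_compose2[OF continuous_bump]) auto
    show "f y = 0" if "norm y < a" for y using bump_eq_0[of a b "norm y"] ab that by (simp add: f_def)
  qed
  have fz: "f y = 0" if "norm y \<ge> b" for y using bump_eq_0[of a b "norm y"] ab that by (simp add: f_def)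
  have fi: "integrable lborel f" using c fz by (rule integrable_continuous_bounded_support)
  have f0: "(LINT y|lborel. f y) = 0"
    unfolding f_def by (rule integral_bump_times_divergence) (use ab Z tang in auto)
  have fnn: "f y \<ge> 0" for y
  proof (cases "y = 0")
    case True
    then show ?thesis using bump_eq_0[of a b 0] ab by (simp add: f_def)
  qed (use nn bump_nonneg in \<open>simp add: f_def\<close>)
  have "AE y in lborel. f y = 0"
    using integral_nonneg_eq_0_iff_AE[OF fi] fnn f0 by simp
  then have "negligible {y. f y \<noteq> 0}"
    by (simp add: AE_iff_null_sets negligible_iff_null_sets eventually_ae_filter)
       (metis (no_types, lifting) Collect_mono_iff completion.complete2 null_sets_completionI)
  moreover have "open {y. f y \<noteq> 0}"
    using continuous_on_open_vimage[OF open_UNIV, of f] c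
    by (metis (no_types, lifting) Collect_cong Int_UNIV_right open_Collect_neq continuous_on_const)
  ultimately have "f x = 0" using open_not_negligible by blast
  then show ?thesis using bump_pos[OF ab(2,3)] by (simp add: f_def)
qed

section \<open>Homogeneous functions\<close>

definition homogeneous :: "int \<Rightarrow> (real^3 \<Rightarrow> real) \<Rightarrow> bool" where
  "homogeneous k f \<longleftrightarrow> (\<forall>l>0. \<forall>x. x \<noteq> 0 \<longrightarrow> f (l *\<^sub>R x) = l powi k * f x)"

lemma homogeneousD: "homogeneous k f \<Longrightarrow> l > 0 \<Longrightarrow> x \<noteq> 0 \<Longrightarrow> f (l *\<^sub>R x) = l powi k * f x"
  by (simp add: homogeneous_def)

lemma homogeneous_const: "homogeneous 0 (\<lambda>x. c)"
  by (simp add: homogeneous_def)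

lemma homogeneous_component: "homogeneous 1 (\<lambda>x. x $ j)"
  by (simp add: homogeneous_def)

lemma homogeneous_norm: "homogeneous 1 norm"
  by (simp add: homogeneous_def)

lemma homogeneous_add: "homogeneous k f \<Longrightarrow> homogeneous k g \<Longrightarrow> homogeneous k (\<lambda>x. f x + g x)"
  by (simp add: homogeneous_def algebra_simps)

lemma homogeneous_diff: "homogeneous k f \<Longrightarrow> homogeneous k g \<Longrightarrow> homogeneous k (\<lambda>x. f x - g x)"
  by (simp add: homogeneous_def algebra_simps)

lemma homogeneous_minus: "homogeneous k f \<Longrightarrow> homogeneous k (\<lambda>x. - f x)"
  by (simp add: homogeneous_def)

lemma homogeneous_mult: "homogeneous k f \<Longrightarrow> homogeneous m g \<Longrightarrow> homogeneous (k + m) (\<lambda>x. f x * g x)"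
  by (simp add: homogeneous_def power_int_add)

lemma homogeneous_divide: "homogeneous k f \<Longrightarrow> homogeneous m g \<Longrightarrow> homogeneous (k - m) (\<lambda>x. f x / g x)"
  by (simp add: homogeneous_def power_int_diff)

lemma homogeneous_power: "homogeneous k f \<Longrightarrow> homogeneous (k * int n) (\<lambda>x. f x ^ n)"
  by (simp add: homogeneous_def power_int_mult power_mult_distrib)

lemma homogeneous_sum: 
  assumes "\<And>j. j \<in> A \<Longrightarrow> homogeneous k (f j)" shows "homogeneous k (\<lambda>x. \<Sum>j\<in>A. f j x)"
  unfolding homogeneous_def
proof (intro allI impI)
  fix l :: real and x :: "real^3" assume "l > 0" "x \<noteq> 0"
  then show "(\<Sum>j\<in>A. f j (l *\<^sub>R x)) = l powi k * (\<Sum>j\<in>A. f j x)"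
    unfolding sum_distrib_left by (intro sum.cong refl homogeneousD assms)
qed

lemma homogeneous_cong: "homogeneous k f \<Longrightarrow> (\<And>x. x \<noteq> 0 \<Longrightarrow> f x = g x) \<Longrightarrow> homogeneous k g"
  by (simp add: homogeneous_def)

lemma smooth_differentiable: "smooth_on f (-{0}) \<Longrightarrow> x \<noteq> 0 \<Longrightarrow> f differentiable at x"
  by (rule smooth_on_differentiable[OF _ open_punctured]) auto

lemma homogeneous_partial:
  assumes "smooth_on f (-{0})" "homogeneous k f"
  shows "homogeneous (k - 1) (partial i f)"
  unfolding homogeneous_def
proof (intro allI impI)
  fix l :: real and x :: "real^3" assume l: "l > 0" and x: "x \<noteq> 0"
  let ?e = "axis i (1::real) :: real^3"
  have nz: "l *\<^sub>R x \<noteq> 0" using l x by simp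
  have "((\<lambda>t. f (l *\<^sub>R x + (l * t) *\<^sub>R ?e)) has_field_derivative partial i f (l *\<^sub>R x) * l) (at 0)"
    using DERIV_chain2[of "\<lambda>t. f (l *\<^sub>R x + t *\<^sub>R ?e)" _ "\<lambda>t. l * t" 0 l UNIV]
      DERIV_partial_line[of f "l *\<^sub>R x" 0 i] smooth_differentiable[OF assms(1) nz]
    by (auto intro!: derivative_eq_intros)
  moreover have "((\<lambda>t. l powi k * f (x + t *\<^sub>R ?e)) has_field_derivative l powi k * partial i f x) (at 0)"
    using DERIV_partial_line[of f x 0 i] smooth_differentiable[OF assms(1) x]
    by (intro DERIV_cmult) simp
  moreover have "\<forall>\<^sub>F t in nhds 0. f (l *\<^sub>R x + (l * t) *\<^sub>R ?e) = l powi k * f (x + t *\<^sub>R ?e)"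
  proof -
    have "((\<lambda>t::real. x + t *\<^sub>R ?e) \<longlongrightarrow> x + 0 *\<^sub>R ?e) (nhds 0)"
      by (intro tendsto_intros filterlim_ident)
    then have "\<forall>\<^sub>F t in nhds 0. x + t *\<^sub>R ?e \<in> -{0}"
      using topological_tendstoD[OF _ open_punctured] x by fastforce
    then show ?thesis
      by eventually_elim (use homogeneousD[OF assms(2) l] in \<open>simp add: scaleR_add_right[symmetric] flip: scaleR_scaleR\<close>)
  qed
  ultimately have "DERIV (\<lambda>t. l powi k * f (x + t *\<^sub>R ?e)) 0 :> partial i f (l *\<^sub>R x) * l"
    "DERIV (\<lambda>t. l powi k * f (x + t *\<^sub>R ?e)) 0 :> l powi k * partial i f x"
    using DERIV_cong_ev[of 0 0 "\<lambda>t. f (l *\<^sub>R x + (l * t) *\<^sub>R ?e)" "\<lambda>t. l powi k * f (x + t *\<^sub>R ?e)"] by auto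
  then have "partial i f (l *\<^sub>R x) * l = l powi k * partial i f x" by (rule DERIV_unique)
  then show "partial i f (l *\<^sub>R x) = l powi (k - 1) * partial i f x"
    using l by (simp add: power_int_diff field_simps)
qed

lemma DERIV_along_ray:
  fixes f :: "real^3 \<Rightarrow> real"
  assumes "f differentiable at (l *\<^sub>R x)"
  shows "((\<lambda>l. f (l *\<^sub>R x)) has_field_derivative (\<Sum>j\<in>UNIV. x $ j * partial j f (l *\<^sub>R x))) (at l)"
proof -
  have "((\<lambda>l. l *\<^sub>R x) has_derivative (\<lambda>h. h *\<^sub>R x)) (at l)" by (auto intro!: derivative_eq_intros)
  from has_derivative_compose[OF this has_derivative_partial[OF assms]]
  have "((\<lambda>l. f (l *\<^sub>R x)) has_derivative (\<lambda>h. \<Sum>j\<in>UNIV. (h *\<^sub>R x) $ j * partial j f (l *\<^sub>R x))) (at l)" .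
  moreover have "(\<lambda>h. \<Sum>j\<in>UNIV. (h *\<^sub>R x) $ j * partial j f (l *\<^sub>R x)) = (*) (\<Sum>j\<in>UNIV. x $ j * partial j f (l *\<^sub>R x))"
    by (simp add: fun_eq_iff sum_distrib_left sum_distrib_right algebra_simps)
  ultimately show ?thesis by (simp add: has_field_derivative_def)
qed

lemma homogeneous_euler:
  assumes "smooth_on f (-{0})" "homogeneous k f" "x \<noteq> 0"
  shows "(\<Sum>j\<in>UNIV. x $ j * partial j f x) = of_int k * f x"
proof -
  have "((\<lambda>l. f (l *\<^sub>R x)) has_field_derivative (\<Sum>j\<in>UNIV. x $ j * partial j f (1 *\<^sub>R x))) (at 1)"
    by (rule DERIV_along_ray) (use smooth_differentiable assms in auto)
  moreover have "((\<lambda>l. l powi k * f x) has_field_derivative of_int k * f x) (at 1)"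
    by (auto intro!: derivative_eq_intros)
  moreover have "\<forall>\<^sub>F l in nhds 1. f (l *\<^sub>R x) = l powi k * f x"
    using eventually_nhds_in_open[of "{0<..}" "1::real"] homogeneousD[OF assms(2) _ assms(3)]
    by (auto elim!: eventually_mono)
  ultimately have "DERIV (\<lambda>l. l powi k * f x) 1 :> (\<Sum>j\<in>UNIV. x $ j * partial j f x)"
    "DERIV (\<lambda>l. l powi k * f x) 1 :> of_int k * f x"
    using DERIV_cong_ev[of 1 1 "\<lambda>l. f (l *\<^sub>R x)" "\<lambda>l. l powi k * f x"] by auto
  then show ?thesis by (rule DERIV_unique)
qed

text \<open>The radial derivative vanishes, so the function is constant along rays.\<close>
lemma homogeneous_0I:
  assumes "smooth_on f (-{0})" "\<And>x. x \<noteq> 0 \<Longrightarrow> (\<Sum>j\<in>UNIV. x $ j * partial j f x) = 0"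
  shows "homogeneous 0 f"
  unfolding homogeneous_def
proof (intro allI impI)
  fix l :: real and x :: "real^3" assume l: "l > 0" and x: "x \<noteq> 0"
  have "\<exists>c. \<forall>l\<in>{0<..}. f (l *\<^sub>R x) = c"
  proof (rule has_field_derivative_zero_constant)
    fix m :: real assume m: "m \<in> {0<..}"
    then have nz: "m *\<^sub>R x \<noteq> 0" using x by simp
    have "m * (\<Sum>j\<in>UNIV. x $ j * partial j f (m *\<^sub>R x)) = 0"
      using assms(2)[OF nz] by (simp add: sum_distrib_left algebra_simps)
    then have "(\<Sum>j\<in>UNIV. x $ j * partial j f (m *\<^sub>R x)) = 0" using m by simp
    then show "((\<lambda>l. f (l *\<^sub>R x)) has_field_derivative 0) (at m within {0<..})"
      using DERIV_along_ray[OF smooth_differentiable[OF assms(1) nz]] has_field_derivative_at_within by metis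
  qed simp
  then obtain c where "\<forall>l\<in>{0<..}. f (l *\<^sub>R x) = c" by blast
  from bspec[OF this, of l] bspec[OF this, of 1] show "f (l *\<^sub>R x) = l powi 0 * f x" using l by simp
qed

lemma gradient_zero_const:
  fixes f :: "real^3 \<Rightarrow> real"
  assumes "smooth_on f (-{0})" "\<And>x j. x \<noteq> 0 \<Longrightarrow> partial j f x = 0"
  shows "\<exists>c. \<forall>x. x \<noteq> 0 \<longrightarrow> f x = c"
proof -
  have d: "(f has_derivative (\<lambda>x. 0)) (at x)" if "x \<in> -{0}" for x
    using has_derivative_partial[OF smooth_differentiable[OF assms(1), of x]] assms(2) that by simp
  have "f x = f y" if "x \<noteq> 0" "y \<noteq> 0" for x y
    by (rule has_derivative_zero_unique_connected[OF open_punctured connected_punctured_universe d])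
      (use that in auto)
  then show ?thesis by metis
qed

text \<open>A weighted harmonic function that is constant along rays is constant: testing its equation
  with \<open>1\<close> and with itself, with a radial cutoff, produces no radial terms.\<close>
lemma weighted_harmonic_const:
  fixes \<eta> \<rho> :: "real^3 \<Rightarrow> real"
  assumes \<eta>: "smooth_on \<eta> (-{0})" "homogeneous 0 \<eta>"
    and \<rho>: "smooth_on \<rho> (-{0})" "\<And>x. x \<noteq> 0 \<Longrightarrow> \<rho> x > 0"
    and eq: "\<And>x. x \<noteq> 0 \<Longrightarrow> \<rho> x * laplacian \<eta> x + (\<Sum>j\<in>UNIV. partial j \<rho> x * partial j \<eta> x) = k / (norm x)\<^sup>2"
  shows "k = 0" "\<exists>c. \<forall>x. x \<noteq> 0 \<longrightarrow> \<eta> x = c"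
proof -
  have eu: "(\<Sum>j\<in>UNIV. x $ j * partial j \<eta> x) = 0" if "x \<noteq> 0" for x
    using homogeneous_euler[OF \<eta> that] by simp
  have tang: "(\<Sum>j\<in>UNIV. x $ j * (c x * partial j \<eta> x)) = 0" if "x \<noteq> 0" for c :: "real^3 \<Rightarrow> real" and x
  proof -
    have "(\<Sum>j\<in>UNIV. x $ j * (c x * partial j \<eta> x)) = c x * (\<Sum>j\<in>UNIV. x $ j * partial j \<eta> x)"
      by (simp add: sum_distrib_left algebra_simps)
    then show ?thesis using eu that by simp
  qed
  have sm: "smooth_on (\<lambda>x. c x * partial j \<eta> x) (-{0})" if "smooth_on c (-{0})" for j c
    by (intro smooth_intros open_punctured that \<eta>)
  have pd: "partial j (\<lambda>x. c x * partial j \<eta> x) x = partial j c x * partial j \<eta> x + c x * partial j (partial j \<eta>) x"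
    if "smooth_on c (-{0})" "x \<noteq> 0" for j c x
    by (rule partial_mult) (intro smooth_differentiable smooth_on_partial that \<eta>)+
  \<comment> \<open>\<open>\<rho> \<nabla>\<eta>\<close> is tangential, and its divergence has one sign\<close>
  have div: "(\<Sum>j\<in>UNIV. partial j (\<lambda>x. \<rho> x * partial j \<eta> x) x) = k / (norm x)\<^sup>2" if "x \<noteq> 0" for x
    using eq[OF that] by (simp add: pd[OF \<rho>(1) that] sum.distrib sum_distrib_left[symmetric] laplacian_def)
  have e1: "axis 1 1 \<noteq> (0::real^3)" "norm (axis 1 1 :: real^3) = 1" by (auto simp: norm_axis_1)
  have sm\<rho>': "smooth_on (\<lambda>x. - \<rho> x) (-{0})" by (intro smooth_intros open_punctured \<rho>)
  have div': "(\<Sum>j\<in>UNIV. partial j (\<lambda>x. - \<rho> x * partial j \<eta> x) x) = - (k / (norm x)\<^sup>2)" if "x \<noteq> 0" for x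
    using eq[OF that] smooth_differentiable[OF \<rho>(1) that]
    by (simp only: pd[OF sm\<rho>' that] partial_minus) 
       (simp add: sum_subtractf sum.distrib sum_distrib_left[symmetric] sum_negf laplacian_def)
  show k: "k = 0"
  proof (cases "k \<ge> 0")
    case True
    have "(\<Sum>j\<in>UNIV. partial j (\<lambda>x. \<rho> x * partial j \<eta> x) (axis 1 1)) = 0"
      by (rule tangential_divergence_nonneg[where Z="\<lambda>j x. \<rho> x * partial j \<eta> x", OF sm[OF \<rho>(1)] tang[where c=\<rho>] _ e1(1)]) (auto simp: div True)
    then show ?thesis using div[OF e1(1)] e1(2) by simp
  next
    case False
    have nn: "(\<Sum>j\<in>UNIV. partial j (\<lambda>x. - \<rho> x * partial j \<eta> x) x) \<ge> 0" if "x \<noteq> 0" for x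
      unfolding div'[OF that] using False by (simp add: divide_nonpos_nonneg)
    have "(\<Sum>j\<in>UNIV. partial j (\<lambda>x. - \<rho> x * partial j \<eta> x) (axis 1 1)) = 0"
      by (rule tangential_divergence_nonneg[where Z="\<lambda>j x. - \<rho> x * partial j \<eta> x", OF sm[OF sm\<rho>'] tang[where c="\<lambda>x. - \<rho> x"] nn e1(1)])
    then show ?thesis using div'[OF e1(1)] e1(2) by simp
  qed
  have s2: "smooth_on (\<lambda>x. \<rho> x * \<eta> x) (-{0})" by (intro smooth_intros open_punctured \<rho> \<eta>)
  \<comment> \<open>the divergence of \<open>\<rho> \<eta> \<nabla>\<eta>\<close> is \<open>\<rho> |\<nabla>\<eta>|\<^sup>2\<close>\<close>
  have d2: "(\<Sum>j\<in>UNIV. partial j (\<lambda>x. (\<rho> x * \<eta> x) * partial j \<eta> x) x) = \<rho> x * (\<Sum>j\<in>UNIV. (partial j \<eta> x)\<^sup>2)"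
    if "x \<noteq> 0" for x
  proof -
    have "partial j (\<lambda>x. (\<rho> x * \<eta> x) * partial j \<eta> x) x = 
       \<eta> x * (partial j \<rho> x * partial j \<eta> x + \<rho> x * partial j (partial j \<eta>) x) + \<rho> x * (partial j \<eta> x)\<^sup>2" for j
      unfolding pd[OF s2 that] partial_mult[OF smooth_differentiable[OF \<rho>(1) that] smooth_differentiable[OF \<eta>(1) that]]
      by (simp add: algebra_simps power2_eq_square)
    then have "(\<Sum>j\<in>UNIV. partial j (\<lambda>x. (\<rho> x * \<eta> x) * partial j \<eta> x) x)
      = \<eta> x * (\<rho> x * laplacian \<eta> x + (\<Sum>j\<in>UNIV. partial j \<rho> x * partial j \<eta> x)) + \<rho> x * (\<Sum>j\<in>UNIV. (partial j \<eta> x)\<^sup>2)"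
      by (simp add: sum.distrib sum_distrib_left[symmetric] laplacian_def algebra_simps)
    then show ?thesis using eq[OF that] k by simp
  qed
  have nn2: "(\<Sum>j\<in>UNIV. partial j (\<lambda>x. (\<rho> x * \<eta> x) * partial j \<eta> x) x) \<ge> 0" if "x \<noteq> 0" for x
    unfolding d2[OF that] using \<rho>(2)[OF that] by (intro mult_nonneg_nonneg sum_nonneg) auto
  have "(\<Sum>j\<in>UNIV. partial j (\<lambda>x. (\<rho> x * \<eta> x) * partial j \<eta> x) x) = 0" if "x \<noteq> 0" for x
    by (rule tangential_divergence_nonneg[where Z="\<lambda>j x. (\<rho> x * \<eta> x) * partial j \<eta> x", OF sm[OF s2] tang[where c="\<lambda>x. \<rho> x * \<eta> x"] nn2 that])
  then have "(\<Sum>j\<in>UNIV. (partial j \<eta> x)\<^sup>2) = 0" if "x \<noteq> 0" for x using d2[OF that] \<rho>(2)[OF that] that by simp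
  then have "partial j \<eta> x = 0" if "x \<noteq> 0" for x j
    using that by (simp add: sum_nonneg_eq_0_iff)
  then show "\<exists>c. \<forall>x. x \<noteq> 0 \<longrightarrow> \<eta> x = c" using gradient_zero_const[OF \<eta>(1)] by blast
qed

section \<open>Potentials of curl-free fields\<close>

text \<open>The potential is the line integral of \<open>v\<close> along the segment from \<open>p\<close>. Because \<open>v\<close> is curl free,
  the integrand of its \<open>i\<close>-th derivative is the derivative of \<open>t v\<^sub>i (p + t (x - p))\<close> in \<open>t\<close>.\<close>
lemma star_shaped_potential:
  fixes v :: "3 \<Rightarrow> real^3 \<Rightarrow> real"
  assumes S: "open S" and star: "\<And>x t. x \<in> S \<Longrightarrow> 0 \<le> t \<Longrightarrow> t \<le> 1 \<Longrightarrow> p + t *\<^sub>R (x - p) \<in> S"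
    and v: "\<And>j. smooth_on (v j) S" and curl: "\<And>x i j. x \<in> S \<Longrightarrow> partial i (v j) x = partial j (v i) x"
  shows "\<exists>\<phi>. \<forall>x\<in>S. (\<phi> has_derivative (\<lambda>h. \<Sum>j\<in>UNIV. h $ j * v j x)) (at x)"
proof -
  define y where "y x t = p + t *\<^sub>R (x - p)" for x :: "real^3" and t :: real
  define f where "f x t = (\<Sum>j\<in>UNIV. (x - p) $ j * v j (y x t))" for x t
  define c where "c i x t = v i (y x t) + (\<Sum>j\<in>UNIV. (x - p) $ j * (t * partial i (v j) (y x t)))" for i x t
  define E :: "3 \<Rightarrow> (real^3) \<Rightarrow>\<^sub>L real" where "E i = Blinfun (\<lambda>h. h $ i)" for i
  have E: "blinfun_apply (E i) h = h $ i" for i h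
    unfolding E_def by (simp add: bounded_linear_Blinfun_apply bounded_linear_vec_nth)
  have yS: "y x t \<in> S" if "x \<in> S" "t \<in> cbox 0 1" for x t using star that by (simp add: y_def)
  have dv: "v j differentiable at z" if "z \<in> S" for j z using smooth_on_differentiable[OF v S that] .
  have "((\<lambda>x. integral (cbox 0 1) (f x)) has_derivative (\<lambda>h. \<Sum>j\<in>UNIV. h $ j * v j x0)) (at x0)"
    if x0: "x0 \<in> S" for x0
  proof -
    obtain e where e: "e > 0" "ball x0 e \<subseteq> S" using openE[OF S x0] by blast
    let ?U = "ball x0 e"
    have yc: "continuous_on (?U \<times> cbox 0 1) (\<lambda>p. y (fst p) (snd p))"
      unfolding y_def by (intro continuous_intros)
    have cv: "continuous_on (?U \<times> cbox 0 1) (\<lambda>p. g (y (fst p) (snd p)))" if "continuous_on S g" for g :: "real^3 \<Rightarrow> real"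
      by (rule continuous_on_compose2[OF that yc]) (use yS e in auto)
    have cc: "continuous_on (?U \<times> cbox 0 1) (\<lambda>p. c i (fst p) (snd p))" for i
      unfolding c_def by (intro continuous_intros cv smooth_on_continuous smooth_on_partial v)
    have cc1: "continuous_on (cbox 0 1) (c i x)" if "x \<in> ?U" for i x
      by (rule continuous_on_compose2[OF cc, of _ "\<lambda>t. (x, t)", simplified]) (use that in \<open>auto intro!: continuous_intros\<close>)
    have "((\<lambda>x. integral (cbox 0 1) (f x)) has_derivative integral (cbox 0 1) (\<lambda>t. \<Sum>i\<in>UNIV. c i x0 t *\<^sub>R E i)) (at x0 within ?U)"
    proof (rule leibniz_rule)
      fix x t assume x: "x \<in> ?U" and t: "t \<in> cbox 0 (1::real)"
      have z: "y x t \<in> S" using x t yS e by auto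
      have dy: "((\<lambda>x. y x t) has_derivative (\<lambda>h. t *\<^sub>R h)) (at x)"
        unfolding y_def by (auto intro!: derivative_eq_intros)
      have dvy: "((\<lambda>x. v j (y x t)) has_derivative (\<lambda>h. \<Sum>i\<in>UNIV. (t *\<^sub>R h) $ i * partial i (v j) (y x t))) (at x)" for j
        using has_derivative_compose[OF dy has_derivative_partial[OF dv[OF z]]] .
      have dxc: "((\<lambda>x. (x - p) $ j) has_derivative (\<lambda>h. h $ j)) (at x)" for j
        by (auto intro!: derivative_eq_intros bounded_linear.has_derivative[OF bounded_linear_vec_nth])
      have "((\<lambda>x. f x t) has_derivative (\<lambda>h. \<Sum>j\<in>UNIV. (x - p) $ j * (\<Sum>i\<in>UNIV. (t *\<^sub>R h) $ i * partial i (v j) (y x t)) + h $ j * v j (y x t))) (at x)"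
        unfolding f_def by (intro has_derivative_sum has_derivative_mult dxc dvy)
      moreover have "(\<lambda>h. \<Sum>j\<in>UNIV. (x - p) $ j * (\<Sum>i\<in>UNIV. (t *\<^sub>R h) $ i * partial i (v j) (y x t)) + h $ j * v j (y x t))
        = blinfun_apply (\<Sum>i\<in>UNIV. c i x t *\<^sub>R E i)"
        unfolding sum_3 fun_eq_iff blinfun.add_left blinfun.scaleR_left E c_def by (simp add: algebra_simps)
      ultimately have "((\<lambda>x. f x t) has_derivative blinfun_apply (\<Sum>i\<in>UNIV. c i x t *\<^sub>R E i)) (at x)"
        by simp
      then show "((\<lambda>x. f x t) has_derivative blinfun_apply (\<Sum>i\<in>UNIV. c i x t *\<^sub>R E i)) (at x within ?U)"
        by (rule has_derivative_at_withinI)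
    next
      fix x assume "x \<in> ?U"
      then have "continuous_on (cbox 0 1) (\<lambda>t. v j (y x t))" for j
        using cv[OF smooth_on_continuous[OF v]]
        by (rule_tac continuous_on_compose2[of "?U \<times> cbox 0 1" "\<lambda>p. v j (y (fst p) (snd p))" _ "\<lambda>t. (x, t)", simplified]) (auto intro!: continuous_intros)
      then show "f x integrable_on cbox 0 1"
        unfolding f_def by (intro integrable_continuous continuous_intros)
    next
      show "continuous_on (?U \<times> cbox 0 1) (\<lambda>(x, t). \<Sum>i\<in>UNIV. c i x t *\<^sub>R E i)"
        unfolding split_beta by (intro continuous_intros cc)
    qed (use e in auto)
    moreover have "integral (cbox 0 1) (\<lambda>t. \<Sum>i\<in>UNIV. c i x0 t *\<^sub>R E i) = (\<Sum>i\<in>UNIV. v i x0 *\<^sub>R E i)"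
    proof -
      have "(c i x0 has_integral (1 *\<^sub>R v i (y x0 1) - 0 *\<^sub>R v i (y x0 0))) {0..1}" for i
      proof (rule fundamental_theorem_of_calculus)
        fix t assume t: "t \<in> {0..(1::real)}"
        have z: "y x0 t \<in> S" using t yS x0 by auto
        have "((\<lambda>t. y x0 t) has_derivative (\<lambda>s. s *\<^sub>R (x0 - p))) (at t)"
          unfolding y_def by (auto intro!: derivative_eq_intros)
        from has_derivative_compose[OF this has_derivative_partial[OF dv[OF z]]]
        have "((\<lambda>t. v i (y x0 t)) has_derivative (\<lambda>s. \<Sum>j\<in>UNIV. (s *\<^sub>R (x0 - p)) $ j * partial j (v i) (y x0 t))) (at t)" .
        then have "((\<lambda>t. t * v i (y x0 t)) has_derivative (\<lambda>s. t * (\<Sum>j\<in>UNIV. (s *\<^sub>R (x0 - p)) $ j * partial j (v i) (y x0 t)) + s * v i (y x0 t))) (at t)"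
          by (intro has_derivative_mult has_derivative_ident)
        moreover have "(\<lambda>s. t * (\<Sum>j\<in>UNIV. (s *\<^sub>R (x0 - p)) $ j * partial j (v i) (y x0 t)) + s * v i (y x0 t)) = (\<lambda>s. s *\<^sub>R c i x0 t)"
          unfolding c_def using curl[OF z] by (simp add: fun_eq_iff sum_3 algebra_simps)
        ultimately show "((\<lambda>t. t *\<^sub>R v i (y x0 t)) has_vector_derivative c i x0 t) (at t within {0..1})"
          by (simp add: has_vector_derivative_def has_derivative_at_withinI)
      qed simp
      then have ci: "(c i x0 has_integral v i x0) (cbox 0 1)" for i by (simp add: y_def)
      have "((\<lambda>t. \<Sum>i\<in>UNIV. c i x0 t *\<^sub>R E i) has_integral (\<Sum>i\<in>UNIV. v i x0 *\<^sub>R E i)) (cbox 0 1)"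
        by (intro has_integral_sum has_integral_scaleR_left ci) simp
      then show ?thesis by (rule integral_unique)
    qed
    moreover have "blinfun_apply (\<Sum>i\<in>UNIV. v i x0 *\<^sub>R E i) = (\<lambda>h. \<Sum>j\<in>UNIV. h $ j * v j x0)"
      by (simp add: fun_eq_iff blinfun.sum_left blinfun.scaleR_left E mult.commute)
    ultimately show ?thesis using at_within_open[of x0 ?U] e by simp
  qed
  then show ?thesis by blast
qed

text \<open>The complements of the two halves of the third axis are star-shaped. Their intersection
  is the union of four half spaces, consecutive ones of which overlap, so that the two potentials
  differ by one constant there.\<close>
lemma punctured_potential:
  fixes v :: "3 \<Rightarrow> real^3 \<Rightarrow> real"
  assumes v: "\<And>j. smooth_on (v j) (-{0})" 
    and curl: "\<And>x i j. x \<noteq> 0 \<Longrightarrow> partial i (v j) x = partial j (v i) x"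
  obtains \<phi> where "smooth_on \<phi> (-{0})" "\<And>x j. x \<noteq> 0 \<Longrightarrow> partial j \<phi> x = v j x"
proof -
  define S where "S s = - {x::real^3. x $ 1 = 0 \<and> x $ 2 = 0 \<and> s * x $ 3 \<le> 0}" for s :: real
  \<comment> \<open>\<open>S 1\<close> and \<open>S (-1)\<close> are the complements of the two closed halves of the third axis; they are
    star-shaped with respect to \<open>s e\<^sub>3\<close>\<close>
  have oS: "open (S s)" for s unfolding S_def
    by (intro open_Compl closed_Collect_conj closed_Collect_eq closed_Collect_le continuous_intros)
  have sub: "S s \<subseteq> -{0}" for s by (auto simp: S_def)
  have smS: "smooth_on g T" if "smooth_on g (-{0})" "T \<subseteq> -{0}" for g :: "real^3 \<Rightarrow> real" and T
    using that by (rule smooth_on_subset)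
  have pot: "\<exists>\<phi>. \<forall>x\<in>S s. (\<phi> has_derivative (\<lambda>h. \<Sum>j\<in>UNIV. h $ j * v j x)) (at x)" if s: "s = 1 \<or> s = -1" for s
  proof (rule star_shaped_potential[where p = "s *\<^sub>R axis 3 1"])
    fix x t assume x: "x \<in> S s" and t: "0 \<le> t" "t \<le> (1::real)"
    have "t = 0 \<or> x $ 1 \<noteq> 0 \<or> x $ 2 \<noteq> 0 \<or> s * x $ 3 > 0" using x by (auto simp: S_def not_le)
    moreover have "s * s = 1" using s by auto
    moreover have "s * (s + t * (x $ 3 - s)) = (1 - t) + t * (s * x $ 3)" using \<open>s * s = 1\<close> by (simp add: algebra_simps) 
    moreover have "(1 - t) + t * (s * x $ 3) > 0" if "s * x $ 3 > 0" 
      using that t by (cases "t = 0") (auto intro: add_nonneg_pos)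
    ultimately show "s *\<^sub>R axis 3 1 + t *\<^sub>R (x - s *\<^sub>R axis 3 1) \<in> S s"
      by (auto simp: S_def axis_def)
  next
    fix x i j assume "x \<in> S s"
    then have "x \<noteq> 0" using sub by blast
    then show "partial i (v j) x = partial j (v i) x" by (rule curl)
  qed (use oS smS[OF v sub] in auto)
  obtain f g where f: "\<And>x. x \<in> S 1 \<Longrightarrow> (f has_derivative (\<lambda>h. \<Sum>j\<in>UNIV. h $ j * v j x)) (at x)"
    and g: "\<And>x. x \<in> S (-1) \<Longrightarrow> (g has_derivative (\<lambda>h. \<Sum>j\<in>UNIV. h $ j * v j x)) (at x)"
    using pot[of 1] pot[of "-1"] by blast
  define d where "d x = f x - g x" for x
  have d': "(d has_derivative (\<lambda>h. 0)) (at x)" if "x $ 1 \<noteq> 0 \<or> x $ 2 \<noteq> 0" for x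
  proof -
    have "x \<in> S 1" "x \<in> S (-1)" using that by (auto simp: S_def)
    from has_derivative_diff[OF f[OF this(1)] g[OF this(2)]] show ?thesis by (simp add: d_def[abs_def])
  qed
  have half: "\<exists>c. \<forall>x\<in>{x. axis i s \<bullet> x > 0}. d x = c" if "i = 1 \<or> i = 2" for i s
    by (rule has_derivative_zero_constant[OF convex_halfspace_gt])
       (use that in \<open>auto simp: inner_axis' intro!: has_derivative_at_withinI[OF d']\<close>)
  have "\<forall>i s. \<exists>c. i = 1 \<or> i = 2 \<longrightarrow> (\<forall>x. s * x $ i > 0 \<longrightarrow> d x = c)"
  proof (intro allI)
    fix i :: 3 and s :: real
    show "\<exists>c. i = 1 \<or> i = 2 \<longrightarrow> (\<forall>x. s * x $ i > 0 \<longrightarrow> d x = c)"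
      using half[of i s] by (cases "i = 1 \<or> i = 2") (auto simp: inner_axis')
  qed
  then obtain c where c: "\<And>i s x. i = 1 \<or> i = 2 \<Longrightarrow> s * x $ i > 0 \<Longrightarrow> d x = c i s"
    unfolding choice_iff by blast
  \<comment> \<open>points in the four overlaps of consecutive half spaces\<close>
  define p :: "real \<Rightarrow> real \<Rightarrow> real^3" where "p a b = vector [a, b, 0]" for a b
  have "c 1 1 = c 2 1" "c 1 1 = c 2 (-1)" "c 1 (-1) = c 2 1"
    using c[of 1 1 "p 1 1"] c[of 2 1 "p 1 1"] c[of 1 1 "p 1 (-1)"] c[of 2 "-1" "p 1 (-1)"]
      c[of 1 "-1" "p (-1) 1"] c[of 2 1 "p (-1) 1"] by (simp_all add: p_def)
  then have cc: "d x = c 1 1" if "x $ 1 \<noteq> 0 \<or> x $ 2 \<noteq> 0" for x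
    using that c[of 1 1 x] c[of 1 "-1" x] c[of 2 1 x] c[of 2 "-1" x]
    by (cases "x $ 1" "0::real" rule: linorder_cases; cases "x $ 2" "0::real" rule: linorder_cases) auto
  define \<phi> where "\<phi> x = (if x \<in> S 1 then f x else g x + c 1 1)" for x
  have \<phi>': "(\<phi> has_derivative (\<lambda>h. \<Sum>j\<in>UNIV. h $ j * v j x)) (at x)" if "x \<noteq> 0" for x
  proof (cases "x \<in> S 1")
    case True
    show ?thesis
      by (rule has_derivative_transform_within_open[OF f[OF True] oS True]) (simp add: \<phi>_def)
  next
    case False
    then have x: "x \<in> S (-1)" using that by (auto simp: S_def vec_eq_iff forall_3)
    have "((\<lambda>x. g x + c 1 1) has_derivative (\<lambda>h. \<Sum>j\<in>UNIV. h $ j * v j x)) (at x)"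
      using has_derivative_add[OF g[OF x] has_derivative_const[of "c 1 1"]] by simp
    moreover have "g y + c 1 1 = \<phi> y" if "y \<in> S (-1)" for y
      using that cc[of y] by (auto simp: \<phi>_def d_def S_def)
    ultimately show ?thesis by (rule has_derivative_transform_within_open[OF _ oS x])
  qed
  have pp: "partial j \<phi> x = v j x" if "x \<noteq> 0" for x j
  proof -
    have "partial j \<phi> x = (\<Sum>i\<in>UNIV. axis j 1 $ i * v i x)" by (rule partial_has_derivative[OF \<phi>'[OF that]])
    also have "\<dots> = (\<Sum>i\<in>UNIV. if i = j then v i x else 0)" by (rule sum.cong) (auto simp: axis_def)
    finally show ?thesis by simp
  qed
  have "smooth_on \<phi> (-{0})"
  proof (rule smooth_on_from_partials)
    show "\<phi> differentiable_on -{0}"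
      using \<phi>' by (auto simp: differentiable_on_def differentiable_def intro: has_derivative_at_withinI)
    show "smooth_on (partial i \<phi>) (-{0})" for i
      by (rule smooth_on_cong[OF v[of i] open_punctured]) (use pp in auto)
  qed
  then show thesis using pp that by blast
qed

section \<open>Differential operators on functions defined off the origin\<close>

lemma partial_cong_punctured:
  assumes "\<And>y. y \<noteq> 0 \<Longrightarrow> f y = g y" "x \<noteq> (0::real^3)"
  shows "partial i f x = partial i g x"
  by (rule partial_cong[OF open_punctured]) (use assms in auto)

lemma smooth_partial_mult:
  fixes f g :: "real^3 \<Rightarrow> real"
  assumes "smooth_on f (-{0})" "smooth_on g (-{0})" "x \<noteq> 0"
  shows "partial i (\<lambda>x. f x * g x) x = partial i f x * g x + f x * partial i g x"
  by (rule partial_mult) (use assms smooth_differentiable in auto)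

lemma smooth_partial_add:
  assumes "smooth_on f (-{0})" "smooth_on g (-{0})" "x \<noteq> 0"
  shows "partial i (\<lambda>x. f x + g x) x = partial i f x + partial i g x"
  by (rule partial_add) (use assms smooth_differentiable in auto)

lemma smooth_partial_diff:
  assumes "smooth_on f (-{0})" "smooth_on g (-{0})" "x \<noteq> 0"
  shows "partial i (\<lambda>x. f x - g x) x = partial i f x - partial i g x"
  by (rule partial_diff) (use assms smooth_differentiable in auto)

lemma smooth_partial_sum:
  assumes "\<And>j. smooth_on (f j) (-{0})" "x \<noteq> 0"
  shows "partial i (\<lambda>x. \<Sum>j\<in>A. f j x) x = (\<Sum>j\<in>A. partial i (f j) x)"
  by (rule partial_sum) (use assms smooth_differentiable in auto)

lemma smooth_partial_cmult:
  fixes f :: "real^3 \<Rightarrow> real"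
  assumes "smooth_on f (-{0})" "x \<noteq> 0"
  shows "partial i (\<lambda>x. c * f x) x = c * partial i f x"
  using smooth_partial_mult[OF smooth_on_const[of c] assms, of i] by simp

lemma smooth_partial_swap:
  fixes f :: "real^3 \<Rightarrow> real"
  assumes "smooth_on f (-{0})" "x \<noteq> 0"
  shows "partial i (partial j f) x = partial j (partial i f) x"
  by (rule smooth_partial_commute[OF assms(1) open_punctured]) (use assms in auto)

lemma laplacian_cong:
  assumes "\<And>y. y \<noteq> 0 \<Longrightarrow> f y = g y" "x \<noteq> (0::real^3)"
  shows "laplacian f x = laplacian g x"
proof -
  have *: "partial i f y = partial i g y" if "y \<noteq> 0" for i y by (rule partial_cong_punctured[OF assms(1) that])
  have "partial i (partial i f) x = partial i (partial i g) x" for i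
    by (rule partial_cong_punctured[OF * assms(2)])
  then show ?thesis by (simp add: laplacian_def)
qed

lemma laplacian_mult:
  fixes f g :: "real^3 \<Rightarrow> real"
  assumes "smooth_on f (-{0})" "smooth_on g (-{0})" "x \<noteq> 0"
  shows "laplacian (\<lambda>x. f x * g x) x
    = laplacian f x * g x + 2 * (\<Sum>j\<in>UNIV. partial j f x * partial j g x) + f x * laplacian g x"
proof -
  have "partial j (partial j (\<lambda>x. f x * g x)) x
     = partial j (partial j f) x * g x + 2 * (partial j f x * partial j g x) + f x * partial j (partial j g) x" for j
  proof -
    have "partial j (partial j (\<lambda>x. f x * g x)) x = partial j (\<lambda>x. partial j f x * g x + f x * partial j g x) x"
      by (rule partial_cong_punctured[OF smooth_partial_mult[OF assms(1,2)] assms(3)])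
    also have "\<dots> = partial j (\<lambda>x. partial j f x * g x) x + partial j (\<lambda>x. f x * partial j g x) x"
      by (rule smooth_partial_add) (intro smooth_intros open_punctured assms)+
    finally show ?thesis
      by (simp add: smooth_partial_mult assms smooth_on_partial)
  qed
  then show ?thesis by (simp add: laplacian_def sum.distrib sum_distrib_left sum_distrib_right)
qed

lemma laplacian_add:
  assumes "smooth_on f (-{0})" "smooth_on g (-{0})" "x \<noteq> 0"
  shows "laplacian (\<lambda>x. f x + g x) x = laplacian f x + laplacian g x"
proof -
  have "partial j (partial j (\<lambda>x. f x + g x)) x = partial j (\<lambda>x. partial j f x + partial j g x) x" for j
    by (rule partial_cong_punctured[OF smooth_partial_add[OF assms(1,2)] assms(3)])
  then show ?thesis
    by (simp add: laplacian_def sum.distrib smooth_partial_add assms smooth_on_partial)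
qed

lemma laplacian_diff:
  assumes "smooth_on f (-{0})" "smooth_on g (-{0})" "x \<noteq> 0"
  shows "laplacian (\<lambda>x. f x - g x) x = laplacian f x - laplacian g x"
proof -
  have "partial j (partial j (\<lambda>x. f x - g x)) x = partial j (\<lambda>x. partial j f x - partial j g x) x" for j
    by (rule partial_cong_punctured[OF smooth_partial_diff[OF assms(1,2)] assms(3)])
  then show ?thesis
    by (simp add: laplacian_def sum_subtractf smooth_partial_diff assms smooth_on_partial)
qed

lemma laplacian_cmult:
  fixes f :: "real^3 \<Rightarrow> real"
  assumes "smooth_on f (-{0})" "x \<noteq> 0"
  shows "laplacian (\<lambda>x. c * f x) x = c * laplacian f x"
  using laplacian_mult[OF smooth_on_const[of c] assms] by (simp add: laplacian_def partial_const[abs_def])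

lemma laplacian_component: "laplacian (\<lambda>x. x $ i) x = 0"
proof -
  have "partial j (\<lambda>x. x $ i) = (\<lambda>x. if j = i then 1 else 0)" for j by (rule ext) (rule partial_component)
  then show ?thesis by (simp add: laplacian_def)
qed

lemma laplacian_component_mult:
  fixes f :: "real^3 \<Rightarrow> real"
  assumes "smooth_on f (-{0})" "x \<noteq> 0"
  shows "laplacian (\<lambda>x. x $ i * f x) x = x $ i * laplacian f x + 2 * partial i f x"
  using laplacian_mult[OF smooth_on_component assms, of i]
  by (simp add: laplacian_component partial_component if_distrib[of "\<lambda>c. c * _"] cong: if_cong)

lemma laplacian_partial:
  fixes f :: "real^3 \<Rightarrow> real"
  assumes "smooth_on f (-{0})" "x \<noteq> 0"
  shows "laplacian (partial i f) x = partial i (laplacian f) x"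
proof -
  have "partial j (partial j (partial i f)) x = partial i (partial j (partial j f)) x" for j
  proof -
    have "partial j (partial j (partial i f)) x = partial j (partial i (partial j f)) x"
      by (rule partial_cong_punctured[OF smooth_partial_swap[OF assms(1)] assms(2)])
    also have "\<dots> = partial i (partial j (partial j f)) x"
      by (rule smooth_partial_swap[OF smooth_on_partial[OF assms(1)] assms(2)])
    finally show ?thesis .
  qed
  then show ?thesis unfolding laplacian_def[abs_def]
    by (simp add: smooth_partial_sum smooth_on_partial assms)
qed

section \<open>The radial component of the vorticity\<close>

text \<open>This is \<open>x \<bullet> curl w\<close>.\<close>
definition radial_curl :: "(3 \<Rightarrow> real^3 \<Rightarrow> real) \<Rightarrow> real^3 \<Rightarrow> real" where
  "radial_curl w x = x $ 1 * (partial 2 (w 3) x - partial 3 (w 2) x)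
     + x $ 2 * (partial 3 (w 1) x - partial 1 (w 3) x) + x $ 3 * (partial 1 (w 2) x - partial 2 (w 1) x)"

lemma smooth_radial_curl:
  assumes "\<And>i. smooth_on (w i) (-{0})" shows "smooth_on (radial_curl w) (-{0})"
  unfolding radial_curl_def[abs_def] by (intro smooth_intros open_punctured assms)

lemma partial_radial_curl:
  assumes w: "\<And>i. smooth_on (w i) (-{0})" and x: "x \<noteq> 0"
  shows "partial j (radial_curl w) x = radial_curl (\<lambda>i. partial j (w i)) x
    + (if j = 1 then partial 2 (w 3) x - partial 3 (w 2) x
       else if j = 2 then partial 3 (w 1) x - partial 1 (w 3) x else partial 1 (w 2) x - partial 2 (w 1) x)"
proof -
  have c: "smooth_on (\<lambda>x. partial a (w b) x - partial c (w d) x) (-{0})" for a b c d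
    by (intro smooth_intros open_punctured w)
  have d: "partial j (\<lambda>x. partial a (w b) x - partial c (w d) x) x = partial a (partial j (w b)) x - partial c (partial j (w d)) x" for a b c d
    by (simp add: smooth_partial_diff smooth_on_partial w x smooth_partial_swap[OF w x, of j])
  have e: "partial j (\<lambda>x. x $ i * (partial a (w b) x - partial c (w d) x)) x
     = (if j = i then 1 else 0) * (partial a (w b) x - partial c (w d) x) 
       + x $ i * (partial a (partial j (w b)) x - partial c (partial j (w d)) x)" for i a b c d
    using smooth_partial_mult[OF smooth_on_component c x, of j i] by (simp add: partial_component d)
  have s: "smooth_on (\<lambda>x. x $ i * (partial a (w b) x - partial c (w d) x)) (-{0})" for i a b c d
    by (intro smooth_intros open_punctured w)
  have s2: "smooth_on (\<lambda>x. x $ 1 * (partial 2 (w 3) x - partial 3 (w 2) x)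
     + x $ 2 * (partial 3 (w 1) x - partial 1 (w 3) x)) (-{0})"
    by (intro smooth_intros open_punctured w)
  show ?thesis
    unfolding radial_curl_def[abs_def] smooth_partial_add[OF s2 s x] smooth_partial_add[OF s s x] e
    using exhaust_3[of j] by auto
qed

text \<open>The first derivatives produced by the factors \<open>x\<^sub>i\<close> sum to twice the divergence of a curl.\<close>
lemma laplacian_radial_curl:
  assumes w: "\<And>i. smooth_on (w i) (-{0})" and x: "x \<noteq> 0"
  shows "laplacian (radial_curl w) x = radial_curl (\<lambda>i. laplacian (w i)) x"
proof -
  have c: "smooth_on (\<lambda>x. partial a (w b) x - partial c (w d) x) (-{0})" for a b c d
    by (intro smooth_intros open_punctured w)
  have e: "laplacian (\<lambda>x. x $ i * (partial a (w b) x - partial c (w d) x)) x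
     = x $ i * (partial a (laplacian (w b)) x - partial c (laplacian (w d)) x)
      + 2 * (partial i (partial a (w b)) x - partial i (partial c (w d)) x)" for i a b c d
    by (simp add: laplacian_component_mult[OF c x] laplacian_diff smooth_partial_diff
        smooth_on_partial w x laplacian_partial)
  have s: "smooth_on (\<lambda>x. x $ i * (partial a (w b) x - partial c (w d) x)) (-{0})" for i a b c d
    by (intro smooth_intros open_punctured w)
  have s2: "smooth_on (\<lambda>x. x $ 1 * (partial 2 (w 3) x - partial 3 (w 2) x)
     + x $ 2 * (partial 3 (w 1) x - partial 1 (w 3) x)) (-{0})"
    by (intro smooth_intros open_punctured w)
  show ?thesis
    unfolding radial_curl_def[abs_def] laplacian_add[OF s2 s x] laplacian_add[OF s s x] e
    using smooth_partial_swap[OF w x, of 1 2] smooth_partial_swap[OF w x, of 1 3] smooth_partial_swap[OF w x, of 2 3]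
    by simp
qed

text \<open>Here \<open>a\<close> and \<open>b\<close> are the gradients of \<open>u\<close> and \<open>w\<close>, traceless because the fields are divergence
  free; Euler's relation for degree \<open>-1\<close> gives \<open>u = - a x\<close> and \<open>w = - b x\<close>. The right-hand side is
  \<open>u \<bullet> curl w + w \<bullet> curl u\<close>.\<close>
lemma vorticity_stretching_identity:
  fixes x1 x2 x3 :: real
  assumes "u1 = - (a11 * x1 + a12 * x2 + a13 * x3)" "u2 = - (a21 * x1 + a22 * x2 + a23 * x3)"
    "u3 = - (a31 * x1 + a32 * x2 + a33 * x3)"
    "w1 = - (b11 * x1 + b12 * x2 + b13 * x3)" "w2 = - (b21 * x1 + b22 * x2 + b23 * x3)"
    "w3 = - (b31 * x1 + b32 * x2 + b33 * x3)"
    "a33 = - a11 - a22" "b33 = - b11 - b22"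
  shows "x1 * ((a12*b31 + a22*b32 + a32*b33 + b12*a31 + b22*a32 + b32*a33)
               - (a13*b21 + a23*b22 + a33*b23 + b13*a21 + b23*a22 + b33*a23))
       + x2 * ((a13*b11 + a23*b12 + a33*b13 + b13*a11 + b23*a12 + b33*a13)
               - (a11*b31 + a21*b32 + a31*b33 + b11*a31 + b21*a32 + b31*a33))
       + x3 * ((a11*b21 + a21*b22 + a31*b23 + b11*a21 + b21*a22 + b31*a23)
               - (a12*b11 + a22*b12 + a32*b13 + b12*a11 + b22*a12 + b32*a13))
    = u1 * (b32 - b23) + u2 * (b13 - b31) + u3 * (b21 - b12)
    + w1 * (a32 - a23) + w2 * (a13 - a31) + w3 * (a21 - a12)"
  unfolding assms by algebra

text \<open>The operator \<open>x \<bullet> curl\<close> commutes with the Laplacian and annihilates gradients, so applied to the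
  equation it yields an equation for the radial vorticity. There the stretching terms cancel, because
  both fields are divergence free and homogeneous of degree \<open>-1\<close>.\<close>
lemma radial_vorticity_equation:
  fixes w u :: "3 \<Rightarrow> real^3 \<Rightarrow> real"
  assumes w: "\<And>i. smooth_on (w i) (-{0})" "\<And>i. homogeneous (-1) (w i)"
      "\<And>x. x \<noteq> 0 \<Longrightarrow> (\<Sum>i\<in>UNIV. partial i (w i) x) = 0"
    and u: "\<And>i. smooth_on (u i) (-{0})" "\<And>i. homogeneous (-1) (u i)"
      "\<And>x. x \<noteq> 0 \<Longrightarrow> (\<Sum>i\<in>UNIV. partial i (u i) x) = 0"
      "\<And>x. x \<noteq> 0 \<Longrightarrow> radial_curl u x = 0"
    and q: "smooth_on q (-{0})"
    and eq: "\<And>x i. x \<noteq> 0 \<Longrightarrow> laplacian (w i) x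
        = (\<Sum>j\<in>UNIV. u j x * partial j (w i) x + w j x * partial j (u i) x) + partial i q x"
    and x: "x \<noteq> 0"
  shows "laplacian (radial_curl w) x = (\<Sum>j\<in>UNIV. u j x * partial j (radial_curl w) x)"
proof -
  have in_sum: "partial k (\<lambda>x. u j x * partial j (w i) x + w j x * partial j (u i) x) x =
       partial k (u j) x * partial j (w i) x + u j x * partial j (partial k (w i)) x
     + partial k (w j) x * partial j (u i) x + w j x * partial j (partial k (u i)) x" for i j k
  proof -
    have "partial k (\<lambda>x. u j x * partial j (w i) x + w j x * partial j (u i) x) x
      = partial k (\<lambda>x. u j x * partial j (w i) x) x + partial k (\<lambda>x. w j x * partial j (u i) x) x"
      by (rule smooth_partial_add[OF _ _ x]) (intro smooth_intros open_punctured w u)+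
    then show ?thesis
      by (simp add: smooth_partial_mult w u smooth_on_partial x smooth_partial_swap[OF w(1) x, of k] smooth_partial_swap[OF u(1) x, of k])
  qed
  have dL: "partial k (laplacian (w i)) x = (\<Sum>j\<in>UNIV. partial k (u j) x * partial j (w i) x + u j x * partial j (partial k (w i)) x
     + partial k (w j) x * partial j (u i) x + w j x * partial j (partial k (u i)) x) + partial k (partial i q) x" for k i
  proof -
    have "partial k (laplacian (w i)) x = partial k (\<lambda>x. (\<Sum>j\<in>UNIV. u j x * partial j (w i) x + w j x * partial j (u i) x) + partial i q x) x"
      by (rule partial_cong_punctured[OF eq x])
    also have "\<dots> = partial k (\<lambda>x. (\<Sum>j\<in>UNIV. u j x * partial j (w i) x + w j x * partial j (u i) x)) x + partial k (partial i q) x"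
      by (rule smooth_partial_add[OF _ _ x]) (intro smooth_intros open_punctured w u q)+
    also have "partial k (\<lambda>x. (\<Sum>j\<in>UNIV. u j x * partial j (w i) x + w j x * partial j (u i) x)) x
       = (\<Sum>j\<in>UNIV. partial k (\<lambda>x. u j x * partial j (w i) x + w j x * partial j (u i) x) x)"
      by (rule smooth_partial_sum[OF _ x]) (intro smooth_intros open_punctured w u)
    finally show ?thesis unfolding in_sum .
  qed
  have dU: "partial j (radial_curl u) x = 0" for j
    using partial_cong_punctured[of "radial_curl u" "\<lambda>x. 0", OF u(4) x] by simp
  note dU' = dU[unfolded partial_radial_curl[OF u(1) x]]
  have e1: "u i x = - (partial 1 (u i) x * x $ 1 + partial 2 (u i) x * x $ 2 + partial 3 (u i) x * x $ 3)"
     "w i x = - (partial 1 (w i) x * x $ 1 + partial 2 (w i) x * x $ 2 + partial 3 (w i) x * x $ 3)" for i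
    using homogeneous_euler[OF u(1,2) x, of i] homogeneous_euler[OF w(1,2) x, of i]
    by (simp_all add: sum_3 algebra_simps)
  have tr: "partial 3 (u 3) x = - partial 1 (u 1) x - partial 2 (u 2) x"
    "partial 3 (w 3) x = - partial 1 (w 1) x - partial 2 (w 2) x"
    using u(3)[OF x] w(3)[OF x] by (simp_all add: sum_3 algebra_simps)
  have c0: "radial_curl (\<lambda>i. partial 1 (u i)) x = - (partial 2 (u 3) x - partial 3 (u 2) x)"
    "radial_curl (\<lambda>i. partial 2 (u i)) x = - (partial 3 (u 1) x - partial 1 (u 3) x)"
    "radial_curl (\<lambda>i. partial 3 (u i)) x = - (partial 1 (u 2) x - partial 2 (u 1) x)"
    using dU'[of 1] dU'[of 2] dU'[of 3] by simp_all
  have id: "x $ 1 * ((partial 2 (u 1) x * partial 1 (w 3) x + partial 2 (u 2) x * partial 2 (w 3) x + partial 2 (u 3) x * partial 3 (w 3) x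
       + partial 2 (w 1) x * partial 1 (u 3) x + partial 2 (w 2) x * partial 2 (u 3) x + partial 2 (w 3) x * partial 3 (u 3) x)
     - (partial 3 (u 1) x * partial 1 (w 2) x + partial 3 (u 2) x * partial 2 (w 2) x + partial 3 (u 3) x * partial 3 (w 2) x
       + partial 3 (w 1) x * partial 1 (u 2) x + partial 3 (w 2) x * partial 2 (u 2) x + partial 3 (w 3) x * partial 3 (u 2) x))
   + x $ 2 * ((partial 3 (u 1) x * partial 1 (w 1) x + partial 3 (u 2) x * partial 2 (w 1) x + partial 3 (u 3) x * partial 3 (w 1) x
       + partial 3 (w 1) x * partial 1 (u 1) x + partial 3 (w 2) x * partial 2 (u 1) x + partial 3 (w 3) x * partial 3 (u 1) x)
     - (partial 1 (u 1) x * partial 1 (w 3) x + partial 1 (u 2) x * partial 2 (w 3) x + partial 1 (u 3) x * partial 3 (w 3) x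
       + partial 1 (w 1) x * partial 1 (u 3) x + partial 1 (w 2) x * partial 2 (u 3) x + partial 1 (w 3) x * partial 3 (u 3) x))
   + x $ 3 * ((partial 1 (u 1) x * partial 1 (w 2) x + partial 1 (u 2) x * partial 2 (w 2) x + partial 1 (u 3) x * partial 3 (w 2) x
       + partial 1 (w 1) x * partial 1 (u 2) x + partial 1 (w 2) x * partial 2 (u 2) x + partial 1 (w 3) x * partial 3 (u 2) x)
     - (partial 2 (u 1) x * partial 1 (w 1) x + partial 2 (u 2) x * partial 2 (w 1) x + partial 2 (u 3) x * partial 3 (w 1) x
       + partial 2 (w 1) x * partial 1 (u 1) x + partial 2 (w 2) x * partial 2 (u 1) x + partial 2 (w 3) x * partial 3 (u 1) x))
   = u 1 x * (partial 2 (w 3) x - partial 3 (w 2) x) + u 2 x * (partial 3 (w 1) x - partial 1 (w 3) x) + u 3 x * (partial 1 (w 2) x - partial 2 (w 1) x)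
   + w 1 x * (partial 2 (u 3) x - partial 3 (u 2) x) + w 2 x * (partial 3 (u 1) x - partial 1 (u 3) x) + w 3 x * (partial 1 (u 2) x - partial 2 (u 1) x)"
    by (rule vorticity_stretching_identity[OF e1(1) e1(1) e1(1) e1(2) e1(2) e1(2) tr])
  have swap: "partial 1 (partial 2 f) x = partial 2 (partial 1 f) x" "partial 1 (partial 3 f) x = partial 3 (partial 1 f) x"
    "partial 2 (partial 3 f) x = partial 3 (partial 2 f) x" if "smooth_on f (-{0})" for f :: "real^3 \<Rightarrow> real"
    by (rule smooth_partial_swap[OF that x])+
  have "radial_curl (\<lambda>i. laplacian (w i)) x = 
     (u 1 x * (partial 2 (w 3) x - partial 3 (w 2) x) + u 2 x * (partial 3 (w 1) x - partial 1 (w 3) x) + u 3 x * (partial 1 (w 2) x - partial 2 (w 1) x)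
   + w 1 x * (partial 2 (u 3) x - partial 3 (u 2) x) + w 2 x * (partial 3 (u 1) x - partial 1 (u 3) x) + w 3 x * (partial 1 (u 2) x - partial 2 (u 1) x))
   + (u 1 x * radial_curl (\<lambda>i. partial 1 (w i)) x + u 2 x * radial_curl (\<lambda>i. partial 2 (w i)) x + u 3 x * radial_curl (\<lambda>i. partial 3 (w i)) x)
   + (w 1 x * radial_curl (\<lambda>i. partial 1 (u i)) x + w 2 x * radial_curl (\<lambda>i. partial 2 (u i)) x + w 3 x * radial_curl (\<lambda>i. partial 3 (u i)) x)"
    unfolding id[symmetric] unfolding radial_curl_def dL sum_3
    by (simp add: algebra_simps swap[OF q] swap[OF w(1)] swap[OF u(1)])
  then show ?thesis
    unfolding laplacian_radial_curl[OF w(1) x] c0 sum_3 partial_radial_curl[OF w(1) x]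
    by (simp add: algebra_simps)
qed

section \<open>Fields that are a tangential gradient plus a radial part\<close>

definition inv_sq :: "real^3 \<Rightarrow> real" where
  "inv_sq x = 1 / (norm x)\<^sup>2"

definition radial_unit :: "3 \<Rightarrow> real^3 \<Rightarrow> real" where
  "radial_unit i x = x $ i * inv_sq x"

lemma norm_sq_3: "(norm (x::real^3))\<^sup>2 = x $ 1 * x $ 1 + x $ 2 * x $ 2 + x $ 3 * x $ 3"
  unfolding power2_norm_eq_inner by (simp add: inner_vec_def sum_3)

lemma sum_sq_over_norm: "x \<noteq> (0::real^3) \<Longrightarrow> (\<Sum>j\<in>UNIV. x $ j * x $ j) * inv_sq x = 1"
  by (simp add: sum_3 norm_sq_3[symmetric] inv_sq_def)

lemma smooth_norm_punctured: "smooth_on (\<lambda>x::real^3. norm x) (-{0})"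
  by (rule smooth_on_norm) auto

lemma smooth_inverse_norm_sq: "smooth_on inv_sq (-{0})"
  unfolding inv_sq_def[abs_def]
  by (intro smooth_intros open_punctured smooth_norm_punctured) auto

lemma homogeneous_inverse_norm_sq: "homogeneous (-2) inv_sq"
  unfolding inv_sq_def[abs_def]
  using homogeneous_divide[OF homogeneous_const[of 1] homogeneous_power[OF homogeneous_norm, of 2]] by simp

lemma partial_inverse_norm_sq:
  assumes "x \<noteq> 0"
  shows "partial i inv_sq x = - 2 * x $ i * (inv_sq x)\<^sup>2"
proof -
  have "((\<lambda>r. 1 / r\<^sup>2) has_field_derivative (- 2 / (norm x) ^ 3)) (at (norm x))"
    using assms by (auto intro!: derivative_eq_intros simp: power2_eq_square power3_eq_cube field_simps)
  from partial_radial[OF this assms] show ?thesis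
    using assms by (simp add: inv_sq_def[abs_def] power2_eq_square power3_eq_cube field_simps)
qed

lemma smooth_radial_unit: "smooth_on (radial_unit i) (-{0})"
  unfolding radial_unit_def[abs_def] by (intro smooth_intros open_punctured smooth_inverse_norm_sq)

lemma homogeneous_radial_unit: "homogeneous (-1) (radial_unit i)"
  unfolding radial_unit_def[abs_def]
  using homogeneous_mult[OF homogeneous_component homogeneous_inverse_norm_sq] by simp

lemma partial_radial_unit:
  assumes "x \<noteq> 0"
  shows "partial j (radial_unit i) x = (if j = i then 1 else 0) * inv_sq x - 2 * x $ i * x $ j * (inv_sq x)\<^sup>2"
  unfolding radial_unit_def[abs_def]
  by (simp add: smooth_partial_mult smooth_on_component smooth_inverse_norm_sq assms partial_component
      partial_inverse_norm_sq)

lemma laplacian_inverse_norm_sq: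
  assumes "x \<noteq> 0" shows "laplacian inv_sq x = 2 * (inv_sq x)\<^sup>2"
proof -
  have pp: "partial i (partial i inv_sq) x = - 2 * (inv_sq x)\<^sup>2 + 8 * (x $ i * x $ i) * (inv_sq x)^3" for i
  proof -
    have "partial i (partial i inv_sq) x = partial i (\<lambda>x. - 2 * x $ i * (inv_sq x)\<^sup>2) x"
      by (rule partial_cong_punctured[OF partial_inverse_norm_sq assms])
    also have "\<dots> = partial i (\<lambda>x. (- 2 * radial_unit i x) * inv_sq x) x"
      by (rule partial_cong_punctured[OF _ assms]) (simp add: radial_unit_def power2_eq_square)
    also have "\<dots> = (- 2 * partial i (radial_unit i) x) * inv_sq x + (- 2 * radial_unit i x) * partial i inv_sq x"
      by (subst smooth_partial_mult[OF _ smooth_inverse_norm_sq assms]) 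
        (intro smooth_intros open_punctured smooth_radial_unit, simp only: smooth_partial_cmult[OF smooth_radial_unit assms])
    finally show ?thesis
      by (simp only: partial_radial_unit[OF assms] partial_inverse_norm_sq[OF assms]) 
         (simp add: radial_unit_def algebra_simps power2_eq_square power3_eq_cube)
  qed
  have "laplacian inv_sq x = - 6 * (inv_sq x)\<^sup>2 + 8 * ((\<Sum>i\<in>UNIV. x $ i * x $ i) * inv_sq x) * (inv_sq x)\<^sup>2"
    unfolding laplacian_def pp by (simp add: sum_3 algebra_simps power2_eq_square power3_eq_cube)
  then show ?thesis unfolding sum_sq_over_norm[OF assms] by simp
qed

lemma laplacian_radial_unit:
  assumes "x \<noteq> 0" shows "laplacian (radial_unit i) x = - 2 * x $ i * (inv_sq x)\<^sup>2"
  unfolding radial_unit_def[abs_def]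
  by (simp add: laplacian_component_mult[OF smooth_inverse_norm_sq assms] laplacian_inverse_norm_sq[OF assms]
     partial_inverse_norm_sq[OF assms])

text \<open>A divergence-free field \<open>v + f x / |x|\<^sup>2\<close> of degree \<open>-1\<close> whose tangential part is curl free;
  the divergence condition couples \<open>f\<close> to \<open>v\<close>.\<close>
definition split_flow :: "(3 \<Rightarrow> real^3 \<Rightarrow> real) \<Rightarrow> (real^3 \<Rightarrow> real) \<Rightarrow> bool" where
  "split_flow v f \<longleftrightarrow> (\<forall>i. smooth_on (v i) (-{0})) \<and> (\<forall>i. homogeneous (-1) (v i))
     \<and> smooth_on f (-{0}) \<and> homogeneous 0 f
     \<and> (\<forall>x. x \<noteq> 0 \<longrightarrow> (\<Sum>j\<in>UNIV. x $ j * v j x) = 0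
          \<and> (\<forall>i j. partial i (v j) x = partial j (v i) x)
          \<and> (\<Sum>j\<in>UNIV. partial j (v j) x) = - f x * inv_sq x)"

definition flow_field :: "(3 \<Rightarrow> real^3 \<Rightarrow> real) \<Rightarrow> (real^3 \<Rightarrow> real) \<Rightarrow> 3 \<Rightarrow> real^3 \<Rightarrow> real" where
  "flow_field v f i x = v i x + f x * radial_unit i x"

lemma split_flowD:
  assumes "split_flow v f"
  shows "smooth_on (v i) (-{0})" "homogeneous (-1) (v i)" "smooth_on f (-{0})" "homogeneous 0 f"
    "x \<noteq> 0 \<Longrightarrow> (\<Sum>j\<in>UNIV. x $ j * v j x) = 0" "x \<noteq> 0 \<Longrightarrow> partial i (v j) x = partial j (v i) x"
    "x \<noteq> 0 \<Longrightarrow> (\<Sum>j\<in>UNIV. partial j (v j) x) = - f x * inv_sq x"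
  using assms by (auto simp: split_flow_def)

context
  fixes v f assumes vf: "split_flow v f"
begin

lemma smooth_flow_field: "smooth_on (flow_field v f i) (-{0})"
  unfolding flow_field_def[abs_def]
  by (intro smooth_intros open_punctured split_flowD[OF vf] smooth_radial_unit)

lemma homogeneous_flow_field: "homogeneous (-1) (flow_field v f i)"
  unfolding flow_field_def[abs_def]
  using homogeneous_add[OF split_flowD(2)[OF vf] homogeneous_mult[OF split_flowD(4)[OF vf] homogeneous_radial_unit, simplified]]
  by simp

lemma partial_flow_field:
  assumes x: "x \<noteq> 0"
  shows "partial j (flow_field v f i) x = partial j (v i) x + (partial j f x * radial_unit i x + f x * partial j (radial_unit i) x)"
proof -
  have "partial j (flow_field v f i) x = partial j (v i) x + partial j (\<lambda>x. f x * radial_unit i x) x"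
    unfolding flow_field_def[abs_def] 
    by (rule smooth_partial_add[OF _ _ x]) (intro smooth_intros open_punctured split_flowD[OF vf] smooth_radial_unit)+
  then show ?thesis by (simp add: smooth_partial_mult split_flowD[OF vf] smooth_radial_unit x)
qed

lemma euler_f: "x \<noteq> 0 \<Longrightarrow> (\<Sum>j\<in>UNIV. x $ j * partial j f x) = 0"
  using homogeneous_euler[OF split_flowD(3,4)[OF vf]] by simp

lemma divergence_flow_field:
  assumes x: "x \<noteq> 0" shows "(\<Sum>i\<in>UNIV. partial i (flow_field v f i) x) = 0"
proof -
  let ?g = "inv_sq x"
  have "(\<Sum>i\<in>UNIV. partial i (flow_field v f i) x) = (\<Sum>i\<in>UNIV. partial i (v i) x)
     + (\<Sum>j\<in>UNIV. x $ j * partial j f x) * ?g + f x * (3 * ?g - 2 * ((\<Sum>j\<in>UNIV. x $ j * x $ j) * ?g) * ?g)"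
    unfolding partial_flow_field[OF x] partial_radial_unit[OF x] radial_unit_def
    by (simp add: sum_3 algebra_simps add_divide_distrib power2_eq_square)
  then show ?thesis unfolding sum_sq_over_norm[OF x] split_flowD(7)[OF vf x] euler_f[OF x] by simp
qed

lemma radial_curl_flow_field:
  assumes x: "x \<noteq> 0" shows "radial_curl (flow_field v f) x = 0"
  unfolding radial_curl_def partial_flow_field[OF x] partial_radial_unit[OF x] radial_unit_def
  using split_flowD(6)[OF vf x, of 1 2] split_flowD(6)[OF vf x, of 1 3] split_flowD(6)[OF vf x, of 2 3]
  by (simp add: algebra_simps)

lemma laplacian_flow_field:
  assumes x: "x \<noteq> 0"
  shows "laplacian (flow_field v f i) x = (partial i f x + x $ i * laplacian f x) * inv_sq x"
proof -
  let ?g = "inv_sq x"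
  have sw: "partial j (partial j (v i)) x = partial i (partial j (v j)) x" for j
  proof -
    have "partial j (partial j (v i)) x = partial j (partial i (v j)) x"
      by (rule partial_cong_punctured[OF split_flowD(6)[OF vf] x])
    then show ?thesis using smooth_partial_swap[OF split_flowD(1)[OF vf] x] by simp
  qed
  have "laplacian (v i) x = partial i (\<lambda>x. \<Sum>j\<in>UNIV. partial j (v j) x) x"
    unfolding laplacian_def sw by (simp add: smooth_partial_sum smooth_on_partial split_flowD[OF vf] x)
  also have "\<dots> = partial i (\<lambda>x. - f x * inv_sq x) x"
    by (rule partial_cong_punctured[OF split_flowD(7)[OF vf] x])
  also have "\<dots> = - partial i f x * ?g + 2 * f x * x $ i * ?g\<^sup>2"
    by (subst smooth_partial_mult[OF _ smooth_inverse_norm_sq x])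
       (intro smooth_intros open_punctured split_flowD[OF vf],
        simp add: partial_minus[OF smooth_differentiable[OF split_flowD(3)[OF vf] x]] partial_inverse_norm_sq[OF x])
  finally have 1: "laplacian (v i) x = - partial i f x * ?g + 2 * f x * x $ i * ?g\<^sup>2" .
  have "(\<Sum>j\<in>UNIV. partial j f x * partial j (radial_unit i) x) = partial i f x * ?g - 2 * x $ i * ?g\<^sup>2 * (\<Sum>j\<in>UNIV. x $ j * partial j f x)"
    unfolding partial_radial_unit[OF x] by (cases i rule: exhaust_3[THEN disjE]) (use exhaust_3[of i] in \<open>auto simp: sum_3 algebra_simps\<close>)
  then have 2: "(\<Sum>j\<in>UNIV. partial j f x * partial j (radial_unit i) x) = partial i f x * ?g"
    using euler_f[OF x] by simp
  have "laplacian (flow_field v f i) x = laplacian (v i) x + laplacian (\<lambda>x. f x * radial_unit i x) x"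
    unfolding flow_field_def[abs_def]
    by (rule laplacian_add[OF _ _ x]) (intro smooth_intros open_punctured split_flowD[OF vf] smooth_radial_unit)+
  also have "laplacian (\<lambda>x. f x * radial_unit i x) x = laplacian f x * radial_unit i x + 2 * (partial i f x * ?g) - 2 * f x * x $ i * ?g\<^sup>2"
    unfolding laplacian_mult[OF split_flowD(3)[OF vf] smooth_radial_unit x] 2 laplacian_radial_unit[OF x] by simp
  finally show ?thesis unfolding 1 radial_unit_def by (simp add: algebra_simps)
qed

lemma flow_field_derivative:
  assumes x: "x \<noteq> 0" and h: "smooth_on h (-{0})" "homogeneous k h"
  shows "(\<Sum>j\<in>UNIV. flow_field v f j x * partial j h x) = (\<Sum>j\<in>UNIV. v j x * partial j h x) + of_int k * inv_sq x * f x * h x"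
proof -
  have "(\<Sum>j\<in>UNIV. flow_field v f j x * partial j h x) = (\<Sum>j\<in>UNIV. v j x * partial j h x) + f x * inv_sq x * (\<Sum>j\<in>UNIV. x $ j * partial j h x)"
    by (simp add: flow_field_def radial_unit_def sum_3 algebra_simps)
  then show ?thesis unfolding homogeneous_euler[OF h x] by simp
qed

lemma flow_field_derivative_radial_unit:
  assumes x: "x \<noteq> 0"
  shows "(\<Sum>j\<in>UNIV. flow_field v f j x * partial j (radial_unit i) x) = inv_sq x * v i x - inv_sq x * f x * radial_unit i x"
proof -
  have "(\<Sum>j\<in>UNIV. v j x * partial j (radial_unit i) x) = inv_sq x * v i x - 2 * x $ i * (inv_sq x)\<^sup>2 * (\<Sum>j\<in>UNIV. x $ j * v j x)"
    unfolding partial_radial_unit[OF x] using exhaust_3[of i] by (auto simp: sum_3 algebra_simps)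
  then show ?thesis
    unfolding flow_field_derivative[OF x smooth_radial_unit homogeneous_radial_unit] split_flowD(5)[OF vf x] by simp
qed

end

text \<open>Euler's relation evaluates the derivatives along \<open>x\<close>, and the gradient of \<open>x / |x|\<^sup>2\<close> couples \<open>f\<close>
  to the tangential part \<open>V\<close>.\<close>
lemma flow_field_convection:
  assumes vf: "split_flow v f" and VF: "split_flow V F" and x: "x \<noteq> 0"
  shows "(\<Sum>j\<in>UNIV. flow_field V F j x * partial j (flow_field v f i) x)
    = (\<Sum>j\<in>UNIV. V j x * partial j (v i) x) - inv_sq x * F x * v i x + inv_sq x * f x * V i x
      + (\<Sum>j\<in>UNIV. V j x * partial j f x) * radial_unit i x - inv_sq x * f x * F x * radial_unit i x"
proof -
  have "(\<Sum>j\<in>UNIV. flow_field V F j x * partial j (flow_field v f i) x)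
    = (\<Sum>j\<in>UNIV. flow_field V F j x * partial j (v i) x) + (\<Sum>j\<in>UNIV. flow_field V F j x * partial j f x) * radial_unit i x
      + f x * (\<Sum>j\<in>UNIV. flow_field V F j x * partial j (radial_unit i) x)"
    unfolding partial_flow_field[OF vf x] by (simp add: sum_3 algebra_simps)
  then show ?thesis
    unfolding flow_field_derivative[OF VF x split_flowD(1,2)[OF vf]] flow_field_derivative[OF VF x split_flowD(3,4)[OF vf]]
      flow_field_derivative_radial_unit[OF VF x]
    by (simp add: algebra_simps)
qed

text \<open>The gradient of \<open>V \<bullet> v\<close> absorbs the convection of the curl-free tangential parts by each other,
  and the Laplacian of the field contributes \<open>\<nabla>f / |x|\<^sup>2\<close>. What remains tangentially is the gradient
  of the function \<open>H\<close>, a linearized Bernoulli head.\<close>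
lemma linearized_split_flow:
  assumes vf: "split_flow v f" and VF: "split_flow V F" and q: "smooth_on q (-{0})" and x: "x \<noteq> 0"
    and H: "H = (\<lambda>x. (norm x)\<^sup>2 * ((\<Sum>j\<in>UNIV. V j x * v j x) + q x) - f x)"
  shows "- laplacian (flow_field v f i) x
    + (\<Sum>j\<in>UNIV. flow_field V F j x * partial j (flow_field v f i) x + flow_field v f j x * partial j (flow_field V F i) x)
    + partial i q x
    = inv_sq x * (partial i H x + x $ i * (- laplacian f x + (\<Sum>j\<in>UNIV. V j x * partial j f x + v j x * partial j F x)
        - 2 * inv_sq x * (F x * f x + H x + f x)))"
proof -
  let ?g = "inv_sq x"
  define N where "N x = (\<Sum>j\<in>UNIV. V j x * v j x)" for x
  have sN: "smooth_on N (-{0})" unfolding N_def[abs_def]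
    by (intro smooth_intros open_punctured split_flowD[OF vf] split_flowD[OF VF])
  have sH: "smooth_on H (-{0})" unfolding H
    by (intro smooth_intros open_punctured smooth_norm_punctured split_flowD[OF vf] split_flowD[OF VF] q)
  have dN: "partial i N x = (\<Sum>j\<in>UNIV. V j x * partial j (v i) x) + (\<Sum>j\<in>UNIV. v j x * partial j (V i) x)"
  proof -
    have "partial i N x = (\<Sum>j\<in>UNIV. partial i (\<lambda>x. V j x * v j x) x)"
      unfolding N_def[abs_def] by (rule smooth_partial_sum[OF _ x]) (intro smooth_intros open_punctured split_flowD[OF vf] split_flowD[OF VF])
    then show ?thesis
      by (simp add: smooth_partial_mult split_flowD[OF vf] split_flowD[OF VF] x sum.distrib split_flowD(6)[OF vf x, of i] split_flowD(6)[OF VF x, of i] mult.commute add.commute)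
  qed
  have "partial i q x = partial i (\<lambda>x. inv_sq x * (H x + f x) - N x) x"
    by (rule partial_cong_punctured[OF _ x]) (simp add: H N_def inv_sq_def)
  also have "\<dots> = partial i (\<lambda>x. inv_sq x * (H x + f x)) x - partial i N x"
    by (rule smooth_partial_diff[OF _ sN x]) (intro smooth_intros open_punctured smooth_inverse_norm_sq sH split_flowD[OF vf])
  also have "partial i (\<lambda>x. inv_sq x * (H x + f x)) x = - 2 * x $ i * ?g\<^sup>2 * (H x + f x) + ?g * (partial i H x + partial i f x)"
    by (subst smooth_partial_mult[OF smooth_inverse_norm_sq _ x])
       (intro smooth_intros open_punctured sH split_flowD[OF vf], simp add: smooth_partial_add[OF sH split_flowD(3)[OF vf] x] partial_inverse_norm_sq[OF x])
  finally have dq: "partial i q x = - 2 * x $ i * ?g\<^sup>2 * (H x + f x) + ?g * (partial i H x + partial i f x) - partial i N x" .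
  show ?thesis
    unfolding sum.distrib flow_field_convection[OF vf VF x] flow_field_convection[OF VF vf x] laplacian_flow_field[OF vf x] dq dN
    by (simp add: radial_unit_def algebra_simps power2_eq_square)
qed

definition inv_norm :: "real^3 \<Rightarrow> real" where
  "inv_norm x = 1 / norm x"

lemma smooth_inv_norm: "smooth_on inv_norm (-{0})"
  unfolding inv_norm_def[abs_def] by (intro smooth_intros open_punctured smooth_norm_punctured) auto

lemma homogeneous_inv_norm: "homogeneous (-1) inv_norm"
  unfolding inv_norm_def[abs_def] using homogeneous_divide[OF homogeneous_const[of 1] homogeneous_norm] by simp

lemma partial_inv_norm:
  assumes "x \<noteq> 0" shows "partial i inv_norm x = - x $ i * (inv_norm x * inv_sq x)"
proof -
  have "((\<lambda>r. 1 / r) has_field_derivative (- 1 / (norm x) ^ 2)) (at (norm x))"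
    using assms by (auto intro!: derivative_eq_intros simp: power2_eq_square field_simps)
  from partial_radial[OF this assms] show ?thesis
    using assms by (simp add: inv_norm_def[abs_def] inv_sq_def power2_eq_square field_simps)
qed

lemma laplacian_inv_norm:
  assumes x: "x \<noteq> 0" shows "laplacian inv_norm x = 0"
proof -
  have pp: "partial i (partial i inv_norm) x = - (inv_norm x * inv_sq x) + 3 * (x $ i * x $ i * inv_sq x) * (inv_norm x * inv_sq x)" for i
  proof -
    have "partial i (partial i inv_norm) x = partial i (\<lambda>x. (-1) * (radial_unit i x * inv_norm x)) x"
      by (rule partial_cong_punctured[OF _ x]) (simp add: radial_unit_def partial_inv_norm inv_sq_def)
    also have "\<dots> = (-1) * partial i (\<lambda>x. radial_unit i x * inv_norm x) x"
      by (rule smooth_partial_cmult[OF _ x]) (intro smooth_intros open_punctured smooth_radial_unit smooth_inv_norm)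
    finally show ?thesis
      unfolding smooth_partial_mult[OF smooth_radial_unit smooth_inv_norm x] partial_radial_unit[OF x] partial_inv_norm[OF x]
      by (simp add: radial_unit_def algebra_simps power2_eq_square)
  qed
  have "laplacian inv_norm x = - 3 * (inv_norm x * inv_sq x) + 3 * ((\<Sum>i\<in>UNIV. x $ i * x $ i) * inv_sq x) * (inv_norm x * inv_sq x)"
    unfolding laplacian_def pp by (simp add: sum_3 algebra_simps)
  then show ?thesis unfolding sum_sq_over_norm[OF x] by simp
qed

section \<open>The linearization at a solution of the Liouville equation\<close>

text \<open>On the unit sphere, the equation says that the metric \<open>K \<rho>\<close> times the round one again has
  curvature \<open>1\<close>. The background flow is then \<open>\<nabla> log \<rho> + (2 K \<rho> - 2) x / |x|\<^sup>2\<close>.\<close>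
locale liouville =
  fixes \<rho> :: "real^3 \<Rightarrow> real" and K :: real
  assumes smooth_rho: "smooth_on \<rho> (-{0})" and rho_pos: "x \<noteq> 0 \<Longrightarrow> \<rho> x > 0"
    and hom_rho: "homogeneous 0 \<rho>" and K_pos: "K > 0"
    and liouville: "x \<noteq> 0 \<Longrightarrow> (\<Sum>i\<in>UNIV. partial i (\<lambda>x. partial i \<rho> x / \<rho> x) x) = - (2 * K * \<rho> x - 2) * inv_sq x"
begin

definition V :: "3 \<Rightarrow> real^3 \<Rightarrow> real" where "V i x = partial i \<rho> x / \<rho> x"
definition F :: "real^3 \<Rightarrow> real" where "F x = 2 * K * \<rho> x - 2"
definition u :: "3 \<Rightarrow> real^3 \<Rightarrow> real" where "u = flow_field V F"

lemma rho_nz: "x \<noteq> 0 \<Longrightarrow> \<rho> x \<noteq> 0"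
  using rho_pos by (metis less_irrefl)

lemma smooth_div_rho: "smooth_on f (-{0}) \<Longrightarrow> smooth_on (\<lambda>x. f x / \<rho> x) (-{0})"
  by (intro smooth_intros open_punctured smooth_rho) (auto simp: rho_nz)

lemma hom_div_rho: "homogeneous k f \<Longrightarrow> homogeneous k (\<lambda>x. f x / \<rho> x)"
  using homogeneous_divide[OF _ hom_rho] by fastforce

lemma smooth_V: "smooth_on (V i) (-{0})"
  unfolding V_def[abs_def] by (intro smooth_div_rho smooth_intros smooth_rho)

lemma partial_rho: "x \<noteq> 0 \<Longrightarrow> partial i \<rho> x = \<rho> x * V i x"
  by (simp add: V_def rho_nz)

lemma partial_F: "x \<noteq> 0 \<Longrightarrow> partial i F x = 2 * K * \<rho> x * V i x"
proof -
  assume x: "x \<noteq> 0"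
  have "partial i F x = partial i (\<lambda>x. (2 * K) * \<rho> x) x - partial i (\<lambda>x. 2) x"
    unfolding F_def[abs_def] by (rule smooth_partial_diff[OF _ _ x]) (intro smooth_intros open_punctured smooth_rho)+
  then show ?thesis using partial_rho[OF x, of i] by (simp add: smooth_partial_cmult[OF smooth_rho x])
qed

text \<open>Away from the origin, \<open>V\<close> is the gradient of \<open>log \<rho>\<close>, and the Liouville equation is the relation
  that ties \<open>F\<close> to the divergence of \<open>V\<close>.\<close>
lemma split_background: "split_flow V F"
  unfolding split_flow_def
proof (intro conjI allI impI)
  fix i j
  show "smooth_on (V i) (-{0})" by (rule smooth_V)
  show "homogeneous (-1) (V i)"
    unfolding V_def[abs_def] using hom_div_rho[OF homogeneous_partial[OF smooth_rho hom_rho]] by simp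
  show "smooth_on F (-{0})" unfolding F_def[abs_def] by (intro smooth_intros open_punctured smooth_rho)
  show "homogeneous 0 F" using hom_rho by (simp add: F_def homogeneous_def)
  fix x :: "real^3" assume x: "x \<noteq> 0"
  have "(\<Sum>j\<in>UNIV. x $ j * partial j \<rho> x) / \<rho> x = 0" using homogeneous_euler[OF smooth_rho hom_rho x] by simp
  then show "(\<Sum>j\<in>UNIV. x $ j * V j x) = 0" by (simp add: V_def sum_divide_distrib)
  show "(\<Sum>j\<in>UNIV. partial j (V j) x) = - F x * inv_sq x"
    using liouville[OF x] unfolding V_def[abs_def] F_def by simp
  have pp: "partial i (partial j \<rho>) x = \<rho> x * (V i x * V j x + partial i (V j) x)" for i j
  proof -
    have "partial i (partial j \<rho>) x = partial i (\<lambda>x. \<rho> x * V j x) x"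
      by (rule partial_cong_punctured[OF partial_rho x])
    then show ?thesis by (simp add: smooth_partial_mult[OF smooth_rho smooth_V x] partial_rho[OF x] algebra_simps)
  qed
  have "\<rho> x * (V i x * V j x + partial i (V j) x) = \<rho> x * (V j x * V i x + partial j (V i) x)"
    using smooth_partial_swap[OF smooth_rho x, of i j] unfolding pp .
  then show "partial i (V j) x = partial j (V i) x" using rho_nz[OF x] by simp
qed

lemma laplacian_rho:
  assumes x: "x \<noteq> 0"
  shows "laplacian \<rho> x = \<rho> x * ((\<Sum>j\<in>UNIV. V j x * V j x) - F x * inv_sq x)"
proof -
  have pp: "partial i (partial i \<rho>) x = \<rho> x * (V i x * V i x + partial i (V i) x)" for i
  proof -
    have "partial i (partial i \<rho>) x = partial i (\<lambda>x. \<rho> x * V i x) x"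
      by (rule partial_cong_punctured[OF partial_rho x])
    then show ?thesis by (simp add: smooth_partial_mult[OF smooth_rho smooth_V x] partial_rho[OF x] algebra_simps)
  qed
  have "laplacian \<rho> x = \<rho> x * ((\<Sum>j\<in>UNIV. V j x * V j x) + (\<Sum>j\<in>UNIV. partial j (V j) x))"
    unfolding laplacian_def pp by (simp add: sum_3 algebra_simps)
  then show ?thesis unfolding split_flowD(7)[OF split_background x] by simp
qed

lemma partial_rho_mult:
  assumes a: "smooth_on a (-{0})" and x: "x \<noteq> 0"
  shows "partial j (\<lambda>x. \<rho> x * a x) x = \<rho> x * (V j x * a x + partial j a x)"
  by (simp add: smooth_partial_mult[OF smooth_rho a x] partial_rho[OF x] algebra_simps)

lemma laplacian_rho_mult:
  assumes a: "smooth_on a (-{0})" and x: "x \<noteq> 0"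
  shows "laplacian (\<lambda>x. \<rho> x * a x) x = \<rho> x * (laplacian a x + 2 * (\<Sum>j\<in>UNIV. V j x * partial j a x)
     + a x * ((\<Sum>j\<in>UNIV. V j x * V j x) - F x * inv_sq x))"
  unfolding laplacian_mult[OF smooth_rho a x] laplacian_rho[OF x] partial_rho[OF x]
  by (simp add: sum_3 algebra_simps)

text \<open>The function \<open>\<rho> / |x|\<close> solves the equation of the radial vorticity. Dividing by it leaves a
  weighted harmonic function, so the radial vorticity is a multiple of \<open>\<rho> / |x|\<close>. Being a tangential
  divergence, it vanishes.\<close>
lemma radial_vorticity_vanishes:
  fixes w :: "3 \<Rightarrow> real^3 \<Rightarrow> real"
  assumes w: "\<And>i. smooth_on (w i) (-{0})" "\<And>i. homogeneous (-1) (w i)"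
      "\<And>x. x \<noteq> 0 \<Longrightarrow> (\<Sum>i\<in>UNIV. partial i (w i) x) = 0"
    and q: "smooth_on q (-{0})"
    and eq: "\<And>x i. x \<noteq> 0 \<Longrightarrow> laplacian (w i) x
        = (\<Sum>j\<in>UNIV. u j x * partial j (w i) x + w j x * partial j (u i) x) + partial i q x"
    and x: "x \<noteq> 0"
  shows "radial_curl w x = 0"
proof -
  note B = split_background
  let ?\<omega> = "radial_curl w"
  have s\<omega>: "smooth_on ?\<omega> (-{0})" by (rule smooth_radial_curl[OF w(1)])
  have h2: "homogeneous (-2) (\<lambda>x. partial a (w b) x - partial c (w d) x)" for a b c d
    using homogeneous_diff[OF homogeneous_partial[OF w(1,2)] homogeneous_partial[OF w(1,2)]] by simp
  have h1: "homogeneous (-1) (\<lambda>x. x $ i * (partial a (w b) x - partial c (w d) x))" for i a b c d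
    using homogeneous_mult[OF homogeneous_component h2] by simp
  have h\<omega>: "homogeneous (-1) ?\<omega>"
    unfolding radial_curl_def[abs_def] by (intro homogeneous_add h1)
  \<comment> \<open>\<open>m\<close> is the positive solution \<open>\<rho> / |x|\<close>, and \<open>\<eta>\<close> the quotient of the radial vorticity by it\<close>
  define \<eta> where "\<eta> x = norm x * ?\<omega> x / \<rho> x" for x
  define m where "m x = \<rho> x * inv_norm x" for x
  have s\<eta>: "smooth_on \<eta> (-{0})" unfolding \<eta>_def[abs_def]
    by (intro smooth_div_rho smooth_intros open_punctured s\<omega> smooth_norm_punctured)
  have h\<eta>: "homogeneous 0 \<eta>" unfolding \<eta>_def[abs_def]
    using hom_div_rho[OF homogeneous_mult[OF homogeneous_norm h\<omega>]] by simp
  have sm: "smooth_on m (-{0})" unfolding m_def[abs_def]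
    by (intro smooth_intros open_punctured smooth_rho smooth_inv_norm)
  have hm: "homogeneous (-1) m" unfolding m_def[abs_def]
    using homogeneous_mult[OF hom_rho homogeneous_inv_norm] by simp
  have \<omega>: "?\<omega> x = m x * \<eta> x" if "x \<noteq> 0" for x
    using that rho_nz[OF that] by (simp add: m_def \<eta>_def inv_norm_def)
  have "\<rho> x * laplacian \<eta> x + (\<Sum>j\<in>UNIV. partial j \<rho> x * partial j \<eta> x) = 0 / (norm x)\<^sup>2" if x: "x \<noteq> 0" for x
  proof -
    have tn: "(\<Sum>j\<in>UNIV. c j * partial j inv_norm x) = 0" if "(\<Sum>j\<in>UNIV. x $ j * c j) = 0" for c
    proof -
      have "(\<Sum>j\<in>UNIV. c j * partial j inv_norm x) = - (inv_norm x * inv_sq x) * (\<Sum>j\<in>UNIV. x $ j * c j)"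
        by (simp add: partial_inv_norm[OF x] sum_3 algebra_simps)
      then show ?thesis using that by simp
    qed
    have V0: "(\<Sum>j\<in>UNIV. V j x * partial j inv_norm x) = 0" by (rule tn[OF split_flowD(5)[OF B x]])
    have \<eta>0: "(\<Sum>j\<in>UNIV. partial j \<eta> x * partial j inv_norm x) = 0"
      using tn[of "\<lambda>j. partial j \<eta> x"] homogeneous_euler[OF s\<eta> h\<eta> x] by simp
    have pm: "partial j m x = \<rho> x * (V j x * inv_norm x + partial j inv_norm x)" for j
      unfolding m_def[abs_def] by (rule partial_rho_mult[OF smooth_inv_norm x])
    have Lm: "laplacian m x = m x * ((\<Sum>j\<in>UNIV. V j x * V j x) - F x * inv_sq x)"
      unfolding m_def[abs_def] laplacian_rho_mult[OF smooth_inv_norm x] V0 laplacian_inv_norm[OF x] by simp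
    have "(\<Sum>j\<in>UNIV. V j x * partial j m x) = m x * (\<Sum>j\<in>UNIV. V j x * V j x) + \<rho> x * (\<Sum>j\<in>UNIV. V j x * partial j inv_norm x)"
      unfolding pm m_def by (simp add: sum_3 algebra_simps)
    then have um: "(\<Sum>j\<in>UNIV. u j x * partial j m x) = m x * (\<Sum>j\<in>UNIV. V j x * V j x) - inv_sq x * F x * m x"
      unfolding u_def flow_field_derivative[OF B x sm hm] V0 by simp
    have u\<eta>: "(\<Sum>j\<in>UNIV. u j x * partial j \<eta> x) = (\<Sum>j\<in>UNIV. V j x * partial j \<eta> x)"
      unfolding u_def flow_field_derivative[OF B x s\<eta> h\<eta>] by simp
    have "(\<Sum>j\<in>UNIV. partial j m x * partial j \<eta> x) = m x * (\<Sum>j\<in>UNIV. V j x * partial j \<eta> x) + \<rho> x * (\<Sum>j\<in>UNIV. partial j \<eta> x * partial j inv_norm x)"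
      unfolding pm m_def by (simp add: sum_3 algebra_simps)
    then have m\<eta>: "(\<Sum>j\<in>UNIV. partial j m x * partial j \<eta> x) = m x * (\<Sum>j\<in>UNIV. V j x * partial j \<eta> x)"
      unfolding \<eta>0 by simp
    have L: "laplacian ?\<omega> x = laplacian (\<lambda>x. m x * \<eta> x) x" by (rule laplacian_cong[OF \<omega> x])
    have p\<omega>: "partial j ?\<omega> x = partial j m x * \<eta> x + m x * partial j \<eta> x" for j
      using partial_cong_punctured[OF \<omega> x, where i=j] by (simp add: smooth_partial_mult[OF sm s\<eta> x])
    have "laplacian ?\<omega> x = (\<Sum>j\<in>UNIV. u j x * partial j ?\<omega> x)"
      by (rule radial_vorticity_equation[OF w _ _ _ _ q eq x])
         (auto simp: u_def intro!: smooth_flow_field[OF B] homogeneous_flow_field[OF B] divergence_flow_field[OF B] radial_curl_flow_field[OF B])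
    also have "\<dots> = \<eta> x * (\<Sum>j\<in>UNIV. u j x * partial j m x) + m x * (\<Sum>j\<in>UNIV. u j x * partial j \<eta> x)"
      unfolding p\<omega> by (simp add: sum_3 algebra_simps)
    finally have "m x * (laplacian \<eta> x + (\<Sum>j\<in>UNIV. V j x * partial j \<eta> x)) = 0"
      unfolding L laplacian_mult[OF sm s\<eta> x] Lm um u\<eta> m\<eta> by (simp add: algebra_simps)
    moreover have "m x \<noteq> 0" using x rho_nz[OF x] by (simp add: m_def inv_norm_def)
    ultimately have "laplacian \<eta> x + (\<Sum>j\<in>UNIV. V j x * partial j \<eta> x) = 0" by simp
    then have "\<rho> x * (laplacian \<eta> x + (\<Sum>j\<in>UNIV. V j x * partial j \<eta> x)) = 0" by simp
    then show ?thesis unfolding partial_rho[OF x] by (simp add: sum_3 algebra_simps)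
  qed
  from weighted_harmonic_const(2)[OF s\<eta> h\<eta> smooth_rho rho_pos this]
  obtain C where C: "\<And>x. x \<noteq> 0 \<Longrightarrow> \<eta> x = C" by blast
  \<comment> \<open>\<open>Z\<close> is \<open>s (x \<times> w)\<close>, a tangential field with divergence \<open>- s (x \<bullet> curl w)\<close>; the sign \<open>s\<close> makes the
    divergence nonnegative\<close>
  define Z :: "real \<Rightarrow> 3 \<Rightarrow> real^3 \<Rightarrow> real" where "Z s j x = s * (if j = 1 then x $ 2 * w 3 x - x $ 3 * w 2 x
     else if j = 2 then x $ 3 * w 1 x - x $ 1 * w 3 x else x $ 1 * w 2 x - x $ 2 * w 1 x)" for s j x
  have Zf: "Z s 1 = (\<lambda>x. s * (x $ 2 * w 3 x - x $ 3 * w 2 x))" "Z s 2 = (\<lambda>x. s * (x $ 3 * w 1 x - x $ 1 * w 3 x))"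
    "Z s 3 = (\<lambda>x. s * (x $ 1 * w 2 x - x $ 2 * w 1 x))" for s by (simp_all add: Z_def fun_eq_iff)
  have sZ0: "smooth_on (\<lambda>x. s * (x $ i * w j x - x $ k * w l x)) (-{0})" for s i j k l
    by (intro smooth_intros open_punctured w)
  have sZ: "smooth_on (Z s j) (-{0})" for s j
    using exhaust_3[of j] by (auto simp: Zf intro!: sZ0)
  have pZ: "partial a (\<lambda>x. s * (x $ i * w j x - x $ k * w l x)) x = s * (x $ i * partial a (w j) x - x $ k * partial a (w l) x)"
    if "a \<noteq> i" "a \<noteq> k" "x \<noteq> 0" for s i j k l a x
  proof -
    have s1: "smooth_on (\<lambda>x. x $ i * w j x) (-{0})" for i j by (intro smooth_intros open_punctured w)
    have "partial a (\<lambda>x. s * (x $ i * w j x - x $ k * w l x)) x = s * partial a (\<lambda>x. x $ i * w j x - x $ k * w l x) x"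
      by (rule smooth_partial_cmult[OF _ that(3)]) (intro smooth_intros open_punctured w)
    also have "partial a (\<lambda>x. x $ i * w j x - x $ k * w l x) x = partial a (\<lambda>x. x $ i * w j x) x - partial a (\<lambda>x. x $ k * w l x) x"
      by (rule smooth_partial_diff[OF s1 s1 that(3)])
    finally show ?thesis
      using that by (simp add: smooth_partial_mult[OF smooth_on_component w(1) that(3)] partial_component)
  qed
  have dZ: "(\<Sum>j\<in>UNIV. partial j (Z s j) x) = - s * (C * m x)" if "x \<noteq> 0" for s x
  proof -
    have "(\<Sum>j\<in>UNIV. partial j (Z s j) x) = - s * ?\<omega> x"
      unfolding sum_3 Zf radial_curl_def pZ[OF _ _ that, of 1 2 3 s 3 2, simplified] pZ[OF _ _ that, of 2 3 1 s 1 3, simplified]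
        pZ[OF _ _ that, of 3 1 2 s 2 1, simplified]
      by (simp add: algebra_simps)
    then show ?thesis using \<omega>[OF that] C[OF that] by (simp add: algebra_simps)
  qed
  have tZ: "(\<Sum>j\<in>UNIV. x $ j * Z s j x) = 0" for x s
    unfolding sum_3 Zf by (simp add: algebra_simps)
  have mp: "m x > 0" if "x \<noteq> 0" for x using rho_pos[OF that] that by (simp add: m_def inv_norm_def)
  have "\<exists>s. s \<noteq> 0 \<and> - s * C \<ge> 0" by (rule exI[of _ "if C \<ge> 0 then -1 else 1"]) auto
  then obtain s where s: "s \<noteq> 0" "- s * C \<ge> 0" by blast
  have "(\<Sum>j\<in>UNIV. partial j (Z s j) x) = 0"
  proof (rule tangential_divergence_nonneg[OF sZ tZ _ x])
    fix y :: "real^3" assume y: "y \<noteq> 0"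
    have "0 \<le> (- s * C) * m y" by (rule mult_nonneg_nonneg[OF s(2) less_imp_le[OF mp[OF y]]])
    then show "(\<Sum>j\<in>UNIV. partial j (Z s j) y) \<ge> 0" unfolding dZ[OF y] by (simp add: algebra_simps)
  qed
  then have "C * m x = 0" using dZ[OF x, of s] s(1) by simp
  then show ?thesis using \<omega>[OF x] C[OF x] by (simp add: mult.commute)
qed

text \<open>For a field of degree \<open>-1\<close>, the tangential components of the curl are fixed by \<open>\<nabla>f\<close>, because
  \<open>\<Sum>\<^sub>j x\<^sub>j \<partial>\<^sub>i w\<^sub>j = \<partial>\<^sub>i f - w\<^sub>i\<close>. The field \<open>f x / |x|\<^sup>2\<close> has the same curl.\<close>
lemma split_of_curl_free:
  fixes w :: "3 \<Rightarrow> real^3 \<Rightarrow> real"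
  assumes w: "\<And>i. smooth_on (w i) (-{0})" "\<And>i. homogeneous (-1) (w i)"
      "\<And>x. x \<noteq> 0 \<Longrightarrow> (\<Sum>i\<in>UNIV. partial i (w i) x) = 0" "\<And>x. x \<noteq> 0 \<Longrightarrow> radial_curl w x = 0"
  defines "f \<equiv> \<lambda>x. \<Sum>j\<in>UNIV. x $ j * w j x"
  shows "split_flow (\<lambda>i x. w i x - f x * radial_unit i x) f"
proof -
  have sf: "smooth_on f (-{0})" unfolding f_def by (intro smooth_intros open_punctured w)
  have hf: "homogeneous 0 f" unfolding f_def
    using homogeneous_sum[of UNIV 0 "\<lambda>j x. x $ j * w j x"] homogeneous_mult[OF homogeneous_component w(2)] by simp
  let ?v = "\<lambda>i x. w i x - f x * radial_unit i x"
  have pf: "partial i f x = w i x + (\<Sum>j\<in>UNIV. x $ j * partial i (w j) x)" if x: "x \<noteq> 0" for i x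
  proof -
    have "partial i f x = (\<Sum>j\<in>UNIV. partial i (\<lambda>x. x $ j * w j x) x)" unfolding f_def
      by (rule smooth_partial_sum[OF _ x]) (intro smooth_intros open_punctured w)
    then show ?thesis
      using exhaust_3[of i] by (auto simp: smooth_partial_mult[OF smooth_on_component w(1) x] partial_component sum_3)
  qed
  have pv: "partial i (?v j) x = partial i (w j) x - (partial i f x * radial_unit j x + f x * partial i (radial_unit j) x)" if x: "x \<noteq> 0" for i j x
  proof -
    have "partial i (?v j) x = partial i (w j) x - partial i (\<lambda>x. f x * radial_unit j x) x"
      by (rule smooth_partial_diff[OF w(1) _ x]) (intro smooth_intros open_punctured sf smooth_radial_unit)
    then show ?thesis by (simp add: smooth_partial_mult[OF sf smooth_radial_unit x])
  qed
  show ?thesis unfolding split_flow_def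
  proof (intro conjI allI impI)
    show "smooth_on (?v i) (-{0})" for i by (intro smooth_intros open_punctured sf smooth_radial_unit w)
    show "homogeneous (-1) (?v i)" for i
      using homogeneous_diff[OF w(2) homogeneous_mult[OF hf homogeneous_radial_unit, simplified]] by simp
    fix x :: "real^3" assume x: "x \<noteq> 0"
    have g1: "(x $ 1 * x $ 1 + x $ 2 * x $ 2 + x $ 3 * x $ 3) * inv_sq x = 1" using sum_sq_over_norm[OF x] by (simp add: sum_3)
    have ef: "(\<Sum>j\<in>UNIV. x $ j * partial j f x) = 0" using homogeneous_euler[OF sf hf x] by simp
    have "(\<Sum>j\<in>UNIV. x $ j * ?v j x) = f x - f x * ((\<Sum>j\<in>UNIV. x $ j * x $ j) * inv_sq x)"
      unfolding f_def radial_unit_def by (simp add: sum_3 algebra_simps)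
    then show "(\<Sum>j\<in>UNIV. x $ j * ?v j x) = 0" unfolding sum_sq_over_norm[OF x] by simp
    have "(\<Sum>j\<in>UNIV. partial j (?v j) x) = (\<Sum>j\<in>UNIV. partial j (w j) x) - inv_sq x * (\<Sum>j\<in>UNIV. x $ j * partial j f x)
       - f x * (3 * inv_sq x - 2 * ((\<Sum>j\<in>UNIV. x $ j * x $ j) * inv_sq x) * inv_sq x)"
      unfolding pv[OF x] unfolding partial_radial_unit[OF x] radial_unit_def by (simp add: sum_3 algebra_simps power2_eq_square)
    then show "(\<Sum>j\<in>UNIV. partial j (?v j) x) = - f x * inv_sq x"
      unfolding w(3)[OF x] ef sum_sq_over_norm[OF x] by simp
    have e1: "w i x = - (x $ 1 * partial 1 (w i) x + x $ 2 * partial 2 (w i) x + x $ 3 * partial 3 (w i) x)" for i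
      using homogeneous_euler[OF w(1,2) x, of i] by (simp add: sum_3)
    have rc: "x $ 1 * (partial 2 (w 3) x - partial 3 (w 2) x) + x $ 2 * (partial 3 (w 1) x - partial 1 (w 3) x) + x $ 3 * (partial 1 (w 2) x - partial 2 (w 1) x) = 0"
      using w(4)[OF x] unfolding radial_curl_def .
    \<comment> \<open>the radial vorticity vanishes, so a curl component is recovered from its products with \<open>x\<close>\<close>
    have c: "partial i (?v j) x = partial j (?v i) x" 
      if "(partial i (w j) x - partial j (w i) x) * (x $ 1 * x $ 1 + x $ 2 * x $ 2 + x $ 3 * x $ 3) = x $ j * partial i f x - x $ i * partial j f x" for i j
    proof -
      have "partial i (w j) x - partial j (w i) x = (partial i (w j) x - partial j (w i) x) * (x $ 1 * x $ 1 + x $ 2 * x $ 2 + x $ 3 * x $ 3) * inv_sq x"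
        using g1 by (simp add: mult.assoc)
      also have "\<dots> = (x $ j * partial i f x - x $ i * partial j f x) * inv_sq x" unfolding that ..
      finally have *: "partial i (w j) x = partial j (w i) x + (x $ j * partial i f x - x $ i * partial j f x) * inv_sq x" by simp
      show ?thesis unfolding pv[OF x] unfolding partial_radial_unit[OF x] radial_unit_def * by (simp add: algebra_simps)
    qed
    have c12: "partial 1 (?v 2) x = partial 2 (?v 1) x"
      by (rule c, unfold pf[OF x] sum_3) (use e1[of 1] e1[of 2] rc in algebra)
    have c23: "partial 2 (?v 3) x = partial 3 (?v 2) x"
      by (rule c, unfold pf[OF x] sum_3) (use e1[of 2] e1[of 3] rc in algebra)
    have c31: "partial 3 (?v 1) x = partial 1 (?v 3) x"
      by (rule c, unfold pf[OF x] sum_3) (use e1[of 3] e1[of 1] rc in algebra)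
    show "partial i (?v j) x = partial j (?v i) x" for i j
      using exhaust_3[of i] exhaust_3[of j] c12 c23 c31 by (elim disjE; simp only:)
  qed (use sf hf in auto)
qed

text \<open>The coefficient of \<open>x / |x|\<^sup>2\<close> in the linearized equation, for \<open>f = \<rho> a\<close>.\<close>
lemma radial_equation_rho_mult:
  assumes a: "smooth_on a (-{0})" and x: "x \<noteq> 0"
  shows "- laplacian (\<lambda>x. \<rho> x * a x) x + (\<Sum>j\<in>UNIV. V j x * partial j (\<lambda>x. \<rho> x * a x) x + v j x * partial j F x)
        - 2 * inv_sq x * (F x * (\<rho> x * a x) + h + \<rho> x * a x)
      = - \<rho> x * (laplacian a x + (\<Sum>j\<in>UNIV. V j x * partial j a x))
        + 2 * K * \<rho> x * ((\<Sum>j\<in>UNIV. V j x * v j x) - inv_sq x * (\<rho> x * a x)) - 2 * inv_sq x * h"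
proof -
  have F: "F x = 2 * K * \<rho> x - 2" by (simp add: F_def)
  show ?thesis
    unfolding laplacian_rho_mult[OF a x] partial_rho_mult[OF a x] partial_F[OF x] sum_3 F
    by (simp add: algebra_simps)
qed

text \<open>Here \<open>f / \<rho> - 2 K \<phi>\<close> is weighted harmonic, hence constant, and the constant is absorbed
  into the potential \<open>\<phi>\<close>.\<close>
lemma linearized_solution_potential:
  fixes w :: "3 \<Rightarrow> real^3 \<Rightarrow> real"
  assumes w: "\<And>i. smooth_on (w i) (-{0})" "\<And>i. homogeneous (-1) (w i)"
      "\<And>x. x \<noteq> 0 \<Longrightarrow> (\<Sum>i\<in>UNIV. partial i (w i) x) = 0"
    and q: "smooth_on q (-{0})" "homogeneous (-2) q"
    and eq: "\<And>x i. x \<noteq> 0 \<Longrightarrow> laplacian (w i) x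
        = (\<Sum>j\<in>UNIV. u j x * partial j (w i) x + w j x * partial j (u i) x) + partial i q x"
  obtains \<phi> where "smooth_on \<phi> (-{0})" "homogeneous 0 \<phi>"
    "\<And>x. x \<noteq> 0 \<Longrightarrow> laplacian \<phi> x = - (2 * K * \<rho> x * \<phi> x) * inv_sq x"
    "\<And>x i. x \<noteq> 0 \<Longrightarrow> w i x = partial i \<phi> x + 2 * K * \<rho> x * \<phi> x * radial_unit i x"
    "\<And>x. x \<noteq> 0 \<Longrightarrow> q x = 2 * K * \<rho> x * \<phi> x * inv_sq x - (\<Sum>j\<in>UNIV. V j x * partial j \<phi> x)"
proof -
  define f where "f = (\<lambda>x. \<Sum>j\<in>UNIV. x $ j * w j x)"
  define v where "v = (\<lambda>i x. w i x - f x * radial_unit i x)"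
  have vf: "split_flow v f"
    unfolding v_def f_def by (rule split_of_curl_free[OF w radial_vorticity_vanishes[OF w q(1) eq]])
  have wf: "flow_field v f = w" by (simp add: fun_eq_iff flow_field_def v_def)
  define H where "H = (\<lambda>x. (norm x)\<^sup>2 * ((\<Sum>j\<in>UNIV. V j x * v j x) + q x) - f x)"
  have sN: "smooth_on (\<lambda>x. (\<Sum>j\<in>UNIV. V j x * v j x) + q x) (-{0})"
    by (intro smooth_intros open_punctured smooth_V split_flowD[OF vf] q)
  have sH: "smooth_on H (-{0})" unfolding H_def
    by (intro smooth_intros open_punctured smooth_norm_punctured sN split_flowD[OF vf])
  have hV: "homogeneous (-2) (\<lambda>x. V j x * v j x)" for j
    using homogeneous_mult[OF split_flowD(2)[OF split_background] split_flowD(2)[OF vf]] by simp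
  have hN: "homogeneous (-2) (\<lambda>x. (\<Sum>j\<in>UNIV. V j x * v j x) + q x)"
    by (intro homogeneous_add homogeneous_sum q hV)
  have hH: "homogeneous 0 H"
    unfolding H_def using homogeneous_diff[OF homogeneous_mult[OF homogeneous_power[OF homogeneous_norm, of 2] hN, simplified] split_flowD(4)[OF vf]] by simp
  define Br where "Br x = - laplacian f x + (\<Sum>j\<in>UNIV. V j x * partial j f x + v j x * partial j F x)
        - 2 * inv_sq x * (F x * f x + H x + f x)" for x
  \<comment> \<open>the tangential part \<open>\<nabla>H\<close> and the radial part \<open>Br x\<close> vanish separately\<close>
  have eq0: "partial i H x + x $ i * Br x = 0" if x: "x \<noteq> 0" for i x
  proof -
    have "inv_sq x * (partial i H x + x $ i * Br x) = - laplacian (w i) x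
      + (\<Sum>j\<in>UNIV. u j x * partial j (w i) x + w j x * partial j (u i) x) + partial i q x"
      using linearized_split_flow[OF vf split_background q(1) x H_def, of i] unfolding Br_def wf u_def by simp
    then have "inv_sq x * (partial i H x + x $ i * Br x) = 0" using eq[OF x, of i] by simp
    then show ?thesis using x by (simp add: inv_sq_def)
  qed
  have Br0: "Br x = 0" if x: "x \<noteq> 0" for x
  proof -
    have "(\<Sum>i\<in>UNIV. x $ i * (partial i H x + x $ i * Br x)) = 0" using eq0[OF x] by simp
    then have "(\<Sum>i\<in>UNIV. x $ i * partial i H x) + (\<Sum>i\<in>UNIV. x $ i * x $ i) * Br x = 0"
      by (simp add: sum_3 algebra_simps)
    then have "(\<Sum>i\<in>UNIV. x $ i * x $ i) * Br x = 0" using homogeneous_euler[OF sH hH x] by simp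
    then show ?thesis using sum_sq_over_norm[OF x] by auto
  qed
  have "partial i H x = 0" if "x \<noteq> 0" for i x using eq0[OF that, of i] Br0[OF that] by simp
  then obtain k where k: "\<And>x. x \<noteq> 0 \<Longrightarrow> H x = k" using gradient_zero_const[OF sH] by blast
  obtain \<phi> where s\<phi>: "smooth_on \<phi> (-{0})" and p\<phi>: "\<And>x j. x \<noteq> 0 \<Longrightarrow> partial j \<phi> x = v j x"
    using punctured_potential[OF split_flowD(1,6)[OF vf]] by blast
  have h\<phi>: "homogeneous 0 \<phi>"
    by (rule homogeneous_0I[OF s\<phi>]) (simp add: p\<phi> split_flowD(5)[OF vf])
  have L\<phi>: "laplacian \<phi> x = - f x * inv_sq x" if x: "x \<noteq> 0" for x
  proof -
    have "partial j (partial j \<phi>) x = partial j (v j) x" for j by (rule partial_cong_punctured[OF p\<phi> x])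
    then show ?thesis unfolding laplacian_def using split_flowD(7)[OF vf x] by simp
  qed
  define a where "a x = f x / \<rho> x" for x
  have sa: "smooth_on a (-{0})" unfolding a_def[abs_def] by (rule smooth_div_rho[OF split_flowD(3)[OF vf]])
  have ha: "homogeneous 0 a" unfolding a_def[abs_def] by (rule hom_div_rho[OF split_flowD(4)[OF vf]])
  have fa: "f x = \<rho> x * a x" if "x \<noteq> 0" for x using rho_nz[OF that] by (simp add: a_def)
  define \<mu> where "\<mu> x = a x - (2 * K) * \<phi> x" for x
  have s\<mu>: "smooth_on \<mu> (-{0})" unfolding \<mu>_def[abs_def] by (intro smooth_intros open_punctured sa s\<phi>)
  have h\<mu>: "homogeneous 0 \<mu>" using ha h\<phi> by (simp add: \<mu>_def homogeneous_def)
  \<comment> \<open>the value \<open>k\<close> of \<open>H\<close> is still unknown here; integration over the sphere makes it zero\<close>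
  have eq\<mu>: "\<rho> x * laplacian \<mu> x + (\<Sum>j\<in>UNIV. partial j \<rho> x * partial j \<mu> x) = (- 2 * k) / (norm x)\<^sup>2" if x: "x \<noteq> 0" for x
  proof -
    have sK: "smooth_on (\<lambda>x. (2 * K) * \<phi> x) (-{0})" by (intro smooth_intros open_punctured s\<phi>)
    have L\<mu>: "laplacian \<mu> x = laplacian a x + 2 * K * (\<rho> x * a x * inv_sq x)"
      unfolding \<mu>_def[abs_def] laplacian_diff[OF sa sK x] laplacian_cmult[OF s\<phi> x] L\<phi>[OF x] fa[OF x] by simp
    have p\<mu>: "partial j \<mu> x = partial j a x - 2 * K * v j x" for j
      unfolding \<mu>_def[abs_def] smooth_partial_diff[OF sa sK x] smooth_partial_cmult[OF s\<phi> x] p\<phi>[OF x] by simp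
    have pf: "partial j f x = partial j (\<lambda>x. \<rho> x * a x) x" for j by (rule partial_cong_punctured[OF fa x])
    have Lf: "laplacian f x = laplacian (\<lambda>x. \<rho> x * a x) x" by (rule laplacian_cong[OF fa x])
    have "Br x = - laplacian (\<lambda>x. \<rho> x * a x) x + (\<Sum>j\<in>UNIV. V j x * partial j (\<lambda>x. \<rho> x * a x) x + v j x * partial j F x)
        - 2 * inv_sq x * (F x * (\<rho> x * a x) + k + \<rho> x * a x)"
      unfolding Br_def k[OF x] Lf pf by (simp add: fa[OF x])
    then have "\<rho> x * (laplacian a x + (\<Sum>j\<in>UNIV. V j x * partial j a x))
        = 2 * K * \<rho> x * ((\<Sum>j\<in>UNIV. V j x * v j x) - inv_sq x * (\<rho> x * a x)) - 2 * inv_sq x * k"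
      unfolding radial_equation_rho_mult[OF sa x] Br0[OF x] by simp
    moreover have "\<rho> x * laplacian \<mu> x + (\<Sum>j\<in>UNIV. partial j \<rho> x * partial j \<mu> x)
       = \<rho> x * (laplacian a x + (\<Sum>j\<in>UNIV. V j x * partial j a x)) + 2 * K * \<rho> x * (\<rho> x * a x * inv_sq x - (\<Sum>j\<in>UNIV. V j x * v j x))"
      unfolding L\<mu> p\<mu> partial_rho[OF x] sum_3 by (simp add: algebra_simps)
    ultimately show ?thesis by (simp add: inv_sq_def algebra_simps)
  qed
  have k0: "k = 0" using weighted_harmonic_const(1)[OF s\<mu> h\<mu> smooth_rho rho_pos eq\<mu>] by simp
  obtain C where C: "\<And>x. x \<noteq> 0 \<Longrightarrow> \<mu> x = C" using weighted_harmonic_const(2)[OF s\<mu> h\<mu> smooth_rho rho_pos eq\<mu>] by blast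
  define \<psi> where "\<psi> x = \<phi> x + C / (2 * K)" for x
  have s\<psi>: "smooth_on \<psi> (-{0})" unfolding \<psi>_def[abs_def] by (intro smooth_intros open_punctured s\<phi>)
  have f\<psi>: "f x = 2 * K * \<rho> x * \<psi> x" if "x \<noteq> 0" for x
    using fa[OF that] C[OF that] K_pos by (simp add: \<psi>_def \<mu>_def algebra_simps)
  have p\<psi>: "partial j \<psi> x = v j x" if "x \<noteq> 0" for j x
    unfolding \<psi>_def[abs_def] smooth_partial_add[OF s\<phi> smooth_on_const that] by (simp add: p\<phi>[OF that])
  show thesis
  proof (rule that[OF s\<psi>])
    show "homogeneous 0 \<psi>" using h\<phi> by (simp add: \<psi>_def homogeneous_def)
    fix x :: "real^3" assume x: "x \<noteq> 0"
    have "partial j (partial j \<psi>) x = partial j (v j) x" for j by (rule partial_cong_punctured[OF p\<psi> x])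
    then have "laplacian \<psi> x = - f x * inv_sq x" unfolding laplacian_def using split_flowD(7)[OF vf x] by simp
    then show "laplacian \<psi> x = - (2 * K * \<rho> x * \<psi> x) * inv_sq x" unfolding f\<psi>[OF x] .
    show "w i x = partial i \<psi> x + 2 * K * \<rho> x * \<psi> x * radial_unit i x" for i
      unfolding p\<psi>[OF x] f\<psi>[OF x, symmetric] by (simp add: v_def)
    have "(norm x)\<^sup>2 * ((\<Sum>j\<in>UNIV. V j x * v j x) + q x) = f x" using k[OF x] k0 by (simp add: H_def)
    then show "q x = 2 * K * \<rho> x * \<psi> x * inv_sq x - (\<Sum>j\<in>UNIV. V j x * partial j \<psi> x)"
      unfolding p\<psi>[OF x] f\<psi>[OF x, symmetric] using x by (simp add: inv_sq_def field_simps)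
  qed
qed

text \<open>The pressure is chosen so that \<open>H\<close> vanishes, and then the radial part of the equation holds
  because \<open>f / \<rho>\<close> is \<open>2 K \<phi>\<close>.\<close>
lemma potential_linearized_solution:
  assumes \<phi>: "smooth_on \<phi> (-{0})" "homogeneous 0 \<phi>"
    and L: "\<And>x. x \<noteq> 0 \<Longrightarrow> laplacian \<phi> x = - (2 * K * \<rho> x * \<phi> x) * inv_sq x"
  defines "w \<equiv> \<lambda>i x. partial i \<phi> x + 2 * K * \<rho> x * \<phi> x * radial_unit i x"
    and "q \<equiv> \<lambda>x. 2 * K * \<rho> x * \<phi> x * inv_sq x - (\<Sum>j\<in>UNIV. V j x * partial j \<phi> x)"
  shows "\<And>i. smooth_on (w i) (-{0})" "\<And>i. homogeneous (-1) (w i)"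
      "\<And>x. x \<noteq> 0 \<Longrightarrow> (\<Sum>i\<in>UNIV. partial i (w i) x) = 0"
      "smooth_on q (-{0})" "homogeneous (-2) q"
      "\<And>x i. x \<noteq> 0 \<Longrightarrow> laplacian (w i) x
        = (\<Sum>j\<in>UNIV. u j x * partial j (w i) x + w j x * partial j (u i) x) + partial i q x"
proof -
  define f where "f x = \<rho> x * ((2 * K) * \<phi> x)" for x
  define v where "v i = partial i \<phi>" for i
  have sa: "smooth_on (\<lambda>x. (2 * K) * \<phi> x) (-{0})" by (intro smooth_intros open_punctured \<phi>)
  have sf: "smooth_on f (-{0})" unfolding f_def[abs_def] by (intro smooth_intros open_punctured \<phi> smooth_rho)
  have hf: "homogeneous 0 f" using \<phi>(2) hom_rho by (simp add: f_def homogeneous_def)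
  have vf: "split_flow v f"
    unfolding split_flow_def
  proof (intro conjI allI impI)
    show "smooth_on (v i) (-{0})" for i unfolding v_def by (intro smooth_intros \<phi>)
    show "homogeneous (-1) (v i)" for i unfolding v_def using homogeneous_partial[OF \<phi>] by simp
    fix x :: "real^3" assume x: "x \<noteq> 0"
    show "(\<Sum>j\<in>UNIV. x $ j * v j x) = 0" unfolding v_def using homogeneous_euler[OF \<phi> x] by simp
    show "partial i (v j) x = partial j (v i) x" for i j unfolding v_def by (rule smooth_partial_swap[OF \<phi>(1) x])
    show "(\<Sum>j\<in>UNIV. partial j (v j) x) = - f x * inv_sq x"
      using L[OF x] unfolding v_def f_def laplacian_def by (simp add: algebra_simps)
  qed (use sf hf in auto)
  have wf: "w = flow_field v f" by (simp add: fun_eq_iff w_def flow_field_def v_def f_def)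
  show "smooth_on (w i) (-{0})" "homogeneous (-1) (w i)" for i
    unfolding wf by (rule smooth_flow_field[OF vf], rule homogeneous_flow_field[OF vf])
  show "(\<Sum>i\<in>UNIV. partial i (w i) x) = 0" if "x \<noteq> 0" for x unfolding wf by (rule divergence_flow_field[OF vf that])
  have qf: "q = (\<lambda>x. f x * inv_sq x - (\<Sum>j\<in>UNIV. V j x * v j x))" by (simp add: fun_eq_iff q_def f_def v_def)
  show sq: "smooth_on q (-{0})" unfolding qf
    by (intro smooth_intros open_punctured sf smooth_inverse_norm_sq smooth_V split_flowD[OF vf])
  have hV: "homogeneous (-2) (\<lambda>x. V j x * v j x)" for j
    using homogeneous_mult[OF split_flowD(2)[OF split_background] split_flowD(2)[OF vf]] by simp
  show "homogeneous (-2) q" unfolding qf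
    by (intro homogeneous_diff homogeneous_sum hV) (use homogeneous_mult[OF hf homogeneous_inverse_norm_sq] in simp)
  define H where "H = (\<lambda>x. (norm x)\<^sup>2 * ((\<Sum>j\<in>UNIV. V j x * v j x) + q x) - f x)"
  have H0: "H x = 0" if "x \<noteq> 0" for x using that by (simp add: H_def qf inv_sq_def)
  show "laplacian (w i) x = (\<Sum>j\<in>UNIV. u j x * partial j (w i) x + w j x * partial j (u i) x) + partial i q x" if x: "x \<noteq> 0" for i x
  proof -
    have pH: "partial i H x = 0" using partial_cong_punctured[of H "\<lambda>x. 0", OF H0 x] by simp
    have "- laplacian f x + (\<Sum>j\<in>UNIV. V j x * partial j f x + v j x * partial j F x) - 2 * inv_sq x * (F x * f x + 0 + f x)
      = - \<rho> x * (laplacian (\<lambda>x. (2 * K) * \<phi> x) x + (\<Sum>j\<in>UNIV. V j x * partial j (\<lambda>x. (2 * K) * \<phi> x) x))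
        + 2 * K * \<rho> x * ((\<Sum>j\<in>UNIV. V j x * v j x) - inv_sq x * (\<rho> x * ((2 * K) * \<phi> x))) - 2 * inv_sq x * 0"
      unfolding f_def[abs_def] by (rule radial_equation_rho_mult[OF sa x])
    also have "\<dots> = 0"
      unfolding laplacian_cmult[OF \<phi>(1) x] smooth_partial_cmult[OF \<phi>(1) x] L[OF x] v_def sum_3
      by (simp add: algebra_simps)
    finally show ?thesis
      using linearized_split_flow[OF vf split_background sq x H_def, of i] H0[OF x] pH unfolding wf u_def by simp
  qed
qed

end

section \<open>First spherical harmonics\<close>

lemma inner_3: "(x::real^3) \<bullet> y = x $ 1 * y $ 1 + x $ 2 * y $ 2 + x $ 3 * y $ 3"
  by (simp add: inner_vec_def sum_3)

lemma smooth_inner [smooth_intros]: "open S \<Longrightarrow> smooth_on (\<lambda>x. a \<bullet> x) S"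
  unfolding inner_3 by (intro smooth_intros)

lemma partial_inner: "partial i (\<lambda>x. a \<bullet> x) x = a $ i"
  by (subst partial_has_derivative[where f'="\<lambda>x. a \<bullet> x"]) (auto intro!: derivative_eq_intros simp: inner_axis)

lemma partial_norm': "x \<noteq> 0 \<Longrightarrow> partial i norm x = x $ i * inv_norm x"
  by (simp add: partial_norm inv_norm_def)

lemma inv_norm_sq: "inv_norm x * inv_norm x = inv_sq x"
  by (simp add: inv_norm_def inv_sq_def power2_eq_square)

lemma laplacian_norm:
  assumes x: "x \<noteq> 0" shows "laplacian norm x = 2 * inv_norm x"
proof -
  have pp: "partial i (partial i norm) x = inv_norm x - x $ i * x $ i * inv_sq x * inv_norm x" for i
  proof -
    have "partial i (partial i norm) x = partial i (\<lambda>x. x $ i * inv_norm x) x"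
      by (rule partial_cong_punctured[OF partial_norm' x])
    then show ?thesis
      by (simp add: smooth_partial_mult[OF smooth_on_component smooth_inv_norm x] partial_component partial_inv_norm[OF x])
  qed
  have "laplacian norm x = 3 * inv_norm x - ((\<Sum>i\<in>UNIV. x $ i * x $ i) * inv_sq x) * inv_norm x"
    unfolding laplacian_def pp by (simp add: sum_3 algebra_simps)
  then show ?thesis unfolding sum_sq_over_norm[OF x] by simp
qed

lemma laplacian_norm_mult:
  assumes f: "smooth_on f (-{0})" "homogeneous k f" and x: "x \<noteq> 0"
  shows "laplacian (\<lambda>x. norm x * f x) x = norm x * laplacian f x + 2 * (1 + of_int k) * inv_norm x * f x"
proof -
  have "(\<Sum>j\<in>UNIV. partial j norm x * partial j f x) = inv_norm x * (\<Sum>j\<in>UNIV. x $ j * partial j f x)"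
    by (simp add: partial_norm'[OF x] sum_3 algebra_simps)
  then show ?thesis
    unfolding laplacian_mult[OF smooth_norm_punctured f(1) x] laplacian_norm[OF x] homogeneous_euler[OF f x]
    by (simp add: algebra_simps)
qed

text \<open>Second derivatives of the harmonic function \<open>|x| \<phi>\<close> are harmonic of degree \<open>-1\<close>, hence
  multiples of \<open>1 / |x|\<close>; the symmetry of the third derivatives excludes nonzero multiples.\<close>
lemma sphere_eigenfunction_linear:
  assumes \<phi>: "smooth_on \<phi> (-{0})" "homogeneous 0 \<phi>"
    and L: "\<And>x. x \<noteq> 0 \<Longrightarrow> laplacian \<phi> x = - 2 * inv_sq x * \<phi> x"
  shows "\<exists>l. \<forall>x. x \<noteq> 0 \<longrightarrow> \<phi> x = (l \<bullet> x) * inv_norm x"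
proof -
  define \<psi> where "\<psi> x = norm x * \<phi> x" for x
  have s\<psi>: "smooth_on \<psi> (-{0})" unfolding \<psi>_def[abs_def] by (intro smooth_intros open_punctured smooth_norm_punctured \<phi>)
  have h\<psi>: "homogeneous 1 \<psi>" unfolding \<psi>_def[abs_def] using homogeneous_mult[OF homogeneous_norm \<phi>(2)] by simp
  have L\<psi>: "laplacian \<psi> x = 0" if "x \<noteq> 0" for x
    using that unfolding \<psi>_def[abs_def] laplacian_norm_mult[OF \<phi> that] L[OF that]
    by (simp add: inv_norm_def inv_sq_def power2_eq_square)
  have z: "partial i f x = 0" if "\<And>y. y \<noteq> 0 \<Longrightarrow> f y = 0" "x \<noteq> 0" for i f and x :: "real^3"
    using partial_cong_punctured[of f "\<lambda>x. 0", OF that] by simp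
  have Lp: "laplacian (partial i \<psi>) x = 0" if "x \<noteq> 0" for i x
    using laplacian_partial[OF s\<psi> that] z[OF L\<psi> that] by simp
  have Lpp: "laplacian (partial i (partial j \<psi>)) x = 0" if "x \<noteq> 0" for i j x
    using laplacian_partial[OF smooth_on_partial[OF s\<psi>] that] z[OF Lp that] by simp
  have spp: "smooth_on (partial i (partial j \<psi>)) (-{0})" for i j by (intro smooth_intros s\<psi>)
  have hpp: "homogeneous (-1) (partial i (partial j \<psi>))" for i j
    using homogeneous_partial[OF smooth_on_partial[OF s\<psi>] homogeneous_partial[OF s\<psi> h\<psi>]] by simp
  have "\<exists>c. \<forall>x. x \<noteq> 0 \<longrightarrow> norm x * partial i (partial j \<psi>) x = c" for i j
  proof (rule weighted_harmonic_const(2)[where \<rho>="\<lambda>x. 1" and k=0])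
    show "smooth_on (\<lambda>x. norm x * partial i (partial j \<psi>) x) (-{0})"
      by (intro smooth_intros open_punctured smooth_norm_punctured s\<psi>)
    show "homogeneous 0 (\<lambda>x. norm x * partial i (partial j \<psi>) x)"
      using homogeneous_mult[OF homogeneous_norm hpp] by simp
    show "1 * laplacian (\<lambda>x. norm x * partial i (partial j \<psi>) x) x + (\<Sum>k\<in>UNIV. partial k (\<lambda>x. 1) x * partial k (\<lambda>x. norm x * partial i (partial j \<psi>) x) x)
      = 0 / (norm x)\<^sup>2" if "x \<noteq> 0" for x
      unfolding laplacian_norm_mult[OF spp hpp that] Lpp[OF that] by simp
  qed (auto intro: smooth_intros)
  then obtain c where c: "\<And>i j x. x \<noteq> 0 \<Longrightarrow> norm x * partial i (partial j \<psi>) x = c i j" by metis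
  have c': "partial i (partial j \<psi>) x = c i j * inv_norm x" if "x \<noteq> 0" for i j x
    using c[OF that, of i j] that by (simp add: inv_norm_def field_simps)
  have p3: "partial k (partial i (partial j \<psi>)) x = - c i j * (x $ k * (inv_norm x * inv_sq x))" if "x \<noteq> 0" for i j k x
  proof -
    have "partial k (partial i (partial j \<psi>)) x = partial k (\<lambda>x. c i j * inv_norm x) x"
      by (rule partial_cong_punctured[OF c' that])
    then show ?thesis by (simp add: smooth_partial_cmult[OF smooth_inv_norm that] partial_inv_norm[OF that])
  qed
  \<comment> \<open>on a coordinate axis, one side of the symmetry relation vanishes\<close>
  have c0: "c k j = 0" for k j
  proof -
    obtain i :: 3 where i: "i \<noteq> k" by (metis one_neq_zero)
    let ?x = "axis i 1 :: real^3"
    have x: "?x \<noteq> 0" by simp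
    have "- c i j * (?x $ k * (inv_norm ?x * inv_sq ?x)) = - c k j * (?x $ i * (inv_norm ?x * inv_sq ?x))"
      using smooth_partial_swap[OF smooth_on_partial[OF s\<psi>] x, of k i j] unfolding p3[OF x] .
    then show ?thesis using i by (simp add: axis_def inv_norm_def inv_sq_def norm_axis_1[unfolded axis_def])
  qed
  \<comment> \<open>all second derivatives of \<open>\<psi>\<close> vanish, so \<open>\<psi>\<close> is linear\<close>
  have "\<exists>l. \<forall>x. x \<noteq> 0 \<longrightarrow> partial j \<psi> x = l" for j
    by (rule gradient_zero_const[OF smooth_on_partial[OF s\<psi>]]) (simp add: c' c0)
  then obtain l where l: "\<And>j x. x \<noteq> 0 \<Longrightarrow> partial j \<psi> x = l j" by metis
  have "\<phi> x = ((\<chi> j. l j) \<bullet> x) * inv_norm x" if x: "x \<noteq> 0" for x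
  proof -
    have "norm x * \<phi> x = (\<Sum>j\<in>UNIV. x $ j * partial j \<psi> x)"
      using homogeneous_euler[OF s\<psi> h\<psi> x] by (simp add: \<psi>_def)
    also have "\<dots> = (\<chi> j. l j) \<bullet> x" by (simp add: l[OF x] inner_3 sum_3 mult.commute)
    finally show ?thesis using x by (simp add: inv_norm_def field_simps)
  qed
  then show ?thesis by blast
qed

section \<open>Landau solutions parametrized by the unit ball\<close>

text \<open>The point \<open>\<sigma>\<close> has the direction of the force and the length \<open>1 / a\<close>; the zero flow has \<open>\<sigma> = 0\<close>.\<close>
locale landau_ball =
  fixes \<sigma> :: "real^3"
  assumes norm_lt_1: "norm \<sigma> < 1"
begin

definition K :: real where "K = 1 - \<sigma> \<bullet> \<sigma>"
definition D :: "real^3 \<Rightarrow> real" where "D x = norm x - \<sigma> \<bullet> x"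
definition iD :: "real^3 \<Rightarrow> real" where "iD x = 1 / D x"
definition \<rho> :: "real^3 \<Rightarrow> real" where "\<rho> x = (norm x)\<^sup>2 * (iD x)\<^sup>2"
text \<open>The gradient of \<open>D\<close>.\<close>
definition n :: "3 \<Rightarrow> real^3 \<Rightarrow> real" where "n i x = x $ i * inv_norm x - \<sigma> $ i"

lemma K_pos: "K > 0"
  using norm_lt_1 unfolding K_def power2_norm_eq_inner[symmetric] by (simp add: abs_square_less_1)

lemma abs_inner_less:
  assumes "x \<noteq> 0" shows "\<bar>\<sigma> \<bullet> x\<bar> < norm x"
proof -
  have "norm \<sigma> * norm x < 1 * norm x" by (rule mult_strict_right_mono[OF norm_lt_1]) (use assms in simp)
  then show ?thesis using Cauchy_Schwarz_ineq2[of \<sigma> x] by linarith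
qed

lemma D_pos: "x \<noteq> 0 \<Longrightarrow> D x > 0"
  using abs_inner_less[of x] by (simp add: D_def)

lemma D_iD: "x \<noteq> 0 \<Longrightarrow> D x * iD x = 1"
  using D_pos[of x] by (simp add: iD_def)

lemma iD_pos: "x \<noteq> 0 \<Longrightarrow> iD x > 0"
  using D_pos[of x] by (simp add: iD_def)

lemma norm_inv_norm: "x \<noteq> 0 \<Longrightarrow> norm x * inv_norm x = 1"
  by (simp add: inv_norm_def)

lemma inner_eq_D: "\<sigma> \<bullet> x = norm x - D x"
  by (simp add: D_def)

lemma smooth_D: "smooth_on D (-{0})"
  unfolding D_def[abs_def] by (intro smooth_intros open_punctured smooth_norm_punctured)

lemma smooth_iD: "smooth_on iD (-{0})"
  unfolding iD_def[abs_def] using D_pos by (intro smooth_intros open_punctured smooth_D) force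

lemma homogeneous_D: "homogeneous 1 D"
  by (simp add: homogeneous_def D_def algebra_simps)

lemma homogeneous_iD: "homogeneous (-1) iD"
  unfolding iD_def[abs_def] using homogeneous_divide[OF homogeneous_const[of 1] homogeneous_D] by simp

lemma partial_D: "x \<noteq> 0 \<Longrightarrow> partial i D x = n i x"
  unfolding D_def[abs_def] n_def
  by (subst smooth_partial_diff[OF smooth_norm_punctured smooth_inner]) (auto simp: partial_inner partial_norm')

lemma partial_iD: 
  assumes x: "x \<noteq> 0" shows "partial i iD x = - n i x * (iD x)\<^sup>2"
proof -
  have "partial i iD x = - (iD x * iD x * partial i D x)"
    unfolding iD_def[abs_def] using partial_inverse[OF smooth_differentiable[OF smooth_D x], of i] D_pos[OF x]
    by (simp add: inverse_eq_divide)
  then show ?thesis by (simp add: partial_D[OF x] power2_eq_square)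
qed

lemma smooth_n: "smooth_on (n i) (-{0})"
  unfolding n_def[abs_def] by (intro smooth_intros open_punctured smooth_inv_norm)

lemma partial_n: 
  assumes x: "x \<noteq> 0" 
  shows "partial i (n j) x = (if i = j then inv_norm x else 0) - x $ i * x $ j * inv_sq x * inv_norm x"
proof -
  have "partial i (n j) x = partial i (\<lambda>x. x $ j * inv_norm x) x - partial i (\<lambda>x. \<sigma> $ j) x"
    unfolding n_def[abs_def] by (rule smooth_partial_diff[OF _ _ x]) (intro smooth_intros open_punctured smooth_inv_norm)+
  then show ?thesis
    by (simp add: smooth_partial_mult[OF smooth_on_component smooth_inv_norm x] partial_component partial_inv_norm[OF x])
qed

lemma div_n: assumes x: "x \<noteq> 0" shows "(\<Sum>j\<in>UNIV. partial j (n j) x) = 2 * inv_norm x"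
proof -
  have "(\<Sum>j\<in>UNIV. partial j (n j) x) = 3 * inv_norm x - ((\<Sum>i\<in>UNIV. x $ i * x $ i) * inv_sq x) * inv_norm x"
    unfolding partial_n[OF x] by (simp add: sum_3 algebra_simps)
  then show ?thesis unfolding sum_sq_over_norm[OF x] by simp
qed

text \<open>This is what makes \<open>log \<rho>\<close> a solution of the Liouville equation.\<close>
lemma sum_n_sq: assumes x: "x \<noteq> 0" shows "(\<Sum>j\<in>UNIV. n j x * n j x) = 2 * inv_norm x * D x - K"
proof -
  have "(\<Sum>j\<in>UNIV. n j x * n j x) = (\<Sum>i\<in>UNIV. x $ i * x $ i) * (inv_norm x * inv_norm x) - 2 * inv_norm x * (\<sigma> \<bullet> x) + \<sigma> \<bullet> \<sigma>"
    by (simp add: n_def sum_3 inner_3 algebra_simps)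
  also have "\<dots> = 1 - 2 * (norm x * inv_norm x) + 2 * inv_norm x * D x + \<sigma> \<bullet> \<sigma>"
    unfolding inv_norm_sq sum_sq_over_norm[OF x] by (simp add: inner_eq_D[of x] algebra_simps)
  finally show ?thesis unfolding norm_inv_norm[OF x] by (simp add: K_def)
qed

lemma laplacian_iD:
  assumes x: "x \<noteq> 0" shows "laplacian iD x = 2 * inv_norm x * (iD x)\<^sup>2 - 2 * K * (iD x)^3"
proof -
  have pp: "partial i (partial i iD) x = - partial i (n i) x * (iD x)\<^sup>2 + 2 * (n i x * n i x) * (iD x)^3" for i
  proof -
    have "partial i (partial i iD) x = partial i (\<lambda>x. (-1) * (n i x * (iD x * iD x))) x"
      by (rule partial_cong_punctured[OF _ x]) (simp add: partial_iD power2_eq_square)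
    also have "\<dots> = (-1) * partial i (\<lambda>x. n i x * (iD x * iD x)) x"
      by (rule smooth_partial_cmult[OF _ x]) (intro smooth_intros open_punctured smooth_n smooth_iD)
    also have "partial i (\<lambda>x. n i x * (iD x * iD x)) x = partial i (n i) x * (iD x * iD x) + n i x * (2 * iD x * partial i iD x)"
      by (subst smooth_partial_mult[OF smooth_n _ x], intro smooth_intros open_punctured smooth_iD,
          subst smooth_partial_mult[OF smooth_iD smooth_iD x]) simp
    finally show ?thesis by (simp add: partial_iD[OF x] power2_eq_square power3_eq_cube algebra_simps)
  qed
  have "laplacian iD x = - (\<Sum>j\<in>UNIV. partial j (n j) x) * (iD x)\<^sup>2 + 2 * (\<Sum>j\<in>UNIV. n j x * n j x) * (iD x)^3"
    unfolding laplacian_def pp by (simp add: sum_3 algebra_simps)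
  also have "\<dots> = - 2 * inv_norm x * (iD x)\<^sup>2 + 4 * inv_norm x * (D x * iD x) * (iD x)\<^sup>2 - 2 * K * (iD x)^3"
    unfolding div_n[OF x] sum_n_sq[OF x] by (simp add: power2_eq_square power3_eq_cube algebra_simps)
  finally show ?thesis unfolding D_iD[OF x] by simp
qed

lemma rho_inv_sq: "x \<noteq> 0 \<Longrightarrow> \<rho> x * inv_sq x = (iD x)\<^sup>2"
  by (simp add: \<rho>_def inv_sq_def)

lemma smooth_rho': "smooth_on \<rho> (-{0})"
  unfolding \<rho>_def[abs_def] by (intro smooth_intros open_punctured smooth_norm_punctured smooth_iD)

lemma log_derivative_rho:
  assumes x: "x \<noteq> 0"
  shows "partial i \<rho> x / \<rho> x = 2 * radial_unit i x - 2 * (n i x * iD x)"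
proof -
  have "partial i \<rho> x = 2 * norm x * (x $ i * inv_norm x) * (iD x)\<^sup>2 + (norm x)\<^sup>2 * (2 * iD x * (- n i x * (iD x)\<^sup>2))"
  proof -
    have "partial i \<rho> x = partial i (\<lambda>x. (norm x * norm x) * (iD x * iD x)) x"
      unfolding \<rho>_def[abs_def] by (simp add: power2_eq_square)
    also have "\<dots> = partial i (\<lambda>x. norm x * norm x) x * (iD x * iD x) + (norm x * norm x) * partial i (\<lambda>x. iD x * iD x) x"
      by (rule smooth_partial_mult[OF _ _ x]) (intro smooth_intros open_punctured smooth_norm_punctured smooth_iD)+
    finally show ?thesis
      unfolding smooth_partial_mult[OF smooth_norm_punctured smooth_norm_punctured x] smooth_partial_mult[OF smooth_iD smooth_iD x]
        partial_norm'[OF x] partial_iD[OF x] by (simp add: power2_eq_square algebra_simps)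
  qed
  moreover have "iD x \<noteq> 0" using iD_pos[OF x] by simp
  ultimately show ?thesis using x
    by (simp add: \<rho>_def radial_unit_def inv_norm_def inv_sq_def field_simps power2_eq_square)
qed

sublocale liouville \<rho> K
proof
  show "smooth_on \<rho> (-{0})" by (rule smooth_rho')
  show "\<rho> x > 0" if "x \<noteq> 0" for x using iD_pos[OF that] that by (simp add: \<rho>_def)
  have "homogeneous (1 * int 2 + (-1) * int 2) \<rho>"
    unfolding \<rho>_def[abs_def] by (intro homogeneous_mult homogeneous_power homogeneous_norm homogeneous_iD)
  then show "homogeneous 0 \<rho>" by simp
  show "K > 0" by (rule K_pos)
  fix x :: "real^3" assume x: "x \<noteq> 0"
  have pp: "partial i (\<lambda>x. partial i \<rho> x / \<rho> x) x = 2 * partial i (radial_unit i) x - 2 * (partial i (n i) x * iD x - n i x * n i x * (iD x)\<^sup>2)" for i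
  proof -
    have "partial i (\<lambda>x. partial i \<rho> x / \<rho> x) x = partial i (\<lambda>x. 2 * radial_unit i x - 2 * (n i x * iD x)) x"
      by (rule partial_cong_punctured[OF log_derivative_rho x])
    also have "\<dots> = partial i (\<lambda>x. 2 * radial_unit i x) x - partial i (\<lambda>x. 2 * (n i x * iD x)) x"
      by (rule smooth_partial_diff[OF _ _ x]) (intro smooth_intros open_punctured smooth_radial_unit smooth_n smooth_iD)+
    also have "partial i (\<lambda>x. 2 * radial_unit i x) x = 2 * partial i (radial_unit i) x"
      by (rule smooth_partial_cmult[OF smooth_radial_unit x])
    also have "partial i (\<lambda>x. 2 * (n i x * iD x)) x = 2 * partial i (\<lambda>x. n i x * iD x) x"
      by (rule smooth_partial_cmult[OF _ x]) (intro smooth_intros open_punctured smooth_n smooth_iD)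
    finally show ?thesis
      unfolding smooth_partial_mult[OF smooth_n smooth_iD x] partial_iD[OF x] by (simp add: algebra_simps power2_eq_square)
  qed
  have "(\<Sum>i\<in>UNIV. partial i (\<lambda>x. partial i \<rho> x / \<rho> x) x)
    = 2 * (3 * inv_sq x - 2 * ((\<Sum>i\<in>UNIV. x $ i * x $ i) * inv_sq x) * inv_sq x)
      - 2 * ((\<Sum>j\<in>UNIV. partial j (n j) x) * iD x - (\<Sum>j\<in>UNIV. n j x * n j x) * (iD x)\<^sup>2)"
    unfolding sum_3 pp partial_radial_unit[OF x] by (simp add: algebra_simps power2_eq_square)
  also have "\<dots> = 2 * inv_sq x - 4 * inv_norm x * iD x + 4 * inv_norm x * (D x * iD x) * iD x - 2 * K * (iD x)\<^sup>2"
    unfolding sum_sq_over_norm[OF x] div_n[OF x] sum_n_sq[OF x] by (simp add: algebra_simps power2_eq_square)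
  also have "\<dots> = - (2 * K * \<rho> x - 2) * inv_sq x"
    unfolding D_iD[OF x] using rho_inv_sq[OF x] by (simp add: algebra_simps)
  finally show "(\<Sum>i\<in>UNIV. partial i (\<lambda>x. partial i \<rho> x / \<rho> x) x) = - (2 * K * \<rho> x - 2) * inv_sq x" .
qed

lemma V_eq: "x \<noteq> 0 \<Longrightarrow> V i x = 2 * radial_unit i x - 2 * (n i x * iD x)"
  by (simp add: V_def log_derivative_rho)

lemma u_eq:
  assumes x: "x \<noteq> 0" shows "u i x = 2 * K * (iD x)\<^sup>2 * x $ i - 2 * (n i x * iD x)"
proof -
  have "u i x = 2 * radial_unit i x - 2 * (n i x * iD x) + 2 * K * (\<rho> x * inv_sq x) * x $ i - 2 * radial_unit i x"
    by (simp add: u_def flow_field_def V_eq[OF x] F_def radial_unit_def algebra_simps)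
  then show ?thesis unfolding rho_inv_sq[OF x] by simp
qed

text \<open>Up to a constant, this is the derivative of \<open>log \<rho>\<close> in the direction \<open>d\<close> of the parameter.
  Differentiating the Liouville equation, in which \<open>K\<close> also depends on \<open>\<sigma>\<close>, shows that the right
  constant is the derivative of \<open>log K\<close>.\<close>
definition mode :: "real^3 \<Rightarrow> real^3 \<Rightarrow> real" where
  "mode d x = 2 * (d \<bullet> x) * iD x - 2 * (d \<bullet> \<sigma>) / K"

lemma smooth_mode: "smooth_on (mode d) (-{0})"
  unfolding mode_def[abs_def] divide_inverse by (intro smooth_intros open_punctured smooth_iD)

lemma homogeneous_mode: "homogeneous 0 (mode d)"
proof -
  have "homogeneous (0 + 1 + -1) (\<lambda>x. 2 * (d \<bullet> x) * iD x)"
    by (intro homogeneous_mult homogeneous_iD homogeneous_const) (simp add: homogeneous_def)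
  then show ?thesis by (simp add: mode_def homogeneous_def)
qed

lemma partial_mode:
  assumes x: "x \<noteq> 0" shows "partial i (mode d) x = 2 * d $ i * iD x - 2 * (d \<bullet> x) * n i x * (iD x)\<^sup>2"
proof -
  have "partial i (mode d) x = partial i (\<lambda>x. 2 * ((d \<bullet> x) * iD x)) x - partial i (\<lambda>x. 2 * (d \<bullet> \<sigma>) / K) x"
    unfolding mode_def[abs_def] mult.assoc[of 2] by (rule smooth_partial_diff[OF _ _ x]) (intro smooth_intros open_punctured smooth_iD)+
  also have "partial i (\<lambda>x. 2 * ((d \<bullet> x) * iD x)) x = 2 * partial i (\<lambda>x. (d \<bullet> x) * iD x) x"
    by (rule smooth_partial_cmult[OF _ x]) (intro smooth_intros open_punctured smooth_iD)
  finally show ?thesis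
    by (simp add: smooth_partial_mult[OF smooth_inner[OF open_punctured] smooth_iD x] partial_inner partial_iD[OF x] algebra_simps)
qed

lemma laplacian_inner: "laplacian (\<lambda>x. d \<bullet> x) x = 0"
  by (simp add: laplacian_def partial_inner[abs_def] partial_inner)

lemma laplacian_mode:
  assumes x: "x \<noteq> 0" shows "laplacian (mode d) x = - (2 * K * \<rho> x * mode d x) * inv_sq x"
proof -
  have c: "laplacian (\<lambda>x. c) x = 0" for c :: real by (simp add: laplacian_def partial_const[abs_def])
  have "laplacian (mode d) x = laplacian (\<lambda>x. 2 * ((d \<bullet> x) * iD x)) x - laplacian (\<lambda>x. 2 * (d \<bullet> \<sigma>) / K) x"
    unfolding mode_def[abs_def] mult.assoc[of 2] by (rule laplacian_diff[OF _ _ x]) (intro smooth_intros open_punctured smooth_iD)+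
  also have "laplacian (\<lambda>x. 2 * ((d \<bullet> x) * iD x)) x = 2 * laplacian (\<lambda>x. (d \<bullet> x) * iD x) x"
    by (rule laplacian_cmult[OF _ x]) (intro smooth_intros open_punctured smooth_iD)
  also have "laplacian (\<lambda>x. (d \<bullet> x) * iD x) x = 2 * (\<Sum>j\<in>UNIV. d $ j * partial j iD x) + (d \<bullet> x) * laplacian iD x"
    unfolding laplacian_mult[OF smooth_inner[OF open_punctured] smooth_iD x] laplacian_inner partial_inner by simp
  also have "(\<Sum>j\<in>UNIV. d $ j * partial j iD x) = - ((d \<bullet> x) * inv_norm x - d \<bullet> \<sigma>) * (iD x)\<^sup>2"
    unfolding partial_iD[OF x] n_def by (simp add: sum_3 inner_3 algebra_simps)
  finally have "laplacian (mode d) x = 4 * (d \<bullet> \<sigma>) * (iD x)\<^sup>2 - 4 * K * (d \<bullet> x) * (iD x)^3"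
    unfolding laplacian_iD[OF x] c by (simp add: algebra_simps)
  also have "\<dots> = - (2 * K * mode d x) * (\<rho> x * inv_sq x)"
    unfolding rho_inv_sq[OF x] mode_def using K_pos by (simp add: field_simps power2_eq_square power3_eq_cube)
  finally show ?thesis by simp
qed

end

text \<open>For a null vector \<open>(|y|, y)\<close>, \<open>boost y\<close> is the spatial part of its image under the Lorentz boost
  with velocity \<open>\<sigma>\<close>, and \<open>\<gamma>\<close> is the Lorentz factor. On directions, the boost is a conformal map that
  pulls \<open>K \<rho>\<close> times the round metric back to the round metric. The identity below computes the
  products of the derivatives of the boost, with \<open>m\<close> for the direction of \<open>y\<close>.\<close>

lemma boost_gram_identity:
  fixes g al m1 m2 m3 a1 a2 a3 :: real
  assumes "al * (1 + g) = g * g" "al * (a1 * a1 + a2 * a2 + a3 * a3) = g - 1" "m1 * m1 + m2 * m2 + m3 * m3 = 1"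
  shows "(d1k + al * a1 * ak + g * ak * m1) * (d1l + al * a1 * al' + g * al' * m1)
    + (d2k + al * a2 * ak + g * ak * m2) * (d2l + al * a2 * al' + g * al' * m2)
    + (d3k + al * a3 * ak + g * ak * m3) * (d3l + al * a3 * al' + g * al' * m3)
    = d1k * d1l + d2k * d2l + d3k * d3l
     + al * ak * (a1 * d1l + a2 * d2l + a3 * d3l) + al * al' * (a1 * d1k + a2 * d2k + a3 * d3k)
     + g * ak * (m1 * d1l + m2 * d2l + m3 * d3l) + g * al' * (m1 * d1k + m2 * d2k + m3 * d3k)
     + ak * al' * (2 * g * g - 2 * al + 2 * al * g * (a1 * m1 + a2 * m2 + a3 * m3))"
proof -
  let ?s = "a1 * a1 + a2 * a2 + a3 * a3" and ?m = "m1 * m1 + m2 * m2 + m3 * m3"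
  have "(d1k + al * a1 * ak + g * ak * m1) * (d1l + al * a1 * al' + g * al' * m1)
    + (d2k + al * a2 * ak + g * ak * m2) * (d2l + al * a2 * al' + g * al' * m2)
    + (d3k + al * a3 * ak + g * ak * m3) * (d3l + al * a3 * al' + g * al' * m3)
    = d1k * d1l + d2k * d2l + d3k * d3l
     + al * ak * (a1 * d1l + a2 * d2l + a3 * d3l) + al * al' * (a1 * d1k + a2 * d2k + a3 * d3k)
     + g * ak * (m1 * d1l + m2 * d2l + m3 * d3l) + g * al' * (m1 * d1k + m2 * d2k + m3 * d3k)
     + ak * al' * (al * (al * ?s) + g * g * ?m + 2 * al * g * (a1 * m1 + a2 * m2 + a3 * m3))"
    by (simp add: algebra_simps)
  moreover have "al * (al * ?s) + g * g * ?m = 2 * g * g - 2 * al"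
    unfolding assms(2,3) using assms(1) by (simp add: algebra_simps)
  ultimately show ?thesis by simp
qed

context landau_ball
begin

definition \<gamma> :: real where "\<gamma> = 1 / sqrt K"
definition \<alpha> :: real where "\<alpha> = \<gamma> * \<gamma> / (1 + \<gamma>)"
definition boost :: "real^3 \<Rightarrow> real^3" where "boost y = y + (\<alpha> * (\<sigma> \<bullet> y) + \<gamma> * norm y) *\<^sub>R \<sigma>"
definition unboost :: "real^3 \<Rightarrow> real^3" where "unboost x = x + (\<alpha> * (\<sigma> \<bullet> x) - \<gamma> * norm x) *\<^sub>R \<sigma>"

lemma \<gamma>_pos: "\<gamma> > 0" using K_pos by (simp add: \<gamma>_def)

lemma \<gamma>_sq: "\<gamma> * \<gamma> * K = 1"
  using K_pos by (simp add: \<gamma>_def)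

lemma \<alpha>_eq: "\<alpha> * (1 + \<gamma>) = \<gamma> * \<gamma>"
  using \<gamma>_pos by (simp add: \<alpha>_def)

lemma \<gamma>_sigma: "\<gamma> * \<gamma> * (\<sigma> \<bullet> \<sigma>) = \<gamma> * \<gamma> - 1"
proof -
  have "\<gamma> * \<gamma> * K = \<gamma> * \<gamma> - \<gamma> * \<gamma> * (\<sigma> \<bullet> \<sigma>)" by (simp add: K_def right_diff_distrib)
  then show ?thesis using \<gamma>_sq by linarith
qed

lemma \<alpha>_sigma: "\<alpha> * (\<sigma> \<bullet> \<sigma>) = \<gamma> - 1"
proof -
  have "(1 + \<gamma>) * (\<alpha> * (\<sigma> \<bullet> \<sigma>)) = (\<alpha> * (1 + \<gamma>)) * (\<sigma> \<bullet> \<sigma>)" by simp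
  also have "\<dots> = (1 + \<gamma>) * (\<gamma> - 1)" unfolding \<alpha>_eq \<gamma>_sigma by (simp add: algebra_simps)
  finally show ?thesis using \<gamma>_pos by simp
qed

lemma inner_boost: "\<sigma> \<bullet> boost y = \<gamma> * (\<sigma> \<bullet> y) + \<gamma> * (\<sigma> \<bullet> \<sigma>) * norm y"
proof -
  have "\<sigma> \<bullet> boost y = \<sigma> \<bullet> y + (\<alpha> * (\<sigma> \<bullet> \<sigma>)) * (\<sigma> \<bullet> y) + \<gamma> * (\<sigma> \<bullet> \<sigma>) * norm y"
    by (simp add: boost_def inner_add_right algebra_simps)
  then show ?thesis unfolding \<alpha>_sigma by (simp add: algebra_simps)
qed

lemma norm_boost: "norm (boost y) = \<gamma> * (norm y + \<sigma> \<bullet> y)"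
proof -
  let ?c = "\<alpha> * (\<sigma> \<bullet> y) + \<gamma> * norm y"
  have "boost y \<bullet> boost y = y \<bullet> y + 2 * ?c * (\<sigma> \<bullet> y) + ?c * ?c * (\<sigma> \<bullet> \<sigma>)"
    by (simp add: boost_def inner_add_left inner_add_right inner_commute[of y \<sigma>] algebra_simps)
  also have "?c * ?c * (\<sigma> \<bullet> \<sigma>) = (\<sigma> \<bullet> y) * (\<sigma> \<bullet> y) * \<alpha> * (\<alpha> * (\<sigma> \<bullet> \<sigma>)) + 2 * \<gamma> * norm y * (\<sigma> \<bullet> y) * (\<alpha> * (\<sigma> \<bullet> \<sigma>)) + norm y * norm y * (\<gamma> * \<gamma> * (\<sigma> \<bullet> \<sigma>))"
    by (simp add: algebra_simps)
  also have "y \<bullet> y = norm y * norm y" by (simp add: dot_square_norm power2_eq_square)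
  also have "norm y * norm y + 2 * ?c * (\<sigma> \<bullet> y) + ((\<sigma> \<bullet> y) * (\<sigma> \<bullet> y) * \<alpha> * (\<alpha> * (\<sigma> \<bullet> \<sigma>)) + 2 * \<gamma> * norm y * (\<sigma> \<bullet> y) * (\<alpha> * (\<sigma> \<bullet> \<sigma>)) + norm y * norm y * (\<gamma> * \<gamma> * (\<sigma> \<bullet> \<sigma>)))
     = \<gamma> * \<gamma> * (norm y * norm y) + (\<sigma> \<bullet> y) * (\<sigma> \<bullet> y) * (\<alpha> * (1 + \<gamma>)) + 2 * \<gamma> * \<gamma> * norm y * (\<sigma> \<bullet> y)"
    unfolding \<alpha>_sigma \<gamma>_sigma by (simp add: algebra_simps)
  also have "\<dots> = (\<gamma> * (norm y + \<sigma> \<bullet> y))\<^sup>2" unfolding \<alpha>_eq by (simp add: algebra_simps power2_eq_square)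
  finally have "(norm (boost y))\<^sup>2 = (\<gamma> * (norm y + \<sigma> \<bullet> y))\<^sup>2" by (simp add: dot_square_norm)
  moreover have "norm y + \<sigma> \<bullet> y \<ge> 0" using abs_inner_less[of y] by (cases "y = 0") auto
  ultimately show ?thesis using \<gamma>_pos by (simp add: power2_eq_iff_nonneg)
qed

lemma boost_nonzero: "y \<noteq> 0 \<Longrightarrow> boost y \<noteq> 0"
  using norm_boost[of y] abs_inner_less[of y] \<gamma>_pos by (auto simp: abs_less_iff)

lemma D_boost: "D (boost y) * \<gamma> = norm y"
proof -
  have "D (boost y) * \<gamma> = \<gamma> * \<gamma> * K * norm y" by (simp add: D_def norm_boost inner_boost K_def algebra_simps)
  then show ?thesis unfolding \<gamma>_sq by simp
qed

lemma norm_unboost: "norm (unboost x) = \<gamma> * D x"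
proof -
  interpret neg: landau_ball "- \<sigma>" using norm_lt_1 by unfold_locales simp
  have K: "neg.K = K" by (simp add: neg.K_def K_def)
  have g: "neg.\<gamma> = \<gamma>" by (simp add: neg.\<gamma>_def \<gamma>_def K)
  have a: "neg.\<alpha> = \<alpha>" by (simp add: neg.\<alpha>_def \<alpha>_def g)
  have "neg.boost x = unboost x" by (simp add: neg.boost_def unboost_def a g algebra_simps)
  then show ?thesis using neg.norm_boost[of x] by (simp add: g D_def)
qed

lemma boost_unboost: "boost (unboost x) = x"
proof -
  have "\<sigma> \<bullet> unboost x = \<sigma> \<bullet> x + (\<alpha> * (\<sigma> \<bullet> \<sigma>)) * (\<sigma> \<bullet> x) - \<gamma> * (\<sigma> \<bullet> \<sigma>) * norm x"
    by (simp add: unboost_def inner_add_right algebra_simps)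
  then have i: "\<sigma> \<bullet> unboost x = \<gamma> * (\<sigma> \<bullet> x) - \<gamma> * (\<sigma> \<bullet> \<sigma>) * norm x"
    unfolding \<alpha>_sigma by (simp add: algebra_simps)
  have "\<alpha> * (\<sigma> \<bullet> x) - \<gamma> * norm x + (\<alpha> * (\<sigma> \<bullet> unboost x) + \<gamma> * norm (unboost x))
    = (\<sigma> \<bullet> x) * (\<alpha> * (1 + \<gamma>) - \<gamma> * \<gamma>) + norm x * (\<gamma> * \<gamma> - \<gamma> - \<gamma> * (\<alpha> * (\<sigma> \<bullet> \<sigma>)))"
    unfolding i norm_unboost D_def by (simp add: algebra_simps)
  also have "\<dots> = 0" unfolding \<alpha>_eq \<alpha>_sigma by (simp add: algebra_simps)
  finally show ?thesis
    unfolding boost_def[of "unboost x"] by (simp add: unboost_def flip: scaleR_add_left add.assoc)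
qed

lemma smooth_boost: "smooth_on (\<lambda>y. boost y $ k) (-{0})"
proof -
  have "smooth_on (\<lambda>y. y $ k + (\<alpha> * (\<sigma> \<bullet> y) + \<gamma> * norm y) * \<sigma> $ k) (-{0})"
    by (intro smooth_intros open_punctured smooth_norm_punctured)
  then show ?thesis by (simp add: boost_def)
qed

lemma partial_boost:
  assumes y: "y \<noteq> 0"
  shows "partial i (\<lambda>y. boost y $ k) y = (if i = k then 1 else 0) + \<alpha> * \<sigma> $ i * \<sigma> $ k + \<gamma> * \<sigma> $ k * (y $ i * inv_norm y)"
proof -
  have "((\<lambda>y. boost y $ k) has_derivative (\<lambda>h. h $ k + (\<alpha> * (\<sigma> \<bullet> h) + \<gamma> * ((y \<bullet> h) / norm y)) * \<sigma> $ k)) (at y)"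
    unfolding boost_def vector_add_component vector_scaleR_component real_scaleR_def
    by (auto intro!: derivative_eq_intros has_derivative_norm_at[OF y] bounded_linear.has_derivative[OF bounded_linear_vec_nth])
  from partial_has_derivative[OF this, of i] show ?thesis
    by (simp add: inner_axis inv_norm_def algebra_simps) (simp add: axis_def)
qed

lemma sum_second_partial_boost:
  assumes y: "y \<noteq> 0"
  shows "(\<Sum>i\<in>UNIV. partial i (partial i (\<lambda>y. boost y $ k)) y) = 2 * \<gamma> * inv_norm y * \<sigma> $ k"
proof -
  have "partial i (partial i (\<lambda>y. boost y $ k)) y = \<gamma> * \<sigma> $ k * partial i (partial i norm) y" for i
  proof -
    have "partial i (partial i (\<lambda>y. boost y $ k)) y = partial i (\<lambda>y. ((if i = k then 1 else 0) + \<alpha> * \<sigma> $ i * \<sigma> $ k) + (\<gamma> * \<sigma> $ k) * partial i norm y) y"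
      by (rule partial_cong_punctured[OF _ y]) (simp add: partial_boost partial_norm')
    also have "\<dots> = 0 + partial i (\<lambda>y. (\<gamma> * \<sigma> $ k) * partial i norm y) y"
      by (subst smooth_partial_add[OF smooth_on_const _ y]) (auto intro!: smooth_intros smooth_norm_punctured)
    finally show ?thesis by (simp add: smooth_partial_cmult[OF smooth_on_partial[OF smooth_norm_punctured] y])
  qed
  then show ?thesis using laplacian_norm[OF y] by (simp add: laplacian_def sum_distrib_left[symmetric])
qed

text \<open>Up to terms with a factor \<open>boost y\<close>, which only see radial derivatives, the derivative of the boost
  is orthogonal.\<close>
lemma gram_boost:
  assumes y: "y \<noteq> 0"
  shows "(\<Sum>i\<in>UNIV. partial i (\<lambda>y. boost y $ k) y * partial i (\<lambda>y. boost y $ l) y)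
    = (if k = l then 1 else 0) + \<gamma> * inv_norm y * (\<sigma> $ k * boost y $ l + \<sigma> $ l * boost y $ k)"
proof -
  have m1: "(y $ 1 * inv_norm y) * (y $ 1 * inv_norm y) + (y $ 2 * inv_norm y) * (y $ 2 * inv_norm y) + (y $ 3 * inv_norm y) * (y $ 3 * inv_norm y) = 1"
    using sum_sq_over_norm[OF y] unfolding inv_norm_sq[symmetric] sum_3 by (simp add: algebra_simps)
  have bl: "\<gamma> * inv_norm y * (\<sigma> $ k * boost y $ l) = \<gamma> * \<sigma> $ k * (y $ l * inv_norm y) + \<gamma> * \<alpha> * (\<sigma> \<bullet> y * inv_norm y) * \<sigma> $ k * \<sigma> $ l + \<gamma> * \<gamma> * \<sigma> $ k * \<sigma> $ l" for k l
    using norm_inv_norm[OF y] by (simp add: boost_def algebra_simps)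
  have d: "(\<Sum>i\<in>UNIV. (if i = k then 1 else 0) * f i) = f k" for f :: "3 \<Rightarrow> real" and k
    by (simp add: if_distrib[of "\<lambda>c. c * _"] cong: if_cong)
  let ?d = "\<lambda>i k :: 3. if i = k then 1 else (0::real)"
  have e: "?d 1 k * ?d 1 l + ?d 2 k * ?d 2 l + ?d 3 k * ?d 3 l = ?d k l" 
     "\<sigma> $ 1 * ?d 1 k + \<sigma> $ 2 * ?d 2 k + \<sigma> $ 3 * ?d 3 k = \<sigma> $ k"
     "y $ 1 * inv_norm y * ?d 1 k + y $ 2 * inv_norm y * ?d 2 k + y $ 3 * inv_norm y * ?d 3 k = y $ k * inv_norm y" for k l
    using exhaust_3[of k] exhaust_3[of l] by auto
  show ?thesis
    unfolding sum_3 partial_boost[OF y]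
      boost_gram_identity[OF \<alpha>_eq \<alpha>_sigma[unfolded inner_3] m1]
    unfolding e ring_distribs(1) bl
    by (simp add: inner_3 algebra_simps)
qed

text \<open>Conformal invariance of the Laplacian of the sphere, read on functions constant along rays: the
  conformal factor is hidden in the different lengths of \<open>y\<close> and \<open>boost y\<close>.\<close>
lemma laplacian_boost:
  assumes \<phi>: "smooth_on \<phi> (-{0})" "homogeneous 0 \<phi>" and y: "y \<noteq> 0"
  shows "laplacian (\<lambda>y. \<phi> (boost y)) y = laplacian \<phi> (boost y)"
proof -
  have comp: "smooth_on (\<lambda>y. f (boost y)) (-{0})" if "smooth_on f (-{0})" for f :: "real^3 \<Rightarrow> real"
    by (rule smooth_on_compose[OF open_punctured open_punctured _ that smooth_boost])
      (rule image_subsetI, simp add: boost_nonzero)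
  have bd: "boost differentiable at y" if "y \<noteq> 0" for y
    unfolding differentiable_vec_nth using smooth_differentiable[OF smooth_boost that] by blast
  have pc: "partial i (\<lambda>y. f (boost y)) y = (\<Sum>k\<in>UNIV. partial k f (boost y) * partial i (\<lambda>y. boost y $ k) y)"
    if "smooth_on f (-{0})" "y \<noteq> 0" for f :: "real^3 \<Rightarrow> real" and i y
    by (rule partial_compose[OF smooth_differentiable[OF that(1) boost_nonzero[OF that(2)]] bd[OF that(2)]])
  let ?B = "\<lambda>i k. partial i (\<lambda>y. boost y $ k)"
  have e1: "(\<Sum>l\<in>UNIV. boost y $ l * partial l (partial k \<phi>) (boost y)) = - partial k \<phi> (boost y)" for k
    using homogeneous_euler[OF smooth_on_partial[OF \<phi>(1)] homogeneous_partial[OF \<phi>] boost_nonzero[OF y]] by simp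
  have e2: "(\<Sum>k\<in>UNIV. boost y $ k * partial l (partial k \<phi>) (boost y)) = - partial l \<phi> (boost y)" for l
    using e1[of l] smooth_partial_swap[OF \<phi>(1) boost_nonzero[OF y], of l] by simp
  have "partial i (partial i (\<lambda>y. \<phi> (boost y))) y
    = (\<Sum>k\<in>UNIV. (\<Sum>l\<in>UNIV. partial l (partial k \<phi>) (boost y) * ?B i l y) * ?B i k y + partial k \<phi> (boost y) * partial i (?B i k) y)" for i
  proof -
    have "partial i (partial i (\<lambda>y. \<phi> (boost y))) y = partial i (\<lambda>y. \<Sum>k\<in>UNIV. partial k \<phi> (boost y) * ?B i k y) y"
      by (rule partial_cong_punctured[OF pc[OF \<phi>(1)] y])
    also have "\<dots> = (\<Sum>k\<in>UNIV. partial i (\<lambda>y. partial k \<phi> (boost y) * ?B i k y) y)"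
      by (rule smooth_partial_sum[OF _ y]) (intro smooth_intros open_punctured comp \<phi> smooth_boost)
    finally show ?thesis
      by (simp add: smooth_partial_mult[OF comp[OF smooth_on_partial[OF \<phi>(1)]] smooth_on_partial[OF smooth_boost] y]
        pc[OF smooth_on_partial[OF \<phi>(1)] y])
  qed
  then have "laplacian (\<lambda>y. \<phi> (boost y)) y
    = (\<Sum>i\<in>UNIV. \<Sum>k\<in>UNIV. (\<Sum>l\<in>UNIV. partial l (partial k \<phi>) (boost y) * ?B i l y) * ?B i k y + partial k \<phi> (boost y) * partial i (?B i k) y)"
    by (simp add: laplacian_def)
  also have "\<dots> = (\<Sum>k\<in>UNIV. \<Sum>l\<in>UNIV. partial l (partial k \<phi>) (boost y) * (\<Sum>i\<in>UNIV. ?B i k y * ?B i l y))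
     + (\<Sum>k\<in>UNIV. partial k \<phi> (boost y) * (\<Sum>i\<in>UNIV. partial i (?B i k) y))"
    by (simp add: sum_3 algebra_simps)
  also have "\<dots> = laplacian \<phi> (boost y)
     + \<gamma> * inv_norm y * (\<Sum>k\<in>UNIV. \<sigma> $ k * (\<Sum>l\<in>UNIV. boost y $ l * partial l (partial k \<phi>) (boost y)))
     + \<gamma> * inv_norm y * (\<Sum>l\<in>UNIV. \<sigma> $ l * (\<Sum>k\<in>UNIV. boost y $ k * partial l (partial k \<phi>) (boost y)))
     + 2 * \<gamma> * inv_norm y * (\<Sum>k\<in>UNIV. \<sigma> $ k * partial k \<phi> (boost y))"
    unfolding gram_boost[OF y] sum_second_partial_boost[OF y] laplacian_def by (simp add: sum_3 algebra_simps)
  finally show ?thesis unfolding e1 e2 by (simp add: sum_3 algebra_simps)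
qed

text \<open>Composed with the boost, \<open>\<phi>\<close> is a first spherical harmonic \<open>l \<bullet> y / |y|\<close>; inserting
  \<open>y = unboost x\<close>, with \<open>|y| = \<gamma> D x\<close>, yields a mode.\<close>
theorem eigenfunction_is_mode:
  assumes \<phi>: "smooth_on \<phi> (-{0})" "homogeneous 0 \<phi>"
    and L: "\<And>x. x \<noteq> 0 \<Longrightarrow> laplacian \<phi> x = - (2 * K * \<rho> x * \<phi> x) * inv_sq x"
  shows "\<exists>d. \<forall>x. x \<noteq> 0 \<longrightarrow> \<phi> x = mode d x"
proof -
  let ?\<psi> = "\<lambda>y. \<phi> (boost y)"
  have "smooth_on ?\<psi> (-{0})"
    by (rule smooth_on_compose[OF open_punctured open_punctured _ \<phi>(1) smooth_boost])
      (rule image_subsetI, simp add: boost_nonzero)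
  moreover have "homogeneous 0 ?\<psi>"
    unfolding homogeneous_def
  proof (intro allI impI)
    fix l :: real and y :: "real^3" assume "l > 0" "y \<noteq> 0"
    moreover from this have "boost (l *\<^sub>R y) = l *\<^sub>R boost y" by (simp add: boost_def algebra_simps)
    ultimately show "\<phi> (boost (l *\<^sub>R y)) = l powi 0 * \<phi> (boost y)"
      using homogeneousD[OF \<phi>(2) _ boost_nonzero] by simp
  qed
  moreover have "laplacian ?\<psi> y = - 2 * inv_sq y * ?\<psi> y" if y: "y \<noteq> 0" for y
  proof -
    have "K * (iD (boost y))\<^sup>2 = inv_sq y"
    proof -
      have "K = 1 / (\<gamma> * \<gamma>)" using \<gamma>_sq \<gamma>_pos by (simp add: field_simps)
      then show ?thesis unfolding inv_sq_def iD_def D_boost[of y, symmetric]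
        by (simp add: power2_eq_square)
    qed
    then show ?thesis
      unfolding laplacian_boost[OF \<phi> y] L[OF boost_nonzero[OF y]]
      using rho_inv_sq[OF boost_nonzero[OF y]] by (simp add: mult_ac)
  qed
  ultimately obtain l where l: "\<And>y. y \<noteq> 0 \<Longrightarrow> ?\<psi> y = (l \<bullet> y) * inv_norm y"
    using sphere_eigenfunction_linear by blast
  \<comment> \<open>solves \<open>2 \<gamma> d = l - (\<gamma> / (1 + \<gamma>)) (l \<bullet> \<sigma>) \<sigma>\<close>, read off from the coefficients of \<open>x\<close> in \<open>l \<bullet> unboost x\<close>\<close>
  define d where "d = (1 / (2 * \<gamma>)) *\<^sub>R (l - (\<gamma> / (1 + \<gamma>) * (l \<bullet> \<sigma>)) *\<^sub>R \<sigma>)"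
  have dz: "2 * \<gamma> * (d \<bullet> z) = l \<bullet> z - \<gamma> / (1 + \<gamma>) * (l \<bullet> \<sigma>) * (\<sigma> \<bullet> z)" for z
  proof -
    have "(2 * \<gamma>) *\<^sub>R d = l - (\<gamma> / (1 + \<gamma>) * (l \<bullet> \<sigma>)) *\<^sub>R \<sigma>" using \<gamma>_pos by (simp add: d_def)
    from arg_cong[OF this, of "\<lambda>a. a \<bullet> z"] show ?thesis by (simp only: inner_diff_left inner_scaleR_left)
  qed
  have ds: "2 * \<gamma> * \<gamma> * (d \<bullet> \<sigma>) = l \<bullet> \<sigma>"
  proof -
    have "2 * \<gamma> * \<gamma> * (d \<bullet> \<sigma>) = \<gamma> * (2 * \<gamma> * (d \<bullet> \<sigma>))" by simp
    also have "\<dots> = (l \<bullet> \<sigma>) * (\<gamma> - \<alpha> * (\<sigma> \<bullet> \<sigma>))"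
      unfolding dz[of \<sigma>] by (simp add: \<alpha>_def right_diff_distrib)
    finally have "2 * \<gamma> * \<gamma> * (d \<bullet> \<sigma>) = (l \<bullet> \<sigma>) * (\<gamma> - \<alpha> * (\<sigma> \<bullet> \<sigma>))" .
    then show ?thesis unfolding \<alpha>_sigma by simp
  qed
  have "\<phi> x = mode d x" if x: "x \<noteq> 0" for x
  proof -
    have Dg: "D x > 0" "\<gamma> > 0" using D_pos[OF x] \<gamma>_pos by auto
    have ub: "unboost x \<noteq> 0" using norm_unboost[of x] Dg by auto
    have \<phi>x: "\<phi> x = (l \<bullet> unboost x) / (\<gamma> * D x)"
      using l[OF ub] by (simp add: boost_unboost inv_norm_def norm_unboost)
    note dx = dz[of x]
    have "1 / K = \<gamma> * \<gamma>" using \<gamma>_sq K_pos by (simp add: field_simps)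
    then have "mode d x * (\<gamma> * D x) = 2 * \<gamma> * (d \<bullet> x) * (D x * iD x) - (2 * \<gamma> * \<gamma> * (d \<bullet> \<sigma>)) * \<gamma> * D x"
      by (simp add: mode_def algebra_simps divide_inverse)
    also have "\<dots> = l \<bullet> x + (l \<bullet> \<sigma>) * ((\<gamma> - \<gamma> / (1 + \<gamma>)) * (\<sigma> \<bullet> x) - \<gamma> * norm x)"
      unfolding D_iD[OF x] ds mult_1_right dx by (simp add: D_def algebra_simps)
    also have "\<gamma> - \<gamma> / (1 + \<gamma>) = \<alpha>" using \<gamma>_pos by (simp add: \<alpha>_def field_simps)
    also have "l \<bullet> x + (l \<bullet> \<sigma>) * (\<alpha> * (\<sigma> \<bullet> x) - \<gamma> * norm x) = l \<bullet> unboost x"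
      by (simp add: unboost_def inner_add_right algebra_simps)
    finally have "mode d x * (\<gamma> * D x) = l \<bullet> unboost x" .
    then show ?thesis unfolding \<phi>x using Dg by (simp only: divide_eq_eq) simp
  qed
  then show ?thesis by blast
qed

text \<open>The derivatives of the Landau solution in the direction \<open>d\<close> of the parameter.\<close>
definition dU :: "real^3 \<Rightarrow> 3 \<Rightarrow> real^3 \<Rightarrow> real" where
  "dU d i x = 2 * d $ i * iD x - 2 * (d \<bullet> x) * n i x * (iD x)\<^sup>2 + 4 * K * (d \<bullet> x) * x $ i * (iD x)^3
     - 4 * (d \<bullet> \<sigma>) * x $ i * (iD x)\<^sup>2"
definition dP :: "real^3 \<Rightarrow> real^3 \<Rightarrow> real" where
  "dP d x = 8 * K * (d \<bullet> x) * (iD x)^3 - 8 * (d \<bullet> \<sigma>) * (iD x)\<^sup>2 - 4 * (d \<bullet> x) * inv_norm x * (iD x)\<^sup>2"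

lemma dU_mode:
  assumes x: "x \<noteq> 0"
  shows "dU d i x = partial i (mode d) x + 2 * K * \<rho> x * mode d x * radial_unit i x"
proof -
  have "2 * K * \<rho> x * mode d x * radial_unit i x = 2 * (K * mode d x) * x $ i * (\<rho> x * inv_sq x)"
    by (simp add: radial_unit_def inv_sq_def)
  also have "K * mode d x = 2 * K * (d \<bullet> x) * iD x - 2 * (d \<bullet> \<sigma>)"
    using K_pos by (simp add: mode_def field_simps)
  finally show ?thesis unfolding rho_inv_sq[OF x] partial_mode[OF x] dU_def
    by (simp add: algebra_simps power2_eq_square power3_eq_cube)
qed

lemma dP_mode:
  assumes x: "x \<noteq> 0"
  shows "dP d x = 2 * K * \<rho> x * mode d x * inv_sq x - (\<Sum>j\<in>UNIV. V j x * partial j (mode d) x)"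
proof -
  have e: "(\<Sum>j\<in>UNIV. x $ j * partial j (mode d) x) = 0"
    using homogeneous_euler[OF smooth_mode homogeneous_mode x] by simp
  have "(\<Sum>j\<in>UNIV. V j x * partial j (mode d) x) = 2 * inv_sq x * (\<Sum>j\<in>UNIV. x $ j * partial j (mode d) x)
     - 2 * iD x * (\<Sum>j\<in>UNIV. n j x * partial j (mode d) x)"
    unfolding V_eq[OF x] radial_unit_def by (simp add: sum_3 algebra_simps)
  also have "(\<Sum>j\<in>UNIV. n j x * partial j (mode d) x) = 2 * iD x * (\<Sum>j\<in>UNIV. n j x * d $ j)
      - 2 * (d \<bullet> x) * (iD x)\<^sup>2 * (\<Sum>j\<in>UNIV. n j x * n j x)"
    unfolding partial_mode[OF x] by (simp add: sum_3 algebra_simps)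
  also have "(\<Sum>j\<in>UNIV. n j x * d $ j) = (d \<bullet> x) * inv_norm x - d \<bullet> \<sigma>"
    by (simp add: n_def sum_3 inner_3 algebra_simps)
  finally have "(\<Sum>j\<in>UNIV. V j x * partial j (mode d) x) = - 4 * (iD x)\<^sup>2 * ((d \<bullet> x) * inv_norm x - d \<bullet> \<sigma>)
     + 8 * (d \<bullet> x) * (iD x)\<^sup>2 * inv_norm x * (D x * iD x) - 4 * K * (d \<bullet> x) * (iD x)^3"
    unfolding e sum_n_sq[OF x] by (simp add: algebra_simps power2_eq_square power3_eq_cube)
  moreover have "2 * K * \<rho> x * mode d x * inv_sq x = 2 * (K * mode d x) * (\<rho> x * inv_sq x)" by simp
  moreover have "K * mode d x = 2 * K * (d \<bullet> x) * iD x - 2 * (d \<bullet> \<sigma>)"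
    using K_pos by (simp add: mode_def field_simps)
  ultimately show ?thesis unfolding rho_inv_sq[OF x] D_iD[OF x] dP_def
    by (simp add: algebra_simps power2_eq_square power3_eq_cube)
qed

end

section \<open>The self-similar kernel in terms of the ball parameter\<close>

lemma partial_vec_component:
  fixes f :: "real^3 \<Rightarrow> real^3"
  assumes "smooth_on f (-{0})" "x \<noteq> 0" shows "partial j f x $ i = partial j (\<lambda>x. f x $ i) x"
  using partial_vec_nth[OF smooth_differentiable[OF assms]] by simp

lemma laplacian_vec_component:
  fixes f :: "real^3 \<Rightarrow> real^3"
  assumes "smooth_on f (-{0})" "x \<noteq> 0" shows "laplacian f x $ i = laplacian (\<lambda>x. f x $ i) x"
proof -
  have "partial j (partial j f) x $ i = partial j (partial j (\<lambda>x. f x $ i)) x" for j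
  proof -
    have "partial j (partial j f) x $ i = partial j (\<lambda>x. partial j f x $ i) x"
      by (rule partial_vec_component[OF smooth_on_partial[OF assms(1)] assms(2)])
    also have "\<dots> = partial j (partial j (\<lambda>x. f x $ i)) x"
      by (rule partial_cong_punctured[OF partial_vec_component[OF assms(1)] assms(2)])
    finally show ?thesis .
  qed
  then show ?thesis by (simp add: laplacian_def)
qed

lemma linearized_op_component:
  fixes w U :: "real^3 \<Rightarrow> real^3"
  assumes "smooth_on w (-{0})" "smooth_on U (-{0})" "x \<noteq> 0"
  shows "linearized_op U w q x $ i = - laplacian (\<lambda>x. w x $ i) x
    + (\<Sum>j\<in>UNIV. U x $ j * partial j (\<lambda>x. w x $ i) x + w x $ j * partial j (\<lambda>x. U x $ i) x) + partial i q x"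
  by (simp add: linearized_op_def convective_def grad_def laplacian_vec_component assms partial_vec_component sum.distrib)

lemma divergence_component:
  fixes w :: "real^3 \<Rightarrow> real^3"
  assumes "smooth_on w (-{0})" "x \<noteq> 0"
  shows "divergence w x = (\<Sum>i\<in>UNIV. partial i (\<lambda>x. w x $ i) x)"
  by (simp add: divergence_def partial_vec_component assms)

lemma self_similar_vel_iff: "self_similar_vel w \<longleftrightarrow> (\<forall>i. homogeneous (-1) (\<lambda>x. w x $ i))"
proof
  assume s: "self_similar_vel w"
  show "\<forall>i. homogeneous (-1) (\<lambda>x. w x $ i)" unfolding homogeneous_def
  proof (intro allI impI)
    fix i l x assume l: "l > (0::real)" and x: "x \<noteq> (0::real^3)"
    have "w x = l *\<^sub>R w (l *\<^sub>R x)" using s l x unfolding self_similar_vel_def by blast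
    then have "w x $ i = l * w (l *\<^sub>R x) $ i" by (metis vector_scaleR_component real_scaleR_def)
    then show "w (l *\<^sub>R x) $ i = l powi - 1 * w x $ i" using l by (simp add: power_int_minus)
  qed
next
  assume h: "\<forall>i. homogeneous (-1) (\<lambda>x. w x $ i)"
  show "self_similar_vel w" unfolding self_similar_vel_def
  proof (intro allI impI)
    fix l x assume l: "l > (0::real)" and x: "x \<noteq> (0::real^3)"
    have "w (l *\<^sub>R x) $ i = l powi - 1 * w x $ i" for i using h l x by (simp add: homogeneous_def)
    then show "w x = l *\<^sub>R w (l *\<^sub>R x)" using l by (simp add: vec_eq_iff power_int_minus)
  qed
qed

lemma self_similar_pressure_iff: "self_similar_pressure q \<longleftrightarrow> homogeneous (-2) q"
proof -
  have "q x = l\<^sup>2 * q (l *\<^sub>R x) \<longleftrightarrow> q (l *\<^sub>R x) = l powi - 2 * q x" if "l > 0" for l :: real and x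
    using that by (auto simp: power_int_minus field_simps)
  then show ?thesis unfolding self_similar_pressure_def homogeneous_def by blast
qed

context landau_ball
begin

text \<open>The potential of a solution solves the linearized Liouville equation, hence is a mode, and modes are
  the potentials of the parameter derivatives.\<close>
theorem kernel_subset:
  assumes W: "\<And>x i. x \<noteq> 0 \<Longrightarrow> W x $ i = u i x"
    and sol: "smooth_linearized_solution W w q" "self_similar_vel w" "self_similar_pressure q"
  shows "\<exists>d. \<forall>x. x \<noteq> 0 \<longrightarrow> (\<forall>i. w x $ i = dU d i x) \<and> q x = dP d x"
proof -
  have sw: "smooth_on w (-{0})" and sq: "smooth_on q (-{0})" using sol(1) by (auto simp: smooth_linearized_solution_def)
  have swi: "smooth_on (\<lambda>x. w x $ i) (-{0})" for i by (intro smooth_intros open_punctured sw)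
  have su: "smooth_on (u i) (-{0})" for i unfolding u_def by (rule smooth_flow_field[OF split_background])
  have sWi: "smooth_on (\<lambda>x. W x $ i) (-{0})" for i
    by (rule smooth_on_cong[OF su[of i] open_punctured]) (use W in auto)
  have sW: "smooth_on W (-{0})" by (rule smooth_on_vecI[OF open_punctured sWi])
  have hw: "homogeneous (-1) (\<lambda>x. w x $ i)" for i using sol(2) by (simp add: self_similar_vel_iff)
  have hq: "homogeneous (-2) q" using sol(3) by (simp add: self_similar_pressure_iff)
  have dv: "(\<Sum>i\<in>UNIV. partial i (\<lambda>x. w x $ i) x) = 0" if "x \<noteq> 0" for x
    using sol(1) that divergence_component[OF sw that] by (simp add: smooth_linearized_solution_def)
  have eq: "laplacian (\<lambda>x. w x $ i) x = (\<Sum>j\<in>UNIV. u j x * partial j (\<lambda>x. w x $ i) x + w x $ j * partial j (u i) x) + partial i q x"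
    if x: "x \<noteq> 0" for x i
  proof -
    have "linearized_op W w q x $ i = 0" using sol(1) x by (simp add: smooth_linearized_solution_def)
    moreover have "partial j (\<lambda>x. W x $ i) x = partial j (u i) x" for j by (rule partial_cong_punctured[OF W x])
    ultimately show ?thesis unfolding linearized_op_component[OF sw sW x] W[OF x] by simp
  qed
  obtain \<phi> where \<phi>: "smooth_on \<phi> (-{0})" "homogeneous 0 \<phi>"
    "\<And>x. x \<noteq> 0 \<Longrightarrow> laplacian \<phi> x = - (2 * K * \<rho> x * \<phi> x) * inv_sq x"
    "\<And>x i. x \<noteq> 0 \<Longrightarrow> w x $ i = partial i \<phi> x + 2 * K * \<rho> x * \<phi> x * radial_unit i x"
    "\<And>x. x \<noteq> 0 \<Longrightarrow> q x = 2 * K * \<rho> x * \<phi> x * inv_sq x - (\<Sum>j\<in>UNIV. V j x * partial j \<phi> x)"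
    using linearized_solution_potential[where w="\<lambda>i x. w x $ i", OF swi hw dv sq hq eq] by blast
  obtain d where d: "\<And>x. x \<noteq> 0 \<Longrightarrow> \<phi> x = mode d x" using eigenfunction_is_mode[OF \<phi>(1-3)] by blast
  have "(\<forall>i. w x $ i = dU d i x) \<and> q x = dP d x" if x: "x \<noteq> 0" for x
  proof -
    have "partial i \<phi> x = partial i (mode d) x" for i by (rule partial_cong_punctured[OF d x])
    then show ?thesis using \<phi>(4,5)[OF x] d[OF x] dU_mode[OF x] dP_mode[OF x] by simp
  qed
  then show ?thesis by blast
qed

theorem kernel_superset:
  assumes W: "\<And>x i. x \<noteq> 0 \<Longrightarrow> W x $ i = u i x"
    and w: "\<And>x i. x \<noteq> 0 \<Longrightarrow> w x $ i = dU d i x" and q: "\<And>x. x \<noteq> 0 \<Longrightarrow> q x = dP d x"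
  shows "smooth_linearized_solution W w q" "self_similar_vel w" "self_similar_pressure q"
proof -
  define v where "v = (\<lambda>i x. partial i (mode d) x + 2 * K * \<rho> x * mode d x * radial_unit i x)"
  define p where "p = (\<lambda>x. 2 * K * \<rho> x * mode d x * inv_sq x - (\<Sum>j\<in>UNIV. V j x * partial j (mode d) x))"
  have S1: "smooth_on (v i) (-{0})" for i
    unfolding v_def p_def by (rule potential_linearized_solution(1)[OF smooth_mode homogeneous_mode laplacian_mode])
  have S2: "homogeneous (-1) (v i)" for i
    unfolding v_def p_def by (rule potential_linearized_solution(2)[OF smooth_mode homogeneous_mode laplacian_mode])
  have S3: "(\<Sum>i\<in>UNIV. partial i (v i) x) = 0" if "x \<noteq> 0" for x
    unfolding v_def p_def by (rule potential_linearized_solution(3)[OF smooth_mode homogeneous_mode laplacian_mode], assumption, rule that)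
  have S4: "smooth_on p (-{0})"
    unfolding v_def p_def by (rule potential_linearized_solution(4)[OF smooth_mode homogeneous_mode laplacian_mode])
  have S5: "homogeneous (-2) p"
    unfolding v_def p_def by (rule potential_linearized_solution(5)[OF smooth_mode homogeneous_mode laplacian_mode])
  have S6: "laplacian (v i) x = (\<Sum>j\<in>UNIV. u j x * partial j (v i) x + v j x * partial j (u i) x) + partial i p x" if "x \<noteq> 0" for x i
    unfolding v_def p_def by (rule potential_linearized_solution(6)[OF smooth_mode homogeneous_mode laplacian_mode], assumption, rule that)
  have wv: "w x $ i = v i x" if "x \<noteq> 0" for i x using w[OF that] dU_mode[OF that] by (simp add: v_def)
  have qp: "q x = p x" if "x \<noteq> 0" for x using q[OF that] dP_mode[OF that] by (simp add: p_def)
  have swi: "smooth_on (\<lambda>x. w x $ i) (-{0})" for i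
    by (rule smooth_on_cong[OF S1[of i] open_punctured]) (use wv in auto)
  have sw: "smooth_on w (-{0})" by (rule smooth_on_vecI[OF open_punctured swi])
  have sq: "smooth_on q (-{0})" by (rule smooth_on_cong[OF S4 open_punctured]) (use qp in auto)
  have su: "smooth_on (u i) (-{0})" for i unfolding u_def by (rule smooth_flow_field[OF split_background])
  have sWi: "smooth_on (\<lambda>x. W x $ i) (-{0})" for i
    by (rule smooth_on_cong[OF su[of i] open_punctured]) (use W in auto)
  have sW: "smooth_on W (-{0})" by (rule smooth_on_vecI[OF open_punctured sWi])
  show "self_similar_vel w" unfolding self_similar_vel_iff
    using homogeneous_cong[OF S2] wv by metis
  show "self_similar_pressure q" unfolding self_similar_pressure_iff
    by (rule homogeneous_cong[OF S5]) (simp add: qp)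
  have "linearized_op W w q x = 0 \<and> divergence w x = 0" if x: "x \<noteq> 0" for x
  proof
    have pw: "partial j (\<lambda>x. w x $ i) x = partial j (v i) x" for i j by (rule partial_cong_punctured[OF wv x])
    have pW: "partial j (\<lambda>x. W x $ i) x = partial j (u i) x" for i j by (rule partial_cong_punctured[OF W x])
    have pq: "partial j q x = partial j p x" for j by (rule partial_cong_punctured[OF qp x])
    have lw: "laplacian (\<lambda>x. w x $ i) x = laplacian (v i) x" for i by (rule laplacian_cong[OF wv x])
    have "linearized_op W w q x $ i = 0" for i
      unfolding linearized_op_component[OF sw sW x] pw pW pq lw wv[OF x] W[OF x] S6[OF x] by simp
    then show "linearized_op W w q x = 0" by (simp add: vec_eq_iff)
    show "divergence w x = 0" unfolding divergence_component[OF sw x] pw by (rule S3[OF x])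
  qed
  then show "smooth_linearized_solution W w q" using sw sq by (simp add: smooth_linearized_solution_def)
qed

end

section \<open>Landau solutions in the parameter of the unit ball\<close>

text \<open>The Landau solution without angles: \<open>|x| - \<sigma> \<bullet> x\<close> is \<open>|x| (a - cos \<phi>) / a\<close> when \<open>\<sigma> = e\<^sub>3 / a\<close>.\<close>
definition ball_vel :: "real^3 \<Rightarrow> real^3 \<Rightarrow> real^3" where
  "ball_vel \<sigma> x = (2 * (1 - \<sigma> \<bullet> \<sigma>) / (norm x - \<sigma> \<bullet> x)\<^sup>2) *\<^sub>R x - (2 / (norm x - \<sigma> \<bullet> x)) *\<^sub>R (x /\<^sub>R norm x - \<sigma>)"

definition ball_pressure :: "real^3 \<Rightarrow> real^3 \<Rightarrow> real" where
  "ball_pressure \<sigma> x = 4 * ((\<sigma> \<bullet> x) / norm x - \<sigma> \<bullet> \<sigma>) / (norm x - \<sigma> \<bullet> x)\<^sup>2"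

context landau_ball
begin

lemma ball_vel_eq_u: "x \<noteq> 0 \<Longrightarrow> ball_vel \<sigma> x $ i = u i x"
  unfolding u_eq by (simp add: ball_vel_def K_def iD_def D_def n_def inv_norm_def power2_eq_square divide_inverse)

lemma has_derivative_iD_param:
  assumes x: "x \<noteq> 0"
  shows "((\<lambda>\<tau>. inverse (norm x - \<tau> \<bullet> x)) has_derivative (\<lambda>d. (d \<bullet> x) * (iD x * iD x))) (at \<sigma>)"
proof -
  have nz: "norm x - \<sigma> \<bullet> x \<noteq> 0" using D_pos[OF x] by (simp add: D_def)
  have "((\<lambda>\<tau>. norm x - \<tau> \<bullet> x) has_derivative (\<lambda>d. - (d \<bullet> x))) (at \<sigma>)"
    by (auto intro!: derivative_eq_intros)
  from Deriv.has_derivative_inverse[OF nz this]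
  show ?thesis by (rule has_derivative_eq_rhs) (simp add: fun_eq_iff iD_def D_def divide_inverse)
qed

lemma has_derivative_ball_vel:
  assumes x: "x \<noteq> 0" shows "((\<lambda>\<sigma>. ball_vel \<sigma> x) has_derivative (\<lambda>d. \<chi> i. dU d i x)) (at \<sigma>)"
proof -
  define I where "I \<tau> = inverse (norm x - \<tau> \<bullet> x)" for \<tau>
  have dI: "(I has_derivative (\<lambda>d. (d \<bullet> x) * (iD x * iD x))) (at \<sigma>)"
    unfolding I_def[abs_def] by (rule has_derivative_iD_param[OF x])
  have I: "I \<sigma> = iD x" by (simp add: I_def iD_def D_def inverse_eq_divide)
  have "((\<lambda>\<tau>. ball_vel \<tau> x $ i) has_derivative (\<lambda>d. dU d i x)) (at \<sigma>)" for i
  proof -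
    have "((\<lambda>\<tau>. 2 * (1 - \<tau> \<bullet> \<tau>) * (I \<tau> * I \<tau>) * x $ i - 2 * (I \<tau> * (x $ i * inv_norm x - \<tau> $ i)))
      has_derivative (\<lambda>d. dU d i x)) (at \<sigma>)"
      by (auto intro!: derivative_eq_intros dI bounded_linear.has_derivative[OF bounded_linear_vec_nth] simp: I)
         (simp add: fun_eq_iff dU_def K_def n_def inner_commute algebra_simps power2_eq_square power3_eq_cube)
    moreover have "(\<lambda>\<tau>. ball_vel \<tau> x $ i) = (\<lambda>\<tau>. 2 * (1 - \<tau> \<bullet> \<tau>) * (I \<tau> * I \<tau>) * x $ i - 2 * (I \<tau> * (x $ i * inv_norm x - \<tau> $ i)))"
      by (simp add: fun_eq_iff ball_vel_def I_def inv_norm_def divide_inverse power2_eq_square)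
    ultimately show ?thesis by simp
  qed
  then show ?thesis
    by (subst has_derivative_componentwise_within) (auto simp: Basis_vec_def inner_axis)
qed

lemma has_derivative_ball_pressure:
  assumes x: "x \<noteq> 0" shows "((\<lambda>\<sigma>. ball_pressure \<sigma> x) has_derivative (\<lambda>d. dP d x)) (at \<sigma>)"
proof -
  define I where "I \<tau> = inverse (norm x - \<tau> \<bullet> x)" for \<tau>
  have dI: "(I has_derivative (\<lambda>d. (d \<bullet> x) * (iD x * iD x))) (at \<sigma>)"
    unfolding I_def[abs_def] by (rule has_derivative_iD_param[OF x])
  have I: "I \<sigma> = iD x" by (simp add: I_def iD_def D_def inverse_eq_divide)
  have "((\<lambda>\<tau>. 4 * ((\<tau> \<bullet> x) * inv_norm x - \<tau> \<bullet> \<tau>) * (I \<tau> * I \<tau>)) has_derivative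
     (\<lambda>d. 4 * ((d \<bullet> x) * inv_norm x - 2 * (d \<bullet> \<sigma>)) * (iD x * iD x)
        + 8 * ((\<sigma> \<bullet> x) * inv_norm x - \<sigma> \<bullet> \<sigma>) * (d \<bullet> x) * (iD x)^3)) (at \<sigma>)"
    by (auto intro!: derivative_eq_intros dI simp: I)
       (simp add: fun_eq_iff inner_commute algebra_simps power3_eq_cube)
  moreover have "(\<lambda>\<tau>. ball_pressure \<tau> x) = (\<lambda>\<tau>. 4 * ((\<tau> \<bullet> x) * inv_norm x - \<tau> \<bullet> \<tau>) * (I \<tau> * I \<tau>))"
    by (simp add: fun_eq_iff ball_pressure_def I_def inv_norm_def divide_inverse power2_eq_square)
  moreover have "4 * ((d \<bullet> x) * inv_norm x - 2 * (d \<bullet> \<sigma>)) * (iD x * iD x)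
        + 8 * ((\<sigma> \<bullet> x) * inv_norm x - \<sigma> \<bullet> \<sigma>) * (d \<bullet> x) * (iD x)^3 = dP d x" for d
  proof -
    have "(\<sigma> \<bullet> x) * inv_norm x = 1 - D x * inv_norm x"
      using norm_inv_norm[OF x] by (simp add: D_def algebra_simps)
    then have h: "(\<sigma> \<bullet> x) * inv_norm x - \<sigma> \<bullet> \<sigma> = K - D x * inv_norm x" by (simp add: K_def)
    have "8 * ((\<sigma> \<bullet> x) * inv_norm x - \<sigma> \<bullet> \<sigma>) * (d \<bullet> x) * (iD x)^3
      = 8 * K * (d \<bullet> x) * (iD x)^3 - 8 * (D x * iD x) * inv_norm x * (d \<bullet> x) * (iD x)\<^sup>2"
      unfolding h by (simp add: algebra_simps power2_eq_square power3_eq_cube)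
    then show ?thesis unfolding D_iD[OF x] dP_def by (simp add: algebra_simps power2_eq_square)
  qed
  ultimately show ?thesis by simp
qed

end

section \<open>The strength of the force as a function of the parameter\<close>

text \<open>The function \<open>landau_beta\<close> in the variable \<open>s = 1 / a\<close>, extended to an odd function. At \<open>0\<close>, the
  convention for division by zero gives the right value \<open>0\<close>.\<close>
definition flux :: "real \<Rightarrow> real" where
  "flux s = 16 * pi * (1 / s + ln ((1 - s) / (1 + s)) / (2 * s\<^sup>2) + 4 * s / (3 * (1 - s\<^sup>2)))"

lemma flux_0 [simp]: "flux 0 = 0"
  by (simp add: flux_def)

lemma flux_minus: assumes "\<bar>s\<bar> < 1" shows "flux (- s) = - flux s"
proof -
  have "ln ((1 + s) / (1 - s)) = - ln ((1 - s) / (1 + s))"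
    using assms by (simp add: ln_div abs_less_iff)
  then show ?thesis by (simp add: flux_def algebra_simps)
qed

lemma landau_beta_flux: "landau_beta (ereal a) = flux (1 / a)" if "a > 1"
proof -
  have "1 - 1 / a = (a - 1) / a" "1 + 1 / a = (a + 1) / a" using that by (simp_all add: field_simps)
  then have 1: "(1 - 1 / a) / (1 + 1 / a) = (a - 1) / (a + 1)" using that by simp
  have "1 - (1 / a)\<^sup>2 = (a\<^sup>2 - 1) / a\<^sup>2" using that by (simp add: field_simps power2_eq_square)
  then have 2: "4 * (1 / a) / (3 * (1 - (1 / a)\<^sup>2)) = 4 * a / (3 * (a\<^sup>2 - 1))"
    using that by (simp add: power2_eq_square)
  have 3: "ln ((a - 1) / (a + 1)) / (2 * (1 / a)\<^sup>2) = 1 / 2 * a\<^sup>2 * ln ((a - 1) / (a + 1))"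
    using that by (simp add: power2_eq_square)
  show ?thesis using that unfolding flux_def 1 2 3 by (simp add: landau_beta_def Let_def)
qed

definition flux' :: "real \<Rightarrow> real" where
  "flux' s = (if s = 0 then 16 * pi else 16 * pi * (- 1 / s\<^sup>2 - ln ((1 - s) / (1 + s)) / s^3 - 1 / (s\<^sup>2 * (1 - s\<^sup>2))
     + 4 / 3 * (1 + s\<^sup>2) / (1 - s\<^sup>2)\<^sup>2))"

lemma DERIV_flux:
  assumes "\<bar>s\<bar> < 1" shows "(flux has_field_derivative flux' s) (at s)"
proof (cases "s = 0")
  case True
  have "((\<lambda>h. (flux (0 + h) - flux 0) / h) \<longlongrightarrow> 16 * pi) (at 0)"
    unfolding flux_0 unfolding flux_def by real_asymp
  then show ?thesis using True by (simp add: DERIV_def flux'_def)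
next
  case False
  have nz: "1 - s > 0" "1 + s > 0" "1 - s\<^sup>2 > 0" using assms by (auto simp: abs_less_iff abs_square_less_1)
  have L: "((\<lambda>s. ln ((1 - s) / (1 + s))) has_field_derivative (- 2 / (1 - s\<^sup>2))) (at s)"
    using nz by (auto intro!: derivative_eq_intros simp: power2_eq_square divide_simps) (auto simp: algebra_simps)
  have "((\<lambda>s. ln ((1 - s) / (1 + s)) / (2 * s\<^sup>2)) has_field_derivative (- ln ((1 - s) / (1 + s)) / s^3 - 1 / (s\<^sup>2 * (1 - s\<^sup>2)))) (at s)"
  proof -
    define w l where "w = 1 - s\<^sup>2" and "l = ln ((1 - s) / (1 + s))"
    have "w \<noteq> 0" using nz by (simp add: w_def)
    then have "((- 2 / w) * (2 * s\<^sup>2) - l * (2 * (2 * s))) / ((2 * s\<^sup>2) * (2 * s\<^sup>2)) = - l / s^3 - 1 / (s\<^sup>2 * w)"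
      using False by (simp add: field_simps power2_eq_square power3_eq_cube)
    moreover have "((\<lambda>s. 2 * s\<^sup>2) has_field_derivative 2 * (2 * s)) (at s)" by (auto intro!: derivative_eq_intros)
    ultimately show ?thesis using DERIV_divide[OF L, of "\<lambda>s. 2 * s\<^sup>2" "2 * (2 * s)"] False by (simp add: w_def l_def)
  qed
  moreover have "((\<lambda>s. 4 * s / (3 * (1 - s\<^sup>2))) has_field_derivative 4 / 3 * (1 + s\<^sup>2) / (1 - s\<^sup>2)\<^sup>2) (at s)"
    using nz by (auto intro!: derivative_eq_intros simp: divide_simps) (auto simp: algebra_simps power2_eq_square)
  moreover have "((\<lambda>s. 1 / s) has_field_derivative (- 1 / s\<^sup>2)) (at s)"
    using False by (auto intro!: derivative_eq_intros simp: divide_simps power2_eq_square)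
  ultimately have "((\<lambda>s. 16 * pi * (1 / s + ln ((1 - s) / (1 + s)) / (2 * s\<^sup>2) + 4 * s / (3 * (1 - s\<^sup>2)))) has_field_derivative
     16 * pi * ((- 1 / s\<^sup>2) + (- ln ((1 - s) / (1 + s)) / s^3 - 1 / (s\<^sup>2 * (1 - s\<^sup>2))) + 4 / 3 * (1 + s\<^sup>2) / (1 - s\<^sup>2)\<^sup>2)) (at s)"
    by (intro DERIV_cmult DERIV_add)
  moreover have "16 * pi * ((- 1 / s\<^sup>2) + (- ln ((1 - s) / (1 + s)) / s^3 - 1 / (s\<^sup>2 * (1 - s\<^sup>2))) + 4 / 3 * (1 + s\<^sup>2) / (1 - s\<^sup>2)\<^sup>2) = flux' s"
    using False by (simp add: flux'_def)
  ultimately show ?thesis unfolding flux_def[abs_def] by simp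
qed

text \<open>Two terms of the power series at \<open>0\<close>; all later coefficients are positive.\<close>
lemma artanh_lower_bound:
  fixes s :: real assumes "0 < s" "s < 1" shows "2 * s + 2 * s^3 / 3 \<le> - ln ((1 - s) / (1 + s))"
proof -
  define g where "g s = - ln ((1 - s) / (1 + s)) - 2 * s - 2 * s^3 / 3" for s :: real
  have "g 0 \<le> g s"
  proof (rule DERIV_nonneg_imp_nondecreasing[where f=g])
    fix t :: real assume t: "0 \<le> t" "t \<le> s"
    have nz: "1 - t > 0" "1 + t > 0" "1 - t\<^sup>2 > 0" using assms t by (auto simp: abs_square_less_1)
    have "(g has_field_derivative 2 * t^4 / (1 - t\<^sup>2)) (at t)"
      unfolding g_def[abs_def] using nz
      by (auto intro!: derivative_eq_intros simp: divide_simps) (auto simp: algebra_simps power2_eq_square power4_eq_xxxx)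
    moreover have "2 * t^4 / (1 - t\<^sup>2) \<ge> 0" using nz by simp
    ultimately show "\<exists>y. (g has_field_derivative y) (at t) \<and> 0 \<le> y" by blast
  qed (use assms in auto)
  moreover have "g 0 = 0" by (simp add: g_def)
  ultimately have "0 \<le> g s" by simp
  then show "2 * s + 2 * s^3 / 3 \<le> - ln ((1 - s) / (1 + s))" unfolding g_def by linarith
qed

text \<open>With \<open>t = 1 / (1 - s\<^sup>2)\<close>, the bound for the logarithm leaves the quadratic
  \<open>(4/3) t\<^sup>2 - t + 2/3\<close>, which has no real root.\<close>
lemma flux'_pos:
  assumes "\<bar>s\<bar> < 1" shows "flux' s > 0"
proof -
  have pos: "flux' s > 0" if s: "0 < s" "s < 1" for s
  proof -
    define t where "t = 1 / (1 - s\<^sup>2)"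
    have z: "1 - s\<^sup>2 > 0" using s by (simp add: abs_square_less_1)
    have "2 / s\<^sup>2 + 2 / 3 \<le> - ln ((1 - s) / (1 + s)) / s^3"
    proof -
      have "(2 * s + 2 * s^3 / 3) / s^3 \<le> - ln ((1 - s) / (1 + s)) / s^3"
        using artanh_lower_bound[OF s] s by (intro divide_right_mono) auto
      moreover have "(2 * s + 2 * s^3 / 3) / s^3 = 2 / s\<^sup>2 + 2 / 3"
        using s by (simp add: field_simps power2_eq_square power3_eq_cube)
      ultimately show ?thesis by simp
    qed
    moreover have "1 / (s\<^sup>2 * (1 - s\<^sup>2)) = 1 / s\<^sup>2 + t"
      using z s by (simp add: t_def field_simps)
    moreover have "4 / 3 * (1 + s\<^sup>2) / (1 - s\<^sup>2)\<^sup>2 = 4 / 3 * (t * t) + 4 / 3 * s\<^sup>2 * (t * t)"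
      by (simp add: t_def power2_eq_square add_divide_distrib distrib_left)
    moreover have "4 / 3 * s\<^sup>2 * (t * t) \<ge> 0" by simp
    moreover have "4 / 3 * (t * t) - t + 2 / 3 > 0"
    proof -
      have "4 / 3 * (t * t) - t + 2 / 3 = 4 / 3 * (t - 3 / 8)\<^sup>2 + (2 / 3 - 3 / 16)" by (simp add: power2_eq_square algebra_simps)
      then show ?thesis by (simp add: add_nonneg_pos)
    qed
    ultimately have "- 1 / s\<^sup>2 - ln ((1 - s) / (1 + s)) / s^3 - 1 / (s\<^sup>2 * (1 - s\<^sup>2)) + 4 / 3 * (1 + s\<^sup>2) / (1 - s\<^sup>2)\<^sup>2 > 0"
      by (simp add: algebra_simps)
    then show ?thesis using s by (simp add: flux'_def)
  qed
  have even: "flux' (- s) = flux' s" if "\<bar>s\<bar> < 1" for s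
  proof -
    have "ln ((1 + s) / (1 - s)) = - ln ((1 - s) / (1 + s))"
      using that by (simp add: ln_div abs_less_iff)
    then show ?thesis by (simp add: flux'_def)
  qed
  consider "s = 0" | "s > 0" | "s < 0" by linarith
  then show ?thesis
  proof cases
    case 1 then show ?thesis by (simp add: flux'_def)
  next
    case 2 then show ?thesis using pos assms by simp
  next
    case 3 then show ?thesis using pos[of "- s"] even[of s] assms by simp
  qed
qed

lemma flux_less: assumes "-1 < a" "a < b" "b < 1" shows "flux a < flux b"
proof (rule DERIV_pos_imp_increasing[OF assms(2)])
  fix x assume "a \<le> x" "x \<le> b"
  then have "\<bar>x\<bar> < 1" using assms by auto
  then show "\<exists>y. (flux has_field_derivative y) (at x) \<and> y > 0" using DERIV_flux flux'_pos by blast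
qed

lemma flux_inj: "\<bar>a\<bar> < 1 \<Longrightarrow> \<bar>b\<bar> < 1 \<Longrightarrow> flux a = flux b \<Longrightarrow> a = b"
  using flux_less[of a b] flux_less[of b a] by (cases a b rule: linorder_cases) (auto simp: abs_less_iff)

lemma flux_surj: "\<exists>s. \<bar>s\<bar> < 1 \<and> flux s = y"
proof -
  have nonneg: "\<exists>s. \<bar>s\<bar> < 1 \<and> flux s = y" if y: "y \<ge> 0" for y
  proof -
    have "filterlim flux at_top (at_left 1)" unfolding flux_def[abs_def] by real_asymp
    then have "\<forall>\<^sub>F s in at_left 1. flux s \<ge> y" by (simp add: filterlim_at_top)
    moreover have "\<forall>\<^sub>F s in at_left (1::real). s \<in> {0<..<1}" by (rule eventually_at_left_real) simp
    ultimately have "\<forall>\<^sub>F s in at_left 1. flux s \<ge> y \<and> s \<in> {0<..<1}" by (rule eventually_conj)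
    then have "\<exists>s. flux s \<ge> y \<and> s \<in> {0<..<1}" by (rule eventually_happens'[rotated]) simp
    then obtain s1 where s1: "flux s1 \<ge> y" "0 < s1" "s1 < 1" by auto
    have "\<exists>s\<ge>0. s \<le> s1 \<and> flux s = y"
    proof (rule IVT)
      show "\<forall>x. 0 \<le> x \<and> x \<le> s1 \<longrightarrow> isCont flux x"
        using s1 by (auto intro!: DERIV_isCont[OF DERIV_flux])
    qed (use s1 y in auto)
    then obtain s where "0 \<le> s" "s \<le> s1" "flux s = y" by blast
    then show ?thesis using s1 by (intro exI[of _ s]) auto
  qed
  show ?thesis
  proof (cases "y \<ge> 0")
    case True then show ?thesis by (rule nonneg)
  next
    case False
    then obtain s where "\<bar>s\<bar> < 1" "flux s = - y" using nonneg[of "- y"] by auto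
    then show ?thesis using flux_minus[of s] by (intro exI[of _ "- s"]) auto
  qed
qed

definition strength_param :: "real \<Rightarrow> real" where
  "strength_param y = (SOME s. \<bar>s\<bar> < 1 \<and> flux s = y)"

lemma strength_param: "\<bar>strength_param y\<bar> < 1" "flux (strength_param y) = y"
  using someI_ex[OF flux_surj[of y]] by (auto simp: strength_param_def)

lemma strength_param_flux: "\<bar>s\<bar> < 1 \<Longrightarrow> strength_param (flux s) = s"
  using flux_inj strength_param by blast

lemma strength_param_0 [simp]: "strength_param 0 = 0"
  using strength_param_flux[of 0] by simp

lemma strength_param_pos: "y > 0 \<Longrightarrow> strength_param y > 0"
proof (rule ccontr)
  assume y: "y > 0" and "\<not> strength_param y > 0"
  then consider "strength_param y < 0" | "strength_param y = 0" by linarith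
  then show False
  proof cases
    case 1
    then show ?thesis using flux_less[of "strength_param y" 0] strength_param[of y] y by (auto simp: abs_less_iff)
  next
    case 2
    then show ?thesis using strength_param(2)[of y] y by simp
  qed
qed

lemma strength_param_nonneg: "y \<ge> 0 \<Longrightarrow> strength_param y \<ge> 0"
  using strength_param_pos[of y] by (cases "y = 0") auto

lemma DERIV_strength_param:
  "(strength_param has_field_derivative inverse (flux' (strength_param y))) (at y)"
proof -
  let ?s = "strength_param y"
  have s: "\<bar>?s\<bar> < 1" by (rule strength_param)
  define d where "d = (1 - \<bar>?s\<bar>) / 2"
  have d: "d > 0" "\<bar>z\<bar> < 1" if "\<bar>z - ?s\<bar> \<le> d" for z
    using s that unfolding d_def by (auto simp: abs_if split: if_splits)
  have d0: "d > 0" using s by (simp add: d_def)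
  have "isCont strength_param (flux ?s)"
    by (rule isCont_inverse_function[OF d0]) (use d strength_param_flux DERIV_isCont[OF DERIV_flux] in blast)+
  then have c: "isCont strength_param y" by (simp add: strength_param)
  show ?thesis
    by (rule DERIV_inverse_function[where f=flux and a="y - 1" and b="y + 1"])
       (use c s strength_param DERIV_flux flux'_pos in \<open>auto simp: less_imp_neq[symmetric]\<close>)
qed

section \<open>The vector parameter\<close>

definition ball_param :: "real^3 \<Rightarrow> real^3" where
  "ball_param b = (strength_param (norm b) / norm b) *\<^sub>R b"

definition flux_vec :: "real^3 \<Rightarrow> real^3" where
  "flux_vec \<sigma> = (flux (norm \<sigma>) / norm \<sigma>) *\<^sub>R \<sigma>"

lemma norm_ball_param: "norm (ball_param b) = strength_param (norm b)"
  using strength_param_nonneg[of "norm b"] by (auto simp: ball_param_def)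

lemma norm_ball_param_less: "norm (ball_param b) < 1"
  using strength_param(1)[of "norm b"] by (simp add: norm_ball_param)

lemma flux_vec_ball_param: "flux_vec (ball_param b) = b"
proof (cases "b = 0")
  case True then show ?thesis by (simp add: ball_param_def flux_vec_def)
next
  case False
  then have "strength_param (norm b) > 0" by (intro strength_param_pos) simp
  then show ?thesis using False
    by (simp add: flux_vec_def norm_ball_param strength_param(2)) (simp add: ball_param_def)
qed

lemma ball_param_flux_vec: assumes "norm \<sigma> < 1" shows "ball_param (flux_vec \<sigma>) = \<sigma>"
proof (cases "\<sigma> = 0")
  case True then show ?thesis by (simp add: ball_param_def flux_vec_def)
next
  case False
  then have f: "flux (norm \<sigma>) > 0" using flux_less[of 0 "norm \<sigma>"] assms by simp
  then have n: "norm (flux_vec \<sigma>) = flux (norm \<sigma>)" using False by (simp add: flux_vec_def)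
  have "strength_param (flux (norm \<sigma>)) = norm \<sigma>" by (rule strength_param_flux) (use assms in simp)
  then show ?thesis using f False by (simp add: ball_param_def n) (simp add: flux_vec_def)
qed

text \<open>Off the origin, all factors are differentiable. At the origin, \<open>g t / t\<close> tends to the slope \<open>m\<close>,
  so that the derivative is \<open>m\<close> times the identity.\<close>
lemma differentiable_radial_stretch:
  fixes g :: "real \<Rightarrow> real"
  assumes g0: "g 0 = 0" and g: "(g has_field_derivative m) (at (norm x))"
  shows "(\<lambda>x::real^3. (g (norm x) / norm x) *\<^sub>R x) differentiable (at x)"
proof (cases "x = 0")
  case True
  have lim: "((\<lambda>t. (g t - g 0) / t) \<longlongrightarrow> m) (at 0)" using g True by (simp add: DERIV_def)
  have "filterlim (norm :: real^3 \<Rightarrow> real) (at 0) (at 0)"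
    by (auto simp: filterlim_at eventually_at_filter intro!: tendsto_norm_zero tendsto_ident_at)
  from filterlim_compose[OF lim this]
  have "((\<lambda>h::real^3. g (norm h) / norm h) \<longlongrightarrow> m) (at 0)" by (simp add: g0)
  then have "((\<lambda>h::real^3. g (norm h) / norm h - m) \<longlongrightarrow> 0) (at 0)" by (rule LIM_zero)
  then have "((\<lambda>h::real^3. norm (g (norm h) / norm h - m)) \<longlongrightarrow> 0) (at 0)" by (rule tendsto_norm_zero)
  then have "((\<lambda>h::real^3. norm ((g (norm h) / norm h) *\<^sub>R h - m *\<^sub>R h) / norm h) \<longlongrightarrow> 0) (at 0)"
    by (rule tendsto_cong[THEN iffD1, rotated])
       (auto simp: eventually_at_filter simp flip: scaleR_diff_left intro!: always_eventually)
  then have "((\<lambda>x::real^3. (g (norm x) / norm x) *\<^sub>R x) has_derivative (\<lambda>h. m *\<^sub>R h)) (at 0)"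
    by (simp add: has_derivative_at bounded_linear_scaleR_right)
  then show ?thesis using True by (auto simp: differentiable_def)
next
  case False
  have "(\<lambda>x::real^3. g (norm x)) differentiable at x" by (rule differentiable_radial[OF g False])
  then show ?thesis using differentiable_norm[OF False] False
    by (intro differentiable_scaleR differentiable_divide) auto
qed

lemma differentiable_ball_param: "ball_param differentiable (at b)"
  unfolding ball_param_def[abs_def]
  by (rule differentiable_radial_stretch[OF strength_param_0 DERIV_strength_param])

lemma differentiable_flux_vec: "norm \<sigma> < 1 \<Longrightarrow> flux_vec differentiable (at \<sigma>)"
  unfolding flux_vec_def[abs_def]
  by (rule differentiable_radial_stretch[OF flux_0 DERIV_flux]) simp

text \<open>The two parametrizations are mutually inverse, hence so are their derivatives.\<close>
lemma param_derivatives: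
  obtains E E' where "(ball_param has_derivative E) (at b)" "(flux_vec has_derivative E') (at (ball_param b))"
    "\<And>c. E' (E c) = c" "\<And>d. E (E' d) = d"
proof -
  obtain E where E: "(ball_param has_derivative E) (at b)"
    using differentiable_ball_param by (auto simp: differentiable_def)
  obtain E' where E': "(flux_vec has_derivative E') (at (ball_param b))"
    using differentiable_flux_vec[OF norm_ball_param_less] by (auto simp: differentiable_def)
  have "((\<lambda>x. flux_vec (ball_param x)) has_derivative (\<lambda>c. E' (E c))) (at b)"
    by (rule has_derivative_compose[OF E E'])
  then have "((\<lambda>x. x) has_derivative (\<lambda>c. E' (E c))) (at b)" by (simp add: flux_vec_ball_param)
  from has_derivative_unique[OF this has_derivative_ident] have 1: "E' (E c) = c" for c by metis
  have E2: "(ball_param has_derivative E) (at (flux_vec (ball_param b)))" using E by (simp add: flux_vec_ball_param)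
  have "((\<lambda>x. ball_param (flux_vec x)) has_derivative (\<lambda>c. E (E' c))) (at (ball_param b))"
    by (rule has_derivative_compose[OF E' E2])
  then have "((\<lambda>x. x) has_derivative (\<lambda>c. E (E' c))) (at (ball_param b))"
    by (rule has_derivative_transform_within_open[of _ _ _ _ "ball 0 1"])
       (use norm_ball_param_less ball_param_flux_vec in auto)
  from has_derivative_unique[OF this has_derivative_ident] have 2: "E (E' c) = c" for c by metis
  show thesis by (rule that[OF E E' 1 2])
qed

section \<open>Landau solutions in vector form\<close>

lemma cos_polar_angle: assumes "y \<noteq> 0" shows "cos (polar_angle y) = y $ 3 / norm y"
proof -
  have "y $ 3 = norm y * cos (polar_angle y)" using arg_cong[OF spherical_coordinates[of y], of "\<lambda>v. v $ 3"] by (simp add: vector_3)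
  then show ?thesis using assms by simp
qed

text \<open>This relation replaces the unit vector \<open>e\<^sub>\<phi>\<close>, singular on the axis, by the constant vector \<open>e\<^sub>3\<close>.\<close>
lemma sin_e_phi:
  assumes "y \<noteq> 0" shows "sin (polar_angle y) *\<^sub>R e_phi y = (y $ 3 / norm y) *\<^sub>R e_r y - axis 3 1"
proof -
  define st ct sa ca where "st = sin (polar_angle y)" and "ct = cos (polar_angle y)"
    and "sa = sin (azimuth y)" and "ca = cos (azimuth y)"
  have y: "y $ 1 = norm y * st * ca" "y $ 2 = norm y * st * sa" "y $ 3 = norm y * ct"
    using arg_cong[OF spherical_coordinates[of y], of "\<lambda>v. v $ 1"]
      arg_cong[OF spherical_coordinates[of y], of "\<lambda>v. v $ 2"]
      arg_cong[OF spherical_coordinates[of y], of "\<lambda>v. v $ 3"]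
    by (simp_all add: vector_3 st_def ct_def sa_def ca_def)
  have e: "e_r y $ 1 = st * ca" "e_r y $ 2 = st * sa" "e_r y $ 3 = ct" "y $ 3 / norm y = ct"
    using assms by (simp_all add: e_r_def y)
  have a: "sa * sa + ca * ca = 1" "st * st + ct * ct = 1"
    by (simp_all add: sa_def ca_def st_def ct_def flip: power2_eq_square)
  have "st * (sa * (st * sa)) + st * (ca * (st * ca)) = st * st * (sa * sa + ca * ca)" by (simp add: algebra_simps)
  also have "\<dots> = 1 - ct * ct" using a by (simp add: algebra_simps)
  finally have f: "st * (sa * (st * sa)) + st * (ca * (st * ca)) = 1 - ct * ct" .
  show ?thesis
    unfolding vec_eq_iff forall_3 e(4) e_phi_def e_theta_def cross3_def st_def[symmetric] sa_def[symmetric] ca_def[symmetric]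
    using f by (simp add: vector_3 e(1-3) axis_def algebra_simps)
qed

lemma landau_axis_vel_ball:
  assumes y: "y \<noteq> 0" and a: "a > 1"
  shows "landau_axis_vel (ereal a) y = ball_vel ((1 / a) *\<^sub>R axis 3 1) y"
proof -
  let ?c = "y $ 3 / norm y"
  have r: "norm y > 0" using y by simp
  have "\<bar>?c\<bar> \<le> 1" using component_le_norm_cart[of y 3] r by simp
  then have ac: "a - ?c > 0" using a by linarith
  have "landau_axis_vel (ereal a) y = (2 / norm y * ((a\<^sup>2 - 1) / (a - ?c)\<^sup>2 - 1)) *\<^sub>R e_r y
    - (2 / (norm y * (a - ?c))) *\<^sub>R (sin (polar_angle y) *\<^sub>R e_phi y)"
    by (simp add: landau_axis_vel_def Let_def cos_polar_angle[OF y])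
  also have "\<dots> = (2 / norm y * ((a\<^sup>2 - 1) / (a - ?c)\<^sup>2 - 1) - 2 / (norm y * (a - ?c)) * ?c) *\<^sub>R e_r y + (2 / (norm y * (a - ?c))) *\<^sub>R axis 3 1"
    unfolding sin_e_phi[OF y] by (simp add: algebra_simps)
  also have "2 / norm y * ((a\<^sup>2 - 1) / (a - ?c)\<^sup>2 - 1) - 2 / (norm y * (a - ?c)) * ?c
    = 2 * (a\<^sup>2 - 1) / (norm y * (a - ?c)\<^sup>2) - 2 * a / (norm y * (a - ?c))"
  proof -
    have "2 / r * ((a\<^sup>2 - 1) / (a - c)\<^sup>2 - 1) - 2 / (r * (a - c)) * c = 2 * (a\<^sup>2 - 1) / (r * (a - c)\<^sup>2) - 2 * a / (r * (a - c))"
      if "r > 0" "a - c > 0" for r c :: real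
    proof -
      have "2 / r + 2 / (r * (a - c)) * c = 2 * a / (r * (a - c))" using that by (simp add: divide_simps)
      moreover have "2 / r * ((a\<^sup>2 - 1) / (a - c)\<^sup>2 - 1) = 2 * (a\<^sup>2 - 1) / (r * (a - c)\<^sup>2) - 2 / r"
        by (simp add: right_diff_distrib diff_divide_distrib)
      ultimately show ?thesis by simp
    qed
    from this[OF r ac] show ?thesis .
  qed
  finally have 1: "landau_axis_vel (ereal a) y = (2 * (a\<^sup>2 - 1) / (norm y * (a - ?c)\<^sup>2) - 2 * a / (norm y * (a - ?c))) *\<^sub>R e_r y
      + (2 / (norm y * (a - ?c))) *\<^sub>R axis 3 1" .
  have d: "norm y - ((1 / a) *\<^sub>R axis 3 1) \<bullet> y = norm y * (a - ?c) / a"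
    using a r by (simp add: inner_axis' field_simps)
  have s: "((1 / a) *\<^sub>R axis 3 1) \<bullet> ((1 / a) *\<^sub>R axis 3 (1::real) :: real^3) = 1 / a\<^sup>2"
    by (simp add: inner_axis_axis power2_eq_square)
  have "ball_vel ((1 / a) *\<^sub>R axis 3 1) y = (2 * (a\<^sup>2 - 1) / (norm y * (a - ?c)\<^sup>2)) *\<^sub>R e_r y
     - (2 * a / (norm y * (a - ?c))) *\<^sub>R (e_r y - (1 / a) *\<^sub>R axis 3 1)"
  proof -
    have "(2 * (1 - 1 / a\<^sup>2) / (norm y * (a - ?c) / a)\<^sup>2) *\<^sub>R y = (2 * (a\<^sup>2 - 1) / (norm y * (a - ?c)\<^sup>2)) *\<^sub>R e_r y"
    proof -
      have "2 * (1 - 1 / a\<^sup>2) / (norm y * (a - ?c) / a)\<^sup>2 = 2 * (a\<^sup>2 - 1) / (norm y * (a - ?c)\<^sup>2) * (1 / norm y)"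
      proof -
        have "2 * (1 - 1 / a\<^sup>2) = 2 * (a\<^sup>2 - 1) / a\<^sup>2" using a by (simp add: field_simps)
        then show ?thesis using a r ac by (simp add: power_divide power_mult_distrib power2_eq_square)
      qed
      then show ?thesis by (simp add: e_r_def divide_inverse)
    qed
    then show ?thesis unfolding ball_vel_def d s e_r_def using a by simp
  qed
  then show ?thesis unfolding 1 using a by (simp add: algebra_simps)
qed

lemma landau_axis_pressure_ball:
  assumes y: "y \<noteq> 0" and a: "a > 1"
  shows "landau_axis_pressure (ereal a) y = ball_pressure ((1 / a) *\<^sub>R axis 3 1) y"
proof -
  let ?c = "y $ 3 / norm y"
  have r: "norm y > 0" using y by simp
  have "\<bar>?c\<bar> \<le> 1" using component_le_norm_cart[of y 3] r by simp
  then have ac: "a - ?c > 0" using a by linarith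
  have d: "norm y - ((1 / a) *\<^sub>R axis 3 1) \<bullet> y = norm y * (a - ?c) / a"
    using a r by (simp add: inner_axis' field_simps)
  have s: "((1 / a) *\<^sub>R axis 3 1) \<bullet> ((1 / a) *\<^sub>R axis 3 (1::real) :: real^3) = 1 / a\<^sup>2"
    by (simp add: inner_axis_axis power2_eq_square)
  have t: "((1 / a) *\<^sub>R axis 3 1) \<bullet> y / norm y = ?c / a" by (simp add: inner_axis')
  have "ball_pressure ((1 / a) *\<^sub>R axis 3 1) y = 4 * (?c / a - 1 / a\<^sup>2) / (norm y * (a - ?c) / a)\<^sup>2"
    unfolding ball_pressure_def d s t ..
  also have "?c / a - 1 / a\<^sup>2 = (a * ?c - 1) / a\<^sup>2" using a by (simp add: field_simps power2_eq_square)
  finally show ?thesis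
    using a by (simp add: landau_axis_pressure_def Let_def cos_polar_angle[OF y] power_divide power_mult_distrib)
qed

lemma landau_param_0: "landau_param 0 = \<infinity>"
proof -
  have "0 = landau_beta \<infinity>" by (simp add: landau_beta_def)
  then have "0 \<in> landau_beta ` {1<..}" by (rule image_eqI) simp
  then have i: "landau_param 0 \<in> {1<..}" "landau_beta (landau_param 0) = 0"
    unfolding landau_param_def by (rule inv_into_into, rule f_inv_into_f)
  show ?thesis
  proof (cases "landau_param 0")
    case (real a)
    then have a: "a > 1" using i(1) by (simp add: one_ereal_def)
    then have "flux (1 / a) = 0" using i(2) landau_beta_flux real by simp
    moreover have "flux (1 / a) > 0" using flux_less[of 0 "1 / a"] a by simp
    ultimately show ?thesis by simp
  qed (use i in auto)
qed

lemma landau_param_pos: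
  assumes "t > 0" 
  obtains a where "landau_param t = ereal a" "a > 1" "1 / a = strength_param t"
proof -
  let ?s = "strength_param t"
  have s: "0 < ?s" "?s < 1" using strength_param_pos[OF assms] strength_param(1)[of t] by auto
  then have "t = landau_beta (ereal (1 / ?s))" using landau_beta_flux[of "1 / ?s"] strength_param(2)[of t] by simp
  then have "t \<in> landau_beta ` {1<..}" by (rule image_eqI) (use s in \<open>simp add: one_ereal_def\<close>)
  then have i: "landau_param t \<in> {1<..}" "landau_beta (landau_param t) = t"
    unfolding landau_param_def by (rule inv_into_into, rule f_inv_into_f)
  show thesis
  proof (cases "landau_param t")
    case (real a)
    then have a: "a > 1" using i(1) by (simp add: one_ereal_def)
    then have "flux (1 / a) = t" using i(2) landau_beta_flux real by simp
    then have "1 / a = ?s" using strength_param_flux[of "1 / a"] a by auto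
    then show thesis using that real a by blast
  next
    case PInf then show thesis using i(2) assms by (simp add: landau_beta_def)
  next
    case MInf then show thesis using i(1) by simp
  qed
qed

lemma landau_rot:
  assumes "b \<noteq> 0"
  shows "orthogonal_matrix (landau_rot b)" "landau_rot b *v axis 3 1 = b /\<^sub>R norm b"
proof -
  have "norm (axis 3 1 :: real^3) = norm (b /\<^sub>R norm b)" using assms by (simp add: norm_axis_1)
  then have "\<exists>Q. rotation_matrix Q \<and> Q *v axis 3 1 = b /\<^sub>R norm b"
  proof -
    assume n: "norm (axis 3 1 :: real^3) = norm (b /\<^sub>R norm b)"
    obtain f where f: "orthogonal_transformation f" "det (matrix f) = 1" "f (axis 3 1) = b /\<^sub>R norm b"
      by (rule rotation_exists[OF _ n]) auto
    then have "rotation_matrix (matrix f)" "matrix f *v axis 3 1 = b /\<^sub>R norm b"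
      by (auto simp: rotation_matrix_def orthogonal_transformation_matrix matrix_works orthogonal_transformation_linear)
    then show ?thesis by blast
  qed
  from someI_ex[OF this] show "orthogonal_matrix (landau_rot b)" "landau_rot b *v axis 3 1 = b /\<^sub>R norm b"
    by (auto simp: landau_rot_def rotation_matrix_def)
qed

lemma ball_vel_rotate:
  assumes "orthogonal_matrix Q"
  shows "Q *v ball_vel \<sigma> (transpose Q *v x) = ball_vel (Q *v \<sigma>) x"
    "ball_pressure \<sigma> (transpose Q *v x) = ball_pressure (Q *v \<sigma>) x"
proof -
  have QQ: "Q ** transpose Q = mat 1" "transpose Q ** Q = mat 1" using assms by (auto simp: orthogonal_matrix_def)
  have Q: "Q *v (transpose Q *v x) = x" "transpose Q *v (Q *v x) = x" for x
    by (simp_all only: matrix_vector_mul_assoc QQ matrix_vector_mul_lid)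
  have i: "\<sigma> \<bullet> (transpose Q *v x) = (Q *v \<sigma>) \<bullet> x" for \<sigma> x
    using dot_lmul_matrix[of x Q \<sigma>] by (simp add: inner_commute)
  have n: "norm (transpose Q *v x) = norm x" for x
    unfolding norm_eq_sqrt_inner i Q ..
  have nn: "(Q *v \<sigma>) \<bullet> (Q *v \<sigma>) = \<sigma> \<bullet> \<sigma>"
    unfolding i[symmetric] Q ..
  show "Q *v ball_vel \<sigma> (transpose Q *v x) = ball_vel (Q *v \<sigma>) x"
    unfolding ball_vel_def n i nn matrix_vector_mult_diff_distrib matrix_vector_mult_scaleR Q ..
  show "ball_pressure \<sigma> (transpose Q *v x) = ball_pressure (Q *v \<sigma>) x"
    unfolding ball_pressure_def n i nn ..
qed

text \<open>The closed form is covariant under rotations, so it suffices to compare for \<open>\<sigma>\<close> on the third axis.\<close>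
theorem landau_vel_ball:
  assumes x: "x \<noteq> 0"
  shows "landau_vel b x = ball_vel (ball_param b) x" "landau_pressure b x = ball_pressure (ball_param b) x"
proof -
  have "landau_vel b x = ball_vel (ball_param b) x \<and> landau_pressure b x = ball_pressure (ball_param b) x"
  proof (cases "b = 0")
    case True
    then show ?thesis using x
      by (simp add: landau_vel_def landau_pressure_def landau_param_0 landau_axis_vel_def landau_axis_pressure_def
          ball_param_def ball_vel_def ball_pressure_def power2_eq_square divide_inverse)
  next
    case False
    obtain a where a: "landau_param (norm b) = ereal a" "a > 1" "1 / a = strength_param (norm b)"
      using landau_param_pos[of "norm b"] False by auto
    let ?Q = "landau_rot b"
    note Q = landau_rot[OF False]
    have "?Q ** transpose ?Q = mat 1" using Q(1) by (simp add: orthogonal_matrix_def)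
    then have "?Q *v (transpose ?Q *v x) = x" by (simp only: matrix_vector_mul_assoc matrix_vector_mul_lid)
    then have y: "transpose ?Q *v x \<noteq> 0" using x by (metis matrix_vector_mult_0_right)
    have p: "?Q *v ((1 / a) *\<^sub>R axis 3 1) = ball_param b"
      unfolding matrix_vector_mult_scaleR Q(2) a(3) ball_param_def by (simp add: divide_inverse)
    show ?thesis
      unfolding landau_vel_def landau_pressure_def a(1) landau_axis_vel_ball[OF y a(2)] landau_axis_pressure_ball[OF y a(2)]
        ball_vel_rotate[OF Q(1)] p by simp
  qed
  then show "landau_vel b x = ball_vel (ball_param b) x" "landau_pressure b x = ball_pressure (ball_param b) x" by auto
qed

section \<open>Spherical integrals\<close>

lemma integrand_sphere_area:
  "(\<integral>\<^sup>+x. ennreal (4 * pi * x\<^sup>2 * indicator {0..} x) * indicator {..r} x \<partial>lborel) = ennreal (4 / 3 * pi * (max 0 r) ^ 3)"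
proof (cases "r \<ge> 0")
  case True
  have "(\<integral>\<^sup>+x. ennreal (4 * pi * x\<^sup>2 * indicator {0..} x) * indicator {..r} x \<partial>lborel)
     = (\<integral>\<^sup>+x. ennreal (4 * pi * x\<^sup>2) * indicator {0..r} x \<partial>lborel)"
    by (intro nn_integral_cong) (auto simp: indicator_def)
  also have "\<dots> = ennreal (4 / 3 * pi * r ^ 3 - 4 / 3 * pi * 0 ^ 3)"
  proof (rule nn_integral_FTC_Icc)
    show "((\<lambda>x. 4 / 3 * pi * x ^ 3) has_field_derivative 4 * pi * x\<^sup>2) (at x)" for x :: real
      by (auto intro!: derivative_eq_intros)
  qed (use True in auto)
  finally show ?thesis using True by (simp add: max_def)
next
  case False
  have "(\<integral>\<^sup>+x. ennreal (4 * pi * x\<^sup>2 * indicator {0..} x) * indicator {..r} x \<partial>lborel) = (\<integral>\<^sup>+x. 0 \<partial>(lborel :: real measure))"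
    by (intro nn_integral_cong) (use False in \<open>auto simp: indicator_def\<close>)
  then show ?thesis using False by (simp add: max_def)
qed

text \<open>Polar coordinates for functions of \<open>|x|\<close>: both measures give balls their volume.\<close>
lemma distr_norm_lborel:
  "distr lborel borel (norm :: real^3 \<Rightarrow> real) = density lborel (\<lambda>r. ennreal (4 * pi * r\<^sup>2 * indicator {0..} r))"
proof (rule measure_eqI_generator_eq[where E="range atMost" and \<Omega>=UNIV and A="\<lambda>i. {..real i}"])
  show "Int_stable (range (atMost :: real \<Rightarrow> real set))" by (auto simp: Int_stable_def)
  have s: "sets borel = sigma_sets UNIV (range (atMost :: real \<Rightarrow> real set))"
    unfolding borel_eq_atMost by (simp add: image_def)
  show "sets (distr lborel borel (norm :: real^3 \<Rightarrow> real)) = sigma_sets UNIV (range atMost)" using s by simp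
  show "sets (density lborel (\<lambda>r. ennreal (4 * pi * r\<^sup>2 * indicator {0..} r))) = sigma_sets UNIV (range atMost)" using s by simp
  have e: "emeasure (distr lborel borel (norm :: real^3 \<Rightarrow> real)) {..r} = ennreal (4 / 3 * pi * (max 0 r) ^ 3)" for r
  proof -
    have "emeasure (distr lborel borel (norm :: real^3 \<Rightarrow> real)) {..r} = emeasure lborel (cball (0::real^3) r)"
      by (subst emeasure_distr) (auto intro!: arg_cong[where f="emeasure lborel"])
    also have "\<dots> = ennreal (4 / 3 * pi * (max 0 r) ^ 3)"
    proof (cases "r \<ge> 0")
      case True
      then show ?thesis by (simp add: emeasure_cball max_def unit_ball_vol_numeral fact_numeral)
    next
      case False then show ?thesis by (simp add: max_def)
    qed
    finally show ?thesis .
  qed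
  show "emeasure (distr lborel borel (norm :: real^3 \<Rightarrow> real)) X = emeasure (density lborel (\<lambda>r. ennreal (4 * pi * r\<^sup>2 * indicator {0..} r))) X"
    if "X \<in> range atMost" for X
  proof -
    from that obtain r where X: "X = {..r}" by (rule rangeE)
    show ?thesis unfolding X e by (subst emeasure_density) (simp_all add: integrand_sphere_area)
  qed
  show "emeasure (distr lborel borel (norm :: real^3 \<Rightarrow> real)) {..real i} \<noteq> \<infinity>" for i unfolding e by simp
  show "(\<Union>i. {..real i}) = UNIV" using real_arch_simple by auto
qed auto

lemma nn_integral_radial:
  assumes "h \<in> borel_measurable borel"
  shows "(\<integral>\<^sup>+x. h (norm (x::real^3)) \<partial>lborel) = (\<integral>\<^sup>+r. ennreal (4 * pi * r\<^sup>2 * indicator {0..} r) * h r \<partial>lborel)"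
proof -
  have "(\<integral>\<^sup>+x. h (norm (x::real^3)) \<partial>lborel) = (\<integral>\<^sup>+r. h r \<partial>distr lborel borel (norm :: real^3 \<Rightarrow> real))"
    by (subst nn_integral_distr) (use assms in auto)
  also have "\<dots> = (\<integral>\<^sup>+r. ennreal (4 * pi * r\<^sup>2 * indicator {0..} r) * h r \<partial>lborel)"
    unfolding distr_norm_lborel by (subst nn_integral_density) (use assms in auto)
  finally show ?thesis .
qed

text \<open>For \<open>g\<close> constant along rays, this is the integral of \<open>g\<close> over the unit sphere: the shells of
  radius \<open>r\<close> have area proportional to \<open>r\<^sup>2\<close>, and \<open>30 bump 1 2\<close> has integral \<open>1\<close>. Spreading the sphere
  over a shell makes integration by parts in space available.\<close>
definition sph :: "(real^3 \<Rightarrow> real) \<Rightarrow> real" where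
  "sph g = (LINT x|lborel. 30 * bump 1 2 (norm x) * inv_sq x * g x)"

lemma sph_integrand_0: "norm x \<le> 1 \<or> 2 \<le> norm x \<Longrightarrow> 30 * bump 1 2 (norm x) * inv_sq x * g x = 0"
  using bump_eq_0[of 1 2 "norm x"] by simp

lemma continuous_bump_norm: "continuous_on S (\<lambda>x::real^3. bump 1 2 (norm x))"
  by (rule continuous_on_compose2[OF continuous_bump]) (auto intro: continuous_intros)

lemma sph_continuous:
  assumes "continuous_on (-{0}) g"
  shows "continuous_on UNIV (\<lambda>x. 30 * bump 1 2 (norm x) * inv_sq x * g x)"
proof (rule continuous_on_extend_0[where a=1])
  show "continuous_on (-{0}) (\<lambda>x. 30 * bump 1 2 (norm x) * inv_sq x * g x)"
    using smooth_on_continuous[OF smooth_inverse_norm_sq] assms by (intro continuous_intros continuous_bump_norm)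
  show "30 * bump 1 2 (norm x) * inv_sq x * g x = 0" if "norm x < 1" for x
    by (rule sph_integrand_0) (use that in auto)
qed simp

lemma sph_integrable:
  assumes "continuous_on (-{0}) g"
  shows "integrable lborel (\<lambda>x. 30 * bump 1 2 (norm x) * inv_sq x * g x)"
  by (rule integrable_continuous_bounded_support[OF sph_continuous[OF assms], of 2]) (rule sph_integrand_0, simp)

lemma sph_cong: "(\<And>x. x \<noteq> 0 \<Longrightarrow> f x = g x) \<Longrightarrow> sph f = sph g"
  unfolding sph_def by (rule Bochner_Integration.integral_cong[OF refl]) (metis sph_integrand_0 norm_zero zero_le_one)

lemma sph_add:
  assumes "continuous_on (-{0}) f" "continuous_on (-{0}) g"
  shows "sph (\<lambda>x. f x + g x) = sph f + sph g"
  unfolding sph_def distrib_left by (rule Bochner_Integration.integral_add[OF sph_integrable[OF assms(1)] sph_integrable[OF assms(2)]])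

lemma sph_cmult: "sph (\<lambda>x. c * f x) = c * sph f"
proof -
  have "(\<lambda>x. 30 * bump 1 2 (norm x) * inv_sq x * (c * f x)) = (\<lambda>x. c * (30 * bump 1 2 (norm x) * inv_sq x * f x))"
    by (simp add: fun_eq_iff)
  then show ?thesis unfolding sph_def by (simp only: Bochner_Integration.integral_mult_right_zero)
qed

lemma sph_diff:
  assumes "continuous_on (-{0}) f" "continuous_on (-{0}) g"
  shows "sph (\<lambda>x. f x - g x) = sph f - sph g"
  using sph_add[OF assms(1), of "\<lambda>x. (-1) * g x"] sph_cmult[of "-1" g] assms(2) by (simp add: continuous_intros)

lemma sph_sum:
  assumes "\<And>j. j \<in> A \<Longrightarrow> continuous_on (-{0}) (f j)" "finite A"
  shows "sph (\<lambda>x. \<Sum>j\<in>A. f j x) = (\<Sum>j\<in>A. sph (f j))"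
  using assms(2,1)
proof (induction A)
  case empty then show ?case by (simp add: sph_def)
next
  case (insert a A)
  then show ?case by (simp add: sph_add continuous_on_sum)
qed

lemma integral_bump: "((\<lambda>r. 30 * bump 1 2 r) has_integral 1) {1..2}"
proof -
  have "((\<lambda>r. 30 * ((r - 1) * (2 - r))\<^sup>2) has_integral ((6 * (2 - 1) ^ 5 - 15 * (2 - 1) ^ 4 + 10 * (2 - 1) ^ 3) - (6 * (1 - 1) ^ 5 - 15 * (1 - 1) ^ 4 + 10 * (1 - 1) ^ 3))) {1..(2::real)}"
  proof (rule fundamental_theorem_of_calculus)
    fix x :: real
    have "30 * (y * (1 - y))\<^sup>2 = 30 * y ^ 4 - 60 * y ^ 3 + 30 * y ^ 2" for y :: real
      by (simp add: power2_eq_square power3_eq_cube power4_eq_xxxx algebra_simps)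
    from this[of "x - 1"] have e: "30 * ((x - 1) * (2 - x))\<^sup>2 = 30 * (x - 1) ^ 4 - 60 * (x - 1) ^ 3 + 30 * (x - 1) ^ 2" by simp
    have "((\<lambda>x. 6 * (x - 1) ^ 5 - 15 * (x - 1) ^ 4 + 10 * (x - 1) ^ 3) has_field_derivative 30 * ((x - 1) * (2 - x))\<^sup>2) (at x)"
      unfolding e by (auto intro!: derivative_eq_intros)
    then show "((\<lambda>x. 6 * (x - 1) ^ 5 - 15 * (x - 1) ^ 4 + 10 * (x - 1) ^ 3) has_vector_derivative 30 * ((x - 1) * (2 - x))\<^sup>2) (at x within {1..2})"
      unfolding has_real_derivative_iff_has_vector_derivative by (rule has_vector_derivative_at_within)
  qed simp
  then have "((\<lambda>r. 30 * ((r - 1) * (2 - r))\<^sup>2) has_integral 1) {1..(2::real)}" by simp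
  then show ?thesis
    by (rule has_integral_eq[rotated]) (simp add: bump_def max_def)
qed

lemma sph_one: "sph (\<lambda>x. 1) = 4 * pi"
proof -
  have m: "(\<lambda>r. ennreal (30 * bump 1 2 r * (1 / r\<^sup>2))) \<in> borel_measurable borel"
    using borel_measurable_continuous_onI[OF continuous_bump[of 1 2]] by measurable
  have "(\<integral>\<^sup>+x. ennreal (30 * bump 1 2 (norm x) * inv_sq x * 1) \<partial>(lborel :: (real^3) measure))
    = (\<integral>\<^sup>+r. ennreal (4 * pi * r\<^sup>2 * indicator {0..} r) * ennreal (30 * bump 1 2 r * (1 / r\<^sup>2)) \<partial>lborel)"
    using nn_integral_radial[OF m] by (simp add: inv_sq_def)
  also have "\<dots> = (\<integral>\<^sup>+r. ennreal (4 * pi) * ennreal (30 * bump 1 2 r) \<partial>lborel)"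
  proof (rule nn_integral_cong)
    fix r :: real
    have "4 * pi * r\<^sup>2 * indicator {0..} r * (30 * bump 1 2 r * (1 / r\<^sup>2)) = 4 * pi * (30 * bump 1 2 r)"
      using bump_eq_0[of 1 2 r] by (cases "r > 0") (auto simp: indicator_def)
    then show "ennreal (4 * pi * r\<^sup>2 * indicator {0..} r) * ennreal (30 * bump 1 2 r * (1 / r\<^sup>2)) = ennreal (4 * pi) * ennreal (30 * bump 1 2 r)"
      by (simp add: bump_nonneg flip: ennreal_mult)
  qed
  also have "\<dots> = ennreal (4 * pi) * (\<integral>\<^sup>+r. ennreal (30 * bump 1 2 r) \<partial>lborel)"
    using borel_measurable_continuous_onI[OF continuous_bump[of 1 2]] by (intro nn_integral_cmult) measurable
  also have "(\<integral>\<^sup>+r. ennreal (30 * bump 1 2 r) \<partial>lborel) = ennreal 1"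
  proof (rule nn_integral_has_integral_lborel)
    show "(\<lambda>r. 30 * bump 1 2 r) \<in> borel_measurable borel"
      using borel_measurable_continuous_onI[OF continuous_bump[of 1 2]] by measurable
    show "((\<lambda>r. 30 * bump 1 2 r) has_integral 1) UNIV"
      by (rule has_integral_on_superset[OF integral_bump]) (auto simp: bump_eq_0)
  qed (simp add: bump_nonneg)
  finally have "(\<integral>\<^sup>+x. ennreal (30 * bump 1 2 (norm x) * inv_sq x * 1) \<partial>(lborel :: (real^3) measure)) = ennreal (4 * pi)" by simp
  note nn = this
  have i: "integrable lborel (\<lambda>x::real^3. 30 * bump 1 2 (norm x) * inv_sq x * 1)"
    by (rule sph_integrable) (rule continuous_on_const)
  have "sph (\<lambda>x. 1) = enn2real (\<integral>\<^sup>+x. ennreal (30 * bump 1 2 (norm x) * inv_sq x * 1) \<partial>(lborel :: (real^3) measure))"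
    unfolding sph_def
    by (rule integral_eq_nn_integral[OF borel_measurable_integrable[OF i]], rule AE_I2) (simp add: bump_nonneg inv_sq_def)
  then show ?thesis unfolding nn by simp
qed

lemma sph_bound:
  assumes g: "continuous_on (-{0}) g" and b: "\<And>x. x \<noteq> 0 \<Longrightarrow> \<bar>g x\<bar> \<le> c"
  shows "\<bar>sph g\<bar> \<le> 4 * pi * c"
proof -
  let ?k = "\<lambda>x::real^3. 30 * bump 1 2 (norm x) * inv_sq x"
  have k: "?k x \<ge> 0" for x by (simp add: bump_nonneg inv_sq_def)
  have "\<bar>sph g\<bar> \<le> (LINT x|lborel. \<bar>?k x * g x\<bar>)" unfolding sph_def by (rule integral_abs_bound)
  also have "\<dots> \<le> (LINT x|lborel. ?k x * c)"
  proof (rule integral_mono)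
    show "integrable lborel (\<lambda>x. \<bar>?k x * g x\<bar>)" using sph_integrable[OF g] by (rule integrable_abs)
    show "integrable lborel (\<lambda>x. ?k x * c)" by (rule sph_integrable) (rule continuous_on_const)
    show "\<bar>?k x * g x\<bar> \<le> ?k x * c" for x
    proof (cases "x = 0")
      case True
      have "bump 1 2 0 = 0" by (rule bump_eq_0) auto
      then show ?thesis using True by simp
    next
      case False
      have "\<bar>?k x * g x\<bar> = ?k x * \<bar>g x\<bar>" unfolding abs_mult[of "?k x"] abs_of_nonneg[OF k] ..
      then show ?thesis using mult_left_mono[OF b[OF False] k[of x]] by simp
    qed
  qed
  also have "\<dots> = 4 * pi * c" using sph_one sph_cmult[of c "\<lambda>x. 1"] by (simp add: sph_def mult.commute)
  finally show ?thesis .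
qed

text \<open>The radial weight of \<open>sph\<close> does not interact with tangential fields.\<close>
lemma sph_tangential_divergence:
  fixes Z :: "3 \<Rightarrow> real^3 \<Rightarrow> real"
  assumes "\<And>j. smooth_on (Z j) (-{0})" "\<And>x. x \<noteq> 0 \<Longrightarrow> (\<Sum>j\<in>UNIV. x $ j * Z j x) = 0"
    and "\<And>x. x \<noteq> 0 \<Longrightarrow> (\<Sum>j\<in>UNIV. partial j (Z j) x) = inv_sq x * g x"
  shows "sph g = 0"
proof -
  have "30 * bump 1 2 (norm x) * inv_sq x * g x = 30 * (bump 1 2 (norm x) * (\<Sum>j\<in>UNIV. partial j (Z j) x))" for x
  proof (cases "x = 0")
    case True
    have "bump 1 2 0 = 0" by (rule bump_eq_0) auto
    then show ?thesis using True by simp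
  qed (simp add: assms(3))
  then have "sph g = 30 * (LINT x|lborel. bump 1 2 (norm x) * (\<Sum>j\<in>UNIV. partial j (Z j) x))"
    unfolding sph_def by (simp only: Bochner_Integration.integral_mult_right_zero)
  then show ?thesis using integral_bump_times_divergence[of 1 2 Z] assms(1,2) by simp
qed

definition unit_comp :: "3 \<Rightarrow> real^3 \<Rightarrow> real" where
  "unit_comp i x = x $ i * inv_norm x"
definition height :: "real^3 \<Rightarrow> real^3 \<Rightarrow> real" where
  "height n x = (n \<bullet> x) * inv_norm x"

lemma smooth_unit_comp: "smooth_on (unit_comp i) (-{0})"
  unfolding unit_comp_def[abs_def] by (intro smooth_intros open_punctured smooth_inv_norm)

lemma smooth_height: "smooth_on (height n) (-{0})"
  unfolding height_def[abs_def] by (intro smooth_intros open_punctured smooth_inv_norm)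

lemma height_sum: "height n x = (\<Sum>i\<in>UNIV. n $ i * unit_comp i x)"
  by (simp add: height_def unit_comp_def inner_3 sum_3 algebra_simps)

lemma partial_unit_comp:
  "x \<noteq> 0 \<Longrightarrow> partial j (unit_comp i) x = (if j = i then inv_norm x else 0) - x $ i * x $ j * inv_sq x * inv_norm x"
  unfolding unit_comp_def[abs_def]
  by (simp add: smooth_partial_mult[OF smooth_on_component smooth_inv_norm] partial_component partial_inv_norm)

lemma homogeneous_unit_comp: "homogeneous 0 (unit_comp i)"
  unfolding unit_comp_def[abs_def] using homogeneous_mult[OF homogeneous_component homogeneous_inv_norm] by simp

lemma laplacian_unit_comp:
  assumes x: "x \<noteq> 0" shows "laplacian (unit_comp i) x = - 2 * inv_sq x * unit_comp i x"
  unfolding unit_comp_def[abs_def] laplacian_component_mult[OF smooth_inv_norm x] laplacian_inv_norm[OF x] partial_inv_norm[OF x]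
  by simp

lemma partial_height: "x \<noteq> 0 \<Longrightarrow> partial j (height n) x = n $ j * inv_norm x - (n \<bullet> x) * x $ j * inv_sq x * inv_norm x"
  unfolding height_def[abs_def]
  by (simp add: smooth_partial_mult[OF smooth_inner[OF open_punctured] smooth_inv_norm] partial_inner partial_inv_norm)

lemma gradients_height_unit_comp:
  assumes x: "x \<noteq> 0"
  shows "(\<Sum>j\<in>UNIV. partial j (height n) x * partial j (unit_comp i) x) = inv_sq x * (n $ i - height n x * unit_comp i x)"
proof -
  have "(\<Sum>j\<in>UNIV. x $ j * partial j (unit_comp i) x) = 0"
    using homogeneous_euler[OF smooth_unit_comp homogeneous_unit_comp x] by simp
  moreover have "(\<Sum>j\<in>UNIV. partial j (height n) x * partial j (unit_comp i) x)
    = inv_norm x * (\<Sum>j\<in>UNIV. n $ j * partial j (unit_comp i) x)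
      - (n \<bullet> x) * inv_sq x * inv_norm x * (\<Sum>j\<in>UNIV. x $ j * partial j (unit_comp i) x)"
    by (simp add: partial_height[OF x] sum_3 algebra_simps)
  moreover have "(\<Sum>j\<in>UNIV. n $ j * partial j (unit_comp i) x) = n $ i * inv_norm x - x $ i * (n \<bullet> x) * inv_sq x * inv_norm x"
    unfolding partial_unit_comp[OF x] using exhaust_3[of i] by (auto simp: sum_3 inner_3 algebra_simps)
  ultimately show ?thesis
    by (simp add: height_def unit_comp_def algebra_simps flip: inv_norm_sq)
qed

text \<open>The divergence of the tangential field \<open>height\<^sup>k \<nabla>(x\<^sub>i / |x|)\<close>, integrated over the sphere.\<close>
lemma sph_power_unit_comp:
  "real (k + 2) * sph (\<lambda>x. unit_comp i x * height n x ^ k) = real k * n $ i * sph (\<lambda>x. height n x ^ (k - 1))"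
proof -
  have sT: "smooth_on (\<lambda>x. height n x ^ m) (-{0})" for m by (intro smooth_intros open_punctured smooth_height)
  have ct: "continuous_on (-{0}) (\<lambda>x. height n x ^ m)" for m by (rule smooth_on_continuous[OF sT])
  have cu: "continuous_on (-{0}) (\<lambda>x. unit_comp i x * height n x ^ m)" for m
    by (intro continuous_intros ct smooth_on_continuous[OF smooth_unit_comp])
  have "sph (\<lambda>x. (real k * n $ i) * height n x ^ (k - 1) - real (k + 2) * (unit_comp i x * height n x ^ k)) = 0"
  proof (rule sph_tangential_divergence[where Z="\<lambda>j x. height n x ^ k * partial j (unit_comp i) x"])
    show "smooth_on (\<lambda>x. height n x ^ k * partial j (unit_comp i) x) (-{0})" for j
      by (intro smooth_intros open_punctured smooth_height smooth_unit_comp)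
    fix x :: "real^3" assume x: "x \<noteq> 0"
    have "(\<Sum>j\<in>UNIV. x $ j * (height n x ^ k * partial j (unit_comp i) x)) = height n x ^ k * (\<Sum>j\<in>UNIV. x $ j * partial j (unit_comp i) x)"
      by (simp add: sum_3 algebra_simps)
    then show "(\<Sum>j\<in>UNIV. x $ j * (height n x ^ k * partial j (unit_comp i) x)) = 0"
      using homogeneous_euler[OF smooth_unit_comp homogeneous_unit_comp x] by simp
    have pw: "partial j (\<lambda>x. height n x ^ k) x = real k * height n x ^ (k - 1) * partial j (height n) x" for j
      by (rule partial_real_compose[OF smooth_differentiable[OF smooth_height x], where h="\<lambda>t. t ^ k"])
         (auto intro!: derivative_eq_intros)
    have "(\<Sum>j\<in>UNIV. partial j (\<lambda>x. height n x ^ k * partial j (unit_comp i) x) x)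
      = real k * height n x ^ (k - 1) * (\<Sum>j\<in>UNIV. partial j (height n) x * partial j (unit_comp i) x) + height n x ^ k * laplacian (unit_comp i) x"
      unfolding smooth_partial_mult[OF sT smooth_on_partial[OF smooth_unit_comp] x] pw laplacian_def
      by (simp add: sum_3 algebra_simps)
    also have "\<dots> = inv_sq x * (real k * height n x ^ (k - 1) * n $ i - real k * (height n x ^ (k - 1) * height n x) * unit_comp i x - 2 * height n x ^ k * unit_comp i x)"
      unfolding gradients_height_unit_comp[OF x] laplacian_unit_comp[OF x] by (simp add: algebra_simps)
    also have "real k * (height n x ^ (k - 1) * height n x) = real k * height n x ^ k"
      by (cases k) (simp_all add: mult.commute)
    finally show "(\<Sum>j\<in>UNIV. partial j (\<lambda>x. height n x ^ k * partial j (unit_comp i) x) x)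
      = inv_sq x * ((real k * n $ i) * height n x ^ (k - 1) - real (k + 2) * (unit_comp i x * height n x ^ k))"
      by (simp add: algebra_simps)
  qed
  also have "sph (\<lambda>x. (real k * n $ i) * height n x ^ (k - 1) - real (k + 2) * (unit_comp i x * height n x ^ k))
     = sph (\<lambda>x. (real k * n $ i) * height n x ^ (k - 1)) - sph (\<lambda>x. real (k + 2) * (unit_comp i x * height n x ^ k))"
    by (rule sph_diff) (rule continuous_on_mult_left, rule ct cu)+
  finally show ?thesis unfolding sph_cmult by simp
qed

context
  fixes n :: "real^3" assumes n: "norm n = 1"
begin

lemma cont_height: "continuous_on (-{0}) (height n)"
  by (rule smooth_on_continuous[OF smooth_height])

lemma cont_unit_comp: "continuous_on (-{0}) (unit_comp i)"
  by (rule smooth_on_continuous[OF smooth_unit_comp])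

lemma sph_height_Suc: "sph (\<lambda>x. height n x ^ Suc k) = (\<Sum>i\<in>UNIV. n $ i * sph (\<lambda>x. unit_comp i x * height n x ^ k))"
proof -
  have "sph (\<lambda>x. height n x ^ Suc k) = sph (\<lambda>x. \<Sum>i\<in>UNIV. n $ i * (unit_comp i x * height n x ^ k))"
    by (rule sph_cong) (simp add: height_sum[of n] sum_3 algebra_simps)
  also have "\<dots> = (\<Sum>i\<in>UNIV. sph (\<lambda>x. n $ i * (unit_comp i x * height n x ^ k)))"
    by (rule sph_sum) (auto intro!: continuous_intros cont_height cont_unit_comp)
  finally show ?thesis by (simp add: sph_cmult)
qed

lemma sph_height_recursion: "real (k + 2) * sph (\<lambda>x. height n x ^ Suc k) = real k * sph (\<lambda>x. height n x ^ (k - 1))"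
proof -
  have nn: "n $ 1 * n $ 1 + n $ 2 * n $ 2 + n $ 3 * n $ 3 = 1" using n norm_sq_3[of n] by simp
  have "real (k + 2) * sph (\<lambda>x. height n x ^ Suc k) = (\<Sum>i\<in>UNIV. n $ i * (real (k + 2) * sph (\<lambda>x. unit_comp i x * height n x ^ k)))"
    unfolding sph_height_Suc by (simp add: sum_3 algebra_simps)
  also have "\<dots> = (n $ 1 * n $ 1 + n $ 2 * n $ 2 + n $ 3 * n $ 3) * (real k * sph (\<lambda>x. height n x ^ (k - 1)))"
    unfolding sph_power_unit_comp by (simp add: sum_3 algebra_simps)
  finally show ?thesis unfolding nn by simp
qed

lemma sph_unit_comp_power: "sph (\<lambda>x. unit_comp i x * height n x ^ k) = n $ i * sph (\<lambda>x. height n x ^ Suc k)"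
proof -
  have "real (k + 2) * sph (\<lambda>x. unit_comp i x * height n x ^ k) = real (k + 2) * (n $ i * sph (\<lambda>x. height n x ^ Suc k))"
    using sph_power_unit_comp[of k i n] sph_height_recursion[of k] by simp
  then show ?thesis by (simp del: of_nat_add)
qed

text \<open>For a unit vector \<open>n\<close>, the recursion relates moments whose orders differ by two, and the moments
  of order \<open>0\<close> and \<open>1\<close> start it.\<close>
lemma sph_height_power: "sph (\<lambda>x. height n x ^ k) = 2 * pi * ((1 - (- 1) ^ (k + 1)) / real (k + 1))"
proof (induction k rule: less_induct)
  case (less k)
  consider "k = 0" | "k = 1" | m where "k = Suc (Suc m)" by (metis One_nat_def not0_implies_Suc)
  then show ?case
  proof cases
    case 1 then show ?thesis by (simp add: sph_one)
  next
    case 2 then show ?thesis using sph_height_recursion[of 0] by simp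
  next
    case 3
    have "real (m + 3) * sph (\<lambda>x. height n x ^ k) = real (m + 1) * sph (\<lambda>x. height n x ^ m)"
      using sph_height_recursion[of "Suc m"] 3 by (simp add: numeral_3_eq_3)
    also have "\<dots> = 2 * pi * (1 - (- 1) ^ (m + 1))" using less.IH[of m] 3 by simp
    finally show ?thesis using 3 by (simp add: field_simps)
  qed
qed

lemma abs_height_le: "x \<noteq> 0 \<Longrightarrow> height n x \<in> {-1..1}"
proof -
  assume x: "x \<noteq> 0"
  have "\<bar>n \<bullet> x\<bar> \<le> norm x" using Cauchy_Schwarz_ineq2[of n x] n by simp
  then show ?thesis using x by (simp add: height_def inv_norm_def abs_le_iff field_simps)
qed

lemma abs_unit_comp_le: "x \<noteq> 0 \<Longrightarrow> \<bar>unit_comp i x\<bar> \<le> 1"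
  using component_le_norm_cart[of x i] by (simp add: unit_comp_def inv_norm_def abs_mult)

lemma cont_compose_height: "continuous_on {-1..1} h \<Longrightarrow> continuous_on (-{0}) (\<lambda>x. h (height n x))"
  by (rule continuous_on_compose2[OF _ cont_height], assumption) (rule image_subsetI, rule abs_height_le, simp)

lemma integral_power_sym: "integral {-1..1} (\<lambda>t::real. t ^ k) = (1 - (- 1) ^ (k + 1)) / real (k + 1)"
proof -
  have "((\<lambda>t::real. t ^ k) has_integral (1 ^ (k + 1) / real (k + 1) - (- 1) ^ (k + 1) / real (k + 1))) {-1..1}"
  proof (rule fundamental_theorem_of_calculus)
    fix t :: real
    have "((\<lambda>t. t ^ (k + 1) / real (k + 1)) has_field_derivative real (k + 1) * t ^ (k + 1 - Suc 0) / real (k + 1)) (at t)"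
      by (rule DERIV_cdivide[OF DERIV_pow])
    moreover have "real (k + 1) * t ^ (k + 1 - Suc 0) / real (k + 1) = t ^ k"
    proof -
      have "c * d / c = d" if "c \<noteq> 0" for c d :: real using that by simp
      from this[of "real (k + 1)"] show ?thesis by simp
    qed
    ultimately show "((\<lambda>t. t ^ (k + 1) / real (k + 1)) has_vector_derivative t ^ k) (at t within {-1..1})"
      using has_vector_derivative_at_within has_real_derivative_iff_has_vector_derivative by metis
  qed simp
  from integral_unique[OF this] show ?thesis unfolding diff_divide_distrib by (simp only: power_one)
qed

text \<open>Archimedes' hat-box theorem, by moments and uniform approximation by polynomials.\<close>
theorem sph_height:
  assumes h: "continuous_on {-1..1} h"
  shows "sph (\<lambda>x. h (height n x)) = 2 * pi * integral {-1..1} h"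
    "sph (\<lambda>x. unit_comp i x * h (height n x)) = n $ i * (2 * pi * integral {-1..1} (\<lambda>t. t * h t))"
proof -
  have poly: "sph (\<lambda>x. p (height n x)) = 2 * pi * integral {-1..1} p \<and>
     sph (\<lambda>x. unit_comp i x * p (height n x)) = n $ i * (2 * pi * integral {-1..1} (\<lambda>t. t * p t))"
    if p: "p = (\<lambda>t. \<Sum>j\<le>m. a j * t ^ j)" for p a m
  proof
    have ch: "continuous_on (-{0}) (\<lambda>x. a j * height n x ^ j)" for j by (intro continuous_intros cont_height)
    have cu: "continuous_on (-{0}) (\<lambda>x. a j * (unit_comp i x * height n x ^ j))" for j by (intro continuous_intros cont_height cont_unit_comp)
    have int: "integral {-1..1} (\<lambda>t. \<Sum>j\<le>m. a j * t ^ k j) = (\<Sum>j\<le>m. a j * integral {-1..1} (\<lambda>t. t ^ k j))" for k :: "nat \<Rightarrow> nat"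
    proof -
      have "integral {-1..1} (\<lambda>t. \<Sum>j\<le>m. a j * t ^ k j) = (\<Sum>j\<le>m. integral {-1..1} (\<lambda>t. a j * t ^ k j))"
        by (rule integral_sum) (auto intro!: integrable_continuous_real continuous_intros)
      then show ?thesis by (simp only: integral_mult_right)
    qed
    have "sph (\<lambda>x. p (height n x)) = (\<Sum>j\<le>m. sph (\<lambda>x. a j * height n x ^ j))"
      unfolding p by (rule sph_sum[OF ch]) simp
    also have "\<dots> = 2 * pi * (\<Sum>j\<le>m. a j * integral {-1..1} (\<lambda>t. t ^ j))"
      unfolding sph_cmult sph_height_power integral_power_sym by (simp only: sum_distrib_left mult.left_commute)
    also have "(\<Sum>j\<le>m. a j * integral {-1..1} (\<lambda>t. t ^ j)) = integral {-1..1} p"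
      unfolding p by (rule int[symmetric])
    finally show "sph (\<lambda>x. p (height n x)) = 2 * pi * integral {-1..1} p" .
    have "sph (\<lambda>x. unit_comp i x * p (height n x)) = sph (\<lambda>x. \<Sum>j\<le>m. a j * (unit_comp i x * height n x ^ j))"
      unfolding p by (simp only: sum_distrib_left mult.left_commute)
    also have "\<dots> = (\<Sum>j\<le>m. sph (\<lambda>x. a j * (unit_comp i x * height n x ^ j)))"
      by (rule sph_sum[OF cu]) simp
    also have "\<dots> = (\<Sum>j\<le>m. n $ i * (2 * pi * (a j * integral {-1..1} (\<lambda>t. t ^ Suc j))))"
      unfolding sph_cmult sph_unit_comp_power sph_height_power integral_power_sym by (simp only: mult.left_commute)
    also have "\<dots> = n $ i * (2 * pi * (\<Sum>j\<le>m. a j * integral {-1..1} (\<lambda>t. t ^ Suc j)))"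
      by (simp only: sum_distrib_left)
    also have "(\<Sum>j\<le>m. a j * integral {-1..1} (\<lambda>t. t ^ Suc j)) = integral {-1..1} (\<lambda>t. \<Sum>j\<le>m. a j * t ^ Suc j)"
      by (rule int[symmetric])
    also have "(\<lambda>t. \<Sum>j\<le>m. a j * t ^ Suc j) = (\<lambda>t. t * p t)"
      unfolding p by (simp only: fun_eq_iff sum_distrib_left power_Suc mult.left_commute) simp
    finally show "sph (\<lambda>x. unit_comp i x * p (height n x)) = n $ i * (2 * pi * integral {-1..1} (\<lambda>t. t * p t))" .
  qed
  have ni: "\<bar>n $ i\<bar> \<le> 1" using component_le_norm_cart[of n i] n by simp
  \<comment> \<open>the errors of the approximation by a polynomial enter both sides with at most \<open>4 \<pi> e\<close>\<close>
  have approx: "\<bar>sph (\<lambda>x. h (height n x)) - 2 * pi * integral {-1..1} h\<bar> \<le> 8 * pi * e \<and>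
     \<bar>sph (\<lambda>x. unit_comp i x * h (height n x)) - n $ i * (2 * pi * integral {-1..1} (\<lambda>t. t * h t))\<bar> \<le> 8 * pi * e" if e: "e > 0" for e
  proof -
    obtain p where p: "real_polynomial_function p" "\<And>t. t \<in> {-1..1} \<Longrightarrow> \<bar>h t - p t\<bar> < e"
      using Stone_Weierstrass_real_polynomial_function[OF _ h e] by auto
    obtain a m where pa: "p = (\<lambda>t. \<Sum>j\<le>m. a j * t ^ j)" using p(1) unfolding real_polynomial_function_iff_sum by blast
    have cp: "continuous_on {-1..1} p" unfolding pa by (intro continuous_intros)
    have chh: "continuous_on (-{0}) (\<lambda>x. h (height n x))" by (rule cont_compose_height[OF h])
    have chp: "continuous_on (-{0}) (\<lambda>x. p (height n x))" by (rule cont_compose_height[OF cp])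
    have cuh: "continuous_on (-{0}) (\<lambda>x. unit_comp i x * h (height n x))" by (rule continuous_on_mult[OF cont_unit_comp chh])
    have cup: "continuous_on (-{0}) (\<lambda>x. unit_comp i x * p (height n x))" by (rule continuous_on_mult[OF cont_unit_comp chp])
    have le: "\<bar>h t - p t\<bar> \<le> e" if "t \<in> {-1..1}" for t using p(2)[OF that] by simp
    have I: "\<bar>integral {-1..1} h - integral {-1..1} p\<bar> \<le> 2 * e"
    proof -
      have "integral {-1..1} h - integral {-1..1} p = integral {-1..1} (\<lambda>t. h t - p t)"
        by (rule Henstock_Kurzweil_Integration.integral_diff[symmetric]) (intro integrable_continuous_real h cp)+
      also have "\<bar>\<dots>\<bar> \<le> e * (1 - (-1))"
      proof -
        have "continuous_on {-1..1} (\<lambda>t. h t - p t)" by (intro continuous_intros h cp)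
        then show ?thesis using integral_bound[of "-1" 1 "\<lambda>t. h t - p t" e] le by simp
      qed
      finally show ?thesis by simp
    qed
    have I': "\<bar>integral {-1..1} (\<lambda>t. t * h t) - integral {-1..1} (\<lambda>t. t * p t)\<bar> \<le> 2 * e"
    proof -
      have "integral {-1..1} (\<lambda>t. t * h t) - integral {-1..1} (\<lambda>t. t * p t) = integral {-1..1} (\<lambda>t. t * h t - t * p t)"
        by (rule Henstock_Kurzweil_Integration.integral_diff[symmetric]) (intro integrable_continuous_real continuous_intros h cp)+
      also have "\<bar>\<dots>\<bar> \<le> e * (1 - (-1))"
      proof -
        have "\<bar>t * h t - t * p t\<bar> \<le> e" if "t \<in> {-1..1}" for t
        proof -
          have "\<bar>t * h t - t * p t\<bar> = \<bar>t\<bar> * \<bar>h t - p t\<bar>" by (simp add: right_diff_distrib[symmetric] abs_mult)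
          also have "\<dots> \<le> 1 * e" using that le[OF that] by (intro mult_mono) auto
          finally show ?thesis by simp
        qed
        moreover have "continuous_on {-1..1} (\<lambda>t. t * h t - t * p t)" by (intro continuous_intros h cp)
        ultimately show ?thesis using integral_bound[of "-1" 1 "\<lambda>t. t * h t - t * p t" e] by simp
      qed
      finally show ?thesis by simp
    qed
    have "sph (\<lambda>x. h (height n x)) - sph (\<lambda>x. p (height n x)) = sph (\<lambda>x. h (height n x) - p (height n x))"
      by (rule sph_diff[OF chh chp, symmetric])
    also have "\<bar>\<dots>\<bar> \<le> 4 * pi * e"
      by (rule sph_bound[OF continuous_on_diff[OF chh chp]]) (rule le[OF abs_height_le])
    finally have 1: "\<bar>sph (\<lambda>x. h (height n x)) - sph (\<lambda>x. p (height n x))\<bar> \<le> 4 * pi * e" .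
    have "sph (\<lambda>x. unit_comp i x * h (height n x)) - sph (\<lambda>x. unit_comp i x * p (height n x)) = sph (\<lambda>x. unit_comp i x * h (height n x) - unit_comp i x * p (height n x))"
      by (rule sph_diff[OF cuh cup, symmetric])
    also have "\<bar>\<dots>\<bar> \<le> 4 * pi * e"
    proof (rule sph_bound)
      show "continuous_on (-{0}) (\<lambda>x. unit_comp i x * h (height n x) - unit_comp i x * p (height n x))"
        by (rule continuous_on_diff[OF cuh cup])
      fix x :: "real^3" assume x: "x \<noteq> 0"
      have "\<bar>unit_comp i x * h (height n x) - unit_comp i x * p (height n x)\<bar> = \<bar>unit_comp i x\<bar> * \<bar>h (height n x) - p (height n x)\<bar>"
        by (simp add: right_diff_distrib[symmetric] abs_mult)
      also have "\<dots> \<le> 1 * e" using abs_unit_comp_le[OF x] le[OF abs_height_le[OF x]] by (intro mult_mono) auto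
      finally show "\<bar>unit_comp i x * h (height n x) - unit_comp i x * p (height n x)\<bar> \<le> e" by simp
    qed
    finally have 2: "\<bar>sph (\<lambda>x. unit_comp i x * h (height n x)) - sph (\<lambda>x. unit_comp i x * p (height n x))\<bar> \<le> 4 * pi * e" .
    have J: "\<bar>2 * pi * (integral {-1..1} h - integral {-1..1} p)\<bar> \<le> 4 * pi * e"
      using mult_left_mono[OF I, of "2 * pi"] by (simp add: abs_mult)
    have J': "\<bar>n $ i * (2 * pi * (integral {-1..1} (\<lambda>t. t * h t) - integral {-1..1} (\<lambda>t. t * p t)))\<bar> \<le> 4 * pi * e"
    proof -
      have "\<bar>n $ i * (2 * pi * (integral {-1..1} (\<lambda>t. t * h t) - integral {-1..1} (\<lambda>t. t * p t)))\<bar>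
        = \<bar>n $ i\<bar> * (2 * pi * \<bar>integral {-1..1} (\<lambda>t. t * h t) - integral {-1..1} (\<lambda>t. t * p t)\<bar>)"
        by (simp add: abs_mult)
      also have "\<dots> \<le> 1 * (2 * pi * (2 * e))" using ni I' e by (intro mult_mono) auto
      finally show ?thesis by simp
    qed
    have P: "sph (\<lambda>x. p (height n x)) = 2 * pi * integral {-1..1} p"
      "sph (\<lambda>x. unit_comp i x * p (height n x)) = n $ i * (2 * pi * integral {-1..1} (\<lambda>t. t * p t))" using poly[OF pa] by auto
    have "sph (\<lambda>x. h (height n x)) - 2 * pi * integral {-1..1} h
       = (sph (\<lambda>x. h (height n x)) - sph (\<lambda>x. p (height n x))) - 2 * pi * (integral {-1..1} h - integral {-1..1} p)"
      unfolding P by (simp add: algebra_simps)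
    moreover have "sph (\<lambda>x. unit_comp i x * h (height n x)) - n $ i * (2 * pi * integral {-1..1} (\<lambda>t. t * h t))
       = (sph (\<lambda>x. unit_comp i x * h (height n x)) - sph (\<lambda>x. unit_comp i x * p (height n x)))
        - n $ i * (2 * pi * (integral {-1..1} (\<lambda>t. t * h t) - integral {-1..1} (\<lambda>t. t * p t)))"
      unfolding P by (simp add: algebra_simps)
    ultimately show ?thesis using 1 2 J J' by linarith
  qed
  have z: "a = b" if "\<And>e. e > 0 \<Longrightarrow> \<bar>a - b\<bar> \<le> 8 * pi * e" for a b :: real
  proof -
    have "\<bar>a - b\<bar> \<le> 0 + e" if "e > 0" for e using \<open>\<And>e. e > 0 \<Longrightarrow> \<bar>a - b\<bar> \<le> 8 * pi * e\<close>[of "e / (8 * pi)"] that by simp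
    then have "\<bar>a - b\<bar> \<le> 0" by (rule field_le_epsilon)
    then show ?thesis by simp
  qed
  show "sph (\<lambda>x. h (height n x)) = 2 * pi * integral {-1..1} h" by (rule z, rule approx[THEN conjunct1])
  show "sph (\<lambda>x. unit_comp i x * h (height n x)) = n $ i * (2 * pi * integral {-1..1} (\<lambda>t. t * h t))" by (rule z, rule approx[THEN conjunct2])
qed

end

section \<open>The distribution of a solution across the origin\<close>

lemma borel_measurable_punctured:
  fixes f :: "real^3 \<Rightarrow> real"
  assumes "continuous_on (-{0}) f" shows "f \<in> borel_measurable borel"
proof -
  have "(\<lambda>x. if x \<in> -{0} then f x else f 0) \<in> borel_measurable borel"
    by (rule borel_measurable_continuous_on_if) (use assms in auto)
  moreover have "(\<lambda>x. if x \<in> -{0} then f x else f 0) = f" by auto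
  ultimately show ?thesis by simp
qed

lemma homogeneous_bound:
  assumes f: "continuous_on (-{0}) f" and h: "homogeneous k f"
  obtains C where "C \<ge> 0" "\<And>x. x \<noteq> 0 \<Longrightarrow> \<bar>f x\<bar> \<le> C * norm x powi k"
proof -
  have "compact (f ` sphere 0 1)"
    by (intro compact_continuous_image continuous_on_subset[OF f] compact_sphere) auto
  then obtain C where C: "\<And>x. x \<in> sphere 0 1 \<Longrightarrow> \<bar>f x\<bar> \<le> C"
    by (metis compact_imp_bounded bounded_iff imageI real_norm_def)
  have "\<bar>f x\<bar> \<le> \<bar>C\<bar> * norm x powi k" if x: "x \<noteq> 0" for x
  proof -
    have "f x = f (norm x *\<^sub>R (x /\<^sub>R norm x))" using x by simp
    also have "\<dots> = norm x powi k * f (x /\<^sub>R norm x)" by (rule homogeneousD[OF h]) (use x in auto)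
    finally have "\<bar>f x\<bar> = norm x powi k * \<bar>f (x /\<^sub>R norm x)\<bar>" by (simp add: abs_mult power_int_abs)
    also have "\<dots> \<le> norm x powi k * \<bar>C\<bar>"
    proof (rule mult_left_mono)
      show "\<bar>f (x /\<^sub>R norm x)\<bar> \<le> \<bar>C\<bar>" using C[of "x /\<^sub>R norm x"] x by simp
    qed simp
    finally show ?thesis by (simp add: mult.commute)
  qed
  then show thesis using that[of "\<bar>C\<bar>"] by simp
qed

lemma integrable_inv_sq_ball: "integrable lborel (\<lambda>x::real^3. inv_sq x * indicator (cball 0 R) x)"
proof (rule integrableI_bounded)
  show "(\<lambda>x::real^3. inv_sq x * indicator (cball 0 R) x) \<in> borel_measurable lborel"
    using borel_measurable_times[OF borel_measurable_punctured[OF smooth_on_continuous[OF smooth_inverse_norm_sq]]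
        borel_measurable_indicator[OF borel_closed[OF closed_cball]]] by simp
  have m: "(\<lambda>r. ennreal (1 / r\<^sup>2 * indicator {..R} r)) \<in> borel_measurable borel" by measurable
  have "(\<integral>\<^sup>+x. ennreal (norm (inv_sq x * indicator (cball 0 R) x)) \<partial>(lborel :: (real^3) measure))
     = (\<integral>\<^sup>+x. ennreal (1 / (norm x)\<^sup>2 * indicator {..R} (norm x)) \<partial>(lborel :: (real^3) measure))"
    by (rule nn_integral_cong) (simp add: inv_sq_def indicator_def)
  also have "\<dots> = (\<integral>\<^sup>+r. ennreal (4 * pi * r\<^sup>2 * indicator {0..} r) * ennreal (1 / r\<^sup>2 * indicator {..R} r) \<partial>lborel)"
    by (rule nn_integral_radial[OF m])
  also have "\<dots> \<le> (\<integral>\<^sup>+r. ennreal (4 * pi) * indicator {0..R} r \<partial>lborel)"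
  proof (rule nn_integral_mono)
    fix r :: real
    have "4 * pi * r\<^sup>2 * indicator {0..} r * (1 / r\<^sup>2 * indicator {..R} r) \<le> 4 * pi * indicator {0..R} r"
      by (auto simp: indicator_def)
    then show "ennreal (4 * pi * r\<^sup>2 * indicator {0..} r) * ennreal (1 / r\<^sup>2 * indicator {..R} r) \<le> ennreal (4 * pi) * indicator {0..R} r"
      by (simp add: ennreal_indicator[symmetric] ennreal_mult[symmetric] del: ennreal_indicator)
  qed
  also have "\<dots> < \<infinity>" by (simp add: nn_integral_cmult_indicator ennreal_mult_less_top emeasure_lborel_Icc_eq)
  finally show "(\<integral>\<^sup>+x. ennreal (norm (inv_sq x * indicator (cball 0 R) x)) \<partial>(lborel :: (real^3) measure)) < \<infinity>" .
qed

lemma AE_nonzero: "AE x in lborel. (x::real^3) \<noteq> 0"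
  by (rule AE_I'[of "{0}"]) auto

text \<open>Both degrees are above \<open>-3\<close>; on bounded sets, \<open>1 / |x|\<^sup>2\<close> dominates up to a factor.\<close>
lemma locally_integrable_homogeneous:
  assumes f: "continuous_on (-{0}) f" and h: "homogeneous k f" and k: "k = -1 \<or> k = -2"
  shows "locally_integrable f"
  unfolding locally_integrable_def
proof (intro allI impI)
  fix K :: "(real^3) set" assume K: "compact K"
  obtain R where R': "R > 0" "\<forall>x\<in>K. norm x \<le> R"
    using compact_imp_bounded[OF K] unfolding bounded_pos by blast
  then have R: "K \<subseteq> cball 0 R" "R > 0" by auto
  obtain C where C: "C \<ge> 0" "\<And>x. x \<noteq> 0 \<Longrightarrow> \<bar>f x\<bar> \<le> C * norm x powi k" using homogeneous_bound[OF f h] by blast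
  have b: "\<bar>f x\<bar> \<le> C * (R + 1) * inv_sq x" if x: "x \<noteq> 0" "norm x \<le> R" for x
  proof -
    have p: "norm x powi k \<le> (R + 1) * inv_sq x"
      using k x R by (auto simp: power_int_minus inv_sq_def field_simps power2_eq_square)
    show ?thesis using C(2)[OF x(1)] mult_left_mono[OF p C(1)] by simp
  qed
  show "set_integrable lborel K f"
    unfolding set_integrable_def
  proof (rule Bochner_Integration.integrable_bound)
    show "integrable lborel (\<lambda>x. (C * (R + 1)) * (inv_sq x * indicator (cball 0 R) x))"
      by (rule integrable_mult_right[OF integrable_inv_sq_ball])
    show "(\<lambda>x. indicator K x *\<^sub>R f x) \<in> borel_measurable lborel"
      using borel_measurable_punctured[OF f] borel_compact[OF K] by measurable
    show "AE x in lborel. norm (indicator K x *\<^sub>R f x) \<le> norm ((C * (R + 1)) * (inv_sq x * indicator (cball 0 R) x))"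
      using AE_nonzero
    proof eventually_elim
      case (elim x)
      show ?case
      proof (cases "x \<in> K")
        case True
        then have n: "norm x \<le> R" using R by auto
        have "\<bar>f x\<bar> \<le> \<bar>C * (R + 1) * inv_sq x\<bar>" using b[OF elim n] by linarith
        then show ?thesis using True n by simp
      qed simp
    qed
  qed
qed

lemma integrable_mult_bounded_support:
  fixes \<phi> :: "real^3 \<Rightarrow> real"
  assumes f: "locally_integrable f" and c: "continuous_on UNIV \<phi>" and s: "\<And>x. norm x \<ge> R \<Longrightarrow> \<phi> x = 0"
  shows "integrable lborel (\<lambda>x. f x * \<phi> x)"
proof -
  have fi: "integrable lborel (\<lambda>x. indicator (cball 0 R) x *\<^sub>R f x)"
    using f unfolding locally_integrable_def set_integrable_def by simp
  have "compact (\<phi> ` cball 0 R)" by (intro compact_continuous_image continuous_on_subset[OF c]) auto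
  then obtain B where B: "\<And>x. x \<in> cball 0 R \<Longrightarrow> \<bar>\<phi> x\<bar> \<le> B"
    by (metis compact_imp_bounded bounded_iff imageI real_norm_def)
  have "integrable lborel (\<lambda>x. (indicator (cball 0 R) x *\<^sub>R f x) * \<phi> x)"
  proof (rule Bochner_Integration.integrable_bound)
    show "integrable lborel (\<lambda>x. \<bar>B\<bar> * (indicator (cball 0 R) x *\<^sub>R f x))" using fi by (rule integrable_mult_right)
    show "(\<lambda>x. (indicator (cball 0 R) x *\<^sub>R f x) * \<phi> x) \<in> borel_measurable lborel"
      using borel_measurable_integrable[OF fi] borel_measurable_continuous_onI[OF c] by measurable
    show "AE x in lborel. norm ((indicator (cball 0 R) x *\<^sub>R f x) * \<phi> x) \<le> norm (\<bar>B\<bar> * (indicator (cball 0 R) x *\<^sub>R f x))"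
    proof (rule AE_I2)
      fix x
      show "norm ((indicator (cball 0 R) x *\<^sub>R f x) * \<phi> x) \<le> norm (\<bar>B\<bar> * (indicator (cball 0 R) x *\<^sub>R f x))"
      proof (cases "x \<in> cball 0 R")
        case True
        then have "\<bar>f x\<bar> * \<bar>\<phi> x\<bar> \<le> \<bar>f x\<bar> * \<bar>B\<bar>" using B[OF True] by (intro mult_left_mono) auto
        then show ?thesis using True by (simp add: abs_mult mult.commute)
      qed simp
    qed
  qed
  moreover have "(\<lambda>x. (indicator (cball 0 R) x *\<^sub>R f x) * \<phi> x) = (\<lambda>x. f x * \<phi> x)"
    using s by (fastforce simp: indicator_def)
  ultimately show ?thesis by simp
qed

lemma integral_scale:
  fixes f :: "real^3 \<Rightarrow> real"
  assumes "f \<in> borel_measurable borel" "e > 0"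
  shows "(LINT x|lborel. f x) = e ^ 3 * (LINT x|lborel. f (e *\<^sub>R x))"
proof -
  have "(LINT x|lborel. f x) = (LINT x|density (distr lborel borel (\<lambda>x::real^3. 0 + e *\<^sub>R x)) (\<lambda>_. \<bar>e\<bar> ^ DIM(real^3)). f x)"
    using lborel_affine[of e "0::real^3"] assms(2) by simp
  also have "\<dots> = (LINT x|distr lborel borel (\<lambda>x::real^3. 0 + e *\<^sub>R x). (\<bar>e\<bar> ^ DIM(real^3)) *\<^sub>R f x)"
    by (rule integral_density) (use assms in auto)
  also have "\<dots> = (LINT x|lborel. (\<bar>e\<bar> ^ DIM(real^3)) *\<^sub>R f (0 + e *\<^sub>R x))"
    by (rule integral_distr) (use assms in auto)
  finally show ?thesis using assms(2) by simp
qed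

text \<open>The derivative of this cutoff is the radial weight of \<open>sph\<close>, so that the boundary terms created by
  cutting out the origin appear as values of \<open>sph\<close>.\<close>
definition cutoff :: "real \<Rightarrow> real" where
  "cutoff r = integral {0..r} (\<lambda>r. 30 * bump 1 2 r)"

lemma cont_bump': "continuous_on S (\<lambda>r. 30 * bump 1 2 r)"
  by (intro continuous_intros continuous_on_subset[OF continuous_bump]) auto

lemma cutoff_0: "r \<le> 1 \<Longrightarrow> cutoff r = 0"
  unfolding cutoff_def by (rule integral_unique[OF has_integral_is_0]) (simp add: bump_eq_0)

lemma cutoff_1: "r \<ge> 2 \<Longrightarrow> cutoff r = 1"
  unfolding cutoff_def by (rule integral_unique[OF has_integral_on_superset[OF integral_bump]]) (auto simp: bump_eq_0)

lemma cutoff_range: "0 \<le> cutoff r" "cutoff r \<le> 1"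
proof -
  have int: "(\<lambda>r. 30 * bump 1 2 r) integrable_on {0..t}" for t by (rule integrable_continuous_real[OF cont_bump'])
  show "0 \<le> cutoff r" unfolding cutoff_def by (rule integral_nonneg[OF int]) (simp add: bump_nonneg)
  show "cutoff r \<le> 1"
  proof (cases "r \<le> 2")
    case True
    have "cutoff r \<le> cutoff 2" unfolding cutoff_def
      by (rule integral_subset_le[OF _ int int]) (use True in \<open>simp_all add: bump_nonneg\<close>)
    then show ?thesis by (simp add: cutoff_1)
  qed (simp add: cutoff_1)
qed

lemma DERIV_cutoff: assumes "r > 0" shows "(cutoff has_field_derivative 30 * bump 1 2 r) (at r)"
proof -
  have "((\<lambda>x. integral {0..x} (\<lambda>r. 30 * bump 1 2 r)) has_real_derivative 30 * bump 1 2 r) (at r within {0..r + 1})"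
    by (rule integral_has_real_derivative[OF cont_bump']) (use assms in auto)
  moreover have "at r within {0..r + 1} = at r" by (rule at_within_interior) (use assms in simp)
  ultimately show ?thesis by (simp add: cutoff_def[abs_def])
qed

lemma test_functionD:
  assumes "test_function \<psi>"
  shows "smooth_on \<psi> UNIV" and "\<exists>R>0. \<forall>x. norm x \<ge> R \<longrightarrow> \<psi> x = 0 \<and> (\<forall>i. partial i \<psi> x = 0 \<and> (\<forall>j. partial j (partial i \<psi>) x = 0))"
proof -
  show "smooth_on \<psi> UNIV" using assms by (simp add: test_function_def)
  have "bounded {x. \<psi> x \<noteq> 0}"
    using assms unfolding test_function_def by (metis bounded_subset closure_subset compact_imp_bounded)
  then obtain R where R': "R > 0" "\<forall>x\<in>{x. \<psi> x \<noteq> 0}. norm x \<le> R" unfolding bounded_pos by blast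
  then have R: "{x. \<psi> x \<noteq> 0} \<subseteq> cball 0 R" "R > 0" by auto
  have o: "open {x::real^3. R < norm x}" by (intro open_Collect_less continuous_intros)
  have z: "\<psi> x = 0" if "R < norm x" for x
  proof (rule ccontr)
    assume "\<psi> x \<noteq> 0"
    then have "x \<in> cball 0 R" using R(1) by blast
    then show False using that by simp
  qed
  have zp: "partial i f x = 0" if "R < norm x" "\<And>x. R < norm x \<Longrightarrow> f x = 0" for i f x
    using partial_cong[OF o, of x f "\<lambda>x. 0" i] that by simp
  have zp1: "partial i \<psi> x = 0" if "R < norm x" for i x by (rule zp[OF that z])
  have zp2: "partial j (partial i \<psi>) x = 0" if "R < norm x" for i j x by (rule zp[OF that zp1])
  show "\<exists>R>0. \<forall>x. norm x \<ge> R \<longrightarrow> \<psi> x = 0 \<and> (\<forall>i. partial i \<psi> x = 0 \<and> (\<forall>j. partial j (partial i \<psi>) x = 0))"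
    by (rule exI[of _ "R + 1"]) (use R z zp1 zp2 in auto)
qed

text \<open>A field that solves the equation off the origin solves it across the origin up to a multiple
  of the Dirac mass: cutting out small balls leaves boundary terms, which the homogeneity
  turns into the flux through the unit sphere.\<close>
lemma linearized_distribution_flux:
  fixes w u :: "3 \<Rightarrow> real^3 \<Rightarrow> real"
  assumes w: "\<And>i. smooth_on (w i) (-{0})" "\<And>i. homogeneous (-1) (w i)"
      "\<And>x. x \<noteq> 0 \<Longrightarrow> (\<Sum>i\<in>UNIV. partial i (w i) x) = 0"
    and u: "\<And>i. smooth_on (u i) (-{0})" "\<And>i. homogeneous (-1) (u i)"
      "\<And>x. x \<noteq> 0 \<Longrightarrow> (\<Sum>i\<in>UNIV. partial i (u i) x) = 0"
    and q: "smooth_on q (-{0})" "homogeneous (-2) q"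
    and eq: "\<And>x. x \<noteq> 0 \<Longrightarrow> laplacian (w i) x
        = (\<Sum>j\<in>UNIV. u j x * partial j (w i) x + w j x * partial j (u i) x) + partial i q x"
    and \<psi>: "test_function \<psi>"
  defines "G \<equiv> \<lambda>j x. - partial j (w i) x + (u i x * w j x + w i x * u j x) + (if j = i then q x else 0)"
  shows "- (\<Sum>j\<in>UNIV. LINT x|lborel. w i x * partial j (partial j \<psi>) x)
      - (\<Sum>j\<in>UNIV. LINT x|lborel. (u i x * w j x + w i x * u j x) * partial j \<psi> x)
      - (LINT x|lborel. q x * partial i \<psi> x)
    = sph (\<lambda>x. norm x * (\<Sum>j\<in>UNIV. x $ j * G j x)) * \<psi> 0"
proof -
  have s\<psi>: "smooth_on \<psi> UNIV" by (rule test_functionD(1)[OF \<psi>])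
  obtain R where R: "R > 0" "\<And>x. norm x \<ge> R \<Longrightarrow> \<psi> x = 0" "\<And>x i. norm x \<ge> R \<Longrightarrow> partial i \<psi> x = 0"
    "\<And>x i j. norm x \<ge> R \<Longrightarrow> partial j (partial i \<psi>) x = 0" using test_functionD(2)[OF \<psi>] by blast
  have c\<psi>: "continuous_on UNIV \<psi>" "continuous_on UNIV (partial j \<psi>)" "continuous_on UNIV (partial k (partial j \<psi>))" for j k
    by (intro smooth_on_continuous smooth_on_partial s\<psi>)+
  have s\<psi>': "smooth_on \<psi> (-{0})" "smooth_on (partial j \<psi>) (-{0})" for j
    using s\<psi> smooth_on_partial[OF s\<psi>] by (auto intro: smooth_on_subset)
  have sG: "smooth_on (G j) (-{0})" for j
    unfolding G_def by (cases "j = i") (auto intro!: smooth_intros open_punctured w u q)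
  have h2: "homogeneous (-2) (\<lambda>x. u i x * w j x + w i x * u j x)" for j
    using homogeneous_add[OF homogeneous_mult[OF u(2) w(2)] homogeneous_mult[OF w(2) u(2)]] by simp
  have hG: "homogeneous (-2) (G j)" for j
  proof -
    have "homogeneous (-2) (\<lambda>x. - partial j (w i) x + (u i x * w j x + w i x * u j x))"
      using homogeneous_add[OF homogeneous_minus[OF homogeneous_partial[OF w(1,2)], simplified] h2] by simp
    then have "homogeneous (-2) (\<lambda>x. - partial j (w i) x + (u i x * w j x + w i x * u j x) + (if j = i then q x else 0))"
      using homogeneous_add[OF _ q(2)] by (cases "j = i") auto
    then show ?thesis unfolding G_def .
  qed
  define J where "J x = - (\<Sum>j\<in>UNIV. w i x * partial j (partial j \<psi>) x)
     - (\<Sum>j\<in>UNIV. (u i x * w j x + w i x * u j x) * partial j \<psi> x) - q x * partial i \<psi> x" for x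
  have li: "locally_integrable (w i)" "locally_integrable (\<lambda>x. u i x * w j x + w i x * u j x)" "locally_integrable q" for j
    by (rule locally_integrable_homogeneous[OF smooth_on_continuous[OF w(1)] w(2)], simp,
        rule locally_integrable_homogeneous[OF _ h2], intro continuous_intros smooth_on_continuous w u, simp,
        rule locally_integrable_homogeneous[OF smooth_on_continuous[OF q(1)] q(2)], simp)
  have int1: "integrable lborel (\<lambda>x. w i x * partial j (partial j \<psi>) x)" for j
    by (rule integrable_mult_bounded_support[OF li(1) c\<psi>(3) R(4)])
  have int2: "integrable lborel (\<lambda>x. (u i x * w j x + w i x * u j x) * partial j \<psi> x)" for j
    by (rule integrable_mult_bounded_support[OF li(2) c\<psi>(2) R(3)])
  have int3: "integrable lborel (\<lambda>x. q x * partial i \<psi> x)"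
    by (rule integrable_mult_bounded_support[OF li(3) c\<psi>(2) R(3)])
  have intJ: "integrable lborel J"
    unfolding J_def[abs_def] by (intro Bochner_Integration.integrable_diff integrable_minus Bochner_Integration.integrable_sum int1 int2 int3)
  have LJ: "(LINT x|lborel. J x) = - (\<Sum>j\<in>UNIV. LINT x|lborel. w i x * partial j (partial j \<psi>) x)
      - (\<Sum>j\<in>UNIV. LINT x|lborel. (u i x * w j x + w i x * u j x) * partial j \<psi> x)
      - (LINT x|lborel. q x * partial i \<psi> x)"
    unfolding J_def by (simp add: int1 int2 int3)
  define B where "B j x = - (w i x * partial j \<psi> x) - G j x * \<psi> x" for j x
  have sB: "smooth_on (B j) (-{0})" for j
    unfolding B_def[abs_def] by (intro smooth_intros open_punctured s\<psi>' w sG)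
  have zB: "B j x = 0" if "norm x \<ge> R" for j x using R(2,3)[OF that] by (simp add: B_def)
  have zdB: "partial k (B j) x = 0" if "norm x > R" for k j x
  proof -
    have "partial k (B j) x = partial k (\<lambda>x. 0) x"
      by (rule partial_cong[of "{x. R < norm x}"]) (use that zB in \<open>auto intro!: open_Collect_less continuous_intros\<close>)
    then show ?thesis by simp
  qed
  \<comment> \<open>in divergence form, the equation says that the momentum flux \<open>G\<close> is solenoidal\<close>
  have divG: "(\<Sum>j\<in>UNIV. partial j (G j) x) = 0" if x: "x \<noteq> 0" for x
  proof -
    have pG: "partial j (G j) x = - partial j (partial j (w i)) x
      + (partial j (u i) x * w j x + u i x * partial j (w j) x + (partial j (w i) x * u j x + w i x * partial j (u j) x))
      + (if j = i then partial j q x else 0)" for j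
    proof -
      have s1: "smooth_on (\<lambda>x. - partial j (w i) x + (u i x * w j x + w i x * u j x)) (-{0})"
        "smooth_on (\<lambda>x. - partial j (w i) x) (-{0})" "smooth_on (\<lambda>x. u i x * w j x + w i x * u j x) (-{0})"
        "smooth_on (\<lambda>x. u i x * w j x) (-{0})" "smooth_on (\<lambda>x. w i x * u j x) (-{0})"
        by (intro smooth_intros open_punctured w u)+
      have "partial j (\<lambda>x. - partial j (w i) x + (u i x * w j x + w i x * u j x)) x = - partial j (partial j (w i)) x
      + (partial j (u i) x * w j x + u i x * partial j (w j) x + (partial j (w i) x * u j x + w i x * partial j (u j) x))"
        unfolding smooth_partial_add[OF s1(2,3) x] smooth_partial_add[OF s1(4,5) x]
          smooth_partial_mult[OF u(1) w(1) x] smooth_partial_mult[OF w(1) u(1) x]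
          partial_minus[OF smooth_differentiable[OF smooth_on_partial[OF w(1)] x]] by simp
      moreover have "partial j (\<lambda>x. - partial j (w i) x + (u i x * w j x + w i x * u j x) + (if j = i then q x else 0)) x
        = partial j (\<lambda>x. - partial j (w i) x + (u i x * w j x + w i x * u j x)) x + (if j = i then partial j q x else 0)"
        (is "?L = ?A + _")
      proof -
        have "smooth_on (\<lambda>x. if j = i then q x else 0) (-{0})" by (cases "j = i") (auto intro: smooth_intros q)
        then have "?L = ?A + partial j (\<lambda>x. if j = i then q x else 0) x" by (rule smooth_partial_add[OF s1(1) _ x])
        also have "partial j (\<lambda>x. if j = i then q x else 0) x = (if j = i then partial j q x else 0)"
          by (cases "j = i") simp_all
        finally show ?thesis .
      qed
      ultimately show ?thesis unfolding G_def by (simp only:)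
    qed
    have "(\<Sum>j\<in>UNIV. partial j (G j) x) = - laplacian (w i) x + (\<Sum>j\<in>UNIV. u j x * partial j (w i) x + w j x * partial j (u i) x)
      + u i x * (\<Sum>j\<in>UNIV. partial j (w j) x) + w i x * (\<Sum>j\<in>UNIV. partial j (u j) x) + partial i q x"
      unfolding laplacian_def pG by (simp add: sum.distrib sum_distrib_left sum_negf sum_subtractf algebra_simps)
    then show ?thesis unfolding w(3)[OF x] u(3)[OF x] eq[OF x] by simp
  qed
  \<comment> \<open>off the origin, the integrand of the distribution is a divergence\<close>
  have divB: "(\<Sum>j\<in>UNIV. partial j (B j) x) = J x" if x: "x \<noteq> 0" for x
  proof -
    have s1: "smooth_on (\<lambda>x. w i x * partial j \<psi> x) (-{0})" "smooth_on (\<lambda>x. - (w i x * partial j \<psi> x)) (-{0})"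
      "smooth_on (\<lambda>x. G j x * \<psi> x) (-{0})" for j
      by (intro smooth_intros open_punctured w s\<psi>' sG)+
    have pB: "partial j (B j) x = - (partial j (w i) x * partial j \<psi> x + w i x * partial j (partial j \<psi>) x)
       - (partial j (G j) x * \<psi> x + G j x * partial j \<psi> x)" for j
      unfolding B_def[abs_def] smooth_partial_diff[OF s1(2,3) x] partial_minus[OF smooth_differentiable[OF s1(1) x]]
        smooth_partial_mult[OF w(1) s\<psi>'(2) x] smooth_partial_mult[OF sG s\<psi>'(1) x] by simp
    have "(\<Sum>j\<in>UNIV. partial j (B j) x) = - (\<Sum>j\<in>UNIV. w i x * partial j (partial j \<psi>) x)
       - (\<Sum>j\<in>UNIV. partial j (G j) x) * \<psi> x - (\<Sum>j\<in>UNIV. (partial j (w i) x + G j x) * partial j \<psi> x)"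
      unfolding pB by (simp add: sum_3 algebra_simps)
    also have "(\<Sum>j\<in>UNIV. (partial j (w i) x + G j x) * partial j \<psi> x)
       = (\<Sum>j\<in>UNIV. (u i x * w j x + w i x * u j x) * partial j \<psi> x + (if j = i then q x * partial j \<psi> x else 0))"
      by (rule sum.cong) (simp_all add: G_def algebra_simps)
    finally show ?thesis unfolding divG[OF x] J_def by (simp add: sum.distrib)
  qed
  define g where "g x = norm x * (\<Sum>j\<in>UNIV. x $ j * G j x)" for x
  define T where "T e y = norm y * (e * (w i y * (\<Sum>j\<in>UNIV. y $ j * partial j \<psi> (e *\<^sub>R y))) + \<psi> (e *\<^sub>R y) * (\<Sum>j\<in>UNIV. y $ j * G j y))" for e y
  have main: "(LINT x|lborel. cutoff (norm x / e) * J x) = sph (T e)" if e: "e > 0" for e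
  proof -
    define k where "k x = cutoff (norm x / e)" for x :: "real^3"
    define k' where "k' x = 30 * bump 1 2 (norm x / e) / e" for x :: "real^3"
    have dk: "partial j k x = k' x * (x $ j / norm x)" and dfk: "k differentiable at x" if "x \<noteq> 0" for j x
    proof -
      have "((\<lambda>r. cutoff (r / e)) has_field_derivative 30 * bump 1 2 (norm x / e) / e) (at (norm x))"
      proof -
        have "((\<lambda>r. r / e) has_field_derivative 1 / e) (at (norm x))" using e by (auto intro!: derivative_eq_intros)
        from DERIV_chain2[OF DERIV_cutoff this] show ?thesis using that e by simp
      qed
      from partial_radial[OF this that] differentiable_radial[OF this that]
      show "partial j k x = k' x * (x $ j / norm x)" "k differentiable at x" by (simp_all add: k_def[abs_def] k'_def)
    qed
    have k0: "k x = 0" "k' x = 0" if "norm x \<le> e" for x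
      using cutoff_0[of "norm x / e"] bump_eq_0[of 1 2 "norm x / e"] that e by (auto simp: k_def k'_def field_simps)
    have ck: "continuous_on (-{0}) k"
      by (rule continuous_at_imp_continuous_on) (auto intro: differentiable_imp_continuous_within dfk)
    have ck': "continuous_on (-{0}) k'" unfolding k'_def[abs_def] using e
      by (intro continuous_intros continuous_on_compose2[OF continuous_bump]) auto
    define A where "A j x = k x * B j x" for j x
    have pA: "partial j (A j) x = k' x * (x $ j * B j x / norm x) + k x * partial j (B j) x" and dA: "A j differentiable at x" for j x
    proof -
      have near: "norm x < e \<Longrightarrow> partial j (A j) x = 0" "norm x < e \<Longrightarrow> A j differentiable at x"
        using partial_eq_0_near_0(1)[of e "A j" x j] partial_eq_0_near_0(2)[of e "A j" x] e k0 by (auto simp: A_def)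
      show "partial j (A j) x = k' x * (x $ j * B j x / norm x) + k x * partial j (B j) x"
      proof (cases "x = 0")
        case True
        then show ?thesis using near(1) e k0 by simp
      next
        case False
        show ?thesis unfolding A_def partial_mult[OF dfk[OF False] smooth_differentiable[OF sB False]] dk[OF False] by simp
      qed
      show "A j differentiable at x"
      proof (cases "x = 0")
        case True
        then show ?thesis using near(2) e by simp
      next
        case False
        show ?thesis unfolding A_def by (rule differentiable_mult[OF dfk[OF False] smooth_differentiable[OF sB False]])
      qed
    qed
    have c1: "continuous_on UNIV (\<lambda>x. k' x * (x $ j * B j x / norm x))" for j
    proof (rule continuous_on_extend_0[OF _ e])
      show "continuous_on (-{0}) (\<lambda>x. k' x * (x $ j * B j x / norm x))"
        by (intro continuous_intros ck' smooth_on_continuous[OF sB]) auto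
    qed (use k0 in auto)
    have c2: "continuous_on UNIV (\<lambda>x. k x * partial j (B j) x)" for j
    proof (rule continuous_on_extend_0[OF _ e])
      show "continuous_on (-{0}) (\<lambda>x. k x * partial j (B j) x)"
        by (intro continuous_intros ck smooth_on_continuous[OF smooth_on_partial[OF sB]])
    qed (use k0 in auto)
    have i1: "integrable lborel (\<lambda>x. k' x * (x $ j * B j x / norm x))" for j
      by (rule integrable_continuous_bounded_support[OF c1, of R]) (simp add: zB)
    have i2: "integrable lborel (\<lambda>x. k x * partial j (B j) x)" for j
      by (rule integrable_continuous_bounded_support[OF c2, of "R + 1"]) (simp add: zdB)
    have cA: "continuous_on UNIV (partial j (A j))" for j
      using continuous_on_add[OF c1 c2] pA by (simp cong: continuous_on_cong)
    have "(LINT x|lborel. partial j (A j) x) = 0" for j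
      by (rule integral_partial_eq_0[OF dA cA, of R]) (simp add: A_def zB)
    then have "(LINT x|lborel. k' x * (x $ j * B j x / norm x)) + (LINT x|lborel. k x * partial j (B j) x) = 0" for j
      unfolding pA using Bochner_Integration.integral_add[OF i1 i2] by simp
    then have "(\<Sum>j\<in>UNIV. (LINT x|lborel. k' x * (x $ j * B j x / norm x)) + (LINT x|lborel. k x * partial j (B j) x)) = 0"
      by (simp only: sum.neutral_const)
    then have "(LINT x|lborel. (\<Sum>j\<in>UNIV. k' x * (x $ j * B j x / norm x))) + (LINT x|lborel. (\<Sum>j\<in>UNIV. k x * partial j (B j) x)) = 0"
      unfolding Bochner_Integration.integral_sum[OF i1] Bochner_Integration.integral_sum[OF i2] by (simp only: sum.distrib)
    moreover have "(\<lambda>x. \<Sum>j\<in>UNIV. k x * partial j (B j) x) = (\<lambda>x. k x * J x)"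
    proof
      fix x show "(\<Sum>j\<in>UNIV. k x * partial j (B j) x) = k x * J x"
        using divB[of x] k0[of x] e by (cases "x = 0") (simp_all add: sum_distrib_left[symmetric])
    qed
    ultimately have 1: "(LINT x|lborel. k x * J x) = - (LINT x|lborel. (\<Sum>j\<in>UNIV. k' x * (x $ j * B j x / norm x)))"
      by simp
    have m: "(\<lambda>x. \<Sum>j\<in>UNIV. k' x * (x $ j * B j x / norm x)) \<in> borel_measurable borel"
      by (intro borel_measurable_continuous_onI continuous_on_sum c1)
    \<comment> \<open>substituting \<open>x = e y\<close> turns the shell \<open>e < |x| < 2 e\<close> into a fixed one\<close>
    have 2: "(LINT x|lborel. (\<Sum>j\<in>UNIV. k' x * (x $ j * B j x / norm x)))
       = e ^ 3 * (LINT y|lborel. (\<Sum>j\<in>UNIV. k' (e *\<^sub>R y) * ((e *\<^sub>R y) $ j * B j (e *\<^sub>R y) / norm (e *\<^sub>R y))))"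
      by (rule integral_scale[OF m e])
    have 3: "- (e ^ 3 * (\<Sum>j\<in>UNIV. k' (e *\<^sub>R y) * ((e *\<^sub>R y) $ j * B j (e *\<^sub>R y) / norm (e *\<^sub>R y)))) = 30 * bump 1 2 (norm y) * inv_sq y * T e y" for y
    proof (cases "y = 0")
      case True
      have "bump 1 2 0 = 0" by (rule bump_eq_0) auto
      then show ?thesis using True by (simp add: k'_def)
    next
      case False
      have Be: "B j (e *\<^sub>R y) = - (1 / e * w i y * partial j \<psi> (e *\<^sub>R y)) - 1 / e\<^sup>2 * G j y * \<psi> (e *\<^sub>R y)" for j
        unfolding B_def homogeneousD[OF w(2) e False] homogeneousD[OF hG e False] by (simp add: power_int_minus divide_inverse)
      have ke: "k' (e *\<^sub>R y) = 30 * bump 1 2 (norm y) / e" using e by (simp add: k'_def)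
      have trm: "e ^ 3 * (k' (e *\<^sub>R y) * ((e *\<^sub>R y) $ j * B j (e *\<^sub>R y) / norm (e *\<^sub>R y)))
        = - (30 * bump 1 2 (norm y) / norm y * (e * (w i y * (y $ j * partial j \<psi> (e *\<^sub>R y))) + \<psi> (e *\<^sub>R y) * (y $ j * G j y)))" for j
        unfolding ke Be using e False by (simp add: field_simps power2_eq_square power3_eq_cube)
      have "- (e ^ 3 * (\<Sum>j\<in>UNIV. k' (e *\<^sub>R y) * ((e *\<^sub>R y) $ j * B j (e *\<^sub>R y) / norm (e *\<^sub>R y))))
         = (\<Sum>j\<in>UNIV. 30 * bump 1 2 (norm y) / norm y * (e * (w i y * (y $ j * partial j \<psi> (e *\<^sub>R y))) + \<psi> (e *\<^sub>R y) * (y $ j * G j y)))"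
        unfolding sum_distrib_left[of "e ^ 3"] trm sum_negf by simp
      also have "\<dots> = 30 * bump 1 2 (norm y) * (inv_sq y * norm y) * (\<Sum>j\<in>UNIV. e * (w i y * (y $ j * partial j \<psi> (e *\<^sub>R y))) + \<psi> (e *\<^sub>R y) * (y $ j * G j y))"
        using False by (simp add: sum_distrib_left inv_sq_def power2_eq_square)
      also have "(\<Sum>j\<in>UNIV. e * (w i y * (y $ j * partial j \<psi> (e *\<^sub>R y))) + \<psi> (e *\<^sub>R y) * (y $ j * G j y))
        = e * (w i y * (\<Sum>j\<in>UNIV. y $ j * partial j \<psi> (e *\<^sub>R y))) + \<psi> (e *\<^sub>R y) * (\<Sum>j\<in>UNIV. y $ j * G j y)"
        by (simp only: sum.distrib sum_distrib_left)
      finally show ?thesis by (simp add: T_def)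
    qed
    have "(LINT x|lborel. k x * J x) = (LINT y|lborel. - (e ^ 3 * (\<Sum>j\<in>UNIV. k' (e *\<^sub>R y) * ((e *\<^sub>R y) $ j * B j (e *\<^sub>R y) / norm (e *\<^sub>R y)))))"
      unfolding 1 2 by simp
    then show ?thesis unfolding 3 k_def sph_def .
  qed
  define e where "e n = 1 / (real n + 1)" for n
  have e: "e n > 0" "e n \<le> 1" for n by (auto simp: e_def)
  have e0: "e \<longlonglongrightarrow> 0" unfolding e_def using LIMSEQ_inverse_real_of_nat by (simp add: inverse_eq_divide add.commute)
  \<comment> \<open>as the hole shrinks, the left side of \<open>main\<close> tends to the full integral and the right side
    to the flux times \<open>\<psi> 0\<close>\<close>
  have L1: "(\<lambda>n. LINT x|lborel. cutoff (norm x / e n) * J x) \<longlonglongrightarrow> (LINT x|lborel. J x)"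
  proof (rule integral_dominated_convergence)
    show "J \<in> borel_measurable lborel" using intJ by simp
    have cc: "continuous_on {0<..} cutoff"
      by (rule continuous_at_imp_continuous_on) (auto intro!: DERIV_isCont DERIV_cutoff)
    show "(\<lambda>x. cutoff (norm x / e n) * J x) \<in> borel_measurable lborel" for n
    proof -
      have "continuous_on (-{0}) (\<lambda>x::real^3. cutoff (norm x / e n))"
        by (rule continuous_on_compose2[OF cc]) (use e(1)[of n] in \<open>auto intro!: continuous_intros simp: zero_less_divide_iff\<close>)
      from borel_measurable_punctured[OF this] show ?thesis using borel_measurable_integrable[OF intJ] by simp
    qed
    show "integrable lborel (\<lambda>x. \<bar>J x\<bar>)" using intJ by (rule integrable_abs)
    show "AE x in lborel. (\<lambda>n. cutoff (norm x / e n) * J x) \<longlonglongrightarrow> J x"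
      using AE_nonzero
    proof eventually_elim
      case (elim x)
      obtain N :: nat where N: "real N \<ge> 2 / norm x" using real_arch_simple by blast
      have "cutoff (norm x / e n) * J x = J x" if "n \<ge> N" for n
      proof -
        have "2 / norm x \<le> real n + 1" using N that by linarith
        then have "2 \<le> norm x / e n" using elim by (simp add: e_def field_simps)
        then show ?thesis by (simp add: cutoff_1)
      qed
      then have "\<forall>\<^sub>F n in sequentially. cutoff (norm x / e n) * J x = J x" by (auto simp: eventually_sequentially)
      then show ?case by (rule tendsto_eventually)
    qed
    show "AE x in lborel. norm (cutoff (norm x / e n) * J x) \<le> \<bar>J x\<bar>" for n
      using cutoff_range by (intro AE_I2) (simp add: abs_mult mult_left_le_one_le)
  qed
  have cG: "continuous_on (-{0}) (G j)" and cw: "continuous_on (-{0}) (w j)" for j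
    by (rule smooth_on_continuous[OF sG], rule smooth_on_continuous[OF w(1)])
  have bounded: "\<exists>M. \<forall>x. \<bar>f x\<bar> \<le> M" if "continuous_on UNIV f" "\<And>x. norm x \<ge> R \<Longrightarrow> f x = 0" for f :: "real^3 \<Rightarrow> real"
  proof -
    have "compact (f ` cball 0 R)" by (intro compact_continuous_image continuous_on_subset[OF that(1)]) auto
    then obtain M where M: "\<And>x. x \<in> cball 0 R \<Longrightarrow> \<bar>f x\<bar> \<le> M"
      by (metis compact_imp_bounded bounded_iff imageI real_norm_def)
    have "\<bar>f x\<bar> \<le> \<bar>M\<bar>" for x using M[of x] that(2)[of x] by (cases "norm x \<le> R") auto
    then show ?thesis by blast
  qed
  obtain M0 where M0: "\<And>x. \<bar>\<psi> x\<bar> \<le> M0" using bounded[OF c\<psi>(1) R(2)] by blast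
  have "\<forall>j. \<exists>M. \<forall>x. \<bar>partial j \<psi> x\<bar> \<le> M" using bounded[OF c\<psi>(2) R(3)] by blast
  then obtain M1 where M1: "\<And>j x. \<bar>partial j \<psi> x\<bar> \<le> M1 j" by metis
  define dom where "dom y = norm y * (\<bar>w i y\<bar> * (\<Sum>j\<in>UNIV. \<bar>y $ j\<bar> * M1 j) + M0 * \<bar>\<Sum>j\<in>UNIV. y $ j * G j y\<bar>)" for y
  have L2: "(\<lambda>n. sph (T (e n))) \<longlonglongrightarrow> sph (\<lambda>y. \<psi> 0 * g y)"
    unfolding sph_def
  proof (rule integral_dominated_convergence)
    have cT: "continuous_on (-{0}) (T a)" for a unfolding T_def[abs_def]
      by (intro continuous_intros cw cG continuous_on_compose2[OF c\<psi>(1)] continuous_on_compose2[OF c\<psi>(2)]) auto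
    have cg: "continuous_on (-{0}) (\<lambda>y. \<psi> 0 * g y)" unfolding g_def by (intro continuous_intros cG)
    show "(\<lambda>x. 30 * bump 1 2 (norm x) * inv_sq x * (\<psi> 0 * g x)) \<in> borel_measurable lborel"
      using borel_measurable_integrable[OF sph_integrable[OF cg]] .
    show "(\<lambda>x. 30 * bump 1 2 (norm x) * inv_sq x * T (e n) x) \<in> borel_measurable lborel" for n
      using borel_measurable_integrable[OF sph_integrable[OF cT]] .
    show "integrable lborel (\<lambda>x. 30 * bump 1 2 (norm x) * inv_sq x * dom x)"
      by (rule sph_integrable) (unfold dom_def, intro continuous_intros cw cG)
    show "AE x in lborel. (\<lambda>n. 30 * bump 1 2 (norm x) * inv_sq x * T (e n) x) \<longlonglongrightarrow> 30 * bump 1 2 (norm x) * inv_sq x * (\<psi> 0 * g x)"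
    proof (rule AE_I2)
      fix x :: "real^3"
      have ex: "(\<lambda>n. e n *\<^sub>R x) \<longlonglongrightarrow> 0" using tendsto_scaleR[OF e0 tendsto_const[of x]] by simp
      have c0: "isCont \<psi> 0" "isCont (partial j \<psi>) 0" for j
        using c\<psi>(1) c\<psi>(2)[of j] by (simp_all add: continuous_on_eq_continuous_at)
      have "(\<lambda>n. T (e n) x) \<longlonglongrightarrow> norm x * (0 * (w i x * (\<Sum>j\<in>UNIV. x $ j * partial j \<psi> 0)) + \<psi> 0 * (\<Sum>j\<in>UNIV. x $ j * G j x))"
        unfolding T_def by (intro tendsto_intros e0 isCont_tendsto_compose[OF c0(1) ex] isCont_tendsto_compose[OF c0(2) ex])
      then have "(\<lambda>n. T (e n) x) \<longlonglongrightarrow> \<psi> 0 * g x" by (simp add: g_def mult.left_commute)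
      then show "(\<lambda>n. 30 * bump 1 2 (norm x) * inv_sq x * T (e n) x) \<longlonglongrightarrow> 30 * bump 1 2 (norm x) * inv_sq x * (\<psi> 0 * g x)"
        by (rule tendsto_mult_left)
    qed
    show "AE x in lborel. norm (30 * bump 1 2 (norm x) * inv_sq x * T (e n) x) \<le> 30 * bump 1 2 (norm x) * inv_sq x * dom x" for n
    proof (rule AE_I2)
      fix x :: "real^3"
      have "\<bar>\<Sum>j\<in>UNIV. x $ j * partial j \<psi> (e n *\<^sub>R x)\<bar> \<le> (\<Sum>j\<in>UNIV. \<bar>x $ j * partial j \<psi> (e n *\<^sub>R x)\<bar>)" by (rule sum_abs)
      also have "\<dots> \<le> (\<Sum>j\<in>UNIV. \<bar>x $ j\<bar> * M1 j)" by (intro sum_mono) (simp add: abs_mult mult_left_mono M1)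
      finally have s: "\<bar>\<Sum>j\<in>UNIV. x $ j * partial j \<psi> (e n *\<^sub>R x)\<bar> \<le> (\<Sum>j\<in>UNIV. \<bar>x $ j\<bar> * M1 j)" .
      have a: "\<bar>e n * (w i x * (\<Sum>j\<in>UNIV. x $ j * partial j \<psi> (e n *\<^sub>R x)))\<bar> \<le> 1 * (\<bar>w i x\<bar> * (\<Sum>j\<in>UNIV. \<bar>x $ j\<bar> * M1 j))"
        unfolding abs_mult using e[of n] s by (intro mult_mono mult_left_mono) auto
      have b: "\<bar>\<psi> (e n *\<^sub>R x) * (\<Sum>j\<in>UNIV. x $ j * G j x)\<bar> \<le> M0 * \<bar>\<Sum>j\<in>UNIV. x $ j * G j x\<bar>"
        unfolding abs_mult by (intro mult_right_mono M0) simp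
      have "\<bar>T (e n) x\<bar> \<le> dom x"
        unfolding T_def dom_def abs_mult[of "norm x"] abs_norm_cancel using a b
        by (intro mult_left_mono) (auto intro: order_trans[OF abs_triangle_ineq])
      moreover have "30 * bump 1 2 (norm x) * inv_sq x \<ge> 0" by (simp add: bump_nonneg inv_sq_def)
      ultimately show "norm (30 * bump 1 2 (norm x) * inv_sq x * T (e n) x) \<le> 30 * bump 1 2 (norm x) * inv_sq x * dom x"
        unfolding real_norm_def abs_mult[of "30 * bump 1 2 (norm x) * inv_sq x"] by (simp add: mult_left_mono)
    qed
  qed
  have "(LINT x|lborel. J x) = sph (\<lambda>y. \<psi> 0 * g y)"
    by (rule LIMSEQ_unique[OF L1]) (use L2 in \<open>simp only: main[OF e(1)]\<close>)
  then show ?thesis unfolding LJ sph_cmult g_def by (simp only: mult.commute)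
qed

section \<open>The flux of a Landau solution through the unit sphere\<close>

text \<open>The momentum flux \<open>U\<^sub>i (U \<bullet> \<nu>) - \<partial>\<^sub>\<nu> U\<^sub>i + P \<nu>\<^sub>i\<close> in the radial direction \<open>\<nu> = x / |x|\<close>, times
  \<open>|x|\<^sup>2\<close>; by Euler's relation, \<open>- x \<bullet> \<nabla>U\<^sub>i = U\<^sub>i\<close>.\<close>
definition flux_density :: "real^3 \<Rightarrow> 3 \<Rightarrow> real^3 \<Rightarrow> real" where
  "flux_density \<sigma> i x = norm x * (ball_vel \<sigma> x $ i * (1 + x \<bullet> ball_vel \<sigma> x) + ball_pressure \<sigma> x * x $ i)"

text \<open>Written in \<open>y = 1 - s t\<close>, \<open>s\<close> times the integrand is the derivative in \<open>y\<close> of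
  \<open>- (4/3) k\<^sup>2 / y\<^sup>3 + 4 k\<^sup>2 / y\<^sup>2 - 6 k / y - 4 ln y + 2 y\<close>.\<close>
lemma flux_integral:
  fixes s :: real
  assumes s: "0 < s" "s < 1"
  defines "k \<equiv> 1 - s\<^sup>2" and "I \<equiv> \<lambda>t. inverse (1 - s * t)"
  shows "((\<lambda>t. t * (4 * k\<^sup>2 * I t ^ 4 - 4 * k * I t ^ 3 + 2 * k * I t ^ 2 - 2 * I t)
      + s * ((2 * k * I t ^ 2 - 1) * (2 * I t))) has_integral flux s / (2 * pi)) {-1..1}"
    (is "(?f has_integral _) _")
proof -
  define G where "G t = - (1 / s\<^sup>2) * (- (4/3) * k\<^sup>2 * I t ^ 3 + 4 * k\<^sup>2 * I t ^ 2 - 6 * k * I t - 4 * ln (1 - s * t) + 2 * (1 - s * t))" for t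
  have pos: "1 - s * t > 0" if "t \<in> {-1..1}" for t
  proof -
    have "s * t \<le> s * 1" using that s by (intro mult_left_mono) auto
    then have "s * t \<le> s" by (simp only: mult_1_right)
    then show ?thesis using s by linarith
  qed
  have D: "(G has_field_derivative ?f t) (at t)" if t: "t \<in> {-1..1}" for t
  proof -
    have nz: "1 - s * t \<noteq> 0" using pos[OF t] by simp
    have dI: "(I has_field_derivative s * (I t)\<^sup>2) (at t)"
      unfolding I_def using nz by (auto intro!: derivative_eq_intros simp: power2_eq_square)
    have dl: "((\<lambda>t. ln (1 - s * t)) has_field_derivative - (s * I t)) (at t)"
      unfolding I_def using pos[OF t] by (auto intro!: derivative_eq_intros simp: divide_inverse)
    have dI2: "((\<lambda>t. I t ^ 2) has_field_derivative 2 * I t * (s * (I t)\<^sup>2)) (at t)"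
      and dI3: "((\<lambda>t. I t ^ 3) has_field_derivative 3 * I t ^ 2 * (s * (I t)\<^sup>2)) (at t)"
      using DERIV_power[OF dI, of 2] DERIV_power[OF dI, of 3] by (simp_all add: power2_eq_square mult_ac)
    have d1: "((\<lambda>t. 1 - s * t) has_field_derivative - s) (at t)" by (auto intro!: derivative_eq_intros)
    have "(G has_field_derivative - (1 / s\<^sup>2) * (- (4/3) * k\<^sup>2 * (3 * I t ^ 2 * (s * (I t)\<^sup>2)) + 4 * k\<^sup>2 * (2 * I t * (s * (I t)\<^sup>2))
        - 6 * k * (s * (I t)\<^sup>2) - 4 * (- (s * I t)) + 2 * (- s))) (at t)"
      unfolding G_def by (rule d1 dI3 dI2 dI dl DERIV_cmult DERIV_add DERIV_diff)+
    moreover have "- (1 / s\<^sup>2) * (- (4/3) * k\<^sup>2 * (3 * I t ^ 2 * (s * (I t)\<^sup>2)) + 4 * k\<^sup>2 * (2 * I t * (s * (I t)\<^sup>2))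
        - 6 * k * (s * (I t)\<^sup>2) - 4 * (- (s * I t)) + 2 * (- s)) = ?f t"
    proof -
      have L: "- (1 / c) * Z = F" if "c \<noteq> 0" "c * F = - Z" for c F Z :: real
      proof -
        have "F = (c * F) / c" using that(1) by simp
        then show ?thesis unfolding that(2) by simp
      qed
      have "(1 - s * t) * I t = 1" using nz by (simp add: I_def)
      then have st: "s * t * I t = I t - 1" by (simp add: algebra_simps)
      have s2: "s\<^sup>2 = 1 - k" by (simp add: k_def)
      have "s\<^sup>2 * ?f t = s * (s * t * I t) * (4 * k\<^sup>2 * I t ^ 3 - 4 * k * I t ^ 2 + 2 * k * I t - 2)
          + s\<^sup>2 * s * ((2 * k * I t ^ 2 - 1) * (2 * I t))"
        by (simp add: algebra_simps power2_eq_square power3_eq_cube power4_eq_xxxx)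
      also have "\<dots> = - (- (4/3) * k\<^sup>2 * (3 * I t ^ 2 * (s * (I t)\<^sup>2)) + 4 * k\<^sup>2 * (2 * I t * (s * (I t)\<^sup>2))
          - 6 * k * (s * (I t)\<^sup>2) - 4 * (- (s * I t)) + 2 * (- s))"
        unfolding st s2 by (simp add: algebra_simps power2_eq_square power3_eq_cube)
      finally show ?thesis by (rule L[rotated]) (use s in simp)
    qed
    ultimately show ?thesis by simp
  qed
  have "(?f has_integral (G 1 - G (-1))) {-1..1}"
  proof (rule fundamental_theorem_of_calculus)
    fix t :: real assume "t \<in> {-1..1}"
    from D[OF this] show "(G has_vector_derivative ?f t) (at t within {-1..1})"
      unfolding has_real_derivative_iff_has_vector_derivative by (rule has_vector_derivative_at_within)
  qed simp
  moreover have "G 1 - G (-1) = flux s / (2 * pi)"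
  proof -
    have kp: "k = (1 - s) * (1 + s)" "1 - s > 0" "1 + s > 0" using s by (simp_all add: k_def power2_eq_square algebra_simps)
    have k0: "k \<noteq> 0" using kp by simp
    have inv: "k * I 1 = 1 + s" "k * I (-1) = 1 - s" using kp(2,3) unfolding kp(1) by (simp_all add: I_def)
    have I1: "I 1 = (1 + s) / k" "I (-1) = (1 - s) / k" using inv k0 by (simp_all add: field_simps)
    have c: "k\<^sup>2 * I t ^ 3 = (k * I t) ^ 3 / k" "k\<^sup>2 * I t ^ 2 = (k * I t)\<^sup>2" for t
      using k0 by (simp_all add: power_mult_distrib power2_eq_square power3_eq_cube)
    have G: "G t = - (1 / s\<^sup>2) * (- (4/3) * ((k * I t) ^ 3 / k) + 4 * (k * I t)\<^sup>2 - 6 * (k * I t) - 4 * ln (1 - s * t) + 2 * (1 - s * t))" for t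
      unfolding G_def c[symmetric] by (simp only: mult.assoc)
    have ln: "ln ((1 - s) / (1 + s)) = ln (1 - s) - ln (1 + s)" using kp by (simp add: ln_div)
    have cube: "(1 + s) ^ 3 = 1 + 3 * s + 3 * s\<^sup>2 + s ^ 3" "(1 - s) ^ 3 = 1 - 3 * s + 3 * s\<^sup>2 - s ^ 3"
      by (simp_all add: power3_eq_cube power2_eq_square algebra_simps)
    have "s\<^sup>2 * (G 1 - G (-1)) = 4/3 * ((1 + s) ^ 3 - (1 - s) ^ 3) / k - 4 * ((1 + s)\<^sup>2 - (1 - s)\<^sup>2) + 12 * s
        + 4 * ln ((1 - s) / (1 + s)) + 4 * s"
      unfolding G inv ln using s by (simp add: field_simps) (simp add: diff_divide_distrib)
    also have "\<dots> = (8 * s + 8 * s ^ 3 / 3) / k + 4 * ln ((1 - s) / (1 + s))"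
      unfolding cube by (simp add: power2_eq_square algebra_simps add_divide_distrib)
    also have "(8 * s + 8 * s ^ 3 / 3) / k = 8 * s + 32 * s ^ 3 / (3 * k)"
    proof -
      have "8 * s + 8 * s ^ 3 / 3 = 8 * s * k + 32 * s ^ 3 / 3" by (simp add: k_def power2_eq_square power3_eq_cube algebra_simps)
      then show ?thesis using k0 by (simp add: add_divide_distrib)
    qed
    also have "8 * s + 32 * s ^ 3 / (3 * k) + 4 * ln ((1 - s) / (1 + s)) = s\<^sup>2 * (flux s / (2 * pi))"
    proof -
      have "flux s / (2 * pi) = 8 * (1 / s + ln ((1 - s) / (1 + s)) / (2 * s\<^sup>2) + 4 * s / (3 * k))"
        by (simp add: flux_def k_def)
      moreover have "s\<^sup>2 * (8 * (1 / s + l / (2 * s\<^sup>2) + 4 * s / (3 * k))) = 8 * s + 32 * s ^ 3 / (3 * k) + 4 * l" for l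
        using s k0 by (simp add: distrib_left power2_eq_square power3_eq_cube)
      ultimately show ?thesis by simp
    qed
    finally have "s\<^sup>2 * (G 1 - G (-1)) = s\<^sup>2 * (flux s / (2 * pi))" .
    then show ?thesis by (rule mult_left_cancel[THEN iffD1, rotated]) (use s in simp)
  qed
  ultimately show ?thesis by (simp only:)
qed

text \<open>The flux density is a function of the height over the axis \<open>\<sigma>\<close> plus the \<open>i\<close>-th direction cosine
  times such a function. The hat-box theorem leaves one integral over the heights.\<close>
lemma sph_flux_density:
  assumes \<sigma>: "norm \<sigma> < 1" shows "sph (flux_density \<sigma> i) = flux_vec \<sigma> $ i"
proof (cases "\<sigma> = 0")
  case True
  have "sph (flux_density \<sigma> i) = sph (\<lambda>x. 0 * 0)"
    by (rule sph_cong) (simp add: True flux_density_def ball_vel_def ball_pressure_def power2_eq_square divide_inverse)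
  then show ?thesis using True unfolding sph_cmult by (simp add: flux_vec_def)
next
  case False
  define s where "s = norm \<sigma>"
  define m where "m = \<sigma> /\<^sub>R s"
  define k where "k = 1 - s\<^sup>2"
  define I where "I t = inverse (1 - s * t)" for t :: real
  define A where "A t = 4 * k\<^sup>2 * I t ^ 4 - 4 * k * I t ^ 3 + 2 * k * I t ^ 2 - 2 * I t" for t
  define B where "B t = (2 * k * I t ^ 2 - 1) * (2 * I t)" for t
  have s: "0 < s" "s < 1" using False \<sigma> by (auto simp: s_def)
  have m: "norm m = 1" "\<sigma> = s *\<^sub>R m" using s by (simp_all add: m_def) (simp add: s_def)
  have pos: "1 - s * t > 0" if "t \<in> {-1..1}" for t
  proof -
    have "s * t \<le> s * 1" using that s by (intro mult_left_mono) auto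
    then have "s * t \<le> s" by (simp only: mult_1_right)
    then show ?thesis using s by linarith
  qed
  have cI: "continuous_on {-1..1} I" unfolding I_def[abs_def]
    by (intro continuous_intros) (use pos in fastforce)
  have cA: "continuous_on {-1..1} A" and cB: "continuous_on {-1..1} B"
    unfolding A_def[abs_def] B_def[abs_def] by (intro continuous_intros cI)+
  \<comment> \<open>here \<open>1 - s t\<close> is \<open>(|x| - \<sigma> \<bullet> x) / |x|\<close>, with \<open>t\<close> the height of the direction of \<open>x\<close>\<close>
  have dens: "flux_density \<sigma> i x = unit_comp i x * A (height m x) + \<sigma> $ i * B (height m x)" if x: "x \<noteq> 0" for x
  proof -
    define r e t where "r = norm x" and "e = unit_comp i x" and "t = height m x"
    have r: "r > 0" using x by (simp add: r_def)
    have tt: "1 - s * t > 0" unfolding t_def by (rule pos[OF abs_height_le[OF m(1) x]])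
    have xi: "x $ i = r * e" using r by (simp add: e_def unit_comp_def inv_norm_def r_def)
    have sx: "\<sigma> \<bullet> x = r * (s * t)" using r by (simp add: m(2) t_def height_def inv_norm_def r_def)
    have D: "r - \<sigma> \<bullet> x = r * (1 - s * t)" unfolding sx by (simp add: algebra_simps)
    have ss: "\<sigma> \<bullet> \<sigma> = 1 - k" unfolding k_def s_def by (simp add: power2_norm_eq_inner)
    have nx: "x \<bullet> x = r * r" by (simp add: r_def dot_square_norm power2_eq_square)
    have bv: "ball_vel \<sigma> x = (2 * k * (I t)\<^sup>2 / r\<^sup>2) *\<^sub>R x - (2 * I t / r) *\<^sub>R (x /\<^sub>R r - \<sigma>)"
      unfolding ball_vel_def r_def[symmetric] unfolding D ss I_def by (simp add: divide_inverse power_mult_distrib power_inverse mult_ac)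
    have iD: "(1 - s * t) * I t = 1" using tt by (simp add: I_def)
    have ui: "ball_vel \<sigma> x $ i = (2 * k * (I t)\<^sup>2 * e - 2 * I t * (e - \<sigma> $ i)) / r"
      unfolding bv using r by (simp add: xi field_simps power2_eq_square)
    have "x \<bullet> ball_vel \<sigma> x = 2 * k * (I t)\<^sup>2 - 2 * ((1 - s * t) * I t)"
      unfolding bv inner_diff_right inner_scaleR_right nx inner_commute[of x \<sigma>] sx using r by (simp add: field_simps power2_eq_square)
    then have xu: "x \<bullet> ball_vel \<sigma> x = 2 * k * (I t)\<^sup>2 - 2" unfolding iD by simp
    have bp: "ball_pressure \<sigma> x = 4 * (k - (1 - s * t)) * (I t)\<^sup>2 / r\<^sup>2"
      unfolding ball_pressure_def r_def[symmetric] unfolding D ss I_def unfolding sx using r by (simp add: divide_inverse power_mult_distrib power_inverse mult_ac)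
    have p2: "(k - (1 - s * t)) * (I t)\<^sup>2 = k * (I t)\<^sup>2 - I t"
    proof -
      have "(k - (1 - s * t)) * (I t)\<^sup>2 = k * (I t)\<^sup>2 - ((1 - s * t) * I t) * I t" by (simp add: power2_eq_square algebra_simps)
      then show ?thesis unfolding iD by simp
    qed
    have "flux_density \<sigma> i x = (2 * k * (I t)\<^sup>2 * e - 2 * I t * (e - \<sigma> $ i)) * (1 + (2 * k * (I t)\<^sup>2 - 2)) + 4 * ((k - (1 - s * t)) * (I t)\<^sup>2) * e"
      unfolding flux_density_def ui xu bp r_def[symmetric] xi using r by (simp add: field_simps power2_eq_square)
    also have "\<dots> = e * A t + \<sigma> $ i * B t"
      unfolding p2 A_def B_def by (simp add: algebra_simps power2_eq_square power3_eq_cube power4_eq_xxxx)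
    finally show ?thesis by (simp add: e_def t_def)
  qed
  have "sph (flux_density \<sigma> i) = sph (\<lambda>x. unit_comp i x * A (height m x) + \<sigma> $ i * B (height m x))"
    by (rule sph_cong[OF dens])
  also have "\<dots> = m $ i * (2 * pi * integral {-1..1} (\<lambda>t. t * A t)) + \<sigma> $ i * (2 * pi * integral {-1..1} B)"
    unfolding sph_add[OF continuous_on_mult[OF cont_unit_comp[OF m(1)] cont_compose_height[OF m(1) cA]]
        continuous_on_mult[OF continuous_on_const cont_compose_height[OF m(1) cB]]]
      sph_cmult sph_height[OF m(1) cA] sph_height[OF m(1) cB] ..
  also have "\<dots> = m $ i * (2 * pi * (integral {-1..1} (\<lambda>t. t * A t) + integral {-1..1} (\<lambda>t. s * B t)))"
  proof -
    have "integral {-1..1} (\<lambda>t. s * B t) = s * integral {-1..1} B" by (rule integral_mult_right)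
    moreover have "\<sigma> $ i = s * m $ i" using arg_cong[OF m(2), of "\<lambda>v. v $ i"] by simp
    ultimately show ?thesis by (simp add: distrib_left mult_ac)
  qed
  also have "integral {-1..1} (\<lambda>t. t * A t) + integral {-1..1} (\<lambda>t. s * B t) = integral {-1..1} (\<lambda>t. t * A t + s * B t)"
    by (rule Henstock_Kurzweil_Integration.integral_add[symmetric]) (intro integrable_continuous_real continuous_intros cA cB)+
  also have "\<dots> = flux s / (2 * pi)"
    using integral_unique[OF flux_integral[OF s]] by (simp add: A_def B_def I_def k_def)
  finally have "sph (flux_density \<sigma> i) = m $ i * flux s" by simp
  then show ?thesis
    by (simp only: flux_vec_def m_def s_def vector_scaleR_component real_scaleR_def divide_inverse mult_ac)
qed

section \<open>The flux of a parameter derivative\<close>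

lemma sph_HK:
  assumes g: "continuous_on (-{0}) g" and S: "cball 0 2 \<subseteq> S"
  shows "sph g = integral S (\<lambda>x. 30 * bump 1 2 (norm x) * inv_sq x * g x)" and
    "(\<lambda>x. 30 * bump 1 2 (norm x) * inv_sq x * g x) integrable_on S"
proof -
  let ?f = "\<lambda>x. 30 * bump 1 2 (norm x) * inv_sq x * g x"
  have "(\<lambda>x. if x \<in> S then ?f x else 0) = ?f"
  proof
    fix x show "(if x \<in> S then ?f x else 0) = ?f x"
      using S sph_integrand_0[of x g] by (cases "norm x \<le> 2") auto
  qed
  moreover have "(?f has_integral sph g) UNIV" unfolding sph_def by (rule has_integral_integral_lborel[OF sph_integrable[OF g]])
  ultimately have "((\<lambda>x. if x \<in> S then ?f x else 0) has_integral sph g) UNIV" by (simp only:)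
  then have "(?f has_integral sph g) S" by (simp only: has_integral_restrict_UNIV)
  then show "sph g = integral S ?f" "?f integrable_on S" by (auto simp: integral_unique)
qed

text \<open>The weight of \<open>sph\<close> vanishes near the origin, so the derivative of the integrand extends to a
  jointly continuous function and the integral may be differentiated under the integral sign.\<close>
lemma DERIV_sph:
  fixes g g' :: "real \<Rightarrow> real^3 \<Rightarrow> real"
  assumes e: "e > 0"
    and d: "\<And>t x. \<bar>t\<bar> < e \<Longrightarrow> x \<noteq> 0 \<Longrightarrow> ((\<lambda>t. g t x) has_field_derivative g' t x) (at t)"
    and c: "\<And>t. \<bar>t\<bar> < e \<Longrightarrow> continuous_on (-{0}) (g t)"
    and c': "continuous_on ({-e<..<e} \<times> -{0}) (\<lambda>(t, x). g' t x)"
  shows "((\<lambda>t. sph (g t)) has_field_derivative sph (g' 0)) (at 0)"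
proof -
  define W where "W x = 30 * bump 1 2 (norm x) * inv_sq x" for x :: "real^3"
  obtain a b :: "real^3" where ab: "cball 0 2 \<subseteq> cbox a b"
    using bounded_subset_cbox_symmetric[OF bounded_cball] by metis
  have W0: "W x = 0" if "norm x \<le> 1" for x using bump_eq_0[of 1 2 "norm x"] that by (simp add: W_def)
  have cW: "continuous_on (-{0}) W" unfolding W_def[abs_def]
    using smooth_on_continuous[OF smooth_inverse_norm_sq] by (intro continuous_intros continuous_bump_norm)
  have cont: "continuous_on ({-e<..<e} \<times> UNIV) (\<lambda>(t, x). W x * g' t x)"
  proof -
    have "continuous_on ({-e<..<e} \<times> -{0} \<union> {-e<..<e} \<times> ball 0 1) (\<lambda>(t, x). W x * g' t x)"
    proof (rule continuous_on_open_Un)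
      show "continuous_on ({-e<..<e} \<times> -{0}) (\<lambda>(t, x). W x * g' t x)"
        using c' unfolding case_prod_beta
        by (intro continuous_on_mult continuous_on_compose2[OF cW]) (auto intro!: continuous_intros)
      have "continuous_on ({-e<..<e} \<times> ball (0::real^3) 1) (\<lambda>_. 0 :: real)" by (rule continuous_on_const)
      then show "continuous_on ({-e<..<e} \<times> ball 0 1) (\<lambda>(t, x). W x * g' t x)"
        by (rule continuous_on_eq) (auto simp: W0)
    qed (auto intro!: open_Times)
    moreover have "{-e<..<e} \<times> -{0} \<union> {-e<..<e} \<times> ball 0 1 = {-e<..<e} \<times> (UNIV :: (real^3) set)" by auto
    ultimately show ?thesis by simp
  qed
  have "((\<lambda>t. integral (cbox a b) (\<lambda>x. W x * g t x)) has_field_derivative integral (cbox a b) (\<lambda>x. W x * g' 0 x)) (at 0 within {-e<..<e})"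
  proof (rule leibniz_rule_field_derivative)
    show "((\<lambda>t. W x * g t x) has_field_derivative W x * g' t x) (at t within {-e<..<e})"
      if "t \<in> {-e<..<e}" for t x
    proof (cases "x = 0")
      case False
      have "((\<lambda>t. g t x) has_field_derivative g' t x) (at t within {-e<..<e})"
        using d[of t x] that False by (auto intro: has_field_derivative_at_within)
      then show ?thesis by (rule DERIV_cmult)
    qed (simp add: W0)
    show "(\<lambda>x. W x * g t x) integrable_on cbox a b" if "t \<in> {-e<..<e}" for t
      using sph_HK(2)[OF c ab, of t] that by (auto simp: W_def)
    show "continuous_on ({-e<..<e} \<times> cbox a b) (\<lambda>(t, x). W x * g' t x)"
      by (rule continuous_on_subset[OF cont]) auto
  qed (use e in auto)
  moreover have "at 0 within {-e<..<e} = at 0" by (rule at_within_open) (use e in auto)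
  moreover have "integral (cbox a b) (\<lambda>x. W x * g' 0 x) = sph (g' 0)"
  proof -
    have "continuous_on (-{0}) (\<lambda>x. (\<lambda>(t, x). g' t x) (0, x))"
      by (rule continuous_on_compose2[OF c']) (use e in \<open>auto intro!: continuous_intros\<close>)
    then show ?thesis using sph_HK(1)[OF _ ab, of "g' 0"] by (simp add: W_def)
  qed
  ultimately have "((\<lambda>t. integral (cbox a b) (\<lambda>x. W x * g t x)) has_field_derivative sph (g' 0)) (at 0)" by simp
  then show ?thesis
  proof (rule has_field_derivative_transform_within[OF _ e])
    show "integral (cbox a b) (\<lambda>x. W x * g t x) = sph (g t)" if "dist t 0 < e" for t
      using sph_HK(1)[OF c ab, of t] that by (simp add: W_def)
  qed simp
qed

text \<open>The values \<open>dU\<close> and \<open>dP\<close> with \<open>\<sigma>\<close> replaced by a variable \<open>\<tau>\<close>, as needed for joint continuity.\<close>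
definition vel_deriv :: "real^3 \<Rightarrow> real^3 \<Rightarrow> 3 \<Rightarrow> real^3 \<Rightarrow> real" where
  "vel_deriv \<tau> d i x = (let I = inverse (norm x - \<tau> \<bullet> x) in 2 * d $ i * I - 2 * (d \<bullet> x) * (x $ i * inv_norm x - \<tau> $ i) * I\<^sup>2
     + 4 * (1 - \<tau> \<bullet> \<tau>) * (d \<bullet> x) * x $ i * I^3 - 4 * (d \<bullet> \<tau>) * x $ i * I\<^sup>2)"
definition pressure_deriv :: "real^3 \<Rightarrow> real^3 \<Rightarrow> real^3 \<Rightarrow> real" where
  "pressure_deriv \<tau> d x = (let I = inverse (norm x - \<tau> \<bullet> x) in 8 * (1 - \<tau> \<bullet> \<tau>) * (d \<bullet> x) * I^3 - 8 * (d \<bullet> \<tau>) * I\<^sup>2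
     - 4 * (d \<bullet> x) * inv_norm x * I\<^sup>2)"

lemma (in landau_ball) dU_explicit: "dU d i x = vel_deriv \<sigma> d i x"
  by (simp add: dU_def vel_deriv_def Let_def iD_def D_def n_def K_def inverse_eq_divide)

lemma (in landau_ball) dP_explicit: "dP d x = pressure_deriv \<sigma> d x"
  by (simp add: dP_def pressure_deriv_def Let_def iD_def D_def K_def inverse_eq_divide)

lemma vel_deriv_scale: "vel_deriv \<tau> (h *\<^sub>R d) i x = vel_deriv \<tau> d i x * h"
  by (simp add: vel_deriv_def Let_def algebra_simps)

lemma pressure_deriv_scale: "pressure_deriv \<tau> (h *\<^sub>R d) x = pressure_deriv \<tau> d x * h"
  by (simp add: pressure_deriv_def Let_def algebra_simps)

lemma DERIV_ball:
  assumes \<tau>: "norm (\<sigma> + t *\<^sub>R d) < 1" and x: "x \<noteq> 0"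
  shows "((\<lambda>t. ball_vel (\<sigma> + t *\<^sub>R d) x $ i) has_field_derivative vel_deriv (\<sigma> + t *\<^sub>R d) d i x) (at t)"
    "((\<lambda>t. ball_pressure (\<sigma> + t *\<^sub>R d) x) has_field_derivative pressure_deriv (\<sigma> + t *\<^sub>R d) d x) (at t)"
proof -
  interpret landau_ball "\<sigma> + t *\<^sub>R d" by unfold_locales (rule \<tau>)
  have l: "((\<lambda>t. \<sigma> + t *\<^sub>R d) has_derivative (\<lambda>h. h *\<^sub>R d)) (at t)" by (auto intro!: derivative_eq_intros)
  have "((\<lambda>t. ball_vel (\<sigma> + t *\<^sub>R d) x) has_derivative (\<lambda>h. \<chi> i. dU (h *\<^sub>R d) i x)) (at t)"
    by (rule has_derivative_compose[OF l has_derivative_ball_vel[OF x]])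
  from bounded_linear.has_derivative[OF bounded_linear_vec_nth this, of i]
  show "((\<lambda>t. ball_vel (\<sigma> + t *\<^sub>R d) x $ i) has_field_derivative vel_deriv (\<sigma> + t *\<^sub>R d) d i x) (at t)"
    by (simp add: has_field_derivative_def dU_explicit vel_deriv_scale)
  have "((\<lambda>t. ball_pressure (\<sigma> + t *\<^sub>R d) x) has_derivative (\<lambda>h. dP (h *\<^sub>R d) x)) (at t)"
    by (rule has_derivative_compose[OF l has_derivative_ball_pressure[OF x]])
  then show "((\<lambda>t. ball_pressure (\<sigma> + t *\<^sub>R d) x) has_field_derivative pressure_deriv (\<sigma> + t *\<^sub>R d) d x) (at t)"
    by (simp add: has_field_derivative_def dP_explicit pressure_deriv_scale)
qed

definition flux_density_deriv :: "real^3 \<Rightarrow> real^3 \<Rightarrow> 3 \<Rightarrow> real^3 \<Rightarrow> real" where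
  "flux_density_deriv \<tau> d i x = norm x * (vel_deriv \<tau> d i x * (1 + x \<bullet> ball_vel \<tau> x)
     + ball_vel \<tau> x $ i * (\<Sum>j\<in>UNIV. x $ j * vel_deriv \<tau> d j x) + pressure_deriv \<tau> d x * x $ i)"

lemma DERIV_flux_density:
  assumes \<tau>: "norm (\<sigma> + t *\<^sub>R d) < 1" and x: "x \<noteq> 0"
  shows "((\<lambda>t. flux_density (\<sigma> + t *\<^sub>R d) i x) has_field_derivative flux_density_deriv (\<sigma> + t *\<^sub>R d) d i x) (at t)"
proof -
  note D = DERIV_ball[OF \<tau> x]
  have F: "((\<lambda>t. x \<bullet> ball_vel (\<sigma> + t *\<^sub>R d) x) has_field_derivative (\<Sum>j\<in>UNIV. x $ j * vel_deriv (\<sigma> + t *\<^sub>R d) d j x)) (at t)"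
    unfolding inner_vec_def inner_real_def by (intro DERIV_sum DERIV_cmult D)
  have "((\<lambda>t. 1 + x \<bullet> ball_vel (\<sigma> + t *\<^sub>R d) x) has_field_derivative (0 + (\<Sum>j\<in>UNIV. x $ j * vel_deriv (\<sigma> + t *\<^sub>R d) d j x))) (at t)"
    by (rule DERIV_add[OF DERIV_const F])
  from DERIV_cmult[OF DERIV_add[OF DERIV_mult[OF D(1) this] DERIV_cmult_right[OF D(2)]], of "norm x" i "x $ i"]
  show ?thesis unfolding flux_density_def flux_density_deriv_def by (rule DERIV_cong) (simp add: algebra_simps)
qed

lemma norm_inner_pos: "norm (\<tau>::real^3) < 1 \<Longrightarrow> x \<noteq> 0 \<Longrightarrow> norm x - \<tau> \<bullet> x \<noteq> 0"
  using landau_ball.D_pos[of \<tau> x] landau_ball.intro[of \<tau>] landau_ball.D_def[of \<tau> x] by force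

lemma continuous_flux_density_deriv:
  assumes "\<And>t. t \<in> T \<Longrightarrow> norm (\<sigma> + t *\<^sub>R d) < 1"
  shows "continuous_on (T \<times> -{0}) (\<lambda>(t, x). flux_density_deriv (\<sigma> + t *\<^sub>R d) d i x)"
    and "t \<in> T \<Longrightarrow> continuous_on (-{0}) (flux_density (\<sigma> + t *\<^sub>R d) i)"
proof -
  have nz: "norm x - (\<sigma> + t *\<^sub>R d) \<bullet> x \<noteq> 0" if "t \<in> T" "x \<noteq> 0" for t x
    by (rule norm_inner_pos[OF assms]) (use that in auto)
  show "continuous_on (T \<times> -{0}) (\<lambda>(t, x). flux_density_deriv (\<sigma> + t *\<^sub>R d) d i x)"
    unfolding case_prod_beta flux_density_deriv_def vel_deriv_def pressure_deriv_def ball_vel_def Let_def inv_norm_def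
    by (intro continuous_intros) (use nz in auto)
  show "continuous_on (-{0}) (flux_density (\<sigma> + t *\<^sub>R d) i)" if "t \<in> T"
    unfolding flux_density_def[abs_def] ball_pressure_def ball_vel_def
    by (intro continuous_intros) (use nz that in auto)
qed

text \<open>The integral of the linearized flux is the derivative of the integral of the nonlinear one, which
  is known in closed form.\<close>
lemma sph_flux_density_deriv:
  assumes \<sigma>: "norm \<sigma> < 1" and E': "(flux_vec has_derivative E') (at \<sigma>)"
  shows "sph (flux_density_deriv \<sigma> d i) = E' d $ i"
proof -
  define e where "e = (1 - norm \<sigma>) / (norm d + 1)"
  \<comment> \<open>small enough for the segment to stay in the unit ball\<close>
  have nd: "norm d + 1 > 0" by (rule add_nonneg_pos) auto
  have e: "e > 0" unfolding e_def using \<sigma> nd by (intro divide_pos_pos) auto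
  have lt: "norm (\<sigma> + t *\<^sub>R d) < 1" if "\<bar>t\<bar> < e" for t
  proof -
    have "\<bar>t\<bar> * (norm d + 1) < e * (norm d + 1)" using that nd by (rule mult_strict_right_mono)
    also have "e * (norm d + 1) = 1 - norm \<sigma>" using nd by (simp add: e_def)
    finally have "\<bar>t\<bar> * norm d + \<bar>t\<bar> < 1 - norm \<sigma>" by (simp only: distrib_left mult_1_right)
    then show ?thesis using norm_triangle_ineq[of \<sigma> "t *\<^sub>R d"] by simp
  qed
  have "((\<lambda>t. sph (flux_density (\<sigma> + t *\<^sub>R d) i)) has_field_derivative sph (flux_density_deriv (\<sigma> + 0 *\<^sub>R d) d i)) (at 0)"
  proof (rule DERIV_sph[OF e])
    show "((\<lambda>t. flux_density (\<sigma> + t *\<^sub>R d) i x) has_field_derivative flux_density_deriv (\<sigma> + t *\<^sub>R d) d i x) (at t)"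
      if "\<bar>t\<bar> < e" "x \<noteq> 0" for t x by (rule DERIV_flux_density[OF lt[OF that(1)] that(2)])
    show "continuous_on (-{0}) (flux_density (\<sigma> + t *\<^sub>R d) i)" if "\<bar>t\<bar> < e" for t
      by (rule continuous_flux_density_deriv(2)[of "{t. \<bar>t\<bar> < e}"]) (use lt that in auto)
    show "continuous_on ({-e<..<e} \<times> -{0}) (\<lambda>(t, x). flux_density_deriv (\<sigma> + t *\<^sub>R d) d i x)"
      by (rule continuous_flux_density_deriv(1)) (use lt in \<open>auto simp: abs_less_iff\<close>)
  qed
  then have 1: "((\<lambda>t. flux_vec (\<sigma> + t *\<^sub>R d) $ i) has_field_derivative sph (flux_density_deriv \<sigma> d i)) (at 0)"
    unfolding scaleR_zero_left add_0_right
    by (rule has_field_derivative_transform_within[OF _ e]) (simp_all add: sph_flux_density lt)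
  have l: "((\<lambda>t. \<sigma> + t *\<^sub>R d) has_derivative (\<lambda>h. h *\<^sub>R d)) (at (0::real))" by (auto intro!: derivative_eq_intros)
  have "(flux_vec has_derivative E') (at (\<sigma> + 0 *\<^sub>R d))" using E' by simp
  from bounded_linear.has_derivative[OF bounded_linear_vec_nth has_derivative_compose[OF l this], of i]
  have "((\<lambda>t. flux_vec (\<sigma> + t *\<^sub>R d) $ i) has_derivative (\<lambda>h. E' (h *\<^sub>R d) $ i)) (at 0)" .
  moreover have "E' (h *\<^sub>R d) = h *\<^sub>R E' d" for h
    using has_derivative_bounded_linear[OF E'] by (simp add: bounded_linear.linear linear_scale)
  ultimately have 2: "((\<lambda>t. flux_vec (\<sigma> + t *\<^sub>R d) $ i) has_field_derivative E' d $ i) (at 0)"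
    by (simp add: has_field_derivative_def mult.commute[of _ "E' d $ i"])
  show ?thesis by (rule DERIV_unique[OF 1 2])
qed

section \<open>The force of a self-similar solution\<close>

text \<open>Euler's relation turns the radial derivative in the momentum flux into \<open>w\<close> itself.\<close>
lemma linearized_distr_eq_of_solution:
  fixes U w :: "real^3 \<Rightarrow> real^3"
  assumes U: "smooth_on U (-{0})" "self_similar_vel U" "\<And>x. x \<noteq> 0 \<Longrightarrow> divergence U x = 0"
    and sol: "smooth_linearized_solution U w q" "self_similar_vel w" "self_similar_pressure q"
    and c: "\<And>i. c $ i = sph (\<lambda>x. norm x * (w x $ i * (1 + x \<bullet> U x) + U x $ i * (\<Sum>j\<in>UNIV. x $ j * w x $ j) + q x * x $ i))"
  shows "linearized_distr_eq U w q c"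
proof -
  have sw: "smooth_on w (-{0})" and sq: "smooth_on q (-{0})" using sol(1) by (auto simp: smooth_linearized_solution_def)
  have swi: "smooth_on (\<lambda>x. w x $ i) (-{0})" and sUi: "smooth_on (\<lambda>x. U x $ i) (-{0})" for i
    by (intro smooth_intros open_punctured sw U)+
  have hw: "homogeneous (-1) (\<lambda>x. w x $ i)" and hU: "homogeneous (-1) (\<lambda>x. U x $ i)" for i
    using sol(2) U(2) by (simp_all add: self_similar_vel_iff)
  have hq: "homogeneous (-2) q" using sol(3) by (simp add: self_similar_pressure_iff)
  have dw: "(\<Sum>i\<in>UNIV. partial i (\<lambda>x. w x $ i) x) = 0" and dU: "(\<Sum>i\<in>UNIV. partial i (\<lambda>x. U x $ i) x) = 0" if "x \<noteq> 0" for x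
    using sol(1) U(3)[OF that] that divergence_component[OF sw that] divergence_component[OF U(1) that]
    by (simp_all add: smooth_linearized_solution_def)
  have eq: "laplacian (\<lambda>x. w x $ i) x = (\<Sum>j\<in>UNIV. U x $ j * partial j (\<lambda>x. w x $ i) x + w x $ j * partial j (\<lambda>x. U x $ i) x) + partial i q x"
    if x: "x \<noteq> 0" for x i
  proof -
    have "linearized_op U w q x $ i = 0" using sol(1) x by (simp add: smooth_linearized_solution_def)
    then show ?thesis unfolding linearized_op_component[OF sw U(1) x] by simp
  qed
  have h2: "homogeneous (-2) (\<lambda>x. U x $ i * w x $ j + w x $ i * U x $ j)" for i j
    using homogeneous_add[OF homogeneous_mult[OF hU hw] homogeneous_mult[OF hw hU]] by simp
  have l1: "locally_integrable (\<lambda>x. w x $ i)" for i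
    by (rule locally_integrable_homogeneous[OF smooth_on_continuous[OF swi] hw]) simp
  have l2: "locally_integrable (\<lambda>x. U x $ i * w x $ j + w x $ i * U x $ j)" for i j
    by (rule locally_integrable_homogeneous[OF _ h2]) (intro continuous_intros smooth_on_continuous swi sUi, simp)
  have l3: "locally_integrable q"
    by (rule locally_integrable_homogeneous[OF smooth_on_continuous[OF sq] hq]) simp
  have "linearized_distr U w q i \<psi> = c $ i * dirac0 \<psi>" if \<psi>: "test_function \<psi>" for i \<psi>
  proof -
    have g: "norm x * (\<Sum>j\<in>UNIV. x $ j * (- partial j (\<lambda>x. w x $ i) x + (U x $ i * w x $ j + w x $ i * U x $ j) + (if j = i then q x else 0)))
      = norm x * (w x $ i * (1 + x \<bullet> U x) + U x $ i * (\<Sum>j\<in>UNIV. x $ j * w x $ j) + q x * x $ i)" if x: "x \<noteq> 0" for x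
    proof -
      have "(\<Sum>j\<in>UNIV. x $ j * (- partial j (\<lambda>x. w x $ i) x + (U x $ i * w x $ j + w x $ i * U x $ j) + (if j = i then q x else 0)))
        = - (\<Sum>j\<in>UNIV. x $ j * partial j (\<lambda>x. w x $ i) x) + U x $ i * (\<Sum>j\<in>UNIV. x $ j * w x $ j)
          + w x $ i * (\<Sum>j\<in>UNIV. x $ j * U x $ j) + (\<Sum>j\<in>UNIV. if j = i then x $ j * q x else 0)"
        unfolding sum_distrib_left sum_negf[symmetric] sum.distrib[symmetric]
        by (rule sum.cong) (auto simp: algebra_simps)
      also have "\<dots> = w x $ i * (1 + x \<bullet> U x) + U x $ i * (\<Sum>j\<in>UNIV. x $ j * w x $ j) + q x * x $ i"
        unfolding homogeneous_euler[OF swi hw x] by (simp add: inner_vec_def algebra_simps)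
      finally show ?thesis by (simp only:)
    qed
    have "linearized_distr U w q i \<psi> = - (\<Sum>j\<in>UNIV. LINT x|lborel. w x $ i * partial j (partial j \<psi>) x)
      - (\<Sum>j\<in>UNIV. LINT x|lborel. (U x $ i * w x $ j + w x $ i * U x $ j) * partial j \<psi> x)
      - (LINT x|lborel. q x * partial i \<psi> x)"
      by (simp add: linearized_distr_def distr_partial_def regular_distr_def sum_negf)
    also have "\<dots> = sph (\<lambda>x. norm x * (\<Sum>j\<in>UNIV. x $ j * (- partial j (\<lambda>x. w x $ i) x
        + (U x $ i * w x $ j + w x $ i * U x $ j) + (if j = i then q x else 0)))) * \<psi> 0"
      by (rule linearized_distribution_flux[where w="\<lambda>i x. w x $ i" and u="\<lambda>i x. U x $ i", OF swi hw dw sUi hU dU sq hq eq \<psi>])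
    also have "\<dots> = c $ i * \<psi> 0"
      unfolding c using sph_cong[OF g] by (rule arg_cong)
    finally show ?thesis by (simp add: dirac0_def)
  qed
  then show ?thesis unfolding linearized_distr_eq_def using l1 l2 l3 by blast
qed

section \<open>The parameter derivatives span the kernel\<close>

context landau_ball
begin

lemma background_field:
  assumes W: "\<And>x i. x \<noteq> 0 \<Longrightarrow> W x $ i = u i x"
  shows "smooth_on W (-{0})" "self_similar_vel W" "\<And>x. x \<noteq> 0 \<Longrightarrow> divergence W x = 0"
proof -
  have su: "smooth_on (u i) (-{0})" for i unfolding u_def by (rule smooth_flow_field[OF split_background])
  have sWi: "smooth_on (\<lambda>x. W x $ i) (-{0})" for i
    by (rule smooth_on_cong[OF su[of i] open_punctured]) (use W in auto)
  show sW: "smooth_on W (-{0})" by (rule smooth_on_vecI[OF open_punctured sWi])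
  have hu: "homogeneous (-1) (u i)" for i unfolding u_def by (rule homogeneous_flow_field[OF split_background])
  show "self_similar_vel W" unfolding self_similar_vel_iff
  proof
    fix i show "homogeneous (-1) (\<lambda>x. W x $ i)" by (rule homogeneous_cong[OF hu[of i]]) (simp add: W)
  qed
  show "divergence W x = 0" if x: "x \<noteq> 0" for x
  proof -
    have p: "partial i (\<lambda>x. W x $ i) x = partial i (u i) x" for i by (rule partial_cong_punctured[OF W x])
    show ?thesis unfolding divergence_component[OF sW x] p unfolding u_def by (rule divergence_flow_field[OF split_background x])
  qed
qed

end

lemma sum_axis: fixes L :: "real^3 \<Rightarrow> 'b::real_vector"
  assumes "linear L" shows "(\<Sum>i\<in>UNIV. c $ i *\<^sub>R L (axis i 1)) = L c"
proof -
  have "(\<Sum>i\<in>UNIV. c $ i *\<^sub>R L (axis i 1)) = L (\<Sum>i\<in>UNIV. c $ i *\<^sub>R axis i 1)"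
    by (simp add: linear_sum[OF assms] linear_scale[OF assms])
  also have "(\<Sum>i\<in>UNIV. c $ i *\<^sub>R axis i 1) = c" using basis_expansion[of c] by (simp add: scalar_mult_eq_scaleR)
  finally show ?thesis .
qed

theorem proposition3p1:
  fixes b :: "real^3"
  shows
    "(\<forall>x i. x \<noteq> 0 \<longrightarrow>
        (\<lambda>t. landau_vel (b + t *\<^sub>R axis i 1) x) differentiable (at 0) \<and>
        (\<lambda>t. landau_pressure (b + t *\<^sub>R axis i 1) x) differentiable (at 0)) \<and>
     (\<forall>w q. smooth_linearized_solution (landau_vel b) w q \<longrightarrow>
        self_similar_vel w \<longrightarrow> self_similar_pressure q \<longrightarrow>
        (\<exists>c::real^3.
           (\<forall>x. x \<noteq> 0 \<longrightarrow> w x = (\<Sum>i\<in>UNIV. c $ i *\<^sub>R landau_vel_db i b x)) \<and>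
           (\<forall>x. x \<noteq> 0 \<longrightarrow> q x = (\<Sum>i\<in>UNIV. c $ i * landau_pressure_db i b x)) \<and>
           linearized_distr_eq (landau_vel b) w q c)) \<and>
     self_similar_kernel (landau_vel b) =
       {w. \<exists>c::real^3. \<forall>x. x \<noteq> 0 \<longrightarrow> w x = (\<Sum>i\<in>UNIV. c $ i *\<^sub>R landau_vel_db i b x)}"
proof -
  define \<sigma> where "\<sigma> = ball_param b"
  have \<sigma>1: "norm \<sigma> < 1" unfolding \<sigma>_def by (rule norm_ball_param_less)
  interpret landau_ball \<sigma> by unfold_locales (rule \<sigma>1)
  obtain E E' where E: "(ball_param has_derivative E) (at b)" and E': "(flux_vec has_derivative E') (at \<sigma>)"
    and EE': "\<And>c. E' (E c) = c" "\<And>d. E (E' d) = d"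
    unfolding \<sigma>_def using param_derivatives[of b] by blast
  have W: "landau_vel b x $ i = u i x" if "x \<noteq> 0" for x i
    using landau_vel_ball(1)[OF that] ball_vel_eq_u[OF that] by (simp add: \<sigma>_def)
  have dv: "((\<lambda>b. landau_vel b x) has_derivative (\<lambda>c. \<chi> i. dU (E c) i x)) (at b)" if x: "x \<noteq> 0" for x
    unfolding landau_vel_ball(1)[OF x]
    by (rule has_derivative_compose[OF E]) (use has_derivative_ball_vel[OF x] in \<open>simp add: \<sigma>_def\<close>)
  have dp: "((\<lambda>b. landau_pressure b x) has_derivative (\<lambda>c. dP (E c) x)) (at b)" if x: "x \<noteq> 0" for x
    unfolding landau_vel_ball(2)[OF x]
    by (rule has_derivative_compose[OF E]) (use has_derivative_ball_pressure[OF x] in \<open>simp add: \<sigma>_def\<close>)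
  have line: "(\<lambda>t. f (b + t *\<^sub>R a)) differentiable (at 0)" if "(f has_derivative f') (at b)"
    for f :: "real^3 \<Rightarrow> 'b::real_normed_vector" and f' a
  proof -
    have l: "((\<lambda>t. b + t *\<^sub>R a) has_derivative (\<lambda>h. h *\<^sub>R a)) (at (0::real))" by (auto intro!: derivative_eq_intros)
    have "(f has_derivative f') (at (b + 0 *\<^sub>R a))" using that by simp
    from has_derivative_compose[OF l this] show ?thesis by (auto simp: differentiable_def)
  qed
  have 1: "(\<lambda>t. landau_vel (b + t *\<^sub>R axis i 1) x) differentiable (at 0)"
    "(\<lambda>t. landau_pressure (b + t *\<^sub>R axis i 1) x) differentiable (at 0)" if "x \<noteq> 0" for x i
    by (rule line[OF dv[OF that]], rule line[OF dp[OF that]])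
  have dbv: "(\<Sum>i\<in>UNIV. c $ i *\<^sub>R landau_vel_db i b x) = (\<chi> i. dU (E c) i x)" if x: "x \<noteq> 0" for c x
    unfolding landau_vel_db_def partial_has_derivative[OF dv[OF x]]
    by (rule sum_axis) (rule bounded_linear.linear[OF has_derivative_bounded_linear[OF dv[OF x]]])
  have dbp: "(\<Sum>i\<in>UNIV. c $ i * landau_pressure_db i b x) = dP (E c) x" if x: "x \<noteq> 0" for c x
    unfolding landau_pressure_db_def partial_has_derivative[OF dp[OF x]] real_scaleR_def[symmetric]
    by (rule sum_axis) (rule bounded_linear.linear[OF has_derivative_bounded_linear[OF dp[OF x]]])
  have span: "\<exists>d. \<forall>x. x \<noteq> 0 \<longrightarrow> w x = (\<Sum>i\<in>UNIV. E' d $ i *\<^sub>R landau_vel_db i b x) \<and> q x = (\<Sum>i\<in>UNIV. E' d $ i * landau_pressure_db i b x)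
      \<and> (\<forall>i. w x $ i = dU d i x) \<and> q x = dP d x"
    if "smooth_linearized_solution (landau_vel b) w q" "self_similar_vel w" "self_similar_pressure q" for w q
    using kernel_subset[OF W that] by (auto simp: dbv dbp EE' vec_eq_iff)
  have 2: "\<exists>c::real^3.
           (\<forall>x. x \<noteq> 0 \<longrightarrow> w x = (\<Sum>i\<in>UNIV. c $ i *\<^sub>R landau_vel_db i b x)) \<and>
           (\<forall>x. x \<noteq> 0 \<longrightarrow> q x = (\<Sum>i\<in>UNIV. c $ i * landau_pressure_db i b x)) \<and>
           linearized_distr_eq (landau_vel b) w q c"
    if sol: "smooth_linearized_solution (landau_vel b) w q" "self_similar_vel w" "self_similar_pressure q" for w q
  proof -
    obtain d where d: "\<And>x. x \<noteq> 0 \<Longrightarrow> w x = (\<Sum>i\<in>UNIV. E' d $ i *\<^sub>R landau_vel_db i b x) \<and> q x = (\<Sum>i\<in>UNIV. E' d $ i * landau_pressure_db i b x)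
      \<and> (\<forall>i. w x $ i = dU d i x) \<and> q x = dP d x" using span[OF sol] by blast
    \<comment> \<open>The parameter moves with velocity \<open>d = E (E' d)\<close> when \<open>b\<close> moves with velocity \<open>E' d\<close>, so the
        coefficients \<open>E' d\<close> are also the derivative of the flux.\<close>
    have "linearized_distr_eq (landau_vel b) w q (E' d)"
    proof (rule linearized_distr_eq_of_solution[OF background_field[OF W] sol])
      fix i
      have "flux_density_deriv \<sigma> d i x = norm x * (w x $ i * (1 + x \<bullet> landau_vel b x)
          + landau_vel b x $ i * (\<Sum>j\<in>UNIV. x $ j * w x $ j) + q x * x $ i)" if x: "x \<noteq> 0" for x
      proof -
        have "w x $ j = vel_deriv \<sigma> d j x" "q x = pressure_deriv \<sigma> d x" for j
          using d[OF x] unfolding dU_explicit dP_explicit by blast+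
        then show ?thesis
          unfolding flux_density_deriv_def using landau_vel_ball(1)[OF x, of b] by (simp only: \<sigma>_def)
      qed
      from sph_cong[OF this] show "E' d $ i = sph (\<lambda>x. norm x * (w x $ i * (1 + x \<bullet> landau_vel b x)
          + landau_vel b x $ i * (\<Sum>j\<in>UNIV. x $ j * w x $ j) + q x * x $ i))"
        unfolding sph_flux_density_deriv[OF \<sigma>1 E', symmetric] .
    qed
    then show ?thesis using d by blast
  qed
  have 3: "self_similar_kernel (landau_vel b) =
       {w. \<exists>c::real^3. \<forall>x. x \<noteq> 0 \<longrightarrow> w x = (\<Sum>i\<in>UNIV. c $ i *\<^sub>R landau_vel_db i b x)}"
  proof (intro set_eqI iffI)
    fix w assume "w \<in> self_similar_kernel (landau_vel b)"
    then obtain q where "smooth_linearized_solution (landau_vel b) w q" "self_similar_vel w" "self_similar_pressure q"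
      by (auto simp: self_similar_kernel_def)
    from 2[OF this] show "w \<in> {w. \<exists>c::real^3. \<forall>x. x \<noteq> 0 \<longrightarrow> w x = (\<Sum>i\<in>UNIV. c $ i *\<^sub>R landau_vel_db i b x)}" by blast
  next
    fix w assume "w \<in> {w. \<exists>c::real^3. \<forall>x. x \<noteq> 0 \<longrightarrow> w x = (\<Sum>i\<in>UNIV. c $ i *\<^sub>R landau_vel_db i b x)}"
    then obtain c :: "real^3" where c: "\<And>x. x \<noteq> 0 \<Longrightarrow> w x = (\<Sum>i\<in>UNIV. c $ i *\<^sub>R landau_vel_db i b x)" by blast
    have "w x $ i = dU (E c) i x" if "x \<noteq> 0" for x i using c[OF that] dbv[OF that] by simp
    from kernel_superset[where q="dP (E c)", OF W this refl]
    show "w \<in> self_similar_kernel (landau_vel b)" unfolding self_similar_kernel_def by blast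
  qed
  show ?thesis using 1 2 3 by blast
qed

end
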